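(* Let $m,n\in\mathbb{N}$. There are a function $\varepsilon(d)$, independent of $N$, with $\varepsilon(d)\to0$ as $d\to\infty$, and a constant $K_{m+n}$ such that the following holds. For all $N$, all $d>0$, and all points $z_1,\ldots,z_{m+n},z'_1,\ldots,z'_{m+n}\in\mathcal{Z}$ such that the cloud $\{z_j,z'_j:1\le j\le m\}$ has distance $\ge d$ from the cloud $\{z_j,z'_j:m+1\le j\le m+n\}$, $$\bigl|\rho_{m+n}^{N,\mathcal{Z}}(z_1,\ldots,z_{m+n};z'_1,\ldots,z'_{m+n})-\rho_m^{N,\mathcal{Z}}(z_1,\ldots,z_m;z'_1,\ldots,z'_m)\,\rho_n^{N,\mathcal{Z}}(z_{m+1},\ldots,z_{m+n};z'_{m+1},\ldots,z'_{m+n})\bigr|\le K_{m+n}\varepsilon(d).$$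
   Context: Setting. $\mathcal{Z}=\mathbb{R}\times[0,2\pi R]$ is a cylinder of radius $R>0$, with points $z=x+iy$ and measure $dx\,dy$. Fix $\ell>0$ and $p\in\mathbb{N}$. Laughlin's function. For $N\in\mathbb{N}$, $$\Psi_N(z_1,\ldots,z_N)=\kappa_N\prod_{j<k}\bigl(e^{z_k/R}-e^{z_j/R}\bigr)^p\exp\Bigl(-\frac{1}{2\ell^2}\sum_k x_k^2\Bigr),$$ with $\kappa_N>0$ a constant. Correlation functions. For $k\le N$, $$\rho_k^{N,\mathcal{Z}}(z_1,\ldots,z_k;z'_1,\ldots,z'_k)=\frac{N!}{(N-k)!\,\|\Psi_N\|^2}\int_{\mathcal{Z}^{N-k}}\Psi_N(z_1,\ldots,z_k,z_{k+1},\ldots,z_N)\,\overline{\Psi_N(z'_1,\ldots,z'_k,z_{k+1},\ldots,z_N)}\,\prod_{j>k}dx_j\,dy_j .$$ The norm $\|\cdot\|$ is the $L^2(\mathcal{Z}^N)$ norm. *)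

theory Defs
  imports "HOL-Probability.Probability"
begin

definition cyl :: "real \<Rightarrow> complex set" where
  "cyl R = {z. 0 \<le> Im z \<and> Im z \<le> 2 * pi * R}"

definition cylM :: "real \<Rightarrow> complex measure" where
  "cylM R = restrict_space lborel (cyl R)"

text \<open>Intrinsic distance on the cylinder (the y-coordinate is 2 pi R-periodic).\<close>
definition cyl_dist :: "real \<Rightarrow> complex \<Rightarrow> complex \<Rightarrow> real" where
  "cyl_dist R z w =
     sqrt ((Re z - Re w)\<^sup>2 +
           (INF k\<in>(UNIV::int set). \<bar>Im z - Im w - 2 * pi * R * of_int k\<bar>)\<^sup>2)"

definition laughlin ::
  "real \<Rightarrow> real \<Rightarrow> nat \<Rightarrow> (nat \<Rightarrow> real) \<Rightarrow> nat \<Rightarrow> (nat \<Rightarrow> complex) \<Rightarrow> complex" where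
  "laughlin R l p \<kappa> N w =
     complex_of_real (\<kappa> N) *
     (\<Prod>k<N. \<Prod>j<k. (exp (w k / complex_of_real R) - exp (w j / complex_of_real R)) ^ p) *
     complex_of_real (exp (- (1 / (2 * l\<^sup>2)) * (\<Sum>k<N. (Re (w k))\<^sup>2)))"

definition laughlin_norm2 ::
  "real \<Rightarrow> real \<Rightarrow> nat \<Rightarrow> (nat \<Rightarrow> real) \<Rightarrow> nat \<Rightarrow> real" where
  "laughlin_norm2 R l p \<kappa> N =
     (\<integral>w. (cmod (laughlin R l p \<kappa> N w))\<^sup>2 \<partial>(PiM {..<N} (\<lambda>_. cylM R)))"

definition corr ::
  "real \<Rightarrow> real \<Rightarrow> nat \<Rightarrow> (nat \<Rightarrow> real) \<Rightarrow> nat \<Rightarrow> nat \<Rightarrow>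
   (nat \<Rightarrow> complex) \<Rightarrow> (nat \<Rightarrow> complex) \<Rightarrow> complex" where
  "corr R l p \<kappa> N k z z' =
     complex_of_real (fact N / (fact (N - k) * laughlin_norm2 R l p \<kappa> N)) *
     (\<integral>u. laughlin R l p \<kappa> N (\<lambda>j. if j < k then z j else u j) *
           cnj (laughlin R l p \<kappa> N (\<lambda>j. if j < k then z' j else u j))
        \<partial>(PiM {k..<N} (\<lambda>_. cylM R)))"

end

theory Submission
  imports Defs "HOL-Combinatorics.Multiset_Permutations" "HOL-Real_Asymp.Real_Asymp"
begin

text \<open>Expanding the power of the Vandermonde determinant turns the Laughlin state into a superposition
  of Slater-type monomials in the orbitals \<^term>\<open>exp (z / R) ^ k * exp (- (Re z)\<^sup>2 / (2 * l\<^sup>2))\<close>, which are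
  orthogonal and localised near \<^term>\<open>real k * l\<^sup>2 / R\<close>. The coefficients obey a dominance condition, and they
  factorise at every place where it is attained with equality (a renewal point); this gives the
  occupation numbers the structure of a one-dimensional renewal process with partition function
  \<open>C\<close> satisfying \<open>C m * C n \<le> C (m + n)\<close>.

  Since the particles are ordered along the cylinder, cutting the chain costs only a bounded factor:
  \<open>C (m + n) \<le> K * (C m * C n)\<close> with the same estimate in the presence of a factor
  \<open>exp (t * cloud)\<close>, which also bounds the moments of all occupation numbers uniformly. The first
  bound makes the renewal process recurrent with finite mean gap, so two independent
  copies have a common renewal point in any long window with probability tending to one, uniformly
  in \<open>N\<close>. Exchanging the tails of two copies at such a point turns
  \<open>\<Gamma>(a1 a2; b1 b2) * \<Gamma>(;)\<close> into \<open>\<Gamma>(a1; b1) * \<Gamma>(a2; b2)\<close> up to the small probability that none exists.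
  This is clustering in the orbital basis, and the Gaussian decay of the orbitals transfers it to the
  correlation functions.\<close>

section \<open>Slater coefficients of powers of the Vandermonde determinant\<close>

text \<open>Exchanging tails needs one point that is a renewal for four configurations at once: two
  index lists over each of two backgrounds. No positive weight governs the four jointly, since
  amplitudes carry signs and bra and ket share a background; recurrence only controls one pair of
  independent copies at a time. The way out: renewal at \<open>k\<close> is equality in a bound on a
  quantity additive in the particles (\<open>tent\<close>). Over one background two fillings differ
  there by an affine function of \<open>k\<close>, as long as no observed index is met, and
  interleaved renewals make it vanish. Cauchy-Schwarz then measures each bad event with the weight
  of a single pair. The bounded cost of a cut comes from comparing powers: with a disturbance of
  radius L around the cut, discarding the disturbed block costs a factor exp(const * L^2), while the
  ordering of the positions forces an energy excess of order L^3, so the sum over L converges. The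
  two clouds need not lie on opposite sides of a cut. They may alternate along the axis, so one
  exchange is made at each change of cloud while a threshold sweeps over the orbitals.\<close>

definition edges :: "nat \<Rightarrow> nat \<Rightarrow> (nat \<times> nat \<times> nat) set" where
  "edges p N = {(j, k, i). j < k \<and> k < N \<and> i < p}"

definition winner :: "(nat \<times> nat \<times> nat) set \<Rightarrow> nat \<times> nat \<times> nat \<Rightarrow> nat" where
  "winner X e = (if e \<in> X then fst (snd e) else fst e)"

definition tournaments :: "nat \<Rightarrow> nat list \<Rightarrow> (nat \<times> nat \<times> nat) set set" where
  "tournaments p xs = {X. X \<subseteq> edges p (length xs) \<and>
     (\<forall>v<length xs. card {e \<in> edges p (length xs). winner X e = v} = xs ! v)}"

text \<open>The coefficient of the monomial with exponents \<open>xs\<close> in the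
  \<open>p\<close>-th power of the Vandermonde product. Each of the \<open>p\<close> copies of a
  factor \<open>w k - w j\<close> is a game between \<open>j\<close> and \<open>k\<close>: an edge
  in \<open>X\<close> selects \<open>w k\<close>, an edge outside selects \<open>- w j\<close>, and
  exponents are scores. Dominance and its equality case become a matter of counting games.\<close>

definition amp :: "nat \<Rightarrow> nat list \<Rightarrow> real" where
  "amp p xs = (\<Sum>X\<in>tournaments p xs. (-1) ^ card (edges p (length xs) - X))"

definition tri :: "nat \<Rightarrow> nat \<Rightarrow> nat" where
  "tri p n = (\<Sum>k<n. p * k)"

text \<open>Exponents never exceed \<open>p * (N - 1)\<close>. The bound \<open>p * N\<close> refers
  to the full particle number even for lists of length \<open>n\<close>, so that lists for observed
  and for hidden particles range over the same orbitals.\<close>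

definition orbs :: "nat \<Rightarrow> nat \<Rightarrow> nat \<Rightarrow> nat list set" where
  "orbs p N n = {xs. length xs = n \<and> set xs \<subseteq> {..<p * N}}"

lemma edges_Sigma: "edges p N = (\<lambda>(k, j, i). (j, k, i)) ` (SIGMA k:{..<N}. {..<k} \<times> {..<p})"
  by (auto simp: edges_def image_iff)

lemma finite_edges [simp]: "finite (edges p N)"
  unfolding edges_Sigma by auto

lemma card_edges: "card (edges p N) = tri p N"
  unfolding edges_Sigma tri_def
  by (subst card_image) (auto simp: inj_on_def card_SigmaI mult.commute)

lemma finite_orbs [simp]: "finite (orbs p N n)"
  unfolding orbs_def using finite_lists_length_eq[of "{..<p*N}" n] by (simp add: conj_commute)

lemma sum_winner:
  assumes "finite A" "finite V"
  shows "(\<Sum>v\<in>V. card {e \<in> A. winner X e = v}) = card {e \<in> A. winner X e \<in> V}"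
proof -
  have "{e \<in> A. winner X e \<in> V} = (\<Union>v\<in>V. {e \<in> A. winner X e = v})" by auto
  moreover have "card (\<Union>v\<in>V. {e \<in> A. winner X e = v}) = (\<Sum>v\<in>V. card {e \<in> A. winner X e = v})"
    using assms by (intro card_UN_disjoint) auto
  ultimately show ?thesis by (simp only:)
qed

lemma winner_less: "e \<in> edges p N \<Longrightarrow> winner X e < N"
  by (auto simp: edges_def winner_def)

text \<open>A player meets each of the others in \<open>p\<close> games; a game won is determined by
  the opponent and the number of the copy.\<close>

lemma tournament_score_le:
  assumes "X \<in> tournaments p xs" "v < length xs"
  shows "xs ! v \<le> p * (length xs - 1)"
proof -
  let ?N = "length xs"
  have "xs ! v = card {e \<in> edges p ?N. winner X e = v}" using assms by (auto simp: tournaments_def)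
  also have "\<dots> \<le> card ((({..<?N} - {v}) \<times> {..<p}))"
  proof (rule card_inj_on_le)
    let ?f = "\<lambda>e. (if fst e = v then fst (snd e) else fst e, snd (snd e))"
    show "inj_on ?f {e \<in> edges p ?N. winner X e = v}"
      by (auto simp: inj_on_def edges_def winner_def split: if_splits)
    show "?f ` {e \<in> edges p ?N. winner X e = v} \<subseteq> ({..<?N} - {v}) \<times> {..<p}"
      by (auto simp: edges_def winner_def split: if_splits)
  qed simp
  also have "\<dots> = p * (?N - 1)" using assms by simp
  finally show ?thesis .
qed

lemma prod_winner:
  fixes w :: "nat \<Rightarrow> 'a::comm_monoid_mult"
  shows "(\<Prod>e\<in>edges p N. w (winner X e)) = (\<Prod>v<N. w v ^ card {e \<in> edges p N. winner X e = v})"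
proof -
  have "(\<Prod>v<N. \<Prod>e | e \<in> edges p N \<and> winner X e = v. w (winner X e)) = (\<Prod>e\<in>edges p N. w (winner X e))"
    by (rule prod.group) (auto simp: winner_less)
  moreover have "(\<Prod>e | e \<in> edges p N \<and> winner X e = v. w (winner X e)) = w v ^ card {e \<in> edges p N. winner X e = v}" for v
    by (subst prod.cong[OF refl, of _ _ "\<lambda>_. w v"]) auto
  ultimately show ?thesis by simp
qed

text \<open>Multiplying out, each subset \<open>X\<close> of the games selects one term per factor;
  the subsets are then grouped by their lists of scores.\<close>

theorem vandermonde_expansion:
  fixes w :: "nat \<Rightarrow> complex"
  assumes p: "p > 0"
  shows "(\<Prod>k<N. \<Prod>j<k. (w k - w j) ^ p)
     = (\<Sum>xs\<in>orbs p N N. of_real (amp p xs) * (\<Prod>v<N. w v ^ (xs ! v)))"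
proof -
  let ?E = "edges p N"
  let ?sc = "\<lambda>X. map (\<lambda>v. card {e \<in> ?E. winner X e = v}) [0..<N]"
  have "(\<Prod>k<N. \<Prod>j<k. (w k - w j) ^ p) = (\<Prod>(k,ji)\<in>(SIGMA k:{..<N}. {..<k} \<times> {..<p}). w k - w (fst ji))"
    by (subst prod.Sigma[symmetric]) (auto simp: prod.cartesian_product' split_def intro!: prod.cong)
  also have "\<dots> = (\<Prod>e\<in>?E. w (fst (snd e)) + - w (fst e))"
    unfolding edges_Sigma by (subst prod.reindex) (auto simp: inj_on_def split_def)
  also have "\<dots> = (\<Sum>X\<in>Pow ?E. (\<Prod>e\<in>X. w (fst (snd e))) * (\<Prod>e\<in>?E-X. - w (fst e)))"
    by (rule prod_add) simp
  also have "\<dots> = (\<Sum>X\<in>Pow ?E. (-1) ^ card (?E - X) * (\<Prod>v<N. w v ^ (?sc X ! v)))"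
  proof (rule sum.cong[OF refl])
    fix X assume "X \<in> Pow ?E"
    then have X: "X \<subseteq> ?E" and fX: "finite X" using finite_subset[OF _ finite_edges] by auto
    have "(\<Prod>e\<in>?E. w (winner X e)) = (\<Prod>e\<in>X. w (winner X e)) * (\<Prod>e\<in>?E - X. w (winner X e))"
      using X by (metis finite_edges mult.commute prod.subset_diff)
    also have "\<dots> = (\<Prod>e\<in>X. w (fst (snd e))) * (\<Prod>e\<in>?E - X. w (fst e))"
      by (intro arg_cong2[of _ _ _ _ "(*)"] prod.cong) (auto simp: winner_def)
    finally have "(\<Prod>e\<in>X. w (fst (snd e))) * (\<Prod>e\<in>?E - X. w (fst e)) = (\<Prod>v<N. w v ^ (?sc X ! v))"
      unfolding prod_winner by simp
    moreover have "(\<Prod>e\<in>?E-X. - w (fst e)) = (-1) ^ card (?E - X) * (\<Prod>e\<in>?E - X. w (fst e))"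
      by (simp add: prod_uminus)
    ultimately show "(\<Prod>e\<in>X. w (fst (snd e))) * (\<Prod>e\<in>?E-X. - w (fst e)) =
        (-1) ^ card (?E - X) * (\<Prod>v<N. w v ^ (?sc X ! v))"
      by (simp add: ac_simps)
  qed
  also have "\<dots> = (\<Sum>xs\<in>orbs p N N. \<Sum>X | X \<in> Pow ?E \<and> ?sc X = xs. (-1) ^ card (?E - X) * (\<Prod>v<N. w v ^ (?sc X ! v)))"
  proof (rule sum.group[symmetric])
    show "?sc ` Pow ?E \<subseteq> orbs p N N"
    proof
      fix xs assume "xs \<in> ?sc ` Pow ?E"
      then obtain X where X: "X \<subseteq> ?E" "xs = ?sc X" by auto
      then have T: "X \<in> tournaments p xs" by (auto simp: tournaments_def)
      show "xs \<in> orbs p N N"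
        unfolding orbs_def
      proof (safe)
        show l: "length xs = N" using X by simp
        fix x assume "x \<in> set xs"
        then obtain v where v: "v < length xs" "xs ! v = x" by (auto simp: in_set_conv_nth)
        have "x \<le> p * (N - 1)" using tournament_score_le[OF T v(1)] unfolding v(2) l .
        moreover have "p * (N - 1) < p * N" using v p l by simp
        ultimately show "x < p * N" by linarith
      qed
    qed
  qed auto
  also have "\<dots> = (\<Sum>xs\<in>orbs p N N. of_real (amp p xs) * (\<Prod>v<N. w v ^ (xs ! v)))"
  proof (rule sum.cong[OF refl])
    fix xs assume xs: "xs \<in> orbs p N N"
    then have l: "length xs = N" by (simp add: orbs_def)
    have "{X \<in> Pow ?E. ?sc X = xs} = tournaments p xs"
      using l by (auto simp: tournaments_def list_eq_iff_nth_eq)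
    then show "(\<Sum>X | X \<in> Pow ?E \<and> ?sc X = xs. (-1) ^ card (?E - X) * (\<Prod>v<N. w v ^ (?sc X ! v)))
      = of_real (amp p xs) * (\<Prod>v<N. w v ^ (xs ! v))"
      by (auto simp: amp_def l sum_distrib_right intro!: sum.cong)
  qed
  finally show ?thesis .
qed

section \<open>Dominance, and factorisation of the coefficients in the case of equality\<close>

definition edge_shift :: "nat \<Rightarrow> nat \<times> nat \<times> nat \<Rightarrow> nat \<times> nat \<times> nat" where
  "edge_shift m e = (fst e + m, fst (snd e) + m, snd (snd e))"

definition cross :: "nat \<Rightarrow> nat \<Rightarrow> nat \<Rightarrow> (nat \<times> nat \<times> nat) set" where
  "cross p m n = {..<m} \<times> {m..<m + n} \<times> {..<p}"

lemma finite_cross [simp]: "finite (cross p m n)"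
  by (simp add: cross_def)

lemma inj_edge_shift: "inj (edge_shift m)"
  by (auto simp: inj_def edge_shift_def prod_eq_iff)

lemma edges_split: "edges p (m + n) = edges p m \<union> cross p m n \<union> edge_shift m ` edges p n"
proof (intro set_eqI iffI)
  fix e assume e: "e \<in> edges p (m + n)"
  obtain j k i where [simp]: "e = (j, k, i)" by (cases e)
  have e': "j < k" "k < m + n" "i < p" using e by (auto simp: edges_def)
  consider "k < m" | "j < m" "k \<ge> m" | "j \<ge> m" by linarith
  then show "e \<in> edges p m \<union> cross p m n \<union> edge_shift m ` edges p n"
  proof cases
    case 3
    then have "e = edge_shift m (j - m, k - m, i)" "(j - m, k - m, i) \<in> edges p n"
      using e' by (auto simp: edge_shift_def edges_def)
    then show ?thesis by blast
  qed (use e' in \<open>auto simp: edges_def cross_def\<close>)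
qed (auto simp: edges_def cross_def edge_shift_def)

text \<open>Games inside the first block are won inside it whatever their outcome, so its total
  score is their number plus the cross games it wins, which are those outside \<open>X\<close>.
  Dominance and the equality case are both read off from this identity.\<close>

lemma sum_list_tournament:
  assumes "X \<in> tournaments p (ys @ zs)"
  shows "sum_list ys = tri p (length ys) + card (cross p (length ys) (length zs) - X)"
proof -
  let ?m = "length ys" and ?n = "length zs"
  have "sum_list ys = (\<Sum>v<?m. (ys @ zs) ! v)"
    by (simp add: sum_list_sum_nth atLeast0LessThan nth_append)
  also have "\<dots> = (\<Sum>v<?m. card {e \<in> edges p (?m + ?n). winner X e = v})"
    using assms by (intro sum.cong) (auto simp: tournaments_def)
  also have "\<dots> = card {e \<in> edges p (?m + ?n). winner X e < ?m}"
    by (subst sum_winner) auto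
  also have "{e \<in> edges p (?m + ?n). winner X e < ?m} = edges p ?m \<union> (cross p ?m ?n - X)"
    unfolding edges_split by (auto simp: edges_def cross_def winner_def edge_shift_def)
  also have "card \<dots> = card (edges p ?m) + card (cross p ?m ?n - X)"
    by (rule card_Un_disjoint, simp, simp) (auto simp: edges_def cross_def)
  finally show ?thesis by (simp add: card_edges)
qed

lemma amp_nonzero_obtain:
  assumes "amp p xs \<noteq> 0" obtains X where "X \<in> tournaments p xs"
  using assms unfolding amp_def by (metis all_not_in_conv sum.empty)

lemma amp_dominance: "amp p (ys @ zs) \<noteq> 0 \<Longrightarrow> tri p (length ys) \<le> sum_list ys"
  by (metis amp_nonzero_obtain le_add1 sum_list_tournament)

lemma amp_sum_list:
  assumes "amp p xs \<noteq> 0" shows "sum_list xs = tri p (length xs)"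
proof -
  obtain X where "X \<in> tournaments p (xs @ [])" using amp_nonzero_obtain[of p "xs @ []"] assms by auto
  from sum_list_tournament[OF this] show ?thesis by (simp add: cross_def)
qed

lemma amp_entry_less:
  assumes "p > 0" "amp p xs \<noteq> 0" "x \<in> set xs" shows "x < p * length xs"
proof -
  obtain X where X: "X \<in> tournaments p xs" using amp_nonzero_obtain assms by blast
  obtain v where v: "v < length xs" "xs ! v = x" using assms(3) by (auto simp: in_set_conv_nth)
  have "x \<le> p * (length xs - 1)" using tournament_score_le[OF X v(1)] v by simp
  also have "\<dots> < p * length xs" using assms(1) v by simp
  finally show ?thesis .
qed

text \<open>If the first block loses every cross game, each later player collects exactly
  \<open>p * m\<close> points there, and the rest of the score is earned among the later
  players.\<close>

lemma cross_score:
  assumes X: "X \<subseteq> edges p (m + n)" "cross p m n \<subseteq> X" and u: "u < n"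
  shows "card {e \<in> edges p (m + n). winner X e = m + u}
    = p * m + card {e \<in> edges p n. winner {e \<in> edges p n. edge_shift m e \<in> X} e = u}"
proof -
  define X2 where "X2 = {e \<in> edges p n. edge_shift m e \<in> X}"
  have "{e \<in> edges p (m + n). winner X e = m + u}
     = ({..<m} \<times> {m + u} \<times> {..<p}) \<union> edge_shift m ` {e \<in> edges p n. winner X2 e = u}"
    (is "?L = ?R")
  proof -
    have "winner X (edge_shift m e) = m + winner X2 e" if "e \<in> edges p n" for e
      using that by (auto simp: winner_def edge_shift_def X2_def)
    then have 1: "{e \<in> edges p n. winner X (edge_shift m e) = m + u} = {e \<in> edges p n. winner X2 e = u}"
      by auto
    have 2: "{e \<in> edges p m. winner X e = m + u} = {}"
      using winner_less[of _ p m X] by fastforce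
    have "winner X e = fst (snd e)" if "e \<in> cross p m n" for e
      using that X(2) by (auto simp: winner_def)
    then have "{e \<in> cross p m n. winner X e = m + u} = {e \<in> cross p m n. fst (snd e) = m + u}"
      by auto
    also have "\<dots> = {..<m} \<times> {m + u} \<times> {..<p}"
      using u by (auto simp: cross_def)
    finally have 3: "{e \<in> cross p m n. winner X e = m + u} = {..<m} \<times> {m + u} \<times> {..<p}" .
    have "?L = {e \<in> edges p m. winner X e = m + u} \<union> {e \<in> cross p m n. winner X e = m + u}
        \<union> edge_shift m ` {e \<in> edges p n. winner X (edge_shift m e) = m + u}"
      unfolding edges_split by blast
    then show ?thesis unfolding 1 2 3 by simp
  qed
  also have "card \<dots> = card ({..<m} \<times> {m + u} \<times> {..<p}) + card (edge_shift m ` {e \<in> edges p n. winner X2 e = u})"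
  proof (rule card_Un_disjoint)
    have "fst e < m" if "e \<in> {..<m} \<times> {m + u} \<times> {..<p}" for e using that by auto
    moreover have "\<not> fst e < m" if "e \<in> edge_shift m ` A" for e A using that by (auto simp: edge_shift_def)
    ultimately show "({..<m} \<times> {m + u} \<times> {..<p}) \<inter> edge_shift m ` {e \<in> edges p n. winner X2 e = u} = {}"
      by blast
    show "finite (edge_shift m ` {e \<in> edges p n. winner X2 e = u})"
      by (intro finite_imageI finite_subset[OF _ finite_edges]) blast
  qed simp
  also have "card (edge_shift m ` {e \<in> edges p n. winner X2 e = u}) = card {e \<in> edges p n. winner X2 e = u}"
    by (rule card_image[OF inj_on_subset[OF inj_edge_shift subset_UNIV]])
  also have "card ({..<m} \<times> {m + u} \<times> {..<p}) = p * m" by simp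
  finally show ?thesis unfolding X2_def .
qed

lemma low_score:
  assumes X: "X \<subseteq> edges p (m + n)" "cross p m n \<subseteq> X" and v: "v < m"
  shows "{e \<in> edges p (m + n). winner X e = v} = {e \<in> edges p m. winner (X \<inter> edges p m) e = v}"
proof -
  have 1: "winner X e = winner (X \<inter> edges p m) e" if "e \<in> edges p m" for e
    using that by (auto simp: winner_def)
  have 2: "winner X e \<noteq> v" if "e \<in> cross p m n" for e
    using that X(2) v by (auto simp: winner_def cross_def)
  have 3: "winner X (edge_shift m e) \<noteq> v" for e
    using v by (auto simp: winner_def edge_shift_def)
  have "{e \<in> edges p (m + n). winner X e = v} = {e \<in> edges p m. winner X e = v}"
    unfolding edges_split using 2 3 by blast
  also have "\<dots> = {e \<in> edges p m. winner (X \<inter> edges p m) e = v}"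
    using 1 by metis
  finally show ?thesis .
qed

text \<open>Equality in the dominance bound leaves no cross game won by the first block, so a
  tournament is a pair of independent tournaments, and no cross edge contributes to the sign. The
  bound on \<open>zs\<close> makes the truncated subtraction exact.\<close>

theorem amp_append:
  assumes s: "sum_list ys = tri p (length ys)" and z: "\<And>z. z \<in> set zs \<Longrightarrow> p * length ys \<le> z"
  shows "amp p (ys @ zs) = amp p ys * amp p (map (\<lambda>z. z - p * length ys) zs)"
proof -
  let ?m = "length ys" and ?n = "length zs"
  let ?zs = "map (\<lambda>z. z - p * ?m) zs"
  let ?E = "edges p (?m + ?n)" and ?K = "cross p ?m ?n" and ?sh = "edge_shift ?m"
  let ?T = "tournaments p (ys @ zs)" and ?T1 = "tournaments p ys" and ?T2 = "tournaments p ?zs"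
  let ?i = "\<lambda>X. (X \<inter> edges p ?m, {e \<in> edges p ?n. ?sh e \<in> X})"
  let ?j = "\<lambda>(X1, X2). X1 \<union> ?K \<union> ?sh ` X2"
  have disj: "edges p ?m \<inter> ?K = {}" "edges p ?m \<inter> range ?sh = {}" "?K \<inter> range ?sh = {}"
    by (auto simp: edges_def cross_def edge_shift_def)
  have K: "?K \<subseteq> X" if "X \<in> ?T" for X
  proof -
    have "card (?K - X) = 0" using sum_list_tournament[OF that] s by simp
    then show ?thesis by (simp add: card_eq_0_iff)
  qed
  have iff: "X \<in> ?T \<longleftrightarrow> fst (?i X) \<in> ?T1 \<and> snd (?i X) \<in> ?T2" if X: "X \<subseteq> ?E" "?K \<subseteq> X" for X
  proof -
    have "X \<in> ?T \<longleftrightarrow> (\<forall>v<?m + ?n. card {e \<in> ?E. winner X e = v} = (ys @ zs) ! v)"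
      using X by (simp add: tournaments_def)
    also have "\<dots> \<longleftrightarrow> (\<forall>v<?m. card {e \<in> ?E. winner X e = v} = ys ! v) \<and>
        (\<forall>u<?n. card {e \<in> ?E. winner X e = ?m + u} = zs ! u)" (is "?L = ?R")
    proof
      assume L: ?L
      have "card {e \<in> ?E. winner X e = v} = ys ! v" if "v < ?m" for v
        using L that by (auto simp: nth_append)
      moreover have "card {e \<in> ?E. winner X e = ?m + u} = zs ! u" if "u < ?n" for u
        using L[rule_format, of "?m + u"] that by (simp add: nth_append)
      ultimately show ?R by blast
    next
      assume R: ?R
      show ?L
      proof (intro allI impI)
        fix v assume v: "v < ?m + ?n"
        show "card {e \<in> ?E. winner X e = v} = (ys @ zs) ! v"
        proof (cases "v < ?m")
          case False
          then show ?thesis using R[THEN conjunct2, rule_format, of "v - ?m"] v by (simp add: nth_append)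
        qed (use R in \<open>simp add: nth_append\<close>)
      qed
    qed
    also have "\<dots> \<longleftrightarrow> (\<forall>v<?m. card {e \<in> edges p ?m. winner (fst (?i X)) e = v} = ys ! v) \<and>
        (\<forall>u<?n. card {e \<in> edges p ?n. winner (snd (?i X)) e = u} = ?zs ! u)"
    proof -
      have "card {e \<in> ?E. winner X e = ?m + u} = zs ! u \<longleftrightarrow>
         card {e \<in> edges p ?n. winner (snd (?i X)) e = u} = ?zs ! u" if "u < ?n" for u
        using cross_score[OF X that] z[of "zs ! u"] that by auto
      then show ?thesis using low_score[OF X] by simp
    qed
    also have "\<dots> \<longleftrightarrow> fst (?i X) \<in> ?T1 \<and> snd (?i X) \<in> ?T2"
      by (auto simp: tournaments_def)
    finally show ?thesis .
  qed
  have ji: "?j (?i X) = X" if "X \<subseteq> ?E" "?K \<subseteq> X" for X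
    using that unfolding edges_split prod.case by blast
  have ij: "?i (?j P) = P" if "P \<in> ?T1 \<times> ?T2" for P
  proof -
    obtain X1 X2 where P: "P = (X1, X2)" by (cases P)
    then have X: "X1 \<subseteq> edges p ?m" "X2 \<subseteq> edges p ?n" using that by (auto simp: tournaments_def)
    have 1: "(X1 \<union> ?K \<union> ?sh ` X2) \<inter> edges p ?m = X1" using X disj by blast
    have "?sh e \<in> X1 \<union> ?K \<union> ?sh ` X2 \<longleftrightarrow> e \<in> X2" for e
      using X disj by (auto simp: inj_image_mem_iff[OF inj_edge_shift])
    then have 2: "{e \<in> edges p ?n. ?sh e \<in> X1 \<union> ?K \<union> ?sh ` X2} = X2" using X by blast
    show ?thesis unfolding P prod.case 1 2 ..
  qed
  have jE: "?j P \<subseteq> ?E" "?K \<subseteq> ?j P" if "P \<in> ?T1 \<times> ?T2" for P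
    using that unfolding edges_split by (auto simp: tournaments_def)
  have "amp p (ys @ zs) = (\<Sum>P\<in>?T1 \<times> ?T2. (-1) ^ card (edges p ?m - fst P) * (-1) ^ card (edges p ?n - snd P))"
    unfolding amp_def
  proof (rule sum.reindex_bij_witness[where i = ?j and j = ?i])
    fix X assume X: "X \<in> ?T"
    have XE: "X \<subseteq> ?E" using X by (simp add: tournaments_def)
    show "?j (?i X) = X" using ji[OF XE K[OF X]] .
    show "?i X \<in> ?T1 \<times> ?T2" using iff[OF XE K[OF X]] X unfolding mem_Times_iff by blast
    have "edges p (length (ys @ zs)) - X = (edges p ?m - fst (?i X)) \<union> ?sh ` (edges p ?n - snd (?i X))"
      using K[OF X] by (auto simp: edges_split)
    moreover have "card ((edges p ?m - fst (?i X)) \<union> ?sh ` (edges p ?n - snd (?i X)))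
        = card (edges p ?m - fst (?i X)) + card (?sh ` (edges p ?n - snd (?i X)))"
      using disj by (intro card_Un_disjoint) auto
    moreover have "card (?sh ` (edges p ?n - snd (?i X))) = card (edges p ?n - snd (?i X))"
      by (rule card_image[OF inj_on_subset[OF inj_edge_shift subset_UNIV]])
    ultimately show "(-1) ^ card (edges p ?m - fst (?i X)) * (-1) ^ card (edges p ?n - snd (?i X))
        = ((-1) ^ card (edges p (length (ys @ zs)) - X) :: real)"
      by (simp add: power_add)
  next
    fix P assume P: "P \<in> ?T1 \<times> ?T2"
    show "?i (?j P) = P" using ij[OF P] .
    show "?j P \<in> ?T" using iff[OF jE[OF P]] P unfolding ij[OF P] mem_Times_iff by blast
  qed
  also have "\<dots> = amp p ys * amp p ?zs"
    unfolding amp_def length_map by (subst sum_product, subst sum.cartesian_product) (simp add: split_def)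
  finally show ?thesis .
qed

section \<open>Sign of the coefficients under permutation of the labels\<close>

definition flip_edge :: "nat \<Rightarrow> nat \<times> nat \<times> nat \<Rightarrow> nat \<times> nat \<times> nat" where
  "flip_edge t e = (if fst e = t \<and> fst (snd e) = Suc t \<or> fst e = Suc t \<and> fst (snd e) = t then e
     else (Transposition.transpose t (Suc t) (fst e), Transposition.transpose t (Suc t) (fst (snd e)), snd (snd e)))"

lemma flip_edge_invol [simp]: "flip_edge t (flip_edge t e) = e"
  by (cases e) (auto simp: flip_edge_def Transposition.transpose_def)

text \<open>Games between \<open>t\<close> and \<open>Suc t\<close> are the only ones whose two
  players change order under the transposition, which is why \<open>flip_edge\<close> leaves them in
  place. Their outcome is complemented separately, by the set \<open>F X\<close> in
  \<open>amp_swap\<close>.\<close>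

lemma flip_edge_in: "Suc t < N \<Longrightarrow> e \<in> edges p N \<Longrightarrow> flip_edge t e \<in> edges p N"
  by (cases e) (auto simp: flip_edge_def Transposition.transpose_def edges_def)

text \<open>Exchanging two neighbouring labels preserves the order of all pairs of labels except
  of the exchanged pair, whose \<^term>\<open>p\<close> edges each contribute a factor -1.\<close>
theorem amp_swap: "amp p (pre @ x # y # rest) = (-1) ^ p * amp p (pre @ y # x # rest)"
proof -
  define t where "t = length pre"
  let ?xs = "pre @ x # y # rest" and ?ys = "pre @ y # x # rest"
  define N where "N = length ?xs"
  have N: "length ?xs = N" "length ?ys = N" "Suc t < N" by (auto simp: N_def t_def)
  define P where "P = {t} \<times> {Suc t} \<times> {..<p}"
  have Pm: "e \<in> P \<longleftrightarrow> e \<in> edges p N \<and> fst e = t \<and> fst (snd e) = Suc t" for e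
    using N(3) by (cases e) (auto simp: P_def edges_def)
  define F where "F X = {e \<in> edges p N. (flip_edge t e \<in> X) \<noteq> (e \<in> P)}" for X
  have flP: "e \<in> P \<Longrightarrow> flip_edge t e = e" for e by (auto simp: P_def flip_edge_def)
  have flP': "flip_edge t e \<in> P \<longleftrightarrow> e \<in> P" for e
    using flP by (metis flip_edge_invol)
  have FF: "F (F X) = X" if "X \<subseteq> edges p N" for X
    using that flP' flip_edge_in[OF N(3), of _ p] unfolding F_def by auto
  have win: "winner (F X) (flip_edge t e) = Transposition.transpose t (Suc t) (winner X e)" if "e \<in> edges p N" for X e
  proof -
    have mem: "flip_edge t e \<in> F X \<longleftrightarrow> (e \<in> X) \<noteq> (e \<in> P)"
      using that flip_edge_in[OF N(3) that] flP' by (simp add: F_def)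
    show ?thesis
    proof (cases "e \<in> P")
      case True
      then show ?thesis using mem flP[OF True] by (auto simp: winner_def P_def)
    next
      case False
      moreover have "fst e < fst (snd e)" using that by (auto simp: edges_def)
      ultimately show ?thesis using mem that by (auto simp: winner_def Pm flip_edge_def)
    qed
  qed
  have nth: "?ys ! v = ?xs ! (Transposition.transpose t (Suc t) v)" for v
    by (auto simp: Transposition.transpose_def t_def nth_append nth_Cons' split: if_splits)
  have lt: "Transposition.transpose t (Suc t) v < N \<longleftrightarrow> v < N" for v using N(3) by (auto simp: Transposition.transpose_def)
  have score: "card {e \<in> edges p N. winner (F X) e = v}
      = card {e \<in> edges p N. winner X e = Transposition.transpose t (Suc t) v}" for X v
  proof (rule bij_betw_same_card[of "flip_edge t"], rule bij_betw_byWitness[where f' = "flip_edge t"])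
    show "flip_edge t ` {e \<in> edges p N. winner (F X) e = v}
        \<subseteq> {e \<in> edges p N. winner X e = Transposition.transpose t (Suc t) v}"
    proof
      fix e assume "e \<in> flip_edge t ` {e \<in> edges p N. winner (F X) e = v}"
      then have "flip_edge t e \<in> edges p N" "winner (F X) (flip_edge t e) = v" by auto
      moreover from this have "e \<in> edges p N" using flip_edge_in[OF N(3)] by (metis flip_edge_invol)
      ultimately show "e \<in> {e \<in> edges p N. winner X e = Transposition.transpose t (Suc t) v}"
        using win[of e X] by auto
    qed
    show "flip_edge t ` {e \<in> edges p N. winner X e = Transposition.transpose t (Suc t) v}
        \<subseteq> {e \<in> edges p N. winner (F X) e = v}"
      using win[of _ X] flip_edge_in[OF N(3)] by auto
  qed auto
  have FE: "F X \<subseteq> edges p N" for X by (auto simp: F_def)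
  have all: "(\<forall>v<N. Q (Transposition.transpose t (Suc t) v)) \<longleftrightarrow> (\<forall>v<N. Q v)" for Q :: "nat \<Rightarrow> bool"
    using lt by (metis Transposition.transpose_involutory)
  have mem: "F X \<in> tournaments p ?ys \<longleftrightarrow> X \<in> tournaments p ?xs" if "X \<subseteq> edges p N" for X
  proof -
    have "F X \<in> tournaments p ?ys \<longleftrightarrow>
        (\<forall>v<N. card {e \<in> edges p N. winner X e = Transposition.transpose t (Suc t) v} = ?xs ! Transposition.transpose t (Suc t) v)"
      unfolding tournaments_def N mem_Collect_eq score nth using FE by blast
    also have "\<dots> \<longleftrightarrow> (\<forall>v<N. card {e \<in> edges p N. winner X e = v} = ?xs ! v)"
      by (rule all)
    finally show ?thesis using that unfolding tournaments_def N by blast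
  qed
  have mem': "F X \<in> tournaments p ?xs \<longleftrightarrow> X \<in> tournaments p ?ys" if "X \<subseteq> edges p N" for X
    using mem[OF FE, of X] unfolding FF[OF that] by blast
  have sign: "(-1) ^ card (edges p N - X) = (-1) ^ p * ((-1) ^ card (edges p N - F X) :: real)"
    if X: "X \<subseteq> edges p N" for X
  proof -
    have PE: "P \<subseteq> edges p N" using Pm by auto
    have fP: "finite P" by (simp add: P_def)
    have *: "card (edges p N - Y) = card (edges p N - P - Y) + card (P - Y)" for Y
    proof -
      have "edges p N - Y = (edges p N - P - Y) \<union> (P - Y)" using PE by auto
      moreover have "card ((edges p N - P - Y) \<union> (P - Y)) = card (edges p N - P - Y) + card (P - Y)"
        using fP by (intro card_Un_disjoint) auto
      ultimately show ?thesis by simp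
    qed
    have "card (edges p N - P - F X) = card (edges p N - P - X)"
    proof (rule bij_betw_same_card[of "flip_edge t"], rule bij_betw_byWitness[where f' = "flip_edge t"])
      show "flip_edge t ` (edges p N - P - F X) \<subseteq> edges p N - P - X"
        using flip_edge_in[OF N(3), of _ p] flP' by (auto simp: F_def)
      show "flip_edge t ` (edges p N - P - X) \<subseteq> edges p N - P - F X"
        using flip_edge_in[OF N(3), of _ p] flP' by (auto simp: F_def)
    qed auto
    moreover have "P - F X = P \<inter> X" using PE flP by (auto simp: F_def)
    moreover have "p = card (P \<inter> X) + card (P - X)"
    proof -
      have "card P = card (P \<inter> X) + card (P - X)"
        using fP by (metis card_Diff_subset_Int card_mono add_diff_inverse_nat finite_Int Int_lower1 not_less)
      then show ?thesis by (simp add: P_def)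
    qed
    ultimately have "(-1) ^ p * ((-1) ^ card (edges p N - F X) :: real)
        = (-1) ^ (card (P \<inter> X) + card (P - X)) * ((-1) ^ card (edges p N - P - X) * (-1) ^ card (P \<inter> X))"
      by (subst *) (simp add: power_add)
    also have "\<dots> = ((-1) ^ card (P \<inter> X) * (-1) ^ card (P \<inter> X)) * (-1) ^ card (edges p N - X)"
      unfolding *[of X] by (simp add: power_add ac_simps)
    also have "(-1) ^ card (P \<inter> X) * (-1) ^ card (P \<inter> X) = (1 :: real)"
      by (simp flip: power_add)
    finally show ?thesis by simp
  qed
  have sub: "X \<subseteq> edges p N" if "X \<in> tournaments p ?xs \<or> X \<in> tournaments p ?ys" for X
    using that N by (auto simp: tournaments_def)
  have "amp p ?xs = (\<Sum>X\<in>tournaments p ?ys. (-1) ^ p * (-1) ^ card (edges p N - X))"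
    unfolding amp_def N
  proof (rule sum.reindex_bij_witness[where i = F and j = F])
    fix X assume X: "X \<in> tournaments p ?xs"
    then have X': "X \<subseteq> edges p N" using sub by blast
    show "F (F X) = X" using FF[OF X'] .
    show "F X \<in> tournaments p ?ys" using mem[OF X'] X by blast
    show "(-1) ^ p * (-1) ^ card (edges p N - F X) = ((-1) ^ card (edges p N - X) :: real)"
      using sign[OF X'] by (rule sym)
  next
    fix X assume X: "X \<in> tournaments p ?ys"
    then have X': "X \<subseteq> edges p N" using sub by blast
    show "F (F X) = X" using FF[OF X'] .
    show "F X \<in> tournaments p ?xs" using mem'[OF X'] X by blast
  qed
  then show ?thesis unfolding amp_def N by (simp add: sum_distrib_left)
qed

lemma amp_move_one: "amp p (pre @ x # vs @ rest) = (-1) ^ (p * length vs) * amp p (pre @ vs @ x # rest)"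
proof (induction vs arbitrary: pre)
  case (Cons v vs)
  have "amp p (pre @ x # v # vs @ rest) = (-1) ^ p * amp p ((pre @ [v]) @ x # vs @ rest)"
    by (subst amp_swap) simp
  also have "\<dots> = (-1) ^ p * ((-1) ^ (p * length vs) * amp p ((pre @ [v]) @ vs @ x # rest))"
    by (subst Cons.IH) simp
  finally show ?case by (simp add: power_add)
qed simp

lemma amp_swap_blocks:
  "amp p (pre @ us @ vs @ rest) = (-1) ^ (p * (length us * length vs)) * amp p (pre @ vs @ us @ rest)"
proof (induction us arbitrary: rest rule: rev_induct)
  case (snoc u us)
  have "amp p (pre @ (us @ [u]) @ vs @ rest) = amp p ((pre @ us) @ u # vs @ rest)" by simp
  also have "\<dots> = (-1) ^ (p * length vs) * amp p (pre @ us @ vs @ (u # rest))"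
    by (subst amp_move_one) simp
  also have "\<dots> = (-1) ^ (p * length vs) * ((-1) ^ (p * (length us * length vs)) * amp p (pre @ vs @ us @ (u # rest)))"
    by (subst snoc.IH) simp
  finally show ?case by (simp add: power_add algebra_simps)
qed simp

text \<open>The sign must not depend on what surrounds the block: one \<open>s\<close> later serves
  an index list over all backgrounds at once. Hence \<open>pre\<close> and \<open>rest\<close> are
  quantified after \<open>s\<close> has been chosen.\<close>

lemma amp_permute:
  assumes "mset us = mset vs"
  obtains s :: real where "s = 1 \<or> s = -1" "\<And>pre rest. amp p (pre @ us @ rest) = s * amp p (pre @ vs @ rest)"
proof -
  have "\<exists>s::real. (s = 1 \<or> s = -1) \<and> (\<forall>pre rest. amp p (pre @ us @ rest) = s * amp p (pre @ vs @ rest))"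
    using assms
  proof (induction us arbitrary: vs)
    case Nil
    then show ?case by (intro exI[of _ 1]) auto
  next
    case (Cons u us)
    then have "u \<in> set vs" by (metis list.set_intros(1) mset_eq_setD)
    then obtain v1 v2 where v: "vs = v1 @ u # v2" by (meson split_list)
    then have "mset us = mset (v1 @ v2)" using Cons.prems by simp
    from Cons.IH[OF this] obtain s :: real where s: "s = 1 \<or> s = -1"
      "\<And>pre rest. amp p (pre @ us @ rest) = s * amp p (pre @ (v1 @ v2) @ rest)" by blast
    have "amp p (pre @ (u # us) @ rest) = (s * (-1) ^ (p * length v1)) * amp p (pre @ vs @ rest)" for pre rest
    proof -
      have "amp p (pre @ (u # us) @ rest) = s * amp p ((pre @ [u]) @ (v1 @ v2) @ rest)"
        using s(2)[of "pre @ [u]" rest] by simp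
      also have "\<dots> = s * ((-1) ^ (p * length v1) * amp p (pre @ vs @ rest))"
        using amp_move_one[of p pre u v1 "v2 @ rest"] by (simp add: v)
      finally show ?thesis by simp
    qed
    moreover have "s * (-1) ^ (p * length v1) = 1 \<or> s * (-1) ^ (p * length v1) = -1"
      using s(1) by (cases "even (p * length v1)") auto
    ultimately show ?case by blast
  qed
  then show thesis using that by blast
qed

section \<open>Weights, renewal points and the partition function\<close>

definition en :: "nat list \<Rightarrow> real" where "en xs = (\<Sum>x\<leftarrow>xs. (real x)\<^sup>2)"

text \<open>The product of the factorials of the occupation numbers, so that \<open>F\<close> has
  \<open>fact (size F) / mfac F\<close> orderings.\<close>

definition mfac :: "nat multiset \<Rightarrow> real" where
  "mfac F = (\<Prod>x\<in>set_mset F. fact (count F x))"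

definition shift_ms :: "nat \<Rightarrow> nat multiset \<Rightarrow> nat multiset" where
  "shift_ms c F = image_mset (\<lambda>x. x + c) F"

lemma mfac_pos [simp]: "mfac F > 0"
  by (auto simp: mfac_def intro!: prod_pos)

lemma mfac_nonzero [simp]: "mfac F \<noteq> 0"
  using mfac_pos[of F] by linarith

lemma mfac_add:
  assumes "set_mset F \<inter> set_mset G = {}"
  shows "mfac (F + G) = mfac F * mfac G"
proof -
  have 1: "count G x = 0" if "x \<in># F" for x
    using assms that by (meson count_eq_zero_iff disjoint_iff)
  have 2: "count F x = 0" if "x \<in># G" for x
    using assms that by (meson count_eq_zero_iff disjoint_iff)
  have "mfac (F + G) = (\<Prod>x\<in>set_mset F. fact (count (F + G) x)) * (\<Prod>x\<in>set_mset G. fact (count (F + G) x))"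
    unfolding mfac_def set_mset_union using assms by (intro prod.union_disjoint) auto
  also have "(\<Prod>x\<in>set_mset F. fact (count (F + G) x)) = mfac F"
    unfolding mfac_def by (intro prod.cong) (auto simp: 1)
  also have "(\<Prod>x\<in>set_mset G. fact (count (F + G) x)) = mfac G"
    unfolding mfac_def by (intro prod.cong) (auto simp: 2)
  finally show ?thesis .
qed

lemma count_shift_ms: "count (shift_ms c F) (x + c) = count F x"
  by (induction F) (auto simp: shift_ms_def)

lemma mfac_shift [simp]: "mfac (shift_ms c F) = mfac F"
proof -
  have "set_mset (shift_ms c F) = (\<lambda>x. x + c) ` set_mset F" by (simp add: shift_ms_def)
  then show ?thesis unfolding mfac_def
    by (simp add: prod.reindex inj_on_def count_shift_ms)
qed

lemma size_shift_ms [simp]: "size (shift_ms c F) = size F"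
  by (simp add: shift_ms_def)

lemma set_shift_ms: "set_mset (shift_ms c F) = (\<lambda>x. x + c) ` set_mset F"
  by (simp add: shift_ms_def)

lemma inj_shift_ms: "inj (shift_ms c)"
proof (rule injI)
  fix F G assume *: "shift_ms c F = shift_ms c G"
  show "F = G" by (rule multiset_eqI) (metis * count_shift_ms)
qed

lemma shift_ms_minus:
  assumes "\<And>x. x \<in># F \<Longrightarrow> c \<le> x"
  shows "shift_ms c (image_mset (\<lambda>x. x - c) F) = F"
proof -
  have "image_mset ((\<lambda>x. x + c) \<circ> (\<lambda>x. x - c)) F = image_mset id F"
    using assms by (intro image_mset_cong) auto
  then show ?thesis unfolding shift_ms_def by (simp add: multiset.map_comp)
qed

lemma sum_shift_ms: "sum_mset (shift_ms c F) = sum_mset F + c * size F"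
  by (induction F) (auto simp: shift_ms_def)

lemma sorted_list_of_multiset_eqI:
  "sorted xs \<Longrightarrow> mset xs = F \<Longrightarrow> sorted_list_of_multiset F = xs"
  using sorted_sort_id by (metis sorted_list_of_multiset_mset)

lemma sorted_list_of_multiset_add_shift:
  assumes "\<And>x y. x \<in># F \<Longrightarrow> y \<in># G \<Longrightarrow> x \<le> y"
  shows "sorted_list_of_multiset (F + G) = sorted_list_of_multiset F @ sorted_list_of_multiset G"
  by (rule sorted_list_of_multiset_eqI) (use assms in \<open>auto simp: sorted_append\<close>)

lemma sorted_list_of_multiset_shift:
  "sorted_list_of_multiset (shift_ms c F) = map (\<lambda>x. x + c) (sorted_list_of_multiset F)"
  by (rule sorted_list_of_multiset_eqI) (auto simp: shift_ms_def sorted_map intro: sorted_wrt_mono_rel[of _ "(\<le>)"])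

lemma length_sorted_list_of_multiset [simp]: "length (sorted_list_of_multiset F) = size F"
  by (metis mset_sorted_list_of_multiset size_mset)

lemma en_append [simp]: "en (xs @ ys) = en xs + en ys"
  by (simp add: en_def)

lemma en_shift: "en (map (\<lambda>x. x + c) xs) = en xs + 2 * real c * real (sum_list xs) + real (length xs) * (real c)\<^sup>2"
  by (induction xs) (auto simp: en_def algebra_simps power2_eq_square)

lemma en_mset: "mset xs = mset ys \<Longrightarrow> en xs = en ys"
  unfolding en_def by (metis mset_map sum_mset_sum_list)

lemma tri_add: "tri p (m + n) = tri p m + tri p n + p * m * n"
  by (induction n) (auto simp: tri_def algebra_simps)

section \<open>Weights of occupation multisets and their multiplicativity\<close>

locale discrete =
  fixes p :: nat and g :: real
  assumes p_pos: "p > 0"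
begin

definition e0 :: "nat \<Rightarrow> real" where "e0 n = (\<Sum>j<n. (real (p * j))\<^sup>2)"

text \<open>For \<open>g = l\<^sup>2 / R\<^sup>2\<close> the factor
  \<open>exp (g / 2 * en xs)\<close> is the product of the norms of the orbitals, up to a constant
  per particle. The subtraction of \<open>e0\<close>, the energy of the reference configuration
  \<open>0, p, 2 p, ...\<close>, is what makes amplitudes multiply at renewal points.\<close>

definition lamp :: "nat list \<Rightarrow> real" where
  "lamp xs = amp p xs * exp (g / 2 * (en xs - e0 (length xs)))"

definition ms :: "nat \<Rightarrow> nat multiset set" where
  "ms n = {F. size F = n \<and> sum_mset F = tri p n \<and> set_mset F \<subseteq> {..<p * n}}"

definition wt :: "nat multiset \<Rightarrow> real" where
  "wt F = (lamp (sorted_list_of_multiset F))\<^sup>2 / mfac F"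

text \<open>The squared norm of the Laughlin function of \<open>n\<close> particles up to explicit
  factors, by \<open>laughlin_norm2_eq\<close> and \<open>Gam_Nil\<close>.\<close>

definition C :: "nat \<Rightarrow> real" where "C n = (\<Sum>F\<in>ms n. wt F)"

text \<open>For a multiset of nonzero weight this says that exactly \<open>k\<close> particles lie
  below \<open>p * k\<close> and that dominance holds with equality for them.\<close>

definition ren :: "nat multiset \<Rightarrow> nat \<Rightarrow> bool" where
  "ren F k \<longleftrightarrow> {#x \<in># F. x < p * k#} \<in> ms k"

lemma e0_add: "e0 (m + n) = e0 m + e0 n + 2 * real (p * m) * real (tri p n) + real n * (real (p * m))\<^sup>2"
  by (induction n) (auto simp: e0_def tri_def algebra_simps power2_eq_square)

lemma finite_ms [simp]: "finite (ms n)"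
proof (rule finite_subset)
  show "ms n \<subseteq> mset ` orbs p n n"
  proof
    fix F assume "F \<in> ms n"
    then have "sorted_list_of_multiset F \<in> orbs p n n" by (auto simp: ms_def orbs_def)
    then show "F \<in> mset ` orbs p n n" by (metis imageI mset_sorted_list_of_multiset)
  qed
qed simp

lemma wt_nonneg [simp]: "wt F \<ge> 0"
  by (simp add: wt_def less_imp_le)

text \<open>Shifting the second block by \<open>p * length ys\<close> creates a coupling energy
  linear in \<open>sum_list zs\<close>. Where \<open>amp p zs\<close> is nonzero that sum is fixed,
  and the coupling is exactly the cross term of \<open>e0_add\<close>, so energies measured from
  \<open>e0\<close> add up.\<close>

lemma lamp_append:
  assumes s: "sum_list ys = tri p (length ys)"
  shows "lamp (ys @ map (\<lambda>x. x + p * length ys) zs) = lamp ys * lamp zs"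
proof -
  have a: "amp p (ys @ map (\<lambda>x. x + p * length ys) zs) = amp p ys * amp p zs"
    by (subst amp_append[OF s]) (auto simp: comp_def)
  show ?thesis
  proof (cases "amp p zs = 0")
    case False
    then have "sum_list zs = tri p (length zs)" by (rule amp_sum_list)
    then have "en (ys @ map (\<lambda>x. x + p * length ys) zs) - e0 (length ys + length zs)
       = (en ys - e0 (length ys)) + (en zs - e0 (length zs))"
      unfolding en_append en_shift e0_add by (simp add: algebra_simps)
    moreover have "length (ys @ map (\<lambda>x. x + p * length ys) zs) = length ys + length zs" by simp
    ultimately show ?thesis unfolding lamp_def a by (simp only: distrib_left exp_add) simp
  qed (simp add: lamp_def a)
qed

lemma lamp_eq_0_iff [simp]: "lamp xs = 0 \<longleftrightarrow> amp p xs = 0"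
  by (simp add: lamp_def)

lemma wt_nonzero_in_ms:
  assumes "wt F \<noteq> 0" shows "F \<in> ms (size F)"
proof -
  let ?xs = "sorted_list_of_multiset F"
  have a: "amp p ?xs \<noteq> 0" using assms by (auto simp: wt_def)
  have "sum_list ?xs = sum_mset F" by (metis mset_sorted_list_of_multiset sum_mset_sum_list)
  then show ?thesis using amp_sum_list[OF a] amp_entry_less[OF p_pos a] by (auto simp: ms_def)
qed

lemma sum_sorted_list_of_multiset: "sum_list (sorted_list_of_multiset F) = sum_mset F"
  by (metis mset_sorted_list_of_multiset sum_mset_sum_list)

lemma join_in_ms:
  assumes "F \<in> ms k" "G \<in> ms n"
  shows "F + shift_ms (p * k) G \<in> ms (k + n)"
proof -
  have "x + p * k < p * (k + n)" if "x \<in># G" for x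
    using assms(2) that by (auto simp: ms_def algebra_simps)
  moreover have "x < p * (k + n)" if "x \<in># F" for x
    using assms(1) that by (fastforce simp: ms_def algebra_simps)
  ultimately show ?thesis
    using assms by (auto simp: ms_def sum_shift_ms tri_add set_shift_ms algebra_simps)
qed

lemma filter_join:
  assumes "set_mset F \<subseteq> {..<c}"
  shows "{#x \<in># F + shift_ms c G. x < c#} = F" "{#x \<in># F + shift_ms c G. \<not> x < c#} = shift_ms c G"
proof -
  have 1: "filter_mset (\<lambda>x. x < c) F = F" "filter_mset (\<lambda>x. \<not> x < c) (shift_ms c G) = shift_ms c G"
    using assms by (auto simp: filter_mset_eq_conv set_shift_ms)
  have 2: "filter_mset (\<lambda>x. x < c) (shift_ms c G) = {#}" "filter_mset (\<lambda>x. \<not> x < c) F = {#}"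
    using assms by (auto simp: filter_mset_eq_conv set_shift_ms)
  show "{#x \<in># F + shift_ms c G. x < c#} = F" "{#x \<in># F + shift_ms c G. \<not> x < c#} = shift_ms c G"
    using 1 2 by simp_all
qed

lemma ren_join: "F \<in> ms k \<Longrightarrow> ren (F + shift_ms (p * k) G) k"
  unfolding ren_def by (subst filter_join) (auto simp: ms_def)

lemma ren_split:
  assumes "F \<in> ms (k + n)" "ren F k"
  obtains G H where "G \<in> ms k" "H \<in> ms n" "F = G + shift_ms (p * k) H"
proof -
  let ?G = "{#x \<in># F. x < p * k#}" and ?H' = "{#x \<in># F. \<not> x < p * k#}"
  let ?H = "image_mset (\<lambda>x. x - p * k) ?H'"
  have H: "shift_ms (p * k) ?H = ?H'" by (rule shift_ms_minus) auto
  have G: "?G \<in> ms k" using assms(2) by (simp add: ren_def)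
  have F: "F = ?G + shift_ms (p * k) ?H" unfolding H by (rule multiset_partition)
  have "size F = size ?G + size ?H" by (subst F) simp
  then have s: "size ?H = n" using assms(1) G by (simp add: ms_def)
  have "sum_mset F = sum_mset ?G + sum_mset ?H + p * k * size ?H"
    by (subst F) (simp only: sum_mset.union sum_shift_ms)
  then have t: "sum_mset ?H = tri p n" using assms(1) G s by (simp add: ms_def tri_add)
  have "x < p * n" if "x \<in># ?H" for x
    using that assms(1) by (auto simp: ms_def algebra_simps)
  then have "?H \<in> ms n" using s t by (auto simp: ms_def)
  with G F show thesis using that by blast
qed

lemma mfac_join:
  assumes "set_mset F \<subseteq> {..<c}"
  shows "mfac (F + shift_ms c G) = mfac F * mfac G"
  using assms by (subst mfac_add) (auto simp: set_shift_ms)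

lemma sorted_join:
  assumes "set_mset F \<subseteq> {..<c}"
  shows "sorted_list_of_multiset (F + shift_ms c G) = sorted_list_of_multiset F @ map (\<lambda>x. x + c) (sorted_list_of_multiset G)"
  by (subst sorted_list_of_multiset_add_shift) (use assms in \<open>auto simp: set_shift_ms sorted_list_of_multiset_shift\<close>)

lemma wt_join:
  assumes "F \<in> ms k" shows "wt (F + shift_ms (p * k) G) = wt F * wt G"
proof -
  have F: "set_mset F \<subseteq> {..<p * k}" "size F = k" using assms by (auto simp: ms_def)
  have "sum_list (sorted_list_of_multiset F) = tri p (length (sorted_list_of_multiset F))"
    using assms by (simp add: sum_sorted_list_of_multiset ms_def)
  from lamp_append[OF this, of "sorted_list_of_multiset G"]
  show ?thesis unfolding wt_def sorted_join[OF F(1)] mfac_join[OF F(1)]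
    by (simp add: F power_mult_distrib)
qed

lemma inj_join: "inj_on (\<lambda>(F, G). F + shift_ms (p * k) G) (ms k \<times> UNIV)"
proof (rule inj_onI, clarify)
  fix F G F' G' assume F: "F \<in> ms k" "F' \<in> ms k" and e: "F + shift_ms (p * k) G = F' + shift_ms (p * k) G'"
  have "F = F'" using filter_join(1)[of F "p*k" G] filter_join(1)[of F' "p*k" G'] F e by (simp add: ms_def)
  moreover have "shift_ms (p * k) G = shift_ms (p * k) G'" using e \<open>F = F'\<close> by simp
  ultimately show "F = F' \<and> G = G'" using inj_shift_ms by (auto simp: inj_def)
qed

lemma sum_ren:
  "(\<Sum>F | F \<in> ms (k + n) \<and> ren F k. f F) = (\<Sum>F\<in>ms k. \<Sum>G\<in>ms n. f (F + shift_ms (p * k) G))"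
proof -
  have "{F \<in> ms (k + n). ren F k} = (\<lambda>(F, G). F + shift_ms (p * k) G) ` (ms k \<times> ms n)"
    using join_in_ms ren_join by (auto elim!: ren_split)
  moreover have "inj_on (\<lambda>(F, G). F + shift_ms (p * k) G) (ms k \<times> ms n)"
    using inj_join by (rule inj_on_subset) auto
  ultimately show ?thesis
    by (simp add: sum.reindex sum.cartesian_product split_def)
qed

lemma C_nonneg: "C n \<ge> 0"
  unfolding C_def by (intro sum_nonneg) auto

text \<open>Joining two chains produces precisely the configurations of the long chain that renew at
  \<open>k\<close>; all others have nonnegative weight.\<close>

lemma C_mult_le: "C k * C n \<le> C (k + n)"
proof -
  have "C k * C n = (\<Sum>F\<in>ms k. \<Sum>G\<in>ms n. wt (F + shift_ms (p * k) G))"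
    unfolding C_def sum_product by (intro sum.cong refl) (simp add: wt_join)
  also have "\<dots> = (\<Sum>F | F \<in> ms (k + n) \<and> ren F k. wt F)" by (simp add: sum_ren)
  also have "\<dots> \<le> C (k + n)" unfolding C_def by (intro sum_mono2) auto
  finally show ?thesis .
qed

lemma edges_trivial [simp]: "edges p 0 = {}" "edges p (Suc 0) = {}"
  by (auto simp: edges_def)

lemma C_0 [simp]: "C 0 = 1"
proof -
  have "ms 0 = {{#}}" by (auto simp: ms_def tri_def)
  moreover have "tournaments p [] = {{}}" by (auto simp: tournaments_def)
  ultimately show ?thesis by (simp add: C_def wt_def lamp_def amp_def en_def e0_def mfac_def)
qed

lemma C_1 [simp]: "C (Suc 0) = 1"
proof -
  have "ms (Suc 0) = {{#0#}}"
  proof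
    show "ms (Suc 0) \<subseteq> {{#0#}}"
    proof
      fix F assume F: "F \<in> ms (Suc 0)"
      then have "size F = 1" by (simp add: ms_def)
      then obtain x where "F = {#x#}" by (metis size_1_singleton_mset)
      then show "F \<in> {{#0#}}" using F by (simp add: ms_def tri_def)
    qed
  qed (use p_pos in \<open>auto simp: ms_def tri_def\<close>)
  moreover have "tournaments p [0] = {{}}" by (auto simp: tournaments_def)
  ultimately show ?thesis by (simp add: C_def wt_def lamp_def amp_def en_def e0_def mfac_def)
qed

lemma C_Suc_le: "C n \<le> C (Suc n)"
  using C_mult_le[of n "Suc 0"] by simp

text \<open>When a chain is cut, a block of particles around the cut is discarded. Monotonicity
  brings the particle numbers of the two remaining stretches back up to the intended ones.\<close>

lemma C_mono: "m \<le> n \<Longrightarrow> C m \<le> C n"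
  by (rule lift_Suc_mono_le[of C]) (use C_Suc_le in auto)

lemma C_ge_1: "C n \<ge> 1"
  using C_mono[of 0 n] by simp

lemma C_pos [simp]: "C n > 0"
  using C_ge_1[of n] by linarith

end

section \<open>Common renewal points of two independent copies\<close>

lemma sum_UN_le:
  fixes f :: "'a \<Rightarrow> real"
  assumes "finite I" "\<And>i. i \<in> I \<Longrightarrow> finite (A i)" "\<And>x. f x \<ge> 0"
  shows "(\<Sum>x\<in>(\<Union>i\<in>I. A i). f x) \<le> (\<Sum>i\<in>I. \<Sum>x\<in>A i. f x)"
  using assms(1,2)
proof (induction I rule: finite_induct)
  case (insert i I)
  have "(\<Sum>x\<in>(\<Union>i\<in>insert i I. A i). f x) = (\<Sum>x\<in>A i. f x) + (\<Sum>x\<in>(\<Union>i\<in>I. A i) - A i. f x)"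
    using insert by (subst sum.union_disjoint[symmetric]) (auto intro: sum.cong)
  also have "(\<Sum>x\<in>(\<Union>i\<in>I. A i) - A i. f x) \<le> (\<Sum>x\<in>(\<Union>i\<in>I. A i). f x)"
    using insert assms(3) by (intro sum_mono2) auto
  finally show ?case using insert by simp
qed simp

context discrete
begin

lemma join_in_ms_iff:
  assumes "F \<in> ms k"
  shows "F + shift_ms (p * k) G \<in> ms (k + n) \<longleftrightarrow> G \<in> ms n"
proof
  assume *: "F + shift_ms (p * k) G \<in> ms (k + n)"
  have s: "size G = n" using * assms by (simp add: ms_def)
  have "x < p * n" if "x \<in># G" for x
  proof -
    have "x + p * k < p * (k + n)" using * that by (auto simp: ms_def set_shift_ms)
    then show ?thesis by (simp add: algebra_simps)
  qed
  then show "G \<in> ms n" using * assms s by (auto simp: ms_def sum_shift_ms tri_add)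
qed (use join_in_ms assms in blast)

lemma ren_join_high:
  assumes "F \<in> ms k"
  shows "ren (F + shift_ms (p * k) G) (k + j) \<longleftrightarrow> ren G j"
proof -
  have 1: "filter_mset (\<lambda>x. x < p * (k + j)) F = F"
    using assms by (fastforce simp: ms_def filter_mset_eq_conv algebra_simps)
  have 2: "filter_mset (\<lambda>x. x < p * (k + j)) (shift_ms (p * k) G) = shift_ms (p * k) (filter_mset (\<lambda>x. x < p * j) G)"
    unfolding shift_ms_def filter_mset_image_mset by (simp add: algebra_simps)
  show ?thesis unfolding ren_def filter_union_mset 1 2 by (rule join_in_ms_iff[OF assms])
qed

lemma ren_join_low:
  assumes "j \<le> k"
  shows "ren (F + shift_ms (p * k) G) j \<longleftrightarrow> ren F j"
proof -
  have "p * j \<le> p * k" using assms by simp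
  then have "\<not> x + p * k < p * j" for x by linarith
  then have *: "filter_mset (\<lambda>x. x < p * j) (shift_ms (p * k) G) = {#}"
    by (auto simp: set_shift_ms)
  show ?thesis unfolding ren_def filter_union_mset * by simp
qed

lemma ren_0 [simp]: "ren F 0"
proof -
  have "{#} \<in> ms 0" by (simp add: ms_def tri_def)
  then show ?thesis by (simp add: ren_def)
qed

lemma ren_self: "F \<in> ms n \<Longrightarrow> ren F n"
proof -
  assume F: "F \<in> ms n"
  then have "filter_mset (\<lambda>x. x < p * n) F = F" by (auto simp: ms_def filter_mset_eq_conv)
  then show ?thesis using F by (simp add: ren_def)
qed

definition com :: "nat multiset \<times> nat multiset \<Rightarrow> nat \<Rightarrow> bool" where
  "com P k \<longleftrightarrow> ren (fst P) k \<and> ren (snd P) k"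

definition wt2 :: "nat multiset \<times> nat multiset \<Rightarrow> real" where
  "wt2 P = wt (fst P) * wt (snd P)"

definition join2 :: "nat \<Rightarrow> nat multiset \<times> nat multiset \<Rightarrow> nat multiset \<times> nat multiset \<Rightarrow> nat multiset \<times> nat multiset" where
  "join2 k P Q = (fst P + shift_ms (p * k) (fst Q), snd P + shift_ms (p * k) (snd Q))"

abbreviation ms2 where "ms2 n \<equiv> ms n \<times> ms n"

definition gaps :: "nat \<Rightarrow> nat \<Rightarrow> nat \<Rightarrow> (nat multiset \<times> nat multiset) set" where
  "gaps N k k' = {P \<in> ms2 N. com P k \<and> com P k' \<and> (\<forall>j. k < j \<longrightarrow> j < k' \<longrightarrow> \<not> com P j)}"

text \<open>The probability that two independent copies of length \<open>n\<close> have no common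
  renewal strictly inside. By \<open>sum_gaps\<close> it determines the weight of a gap of length
  \<open>n\<close> at any place in any longer chain.\<close>

definition irr :: "nat \<Rightarrow> real" where
  "irr n = (\<Sum>P\<in>gaps n 0 n. wt2 P) / (C n)\<^sup>2"

lemma finite_gaps [simp]: "finite (gaps N k k')"
  by (rule finite_subset[of _ "ms2 N"]) (auto simp: gaps_def)

lemma wt2_nonneg [simp]: "wt2 P \<ge> 0"
  by (simp add: wt2_def)

lemma irr_nonneg [simp]: "irr n \<ge> 0"
  unfolding irr_def by (intro divide_nonneg_nonneg sum_nonneg) auto

lemma sum_wt2: "(\<Sum>P\<in>ms2 n. wt2 P) = (C n)\<^sup>2"
  unfolding C_def power2_eq_square sum_product sum.cartesian_product by (simp add: wt2_def split_def)

lemma sum_com: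
  "(\<Sum>P | P \<in> ms2 (k + n) \<and> com P k. f P) = (\<Sum>P\<in>ms2 k. \<Sum>Q\<in>ms2 n. f (join2 k P Q))"
proof -
  have "(\<Sum>P | P \<in> ms2 (k + n) \<and> com P k. f P)
      = (\<Sum>F | F \<in> ms (k + n) \<and> ren F k. \<Sum>G | G \<in> ms (k + n) \<and> ren G k. f (F, G))"
    unfolding sum.cartesian_product by (rule sum.cong) (auto simp: com_def)
  also have "\<dots> = (\<Sum>F\<in>ms k. \<Sum>F'\<in>ms n. \<Sum>G\<in>ms k. \<Sum>G'\<in>ms n. f (join2 k (F, G) (F', G')))"
    unfolding sum_ren join2_def by simp
  also have "\<dots> = (\<Sum>F\<in>ms k. \<Sum>G\<in>ms k. \<Sum>F'\<in>ms n. \<Sum>G'\<in>ms n. f (join2 k (F, G) (F', G')))"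
    by (intro sum.cong refl sum.swap)
  also have "\<dots> = (\<Sum>P\<in>ms2 k. \<Sum>Q\<in>ms2 n. f (join2 k P Q))"
    by (simp only: sum.cartesian_product')
  finally show ?thesis .
qed

lemma com_join2_high: "P \<in> ms2 k \<Longrightarrow> com (join2 k P Q) (k + j) \<longleftrightarrow> com Q j"
  by (auto simp: com_def join2_def ren_join_high)

lemma com_join2_low: "j \<le> k \<Longrightarrow> com (join2 k P Q) j \<longleftrightarrow> com P j"
  by (auto simp: com_def join2_def ren_join_low)

lemma com_self: "P \<in> ms2 n \<Longrightarrow> com P n"
  by (auto simp: com_def ren_self)

lemma com_0 [simp]: "com P 0"
  by (auto simp: com_def)

lemma wt2_join2: "P \<in> ms2 k \<Longrightarrow> wt2 (join2 k P Q) = wt2 P * wt2 Q"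
  by (auto simp: wt2_def join2_def wt_join)

text \<open>Two consecutive common renewals split each copy into three independent stretches, and
  only the middle one is subject to the condition that no common renewal lies inside.\<close>

lemma sum_gaps: "(\<Sum>P\<in>gaps (k + n + l) k (k + n). wt2 P) = irr n * (C k * C n * C l)\<^sup>2"
proof -
  \<comment> \<open>A gap that starts at the left end. The general case reduces to it by splitting
    at \<open>k\<close> first.\<close>
  have 1: "(\<Sum>P\<in>gaps (n + l) 0 n. wt2 P) = irr n * (C n * C l)\<^sup>2"
  proof -
    have "(\<Sum>P\<in>gaps (n + l) 0 n. wt2 P)
       = (\<Sum>P | P \<in> ms2 (n + l) \<and> com P n. if (\<forall>j. 0 < j \<longrightarrow> j < n \<longrightarrow> \<not> com P j) then wt2 P else 0)"
      by (rule sum.mono_neutral_cong_left) (auto simp: gaps_def)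
    also have "\<dots> = (\<Sum>P\<in>ms2 n. \<Sum>Q\<in>ms2 l. if P \<in> gaps n 0 n then wt2 P * wt2 Q else 0)"
      unfolding sum_com
    proof (intro sum.cong refl)
      fix P Q assume P: "P \<in> ms2 n"
      have "(\<forall>j. 0 < j \<longrightarrow> j < n \<longrightarrow> \<not> com (join2 n P Q) j) \<longleftrightarrow> P \<in> gaps n 0 n"
        using P com_self[OF P] by (simp add: gaps_def com_join2_low)
      then show "(if (\<forall>j. 0 < j \<longrightarrow> j < n \<longrightarrow> \<not> com (join2 n P Q) j) then wt2 (join2 n P Q) else 0)
         = (if P \<in> gaps n 0 n then wt2 P * wt2 Q else 0)"
        by (simp add: wt2_join2[OF P])
    qed
    also have "\<dots> = (\<Sum>P\<in>ms2 n. if P \<in> gaps n 0 n then wt2 P * (C l)\<^sup>2 else 0)"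
      by (intro sum.cong refl) (simp add: sum_distrib_left[symmetric] sum_wt2 del: sum.cartesian_product)
    also have "\<dots> = (\<Sum>P\<in>gaps n 0 n. wt2 P * (C l)\<^sup>2)"
      by (rule sum.mono_neutral_cong_right) (auto simp: gaps_def)
    also have "\<dots> = irr n * (C n * C l)\<^sup>2"
      using C_pos[of n, THEN less_imp_neq] by (simp add: irr_def sum_distrib_right[symmetric] power_mult_distrib)
    finally show ?thesis .
  qed
  have "(\<Sum>P\<in>gaps (k + n + l) k (k + n). wt2 P)
     = (\<Sum>P | P \<in> ms2 (k + (n + l)) \<and> com P k.
         if com P (k + n) \<and> (\<forall>j. k < j \<longrightarrow> j < k + n \<longrightarrow> \<not> com P j) then wt2 P else 0)"
    by (rule sum.mono_neutral_cong_left) (auto simp: gaps_def add.assoc)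
  also have "\<dots> = (\<Sum>P\<in>ms2 k. \<Sum>Q\<in>ms2 (n + l). if Q \<in> gaps (n + l) 0 n then wt2 P * wt2 Q else 0)"
    unfolding sum_com
  proof (intro sum.cong refl)
    fix P Q assume P: "P \<in> ms2 k" and Q: "Q \<in> ms2 (n + l)"
    have "(\<forall>j. k < j \<longrightarrow> j < k + n \<longrightarrow> \<not> com (join2 k P Q) j) \<longleftrightarrow> (\<forall>j. 0 < j \<longrightarrow> j < n \<longrightarrow> \<not> com Q j)"
      (is "?L \<longleftrightarrow> ?R")
    proof
      assume L: ?L
      show ?R
        using L[rule_format, of "k + _"] com_join2_high[OF P] by auto
    next
      assume R: ?R
      show ?L
      proof (intro allI impI)
        fix j assume j: "k < j" "j < k + n"
        then show "\<not> com (join2 k P Q) j" using R[rule_format, of "j - k"] com_join2_high[OF P, of Q "j - k"] by simp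
      qed
    qed
    then have "com (join2 k P Q) (k + n) \<and> (\<forall>j. k < j \<longrightarrow> j < k + n \<longrightarrow> \<not> com (join2 k P Q) j) \<longleftrightarrow> Q \<in> gaps (n + l) 0 n"
      using Q com_join2_high[OF P] by (simp add: gaps_def)
    then show "(if com (join2 k P Q) (k + n) \<and> (\<forall>j. k < j \<longrightarrow> j < k + n \<longrightarrow> \<not> com (join2 k P Q) j) then wt2 (join2 k P Q) else 0)
       = (if Q \<in> gaps (n + l) 0 n then wt2 P * wt2 Q else 0)"
      by (simp add: wt2_join2[OF P])
  qed
  also have "\<dots> = (\<Sum>P\<in>ms2 k. \<Sum>Q\<in>gaps (n + l) 0 n. wt2 P * wt2 Q)"
    by (intro sum.cong refl sum.mono_neutral_cong_right) (auto simp: gaps_def)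
  also have "\<dots> = (\<Sum>P\<in>ms2 k. wt2 P) * (\<Sum>Q\<in>gaps (n + l) 0 n. wt2 Q)"
    by (simp only: sum_product)
  also have "\<dots> = irr n * (C k * C n * C l)\<^sup>2"
    unfolding 1 sum_wt2 by (simp add: power_mult_distrib)
  finally show ?thesis .
qed

end

section \<open>Finite mean gap, and long windows without a common renewal\<close>

locale recurrent = discrete +
  fixes K :: real
  assumes C_submult: "C (m + n) \<le> K * (C m * C n)"
begin

lemma K_ge_1: "K \<ge> 1"
  using C_submult[of 0 0] by simp

text \<open>A pair of length \<open>2 * c\<close> has at most one gap straddling the point
  \<open>c\<close>, so the probabilities of the different straddling gaps add up to at most 1. A gap
  of length \<open>n \<le> c\<close> can start at \<open>c - i\<close> for each
  \<open>i < n\<close>, which gives the factor \<open>n\<close>, and stays within the chain. Two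
  uses of submultiplicativity for each of the two copies show that every placement has probability
  at least \<open>irr n / K ^ 4\<close>.\<close>

lemma sum_irr_le: "(\<Sum>n\<le>c. real n * irr n) \<le> K ^ 4"
proof -
  let ?I = "SIGMA n:{..c}. {..<n}"
  let ?G = "\<lambda>(n, i). gaps (2 * c) (c - i) (c - i + n)"
  have each: "irr n * (C (2 * c))\<^sup>2 \<le> K ^ 4 * (\<Sum>P\<in>?G (n, i). wt2 P)" if "n \<le> c" "i < n" for n i
  proof -
    define l where "l = 2 * c - (c - i + n)"
    have N: "2 * c = c - i + n + l" using that by (simp add: l_def)
    have "C (2 * c) \<le> K * (C (c - i) * C (n + l))" using C_submult[of "c - i" "n + l"] N by (simp add: add.assoc)
    also have "\<dots> \<le> K * (C (c - i) * (K * (C n * C l)))"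
      using K_ge_1 C_submult[of n l] by (intro mult_left_mono) (auto simp: less_imp_le)
    finally have "C (2 * c) \<le> K\<^sup>2 * (C (c - i) * C n * C l)" by (simp add: power2_eq_square ac_simps)
    then have "(C (2 * c))\<^sup>2 \<le> (K\<^sup>2 * (C (c - i) * C n * C l))\<^sup>2"
      by (intro power_mono) (auto simp: less_imp_le)
    also have "\<dots> = K ^ 4 * (C (c - i) * C n * C l)\<^sup>2" by (simp add: power_mult_distrib flip: power_mult)
    finally have "irr n * (C (2 * c))\<^sup>2 \<le> irr n * (K ^ 4 * (C (c - i) * C n * C l)\<^sup>2)"
      by (intro mult_left_mono) auto
    also have "\<dots> = K ^ 4 * (\<Sum>P\<in>?G (n, i). wt2 P)"
      unfolding prod.case N sum_gaps by simp
    finally show ?thesis .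
  qed
  have disj: "?G x \<inter> ?G y = {}" if "x \<in> ?I" "y \<in> ?I" "x \<noteq> y" for x y
  proof (rule ccontr)
    assume "?G x \<inter> ?G y \<noteq> {}"
    then obtain P where P: "P \<in> ?G x" "P \<in> ?G y" by blast
    obtain n i m j where xy: "x = (n, i)" "y = (m, j)" by (cases x, cases y)
    have l: "n \<le> c" "i < n" "m \<le> c" "j < m" using that xy by auto
    have a: "com P (c - i)" "com P (c - i + n)" "\<forall>q. c - i < q \<longrightarrow> q < c - i + n \<longrightarrow> \<not> com P q"
      and b: "com P (c - j)" "com P (c - j + m)" "\<forall>q. c - j < q \<longrightarrow> q < c - j + m \<longrightarrow> \<not> com P q"
      using P by (auto simp: xy gaps_def)
    have "\<not> c - i < c - j" using a(3)[rule_format, of "c - j"] b(1) l by linarith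
    moreover have "\<not> c - j < c - i" using b(3)[rule_format, of "c - i"] a(1) l by linarith
    ultimately have ij: "i = j" using l by linarith
    have "\<not> c - i + n < c - j + m" using b(3)[rule_format, of "c - i + n"] a(2) l ij by linarith
    moreover have "\<not> c - j + m < c - i + n" using a(3)[rule_format, of "c - j + m"] b(2) l ij by linarith
    ultimately show False using ij that(3) xy by auto
  qed
  have "(\<Sum>n\<le>c. real n * irr n) * (C (2 * c))\<^sup>2 = (\<Sum>n\<le>c. \<Sum>i<n. irr n * (C (2 * c))\<^sup>2)"
    by (simp add: sum_distrib_right mult.assoc)
  also have "\<dots> \<le> (\<Sum>n\<le>c. \<Sum>i<n. K ^ 4 * (\<Sum>P\<in>?G (n, i). wt2 P))"
    by (intro sum_mono each) auto
  also have "\<dots> = (\<Sum>x\<in>?I. K ^ 4 * (\<Sum>P\<in>?G x. wt2 P))"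
    by (subst sum.Sigma) (auto simp: split_def)
  also have "\<dots> = K ^ 4 * (\<Sum>x\<in>?I. \<Sum>P\<in>?G x. wt2 P)"
    by (simp only: sum_distrib_left)
  also have "(\<Sum>x\<in>?I. \<Sum>P\<in>?G x. wt2 P) = (\<Sum>P\<in>(\<Union>x\<in>?I. ?G x). wt2 P)"
  proof (rule sum.UNION_disjoint[symmetric])
    show "\<forall>x\<in>?I. finite (?G x)" by (simp add: split_def)
    show "\<forall>x\<in>?I. \<forall>y\<in>?I. x \<noteq> y \<longrightarrow> ?G x \<inter> ?G y = {}" using disj by blast
  qed simp
  also have "\<dots> \<le> (\<Sum>P\<in>ms2 (2 * c). wt2 P)"
    by (rule sum_mono2) (auto simp: gaps_def)
  also have "\<dots> = (C (2 * c))\<^sup>2" by (rule sum_wt2)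
  finally have "(\<Sum>n\<le>c. real n * irr n) * (C (2 * c))\<^sup>2 \<le> K ^ 4 * (C (2 * c))\<^sup>2"
    using K_ge_1 by (simp add: mult_left_mono)
  moreover have "(C (2 * c))\<^sup>2 > 0" using C_pos[of "2*c"] by (metis zero_less_power)
  ultimately show ?thesis by (simp only: mult_le_cancel_right_pos)
qed

lemma summable_irr: "summable (\<lambda>n. real n * irr n)"
  by (rule bounded_imp_summable[of _ "K ^ 4"]) (use sum_irr_le in auto)

definition dlt :: "nat \<Rightarrow> real" where
  "dlt d = (\<Sum>n. real (n + Suc d) * irr (n + Suc d))"

lemma dlt_nonneg: "dlt d \<ge> 0"
  unfolding dlt_def using summable_ignore_initial_segment[OF summable_irr, of "Suc d"] by (intro suminf_nonneg) auto

lemma dlt_tendsto: "dlt \<longlonglongrightarrow> 0"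
  unfolding dlt_def using LIMSEQ_Suc[OF suminf_exist_split2[OF summable_irr]] by simp

text \<open>A window of \<open>d\<close> points free of common renewals lies inside one gap of
  length at least \<open>Suc d\<close>, and a gap of length \<open>n\<close> can contain it in at
  most \<open>n\<close> positions. Weights are compared by \<open>C_mult_le\<close>;
  submultiplicativity enters only through the convergence of \<open>dlt\<close>.\<close>

lemma no_com_window:
  assumes "c + d \<le> N" "d > 0"
  shows "(\<Sum>P | P \<in> ms2 N \<and> (\<forall>k. c < k \<longrightarrow> k \<le> c + d \<longrightarrow> \<not> com P k). wt2 P) \<le> dlt d * (C N)\<^sup>2"
proof -
  let ?B = "{P \<in> ms2 N. \<forall>k. c < k \<longrightarrow> k \<le> c + d \<longrightarrow> \<not> com P k}"
  let ?J = "{..c} \<times> {c + d<..N}"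
  have sub: "?B \<subseteq> (\<Union>(k, k')\<in>?J. gaps N k k')"
  proof
    fix P assume P: "P \<in> ?B"
    define k where "k = Max {k. k \<le> c \<and> com P k}"
    define k' where "k' = (LEAST k. k > c \<and> com P k)"
    have "finite {k. k \<le> c \<and> com P k}" "{k. k \<le> c \<and> com P k} \<noteq> {}"
      using com_0 by auto
    then have k: "k \<le> c" "com P k" "\<And>j. j \<le> c \<Longrightarrow> com P j \<Longrightarrow> j \<le> k"
      using Max_in[of "{k. k \<le> c \<and> com P k}"] by (auto simp: k_def)
    have N: "N > c \<and> com P N" using assms P com_self by auto
    have k': "k' > c" "com P k'" "k' \<le> N" "\<And>j. j > c \<Longrightarrow> com P j \<Longrightarrow> k' \<le> j"
      using LeastI[of "\<lambda>k. k > c \<and> com P k", OF N] Least_le[of "\<lambda>k. k > c \<and> com P k", OF N]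
        Least_le[of "\<lambda>k. k > c \<and> com P k"] by (auto simp: k'_def)
    have PN: "P \<in> ms2 N" and Pn: "\<And>k. c < k \<Longrightarrow> k \<le> c + d \<Longrightarrow> \<not> com P k" using P by blast+
    have "k' > c + d" using Pn[of k'] k'(1,2) by linarith
    moreover have "\<not> com P j" if "k < j" "j < k'" for j
      using k(3)[of j] k'(4)[of j] that by linarith
    then have "P \<in> gaps N k k'"
      unfolding gaps_def using PN k(2) k'(2) by blast
    ultimately show "P \<in> (\<Union>(k, k')\<in>?J. gaps N k k')"
      using k(1) k'(3) by (intro UN_I[of "(k, k')"]) simp_all
  qed
  have "(\<Sum>P\<in>?B. wt2 P) \<le> (\<Sum>P\<in>(\<Union>(k, k')\<in>?J. gaps N k k'). wt2 P)"
  proof (rule sum_mono2[OF _ sub])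
    show "finite (\<Union>(k, k')\<in>?J. gaps N k k')" by (rule finite_UN_I) (simp_all add: split_def)
  qed (rule wt2_nonneg)
  also have "\<dots> \<le> (\<Sum>x\<in>?J. \<Sum>P\<in>(case x of (k, k') \<Rightarrow> gaps N k k'). wt2 P)"
    by (rule sum_UN_le) (auto simp: split_def)
  also have "\<dots> \<le> (\<Sum>x\<in>?J. irr (snd x - fst x) * (C N)\<^sup>2)"
  proof (intro sum_mono)
    fix x assume "x \<in> ?J"
    then obtain k k' where x: "x = (k, k')" "k \<le> c" "c + d < k'" "k' \<le> N" by auto
    define n where "n = k' - k"
    define l where "l = N - k'"
    have N: "N = k + n + l" "k' = k + n" using x by (auto simp: n_def l_def)
    have "C k * C n * C l \<le> C N"
    proof -
      have "C k * C n * C l \<le> C (k + n) * C l"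
        by (intro mult_right_mono C_mult_le) (simp add: less_imp_le)
      also have "\<dots> \<le> C N" using C_mult_le N(1) by simp
      finally show ?thesis .
    qed
    then have "irr n * (C k * C n * C l)\<^sup>2 \<le> irr n * (C N)\<^sup>2"
      by (intro mult_left_mono power_mono) (auto simp: less_imp_le)
    then show "(\<Sum>P\<in>(case x of (k, k') \<Rightarrow> gaps N k k'). wt2 P) \<le> irr (snd x - fst x) * (C N)\<^sup>2"
      by (simp add: x(1) N sum_gaps)
  qed
  also have "\<dots> = (\<Sum>x\<in>?J. irr (snd x - fst x)) * (C N)\<^sup>2"
    by (simp add: sum_distrib_right)
  also have "\<dots> \<le> dlt d * (C N)\<^sup>2"
  proof (rule mult_right_mono)
    \<comment> \<open>A gap is recorded by its length and by the offset of \<open>c\<close> in it;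
      the offset is smaller than the length.\<close>
    let ?f = "\<lambda>(k, k'). (k' - k, c - k)"
    let ?S = "SIGMA n:{Suc d..<Suc d + N}. {..<n}"
    have inj: "inj_on ?f ?J" by (auto simp: inj_on_def)
    have "(\<Sum>x\<in>?J. irr (snd x - fst x)) = (\<Sum>y\<in>?f ` ?J. irr (fst y))"
      by (subst sum.reindex[OF inj]) (simp add: split_def)
    also have "\<dots> \<le> (\<Sum>y\<in>?S. irr (fst y))"
      by (rule sum_mono2) auto
    also have "\<dots> = (\<Sum>n=Suc d..<Suc d + N. real n * irr n)"
      using sum.Sigma[of "{Suc d..<Suc d + N}" "\<lambda>n. {..<n}" "\<lambda>n _. irr n"] by (simp add: split_def)
    also have "\<dots> = (\<Sum>n<N. real (n + Suc d) * irr (n + Suc d))"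
      using sum.shift_bounds_nat_ivl[of "\<lambda>n. real n * irr n" 0 "Suc d" N]
      by (simp add: atLeast0LessThan add.commute)
    also have "\<dots> \<le> dlt d"
      unfolding dlt_def using summable_ignore_initial_segment[OF summable_irr, of "Suc d"]
      by (intro sum_le_suminf) auto
    finally show "(\<Sum>x\<in>?J. irr (snd x - fst x)) \<le> dlt d" .
  qed simp
  finally show ?thesis .
qed

end

section \<open>Reduced density matrices in the orbital basis\<close>

lemma cauchy_schwarz_sqrt:
  fixes f h :: "'a \<Rightarrow> real"
  shows "(\<Sum>x\<in>S. f x * h x) \<le> sqrt (\<Sum>x\<in>S. (f x)\<^sup>2) * sqrt (\<Sum>x\<in>S. (h x)\<^sup>2)"
  unfolding real_sqrt_mult[symmetric] by (rule real_le_rsqrt) (rule Cauchy_Schwarz_ineq_sum)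

context discrete
begin

lemma lamp_permute:
  assumes "mset us = mset vs"
  obtains s :: real where "s = 1 \<or> s = -1" "\<And>pre rest. lamp (pre @ us @ rest) = s * lamp (pre @ vs @ rest)"
proof -
  obtain s :: real where s: "s = 1 \<or> s = -1" "\<And>pre rest. amp p (pre @ us @ rest) = s * amp p (pre @ vs @ rest)"
    using amp_permute[OF assms, of p] by metis
  have "length us = length vs" using assms by (rule mset_eq_length)
  moreover have "en us = en vs" using assms by (rule en_mset)
  ultimately have "lamp (pre @ us @ rest) = s * lamp (pre @ vs @ rest)" for pre rest
    using s(2)[of pre rest] by (simp add: lamp_def)
  with s(1) show thesis using that by blast
qed

lemma lamp_mset_sq:
  assumes "mset us = mset vs" shows "(lamp us)\<^sup>2 = (lamp vs)\<^sup>2"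
proof -
  obtain s :: real where s: "s = 1 \<or> s = -1" "\<And>pre rest. lamp (pre @ us @ rest) = s * lamp (pre @ vs @ rest)"
    using lamp_permute[OF assms] by metis
  from s(2)[of "[]" "[]"] s(1) show ?thesis by auto
qed

lemma lamp_swap_blocks:
  "lamp (pre @ us @ vs @ rest) = (-1) ^ (p * (length us * length vs)) * lamp (pre @ vs @ us @ rest)"
  unfolding lamp_def using amp_swap_blocks[of p pre us vs rest] by (simp add: ac_simps)

text \<open>The observed indices keep their order, because they belong to distinguishable points;
  the hidden ones matter only as a multiset, since they are integrated out.\<close>

definition layer :: "nat list \<Rightarrow> nat multiset \<Rightarrow> real" where
  "layer a h = lamp (a @ sorted_list_of_multiset h)"

lemma layer_sq: "(layer a h)\<^sup>2 = wt (h + mset a) * mfac (h + mset a)"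
  using lamp_mset_sq[of "a @ sorted_list_of_multiset h" "sorted_list_of_multiset (h + mset a)"]
  by (simp add: layer_def wt_def)

lemma layer_nonzero_in_ms:
  assumes "layer a h \<noteq> 0" shows "h + mset a \<in> ms (size h + length a)"
proof -
  have "wt (h + mset a) \<noteq> 0" using assms layer_sq[of a h] by auto
  then show ?thesis using wt_nonzero_in_ms by fastforce
qed

definition bgs :: "nat \<Rightarrow> nat \<Rightarrow> nat multiset set" where
  "bgs N k = {h. size h = N - k \<and> set_mset h \<subseteq> {..<p * N}}"

lemma finite_bgs [simp]: "finite (bgs N k)"
proof (rule finite_subset)
  show "bgs N k \<subseteq> mset ` orbs p N (N - k)"
  proof
    fix F assume "F \<in> bgs N k"
    then have "sorted_list_of_multiset F \<in> orbs p N (N - k)" by (auto simp: bgs_def orbs_def)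
    then show "F \<in> mset ` orbs p N (N - k)" by (metis imageI mset_sorted_list_of_multiset)
  qed
qed simp

text \<open>After division by \<open>C N\<close> this is the reduced density matrix in the basis of
  normalised orbitals, see \<open>corr_orbital_sum\<close>. The value 0 for lists of different
  length lets the two lists be split at a threshold even where it leaves unequal numbers on one
  side.\<close>

definition Gam :: "nat \<Rightarrow> nat list \<Rightarrow> nat list \<Rightarrow> real" where
  "Gam N a b = (if length a = length b then \<Sum>h\<in>bgs N (length a). layer a h * layer b h / mfac h else 0)"

definition cnt :: "nat list \<Rightarrow> nat multiset \<Rightarrow> real" where
  "cnt a F = (\<Prod>x\<leftarrow>a. real (count F x))"

lemma cnt_nonneg [simp]: "cnt a F \<ge> 0"
  unfolding cnt_def by (induction a) auto

lemma mfac_remove: "x \<in># F \<Longrightarrow> mfac F = real (count F x) * mfac (F - {#x#})"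
proof -
  assume x: "x \<in># F"
  define G where "G = F - {#x#}"
  have F: "F = add_mset x G" using x by (simp add: G_def)
  have "mfac F = (\<Prod>y\<in>insert x (set_mset G). fact (count F y))" by (simp add: mfac_def F)
  also have "\<dots> = fact (count F x) * (\<Prod>y\<in>set_mset G - {x}. fact (count F y))"
    by (subst prod.insert_remove) auto
  also have "(\<Prod>y\<in>set_mset G - {x}. fact (count F y)) = (\<Prod>y\<in>set_mset G - {x}. (fact (count G y) :: real))"
    by (intro prod.cong) (auto simp: F)
  also have "fact (count F x) = real (count F x) * fact (count G x)" by (simp add: F)
  also have "real (count F x) * fact (count G x) * (\<Prod>y\<in>set_mset G - {x}. fact (count G y))
      = real (count F x) * (\<Prod>y\<in>insert x (set_mset G). fact (count G y))"
    by (subst prod.insert_remove) auto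
  also have "(\<Prod>y\<in>insert x (set_mset G). fact (count G y)) = mfac G"
    unfolding mfac_def by (cases "x \<in># G") (auto simp: insert_absorb not_in_iff)
  finally show ?thesis by (simp add: G_def)
qed

text \<open>Adding the particles of \<open>a\<close> one at a time multiplies \<open>mfac\<close> by
  the occupation number reached so far, which is at most the final one.\<close>

lemma mfac_ratio_le: "mfac (h + mset a) \<le> cnt a (h + mset a) * mfac h"
proof (induction a)
  case (Cons x a)
  have "mfac (h + mset (x # a)) = real (count (h + mset (x # a)) x) * mfac (h + mset a)"
    by (subst mfac_remove[of x]) auto
  also have "\<dots> \<le> real (count (h + mset (x # a)) x) * (cnt a (h + mset a) * mfac h)"
    by (intro mult_left_mono Cons.IH) auto
  also have "\<dots> \<le> real (count (h + mset (x # a)) x) * (cnt a (h + mset (x # a)) * mfac h)"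
  proof -
    have "cnt c (h + mset a) \<le> cnt c (h + mset (x # a))" for c
      by (induction c) (auto simp: cnt_def intro!: mult_mono prod_list_nonneg)
    then show ?thesis by (intro mult_left_mono mult_right_mono) (auto simp: less_imp_le)
  qed
  finally show ?case by (simp add: cnt_def)
qed (simp add: cnt_def)

lemma layer_sq_le: "(layer a h)\<^sup>2 / mfac h \<le> wt (h + mset a) * cnt a (h + mset a)"
proof -
  have "(layer a h)\<^sup>2 \<le> wt (h + mset a) * (cnt a (h + mset a) * mfac h)"
    unfolding layer_sq by (intro mult_left_mono mfac_ratio_le) auto
  then show ?thesis by (simp add: pos_divide_le_eq mult.assoc)
qed

text \<open>Filling the backgrounds with \<open>a1\<close> and \<open>a2\<close> is injective, so a
  diagonal sum over backgrounds becomes an expectation over two independent full configurations. The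
  occupation numbers in \<open>cnt\<close> are the price, and the event \<open>Q\<close> is one
  about full configurations.\<close>

lemma diag2_le:
  assumes "length a1 \<le> N" "length a2 \<le> N"
  shows "(\<Sum>P | P \<in> bgs N (length a1) \<times> bgs N (length a2) \<and> Q (fst P + mset a1, snd P + mset a2).
      (layer a1 (fst P))\<^sup>2 / mfac (fst P) * ((layer a2 (snd P))\<^sup>2 / mfac (snd P)))
    \<le> (\<Sum>P | P \<in> ms2 N \<and> Q P. wt2 P * (cnt a1 (fst P) * cnt a2 (snd P)))" (is "?L \<le> ?R")
proof -
  let ?f = "\<lambda>P. (fst P + mset a1, snd P + mset a2)"
  let ?H = "{P. P \<in> bgs N (length a1) \<times> bgs N (length a2) \<and> Q (fst P + mset a1, snd P + mset a2)}"
  let ?H' = "{P \<in> ?H. ?f P \<in> ms2 N}"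
  have "finite ?H" by (rule finite_subset[of _ "bgs N (length a1) \<times> bgs N (length a2)"]) auto
  moreover have "(layer a1 (fst P))\<^sup>2 / mfac (fst P) * ((layer a2 (snd P))\<^sup>2 / mfac (snd P)) = 0"
    if "P \<in> ?H - ?H'" for P
  proof -
    have "size (fst P) + length a1 = N" "size (snd P) + length a2 = N"
      using that assms by (auto simp: bgs_def)
    then show ?thesis
      using that layer_nonzero_in_ms[of a1 "fst P"] layer_nonzero_in_ms[of a2 "snd P"] by auto
  qed
  ultimately have "?L = (\<Sum>P\<in>?H'. (layer a1 (fst P))\<^sup>2 / mfac (fst P) * ((layer a2 (snd P))\<^sup>2 / mfac (snd P)))"
    by (intro sum.mono_neutral_right) auto
  also have "\<dots> \<le> (\<Sum>P\<in>?H'. wt2 (?f P) * (cnt a1 (fst (?f P)) * cnt a2 (snd (?f P))))"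
  proof (intro sum_mono)
    fix P
    have "(layer a1 (fst P))\<^sup>2 / mfac (fst P) * ((layer a2 (snd P))\<^sup>2 / mfac (snd P))
       \<le> (wt (fst P + mset a1) * cnt a1 (fst P + mset a1)) * (wt (snd P + mset a2) * cnt a2 (snd P + mset a2))"
      by (intro mult_mono layer_sq_le) (auto simp: less_imp_le)
    then show "(layer a1 (fst P))\<^sup>2 / mfac (fst P) * ((layer a2 (snd P))\<^sup>2 / mfac (snd P))
       \<le> wt2 (?f P) * (cnt a1 (fst (?f P)) * cnt a2 (snd (?f P)))"
      by (simp add: wt2_def ac_simps)
  qed
  also have "\<dots> = (\<Sum>P\<in>?f ` ?H'. wt2 P * (cnt a1 (fst P) * cnt a2 (snd P)))"
    by (subst sum.reindex) (auto simp: inj_on_def)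
  also have "\<dots> \<le> ?R"
  proof (rule sum_mono2)
    show "finite {P. P \<in> ms2 N \<and> Q P}" by (rule finite_subset[of _ "ms2 N"]) auto
  qed auto
  finally show ?thesis .
qed

lemma Gam_Nil [simp]: "Gam N [] [] = C N"
proof -
  have "Gam N [] [] = (\<Sum>h\<in>bgs N 0. wt h)"
    by (simp add: Gam_def layer_def wt_def power2_eq_square)
  also have "\<dots> = (\<Sum>h\<in>ms N. wt h)"
  proof (rule sum.mono_neutral_right[OF finite_bgs])
    show "ms N \<subseteq> bgs N 0" by (auto simp: bgs_def ms_def)
    show "\<forall>h\<in>bgs N 0 - ms N. wt h = 0" using wt_nonzero_in_ms by (auto simp: bgs_def)
  qed
  finally show ?thesis by (simp add: C_def)
qed

end

section \<open>Moments of occupation numbers and rare events\<close>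

locale clustering = recurrent +
  fixes Bm :: "nat \<Rightarrow> real"
  assumes moments: "(\<Sum>F\<in>ms N. wt F * real (count F y) ^ k) \<le> Bm k * C N"
begin

lemma Bm_nonneg: "Bm k \<ge> 0"
proof -
  have "0 \<le> (\<Sum>F\<in>ms 0. wt F * real (count F 0) ^ k)" by (intro sum_nonneg) auto
  also have "\<dots> \<le> Bm k" using moments[where N = 0 and y = 0 and k = k] by simp
  finally show ?thesis .
qed

text \<open>Bounds the second moment of a product of \<open>k\<close> occupation numbers: the
  product is at most the \<open>k\<close>-th power of its largest factor, and the largest is
  replaced by a sum over the list. The 1 serves the empty list and makes \<open>Bc k\<close> at
  least 1.\<close>

definition Bc :: "nat \<Rightarrow> real" where "Bc k = 1 + real k * Bm (2 * k)"

lemma Bc_pos: "Bc k > 0"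
  using Bm_nonneg[of "2 * k"] by (simp add: Bc_def add_pos_nonneg)

lemma cnt_sq_le: "(cnt a F)\<^sup>2 \<le> 1 + (\<Sum>x\<leftarrow>a. real (count F x) ^ (2 * length a))"
proof (cases "a = []")
  case False
  define M where "M = Max (count F ` set a)"
  have M: "M \<in> count F ` set a" unfolding M_def using False by (intro Max_in) auto
  then obtain x where x: "x \<in> set a" "count F x = M" by auto
  have le: "count F y \<le> M" if "y \<in> set a" for y
    unfolding M_def using that by (intro Max_ge) auto
  have "cnt c F \<le> real M ^ length c" if "set c \<subseteq> set a" for c
    using that
  proof (induction c)
    case (Cons y c)
    then have "real (count F y) * cnt c F \<le> real M * real M ^ length c"
      using le by (intro mult_mono) auto
    then show ?case by (simp add: cnt_def)
  qed (simp add: cnt_def)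
  then have "(cnt a F)\<^sup>2 \<le> (real M ^ length a)\<^sup>2" by (intro power_mono) auto
  also have "\<dots> = real (count F x) ^ (2 * length a)" using x by (simp add: power_mult[symmetric] mult.commute)
  also have "\<dots> \<le> (\<Sum>x\<leftarrow>a. real (count F x) ^ (2 * length a))"
    using x(1) by (intro member_le_sum_list) auto
  finally show ?thesis by simp
qed (simp add: cnt_def)

lemma cnt_moment: "(\<Sum>F\<in>ms N. wt F * (cnt a F)\<^sup>2) \<le> Bc (length a) * C N"
proof -
  have "(\<Sum>F\<in>ms N. wt F * (cnt a F)\<^sup>2) \<le> (\<Sum>F\<in>ms N. wt F * (1 + (\<Sum>x\<leftarrow>a. real (count F x) ^ (2 * length a))))"
    by (intro sum_mono mult_left_mono cnt_sq_le) auto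
  also have "\<dots> = C N + (\<Sum>F\<in>ms N. \<Sum>x\<leftarrow>a. wt F * real (count F x) ^ (2 * length a))"
    by (simp add: C_def distrib_left sum.distrib sum_list_const_mult)
  also have "(\<Sum>F\<in>ms N. \<Sum>x\<leftarrow>a. wt F * real (count F x) ^ (2 * length a))
     = (\<Sum>x\<leftarrow>a. \<Sum>F\<in>ms N. wt F * real (count F x) ^ (2 * length a))"
  proof -
    have "(\<Sum>F\<in>ms N. \<Sum>x\<leftarrow>a. wt F * real (count F x) ^ e) = (\<Sum>x\<leftarrow>a. \<Sum>F\<in>ms N. wt F * real (count F x) ^ e)" for e
      by (induction a) (simp_all add: sum.distrib)
    then show ?thesis .
  qed
  also have "\<dots> \<le> (\<Sum>x\<leftarrow>a. Bm (2 * length a) * C N)"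
    by (intro sum_list_mono moments)
  finally show ?thesis by (simp add: Bc_def sum_list_triv algebra_simps)
qed

lemma cnt2_moment:
  "(\<Sum>P\<in>ms2 N. wt2 P * (cnt a (fst P) * cnt b (snd P))\<^sup>2) \<le> Bc (length a) * Bc (length b) * (C N)\<^sup>2"
proof -
  have "(\<Sum>P\<in>ms2 N. wt2 P * (cnt a (fst P) * cnt b (snd P))\<^sup>2)
     = (\<Sum>F\<in>ms N. wt F * (cnt a F)\<^sup>2) * (\<Sum>F\<in>ms N. wt F * (cnt b F)\<^sup>2)"
    unfolding sum_product sum.cartesian_product wt2_def
    by (intro sum.cong refl) (auto simp: power_mult_distrib)
  also have "\<dots> \<le> (Bc (length a) * C N) * (Bc (length b) * C N)"
    using Bc_pos by (intro mult_mono cnt_moment sum_nonneg mult_nonneg_nonneg) (auto simp: less_imp_le)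
  finally show ?thesis by (simp add: power2_eq_square ac_simps)
qed

text \<open>Cauchy-Schwarz with respect to the weight: one square root of the probability of the
  event, one of the second moment of the occupation numbers.\<close>

lemma event_moment:
  assumes "(\<Sum>P | P \<in> ms2 N \<and> Q P. wt2 P) \<le> \<delta> * (C N)\<^sup>2"
  shows "(\<Sum>P | P \<in> ms2 N \<and> Q P. wt2 P * (cnt a (fst P) * cnt b (snd P)))
    \<le> sqrt (Bc (length a) * Bc (length b) * \<delta>) * (C N)\<^sup>2"
proof -
  let ?S = "{P. P \<in> ms2 N \<and> Q P}"
  have fS: "finite ?S" by (rule finite_subset[of _ "ms2 N"]) auto
  let ?c = "\<lambda>P. cnt a (fst P) * cnt b (snd P)"
  have "(\<Sum>P\<in>?S. wt2 P * ?c P) = (\<Sum>P\<in>?S. sqrt (wt2 P) * ?c P * sqrt (wt2 P))"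
    by (intro sum.cong refl) (simp add: algebra_simps)
  also have "\<dots> \<le> sqrt (\<Sum>P\<in>?S. (sqrt (wt2 P) * ?c P)\<^sup>2) * sqrt (\<Sum>P\<in>?S. (sqrt (wt2 P))\<^sup>2)"
    by (rule cauchy_schwarz_sqrt)
  also have "\<dots> = sqrt (\<Sum>P\<in>?S. wt2 P * (?c P)\<^sup>2) * sqrt (\<Sum>P\<in>?S. wt2 P)"
    by (simp add: power_mult_distrib)
  also have "\<dots> \<le> sqrt (Bc (length a) * Bc (length b) * (C N)\<^sup>2) * sqrt (\<delta> * (C N)\<^sup>2)"
  proof (intro mult_mono real_sqrt_le_mono assms)
    have "(\<Sum>P\<in>?S. wt2 P * (?c P)\<^sup>2) \<le> (\<Sum>P\<in>ms2 N. wt2 P * (?c P)\<^sup>2)"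
      by (intro sum_mono2) auto
    also note cnt2_moment
    finally show "(\<Sum>P\<in>?S. wt2 P * (?c P)\<^sup>2) \<le> Bc (length a) * Bc (length b) * (C N)\<^sup>2" .
    show "0 \<le> sqrt (\<Sum>P\<in>?S. wt2 P)" by (simp add: sum_nonneg)
    show "0 \<le> sqrt (Bc (length a) * Bc (length b) * (C N)\<^sup>2)" using Bc_pos by (simp add: less_imp_le)
  qed
  also have "\<dots> = sqrt (Bc (length a) * Bc (length b) * \<delta>) * (C N)\<^sup>2"
    by (simp add: real_sqrt_mult power2_eq_square less_imp_le)
  finally show ?thesis .
qed

text \<open>Each of the four layers appears squared in one of the two Cauchy-Schwarz factors, so the
  bad event only has to be rare for one pair of layers.\<close>
lemma bad_sum_le:
  assumes N: "length x1 \<le> N" "length x2 \<le> N" "length y1 = length x1" "length y2 = length x2"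
    and \<delta>: "(\<Sum>P | P \<in> ms2 N \<and> Q P. wt2 P) \<le> \<delta> * (C N)\<^sup>2"
    and S: "\<And>P. P \<in> S \<Longrightarrow> P \<in> bgs N (length x1) \<times> bgs N (length x2) \<and> Q (fst P + mset x1, snd P + mset x2)"
  shows "(\<Sum>P\<in>S. \<bar>layer x1 (fst P) * layer y1 (fst P) / mfac (fst P) * (layer x2 (snd P) * layer y2 (snd P) / mfac (snd P))\<bar>)
    \<le> Bc (length x1) * Bc (length x2) * sqrt (sqrt \<delta>) * (C N)\<^sup>2"
proof -
  let ?A = "{P. P \<in> bgs N (length x1) \<times> bgs N (length x2) \<and> Q (fst P + mset x1, snd P + mset x2)}"
  let ?D = "\<lambda>a b P. (layer a (fst P))\<^sup>2 / mfac (fst P) * ((layer b (snd P))\<^sup>2 / mfac (snd P))"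
  let ?l = "\<lambda>a b P. layer a (fst P) * layer b (snd P) / (sqrt (mfac (fst P)) * sqrt (mfac (snd P)))"
  have fA: "finite ?A" by (rule finite_subset[of _ "bgs N (length x1) \<times> bgs N (length x2)"]) auto
  have SA: "S \<subseteq> ?A" using S by blast
  then have fS: "finite S" using fA finite_subset by blast
  have D: "(?l a b P)\<^sup>2 = ?D a b P" for a b P
    by (simp add: power_divide power_mult_distrib less_imp_le)
  have B: "Bc k > 0" for k by (rule Bc_pos)
  have \<delta>0: "\<delta> \<ge> 0"
  proof -
    have "0 \<le> \<delta> * (C N)\<^sup>2" by (rule order.trans[OF _ \<delta>]) (auto intro: sum_nonneg)
    then show ?thesis using C_pos[of N] by (simp add: zero_le_mult_iff)
  qed
  have 1: "(\<Sum>P\<in>S. ?D x1 x2 P) \<le> sqrt (Bc (length x1) * Bc (length x2) * \<delta>) * (C N)\<^sup>2"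
  proof -
    have "(\<Sum>P\<in>S. ?D x1 x2 P) \<le> (\<Sum>P\<in>?A. ?D x1 x2 P)"
      by (intro sum_mono2 fA SA) (auto simp: less_imp_le)
    also have "\<dots> \<le> (\<Sum>P | P \<in> ms2 N \<and> Q P. wt2 P * (cnt x1 (fst P) * cnt x2 (snd P)))"
      by (rule diag2_le[OF N(1,2)])
    also have "\<dots> \<le> sqrt (Bc (length x1) * Bc (length x2) * \<delta>) * (C N)\<^sup>2"
      by (rule event_moment[OF \<delta>])
    finally show ?thesis .
  qed
  have 2: "(\<Sum>P\<in>S. ?D y1 y2 P) \<le> sqrt (Bc (length x1) * Bc (length x2) * 1) * (C N)\<^sup>2"
  proof -
    let ?A' = "{P. P \<in> bgs N (length y1) \<times> bgs N (length y2) \<and> True}"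
    have fA': "finite ?A'" by (rule finite_subset[of _ "bgs N (length y1) \<times> bgs N (length y2)"]) auto
    have "S \<subseteq> ?A'" using S N by auto
    then have "(\<Sum>P\<in>S. ?D y1 y2 P) \<le> (\<Sum>P\<in>?A'. ?D y1 y2 P)"
      by (intro sum_mono2 fA') (auto simp: less_imp_le)
    also have "\<dots> \<le> (\<Sum>P | P \<in> ms2 N \<and> True. wt2 P * (cnt y1 (fst P) * cnt y2 (snd P)))"
      using diag2_le[of y1 N y2 "\<lambda>_. True"] N by simp
    also have "\<dots> \<le> sqrt (Bc (length y1) * Bc (length y2) * 1) * (C N)\<^sup>2"
      by (rule event_moment) (simp only: simp_thms Collect_mem_eq sum_wt2 mult_1_left order_refl)
    finally show ?thesis by (simp add: N)
  qed
  have "(\<Sum>P\<in>S. \<bar>layer x1 (fst P) * layer y1 (fst P) / mfac (fst P) * (layer x2 (snd P) * layer y2 (snd P) / mfac (snd P))\<bar>)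
      = (\<Sum>P\<in>S. \<bar>?l x1 x2 P\<bar> * \<bar>?l y1 y2 P\<bar>)"
  proof (intro sum.cong refl)
    fix P
    have "?l x1 x2 P * ?l y1 y2 P = (layer x1 (fst P) * layer y1 (fst P) * (layer x2 (snd P) * layer y2 (snd P)))
         / ((sqrt (mfac (fst P)) * sqrt (mfac (fst P))) * (sqrt (mfac (snd P)) * sqrt (mfac (snd P))))"
      by (simp add: ac_simps)
    also have "\<dots> = layer x1 (fst P) * layer y1 (fst P) / mfac (fst P) * (layer x2 (snd P) * layer y2 (snd P) / mfac (snd P))"
      by (simp add: less_imp_le)
    finally show "\<bar>layer x1 (fst P) * layer y1 (fst P) / mfac (fst P) * (layer x2 (snd P) * layer y2 (snd P) / mfac (snd P))\<bar>
      = \<bar>?l x1 x2 P\<bar> * \<bar>?l y1 y2 P\<bar>" by (simp only: abs_mult[symmetric])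
  qed
  also have "\<dots> \<le> sqrt (\<Sum>P\<in>S. ?D x1 x2 P) * sqrt (\<Sum>P\<in>S. ?D y1 y2 P)"
    using cauchy_schwarz_sqrt[of "\<lambda>P. \<bar>?l x1 x2 P\<bar>" "\<lambda>P. \<bar>?l y1 y2 P\<bar>" S]
    unfolding power2_abs D .
  also have "\<dots> \<le> sqrt (sqrt (Bc (length x1) * Bc (length x2) * \<delta>) * (C N)\<^sup>2)
      * sqrt (sqrt (Bc (length x1) * Bc (length x2) * 1) * (C N)\<^sup>2)"
    using 1 2 B \<delta>0 by (intro mult_mono real_sqrt_le_mono) (auto intro!: sum_nonneg mult_nonneg_nonneg simp: less_imp_le)
  also have "\<dots> = sqrt (sqrt (Bc (length x1) * Bc (length x2) * \<delta>)) * sqrt (sqrt (Bc (length x1) * Bc (length x2))) * (C N)\<^sup>2"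
    by (simp add: real_sqrt_mult power2_eq_square less_imp_le)
  also have "sqrt (sqrt (Bc (length x1) * Bc (length x2) * \<delta>)) * sqrt (sqrt (Bc (length x1) * Bc (length x2)))
      = sqrt (Bc (length x1) * Bc (length x2)) * sqrt (sqrt \<delta>)"
  proof -
    have "sqrt (sqrt (X * \<delta>)) * sqrt (sqrt X) = sqrt X * sqrt (sqrt \<delta>)" if "X \<ge> 0" for X
    proof -
      have "sqrt (sqrt (X * \<delta>)) * sqrt (sqrt X) = (sqrt (sqrt X) * sqrt (sqrt X)) * sqrt (sqrt \<delta>)"
        by (simp only: real_sqrt_mult ac_simps)
      also have "sqrt (sqrt X) * sqrt (sqrt X) = sqrt X" using that by simp
      finally show ?thesis .
    qed
    then show ?thesis using B by (simp add: less_imp_le)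
  qed
  also have "sqrt (Bc (length x1) * Bc (length x2)) \<le> Bc (length x1) * Bc (length x2)"
  proof -
    have "1 \<le> Bc k" for k using Bm_nonneg by (simp add: Bc_def)
    then have "1 \<le> Bc (length x1) * Bc (length x2)" using mult_mono[of 1 "Bc (length x1)" 1 "Bc (length x2)"] B[of "length x1"]
      by (simp add: less_imp_le)
    then show ?thesis by (intro real_le_lsqrt self_le_power) auto
  qed
  finally show ?thesis using \<delta>0 by (simp add: mult_right_mono)
qed

lemma Gam_prod:
  assumes "length a1 = length b1" "length a2 = length b2"
  shows "Gam N a1 b1 * Gam N a2 b2 = (\<Sum>P\<in>bgs N (length a1) \<times> bgs N (length a2).
    layer a1 (fst P) * layer b1 (fst P) / mfac (fst P) * (layer a2 (snd P) * layer b2 (snd P) / mfac (snd P)))"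
  using assms by (simp add: Gam_def sum_product sum.cartesian_product split_def)

text \<open>Multiplied by \<open>Gam N [] []\<close>, which is \<open>C N\<close>, the claim is the
  estimate for pairs, taken with the trivial event and \<open>\<delta> = 1\<close>.\<close>

lemma Gam_le:
  assumes "length a = length b" "length a \<le> N"
  shows "\<bar>Gam N a b\<bar> \<le> Bc (length a) * Bc 0 * C N"
proof -
  have "\<bar>Gam N a b * Gam N [] []\<bar> \<le> (\<Sum>P\<in>bgs N (length a) \<times> bgs N 0.
     \<bar>layer a (fst P) * layer b (fst P) / mfac (fst P) * (layer [] (snd P) * layer [] (snd P) / mfac (snd P))\<bar>)"
    unfolding Gam_prod[OF assms(1) refl] list.size by (rule sum_abs)
  also have "\<dots> \<le> Bc (length a) * Bc (length ([] :: nat list)) * sqrt (sqrt 1) * (C N)\<^sup>2"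
    by (rule bad_sum_le[of a N "[]" b "[]" "\<lambda>_. True" 1]) (use assms sum_wt2[of N] in \<open>auto\<close>)
  finally have "\<bar>Gam N a b\<bar> * C N \<le> Bc (length a) * Bc 0 * C N * C N"
    by (simp add: abs_mult power2_eq_square mult.assoc abs_of_pos)
  then show ?thesis by (simp only: mult_le_cancel_right_pos C_pos)
qed

end

section \<open>Exchanging tails\<close>

lemma two_tri: "2 * int (tri p n) = int p * int n * (int n - 1)"
  by (induction n) (auto simp: tri_def algebra_simps)

context discrete
begin

text \<open>A particle at \<open>x\<close> contributes the positive part of
  \<open>2 * p * k - 1 - 2 * x\<close>. Unlike renewal itself, this total is additive in
  \<open>F\<close>, so two fillings of one background can be compared.\<close>

definition tent :: "nat multiset \<Rightarrow> nat \<Rightarrow> int" where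
  "tent F k = (\<Sum>x\<in>#{#x \<in># F. x < p * k#}. 2 * int (p * k) - 1 - 2 * int x)"

definition tent_max :: "nat \<Rightarrow> int" where
  "tent_max k = int k * (2 * int (p * k) - 1) - 2 * int (tri p k)"

lemma tent_add: "tent (F + G) k = tent F k + tent G k"
  by (simp add: tent_def)

lemma sum_mset_affine: "(\<Sum>x\<in>#F. c - 2 * int x) = int (size F) * c - 2 * int (sum_mset F)"
  by (induction F) (auto simp: algebra_simps)

lemma tent_eq: "tent F k = int (size {#x \<in># F. x < p * k#}) * (2 * int (p * k) - 1) - 2 * int (sum_mset {#x \<in># F. x < p * k#})"
  unfolding tent_def by (rule sum_mset_affine)

lemma dominance_ms:
  assumes "wt F \<noteq> 0"
  shows "tri p (size {#x \<in># F. x < c#}) \<le> sum_mset {#x \<in># F. x < c#}"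
proof -
  let ?G = "{#x \<in># F. x < c#}" and ?H = "{#x \<in># F. \<not> x < c#}"
  have F: "F = ?G + ?H" by (rule multiset_partition)
  have "sorted_list_of_multiset F = sorted_list_of_multiset ?G @ sorted_list_of_multiset ?H"
    by (subst F, rule sorted_list_of_multiset_add_shift) auto
  then have "amp p (sorted_list_of_multiset ?G @ sorted_list_of_multiset ?H) \<noteq> 0"
    using assms by (auto simp: wt_def)
  from amp_dominance[OF this] show ?thesis by (simp add: sum_sorted_list_of_multiset)
qed

text \<open>The odd offset \<^term>\<open>2 * int (p * k) - 1\<close> makes \<^term>\<open>j = k\<close> the unique maximiser of
  \<^term>\<open>int j * (2 * int (p * k) - 1) - 2 * int (tri p j)\<close>, so that touching the maximal
  profile detects a renewal point.\<close>
lemma tent_max_strict: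
  assumes "j \<noteq> k"
  shows "int j * (2 * int (p * k) - 1) - 2 * int (tri p j) < tent_max k"
proof -
  define P J L where "P = int p" and "J = int j" and "L = int k"
  have P: "P \<ge> 1" using p_pos by (simp add: P_def)
  have "tent_max k - (int j * (2 * int (p * k) - 1) - 2 * int (tri p j)) = (L - J) * (P * (L - J) + P - 1)"
    unfolding tent_max_def two_tri by (simp add: P_def J_def L_def algebra_simps)
  also have "\<dots> > 0"
  proof (cases "L > J")
    case True
    have "P * (L - J) > 0" using True P by simp
    then show ?thesis using True P by (intro mult_pos_pos) linarith+
  next
    case False
    then have "J - L \<ge> 1" using assms by (simp add: J_def L_def)
    then have "P * (J - L) \<ge> P" using P by (simp add: mult_le_cancel_left1)
    then have "P * (L - J) + P - 1 < 0" by (simp add: algebra_simps)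
    then show ?thesis using \<open>J - L \<ge> 1\<close> by (intro mult_neg_neg) linarith+
  qed
  finally show ?thesis by simp
qed

text \<open>With \<open>j\<close> particles below \<open>p * k\<close>, dominance bounds their sum
  from below by \<open>tri p j\<close>; what remains depends on \<open>j\<close> alone and has its
  strict maximum at \<open>j = k\<close>. Equality therefore forces both the number \<open>k\<close>
  and the minimal sum, which is renewal.\<close>

lemma tent_le: "wt F \<noteq> 0 \<Longrightarrow> tent F k \<le> tent_max k"
  and tent_eq_iff: "wt F \<noteq> 0 \<Longrightarrow> tent F k = tent_max k \<longleftrightarrow> ren F k"
proof -
  assume w: "wt F \<noteq> 0"
  let ?G = "{#x \<in># F. x < p * k#}"
  define S where "S = sum_mset ?G"
  have d: "tri p (size ?G) \<le> S" using dominance_ms[OF w, of "p * k"] by (simp only: S_def)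
  have t: "tent F k = int (size ?G) * (2 * int (p * k) - 1) - 2 * int S" by (simp only: tent_eq S_def)
  show "tent F k \<le> tent_max k"
    using d tent_max_strict[of "size ?G" k] by (cases "size ?G = k") (auto simp: t tent_max_def)
  show "tent F k = tent_max k \<longleftrightarrow> ren F k"
  proof (cases "size ?G = k")
    case True
    then have "ren F k \<longleftrightarrow> S = tri p k" by (auto simp: ren_def ms_def S_def)
    then show ?thesis using True by (auto simp: t tent_max_def)
  next
    case False
    then have "\<not> ren F k" by (auto simp: ren_def ms_def)
    then show ?thesis using tent_max_strict[OF False] d by (auto simp: t)
  qed
qed

text \<open>No entry lies from \<open>p * Suc c\<close> up to \<open>p * c'\<close>, so all
  thresholds \<open>p * k\<close> with \<open>c < k \<le> c'\<close> have the same part of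
  \<open>a\<close> below them.\<close>

definition clear :: "nat \<Rightarrow> nat \<Rightarrow> nat list \<Rightarrow> bool" where
  "clear c c' a \<longleftrightarrow> (\<forall>x\<in>set a. x < p * Suc c \<or> p * c' \<le> x)"

lemma clear_filter:
  assumes "clear c c' a" "c < k" "k \<le> c'"
  shows "{#x \<in># mset a. x < p * k#} = {#x \<in># mset a. x < p * Suc c#}"
proof (rule filter_mset_cong[OF refl])
  fix x assume "x \<in># mset a"
  then have "x < p * Suc c \<or> p * c' \<le> x" using assms by (auto simp: clear_def)
  moreover have "p * Suc c \<le> p * k" using assms by (intro mult_le_mono2) simp
  moreover have "p * k \<le> p * c'" using assms by (intro mult_le_mono2)
  ultimately show "x < p * k \<longleftrightarrow> x < p * Suc c" by linarith
qed

text \<open>Two layers over the same background differ in their tents by an affine function inside the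
  gap, and that function has to change sign twice between interleaved renewal points.\<close>
lemma ren_interleaved:
  assumes w: "wt (h + mset a) \<noteq> 0" "wt (h + mset b) \<noteq> 0"
    and cl: "clear c c' a" "clear c c' b"
    and r: "ren (h + mset a) k1" "ren (h + mset b) k2" "ren (h + mset a) k3"
    and k: "c < k1" "k1 < k2" "k2 < k3" "k3 \<le> c'" "c < k" "k \<le> c'"
  shows "ren (h + mset a) k \<longleftrightarrow> ren (h + mset b) k"
proof -
  let ?A = "{#x \<in># mset a. x < p * Suc c#}" and ?B = "{#x \<in># mset b. x < p * Suc c#}"
  define q where "q = int (size ?B) - int (size ?A)"
  define s where "s = 2 * int (sum_mset ?A) - 2 * int (sum_mset ?B)"
  have diff: "tent (h + mset b) j - tent (h + mset a) j = q * (2 * int (p * j) - 1) + s" if "c < j" "j \<le> c'" for j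
    unfolding tent_add tent_eq[of "mset a"] tent_eq[of "mset b"]
      clear_filter[OF cl(1) that] clear_filter[OF cl(2) that] q_def s_def
    by (simp add: algebra_simps)
  have 1: "q * (2 * int (p * k1) - 1) + s \<le> 0"
    using diff[of k1] k tent_le[OF w(2), of k1] r(1) tent_eq_iff[OF w(1), of k1] by linarith
  have 2: "q * (2 * int (p * k2) - 1) + s \<ge> 0"
    using diff[of k2] k tent_le[OF w(1), of k2] r(2) tent_eq_iff[OF w(2), of k2] by linarith
  have 3: "q * (2 * int (p * k3) - 1) + s \<le> 0"
    using diff[of k3] k tent_le[OF w(2), of k3] r(3) tent_eq_iff[OF w(1), of k3] by linarith
  have pk: "p * k1 < p * k2" "p * k2 < p * k3" using k p_pos by auto
  have "q * (2 * int (p * k2) - 2 * int (p * k1)) \<ge> 0" using 1 2 by (simp add: algebra_simps)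
  then have "q \<ge> 0" using pk by (simp add: zero_le_mult_iff)
  have "q * (2 * int (p * k3) - 2 * int (p * k2)) \<le> 0" using 2 3 by (simp add: algebra_simps)
  then have "q \<le> 0" using pk by (simp add: mult_le_0_iff)
  have "q = 0" using \<open>q \<ge> 0\<close> \<open>q \<le> 0\<close> by simp
  then have "s = 0" using 1 2 by simp
  have "tent (h + mset b) k = tent (h + mset a) k" using diff[of k] k \<open>q = 0\<close> \<open>s = 0\<close> by simp
  then show ?thesis using tent_eq_iff[OF w(1), of k] tent_eq_iff[OF w(2), of k] by simp
qed

definition quad :: "nat list \<Rightarrow> nat list \<Rightarrow> nat list \<Rightarrow> nat list \<Rightarrow> nat multiset \<times> nat multiset \<Rightarrow> nat \<Rightarrow> bool" where
  "quad a1 b1 a2 b2 P k \<longleftrightarrow> ren (fst P + mset a1) k \<and> ren (fst P + mset b1) k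
     \<and> ren (snd P + mset a2) k \<and> ren (snd P + mset b2) k"

text \<open>The four points come from four pairs, since common renewals are controlled for pairs
  only. Over the first background \<open>a1\<close>, \<open>b1\<close>, \<open>a1\<close> renew at
  \<open>k1\<close>, \<open>k2\<close>, \<open>k4\<close>, over the second \<open>a2\<close>,
  \<open>b2\<close>, \<open>a2\<close> renew at \<open>k1\<close>, \<open>k3\<close>,
  \<open>k4\<close>. Each triple interleaves, so \<open>ren_interleaved\<close> carries renewal at
  \<open>k1\<close> over to \<open>b1\<close> and to \<open>b2\<close>.\<close>

lemma quad_exists:
  assumes w: "layer a1 h \<noteq> 0" "layer b1 h \<noteq> 0" "layer a2 g' \<noteq> 0" "layer b2 g' \<noteq> 0"
    and cl: "clear c c' a1" "clear c c' b1" "clear c c' a2" "clear c c' b2"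
    and r1: "com (h + mset a1, g' + mset a2) k1"
    and r2: "com (h + mset b1, g' + mset a2) k2"
    and r3: "com (h + mset a1, g' + mset b2) k3"
    and r4: "com (h + mset a1, g' + mset a2) k4"
    and k: "c < k1" "k1 < k2" "k2 < k3" "k3 < k4" "k4 \<le> c'"
  shows "quad a1 b1 a2 b2 (h, g') k1"
proof -
  have w': "wt (h + mset a1) \<noteq> 0" "wt (h + mset b1) \<noteq> 0" "wt (g' + mset a2) \<noteq> 0" "wt (g' + mset b2) \<noteq> 0"
    using w layer_sq by (metis mult_zero_left zero_eq_power2)+
  have "ren (h + mset a1) k1 \<longleftrightarrow> ren (h + mset b1) k1"
    by (rule ren_interleaved[OF w'(1,2) cl(1,2), of k1 k2 k4]) (use r1 r2 r4 k in \<open>auto simp: com_def\<close>)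
  moreover have "ren (g' + mset a2) k1 \<longleftrightarrow> ren (g' + mset b2) k1"
    by (rule ren_interleaved[OF w'(3,4) cl(3,4), of k1 k3 k4]) (use r1 r3 r4 k in \<open>auto simp: com_def\<close>)
  ultimately show ?thesis using r1 by (simp add: quad_def com_def)
qed

section \<open>Splitting amplitudes at a renewal point and exchanging upper parts\<close>

definition below :: "nat \<Rightarrow> nat multiset \<Rightarrow> nat multiset" where
  "below c h = {#x \<in># h. x < c#}"

definition above :: "nat \<Rightarrow> nat multiset \<Rightarrow> nat multiset" where
  "above c h = {#x \<in># h. \<not> x < c#}"

lemma below_above: "below c h + above c h = h"
  unfolding below_def above_def by (rule multiset_partition[symmetric])

lemma below_add [simp]: "below c (F + G) = below c F + below c G"
  by (simp add: below_def)

lemma below_below [simp]: "below c (below c h) = below c h"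
  by (simp add: below_def filter_filter_mset)

lemma below_above_0 [simp]: "below c (above c h) = {#}"
  by (auto simp: below_def above_def)

lemma above_add [simp]: "above c (F + G) = above c F + above c G"
  by (simp add: above_def)

lemma above_above [simp]: "above c (above c h) = above c h"
  by (simp add: above_def filter_filter_mset)

lemma above_below_0 [simp]: "above c (below c h) = {#}"
  by (auto simp: below_def above_def)

lemma below_mset_small: "\<forall>x\<in>set a. x < c \<Longrightarrow> below c (mset a) = mset a"
  by (auto simp: below_def filter_mset_eq_conv)

lemma below_mset_large: "\<forall>x\<in>set a. c \<le> x \<Longrightarrow> below c (mset a) = {#}"
  by (auto simp: below_def)

lemma ren_below: "j \<le> k \<Longrightarrow> ren (below (p * k) F) j \<longleftrightarrow> ren F j"
proof -
  assume "j \<le> k"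
  then have "p * j \<le> p * k" by simp
  then have "x < p * k" if "x < p * j" for x using that by linarith
  then have "filter_mset (\<lambda>x. x < p * j) (below (p * k) F) = filter_mset (\<lambda>x. x < p * j) F"
    unfolding below_def filter_filter_mset by (intro filter_mset_cong) auto
  then show ?thesis by (simp add: ren_def)
qed

lemma ren_below_ms: "ren F k \<longleftrightarrow> below (p * k) F \<in> ms k"
  by (simp add: ren_def below_def)

definition upper :: "nat \<Rightarrow> nat list \<Rightarrow> nat multiset \<Rightarrow> real" where
  "upper c a h = lamp (map (\<lambda>x. x - c) (a @ sorted_list_of_multiset h))"

text \<open>The upper indices \<open>aR\<close> first move past the \<open>k - length aL\<close>
  background particles below the cut, which gives the sign; then everything below the cut precedes
  everything above, and \<open>lamp_append\<close> applies.\<close>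

lemma layer_split:
  assumes L: "\<forall>x\<in>set aL. x < p * k" and R: "\<forall>x\<in>set aR. p * k \<le> x"
    and r: "ren (h + mset (aL @ aR)) k"
  shows "layer (aL @ aR) h = (-1) ^ (p * (length aR * (k - length aL)))
     * (layer aL (below (p * k) h) * upper (p * k) aR (above (p * k) h))"
    and "size (below (p * k) h) + length aL = k"
proof -
  let ?c = "p * k"
  let ?l = "sorted_list_of_multiset (below ?c h)" and ?u = "sorted_list_of_multiset (above ?c h)"
  have b: "below ?c (h + mset (aL @ aR)) = below ?c h + mset aL"
    using L R by (simp add: below_mset_small below_mset_large)
  have m: "below ?c h + mset aL \<in> ms k" using r unfolding ren_below_ms b .
  show sz: "size (below ?c h) + length aL = k" using m by (simp add: ms_def)
  have s: "sorted_list_of_multiset h = ?l @ ?u"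
    by (subst below_above[of ?c h, symmetric], rule sorted_list_of_multiset_add_shift)
       (auto simp: below_def above_def)
  have sum: "sum_list (aL @ ?l) = tri p (length (aL @ ?l))"
    using m sz by (simp add: ms_def sum_sorted_list_of_multiset sum_mset_sum_list add.commute)
  have up: "aR @ ?u = map (\<lambda>x. x + ?c) (map (\<lambda>x. x - ?c) (aR @ ?u))"
    unfolding map_map by (rule map_idI[symmetric]) (use R in \<open>auto simp: above_def\<close>)
  have len: "length (aL @ ?l) = k" using sz by simp
  have "layer (aL @ aR) h = lamp (aL @ aR @ ?l @ ?u)" by (simp add: layer_def s)
  also have "\<dots> = (-1) ^ (p * (length aR * length ?l)) * lamp (aL @ ?l @ aR @ ?u)"
    by (rule lamp_swap_blocks)
  also have "lamp (aL @ ?l @ aR @ ?u) = lamp ((aL @ ?l) @ map (\<lambda>x. x + p * length (aL @ ?l)) (map (\<lambda>x. x - ?c) (aR @ ?u)))"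
    unfolding len by (subst up[symmetric]) simp
  also have "\<dots> = layer aL (below ?c h) * upper ?c aR (above ?c h)"
    by (subst lamp_append[OF sum]) (simp add: layer_def upper_def)
  also have "length ?l = k - length aL" using sz by simp
  finally show "layer (aL @ aR) h = (-1) ^ (p * (length aR * (k - length aL)))
     * (layer aL (below ?c h) * upper ?c aR (above ?c h))" .
qed

lemma mfac_below_above: "mfac h = mfac (below c h) * mfac (above c h)"
proof -
  have "mfac (below c h + above c h) = mfac (below c h) * mfac (above c h)"
    by (rule mfac_add) (auto simp: below_def above_def)
  then show ?thesis by (simp add: below_above)
qed

text \<open>Bra and ket acquire the same sign, which cancels: they have equally many upper indices
  by assumption, and renewal of both over one background gives equally many lower ones.\<close>

lemma layer_pair_split:
  assumes "\<forall>x\<in>set (aL @ bL). x < p * k" "\<forall>x\<in>set (aR @ bR). p * k \<le> x"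
    and "ren (h + mset (aL @ aR)) k" "ren (h + mset (bL @ bR)) k"
    and "length aR = length bR"
  shows "layer (aL @ aR) h * layer (bL @ bR) h / mfac h
    = (layer aL (below (p * k) h) * layer bL (below (p * k) h) / mfac (below (p * k) h))
    * (upper (p * k) aR (above (p * k) h) * upper (p * k) bR (above (p * k) h) / mfac (above (p * k) h))"
proof -
  have l: "length aL = length bL"
    using layer_split(2)[of aL k aR h] layer_split(2)[of bL k bR h] assms by fastforce
  have a: "layer (aL @ aR) h = (-1) ^ (p * (length aR * (k - length aL)))
     * (layer aL (below (p * k) h) * upper (p * k) aR (above (p * k) h))"
    by (rule layer_split(1)) (use assms in auto)
  have b: "layer (bL @ bR) h = (-1) ^ (p * (length aR * (k - length aL)))
     * (layer bL (below (p * k) h) * upper (p * k) bR (above (p * k) h))"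
    unfolding l assms(5) by (rule layer_split(1)) (use assms in auto)
  have s: "(-1) ^ e * (-1) ^ e = (1::real)" for e :: nat by (simp flip: power_add)
  have "layer (aL @ aR) h * layer (bL @ bR) h = ((-1) ^ (p * (length aR * (k - length aL))) * (-1) ^ (p * (length aR * (k - length aL))))
     * ((layer aL (below (p * k) h) * upper (p * k) aR (above (p * k) h)) * (layer bL (below (p * k) h) * upper (p * k) bR (above (p * k) h)))"
    unfolding a b by (simp only: ac_simps)
  then show ?thesis unfolding s mfac_below_above[of h "p * k"] by simp
qed

definition swap_tails :: "nat \<Rightarrow> nat multiset \<times> nat multiset \<Rightarrow> nat multiset \<times> nat multiset" where
  "swap_tails c P = (below c (fst P) + above c (snd P), below c (snd P) + above c (fst P))"

lemma swap_tails_invol [simp]: "swap_tails c (swap_tails c P) = P"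
  by (simp add: swap_tails_def below_above)

lemma below_swap_tails: "below c (fst (swap_tails c P)) = below c (fst P)" "below c (snd (swap_tails c P)) = below c (snd P)"
  "above c (fst (swap_tails c P)) = above c (snd P)" "above c (snd (swap_tails c P)) = above c (fst P)"
  by (simp_all add: swap_tails_def)

definition prodterm :: "nat list \<Rightarrow> nat list \<Rightarrow> nat list \<Rightarrow> nat list \<Rightarrow> nat multiset \<times> nat multiset \<Rightarrow> real" where
  "prodterm a1 b1 a2 b2 P = layer a1 (fst P) * layer b1 (fst P) / mfac (fst P)
     * (layer a2 (snd P) * layer b2 (snd P) / mfac (snd P))"

text \<open>The first point is taken because the property at points up to \<open>k\<close> depends
  only on what lies below \<open>p * k\<close>, which an exchange of tails at \<open>k\<close> does
  not touch. The exchanged pair thus has the same first point, and the exchange can be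
  undone.\<close>

definition cutpt :: "nat \<Rightarrow> nat \<Rightarrow> (nat \<Rightarrow> bool) \<Rightarrow> nat" where
  "cutpt c c' Q = (LEAST k. c < k \<and> k \<le> c' \<and> Q k)"

definition good :: "nat \<Rightarrow> nat \<Rightarrow> nat \<Rightarrow> nat list \<Rightarrow> nat list \<Rightarrow> nat list \<Rightarrow> nat list \<Rightarrow> (nat multiset \<times> nat multiset) set" where
  "good N c c' a1 b1 a2 b2 = {P \<in> bgs N (length a1) \<times> bgs N (length a2). \<exists>k. c < k \<and> k \<le> c' \<and> quad a1 b1 a2 b2 P k}"

context
  fixes N c c' :: nat and aL aR bL bR a2L a2R b2L b2R :: "nat list"
  assumes low: "\<forall>x\<in>set (aL @ bL @ a2L @ b2L). x < p * Suc c"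
    and high: "\<forall>x\<in>set (aR @ bR @ a2R @ b2R). p * c' \<le> x"
begin

lemma low_high:
  assumes "c < k" "k \<le> c'"
  shows "x \<in> set aL \<union> set bL \<union> set a2L \<union> set b2L \<Longrightarrow> x < p * k"
    and "x \<in> set aR \<union> set bR \<union> set a2R \<union> set b2R \<Longrightarrow> p * k \<le> x"
proof -
  have 1: "p * Suc c \<le> p * k" using assms by (intro mult_le_mono2) simp
  have 2: "p * k \<le> p * c'" using assms by (intro mult_le_mono2)
  show "x \<in> set aL \<union> set bL \<union> set a2L \<union> set b2L \<Longrightarrow> x < p * k"
    using low 1 by (auto dest!: bspec[of _ _ x])
  assume "x \<in> set aR \<union> set bR \<union> set a2R \<union> set b2R"
  then have "p * c' \<le> x" using high by auto
  with 2 show "p * k \<le> x" by (rule order.trans)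
qed

lemma below_lists:
  assumes "c < k" "k \<le> c'"
  shows "below (p * k) (mset aL) = mset aL" "below (p * k) (mset bL) = mset bL"
    "below (p * k) (mset a2L) = mset a2L" "below (p * k) (mset b2L) = mset b2L"
    "below (p * k) (mset aR) = {#}" "below (p * k) (mset bR) = {#}"
    "below (p * k) (mset a2R) = {#}" "below (p * k) (mset b2R) = {#}"
  using low_high[OF assms] by (auto intro!: below_mset_small below_mset_large)

lemma quad_swap:
  assumes "c < k" "k \<le> c'" "j \<le> k"
  shows "quad (aL @ a2R) (bL @ b2R) (a2L @ aR) (b2L @ bR) (swap_tails (p * k) P) j
    \<longleftrightarrow> quad (aL @ aR) (bL @ bR) (a2L @ a2R) (b2L @ b2R) P j"
proof -
  have eq: "ren F j \<longleftrightarrow> ren G j" if "below (p * k) F = below (p * k) G" for F G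
    using ren_below[OF assms(3), of F] ren_below[OF assms(3), of G] that by simp
  have "ren (fst (swap_tails (p * k) P) + mset (aL @ a2R)) j \<longleftrightarrow> ren (fst P + mset (aL @ aR)) j"
    "ren (fst (swap_tails (p * k) P) + mset (bL @ b2R)) j \<longleftrightarrow> ren (fst P + mset (bL @ bR)) j"
    "ren (snd (swap_tails (p * k) P) + mset (a2L @ aR)) j \<longleftrightarrow> ren (snd P + mset (a2L @ a2R)) j"
    "ren (snd (swap_tails (p * k) P) + mset (b2L @ bR)) j \<longleftrightarrow> ren (snd P + mset (b2L @ b2R)) j"
    by (rule eq, simp add: below_swap_tails below_lists[OF assms(1,2)])+
  then show ?thesis by (simp add: quad_def)
qed

lemma quad_balanced:
  assumes "c < k" "k \<le> c'" "quad (aL @ aR) (bL @ bR) (a2L @ a2R) (b2L @ b2R) P k"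
  shows "size (below (p * k) (fst P)) + length aL = k" "size (below (p * k) (fst P)) + length bL = k"
    "size (below (p * k) (snd P)) + length a2L = k" "size (below (p * k) (snd P)) + length b2L = k"
proof -
  note lh = low_high[OF assms(1,2)]
  note q = assms(3)[unfolded quad_def]
  show "size (below (p * k) (fst P)) + length aL = k"
    by (rule layer_split(2)[of aL k aR]) (use lh q in auto)
  show "size (below (p * k) (fst P)) + length bL = k"
    by (rule layer_split(2)[of bL k bR]) (use lh q in auto)
  show "size (below (p * k) (snd P)) + length a2L = k"
    by (rule layer_split(2)[of a2L k a2R]) (use lh q in auto)
  show "size (below (p * k) (snd P)) + length b2L = k"
    by (rule layer_split(2)[of b2L k b2R]) (use lh q in auto)
qed

lemma prodterm_swap:
  assumes k: "c < k" "k \<le> c'" and q: "quad (aL @ aR) (bL @ bR) (a2L @ a2R) (b2L @ b2R) P k"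
    and len: "length aR = length bR" "length a2R = length b2R"
  shows "prodterm (aL @ a2R) (bL @ b2R) (a2L @ aR) (b2L @ bR) (swap_tails (p * k) P)
    = prodterm (aL @ aR) (bL @ bR) (a2L @ a2R) (b2L @ b2R) P"
proof -
  let ?S = "swap_tails (p * k) P"
  have q': "quad (aL @ a2R) (bL @ b2R) (a2L @ aR) (b2L @ bR) ?S k"
    using quad_swap[OF k order.refl] q by simp
  note lh = low_high[OF k]
  have 1: "layer (aL @ aR) (fst P) * layer (bL @ bR) (fst P) / mfac (fst P)
    = (layer aL (below (p * k) (fst P)) * layer bL (below (p * k) (fst P)) / mfac (below (p * k) (fst P)))
    * (upper (p * k) aR (above (p * k) (fst P)) * upper (p * k) bR (above (p * k) (fst P)) / mfac (above (p * k) (fst P)))"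
    by (rule layer_pair_split) (use lh q len in \<open>auto simp: quad_def\<close>)
  have 2: "layer (a2L @ a2R) (snd P) * layer (b2L @ b2R) (snd P) / mfac (snd P)
    = (layer a2L (below (p * k) (snd P)) * layer b2L (below (p * k) (snd P)) / mfac (below (p * k) (snd P)))
    * (upper (p * k) a2R (above (p * k) (snd P)) * upper (p * k) b2R (above (p * k) (snd P)) / mfac (above (p * k) (snd P)))"
    by (rule layer_pair_split) (use lh q len in \<open>auto simp: quad_def\<close>)
  have 3: "layer (aL @ a2R) (fst ?S) * layer (bL @ b2R) (fst ?S) / mfac (fst ?S)
    = (layer aL (below (p * k) (fst P)) * layer bL (below (p * k) (fst P)) / mfac (below (p * k) (fst P)))
    * (upper (p * k) a2R (above (p * k) (snd P)) * upper (p * k) b2R (above (p * k) (snd P)) / mfac (above (p * k) (snd P)))"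
    unfolding below_swap_tails[of "p * k" P, symmetric]
    by (rule layer_pair_split) (use lh q' len in \<open>auto simp: quad_def\<close>)
  have 4: "layer (a2L @ aR) (snd ?S) * layer (b2L @ bR) (snd ?S) / mfac (snd ?S)
    = (layer a2L (below (p * k) (snd P)) * layer b2L (below (p * k) (snd P)) / mfac (below (p * k) (snd P)))
    * (upper (p * k) aR (above (p * k) (fst P)) * upper (p * k) bR (above (p * k) (fst P)) / mfac (above (p * k) (fst P)))"
    unfolding below_swap_tails[of "p * k" P, symmetric]
    by (rule layer_pair_split) (use lh q' len in \<open>auto simp: quad_def\<close>)
  show ?thesis unfolding prodterm_def 1 2 3 4 by (simp only: ac_simps)
qed

text \<open>At the cut each of the four configurations has exactly \<open>k\<close> particles below,
  so the two new backgrounds have the sizes that the exchanged index lists require.\<close>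

lemma swap_good:
  assumes P: "P \<in> good N c c' (aL @ aR) (bL @ bR) (a2L @ a2R) (b2L @ b2R)"
    and len: "length (aL @ aR) \<le> N" "length (a2L @ a2R) \<le> N"
    and len': "length aR = length bR" "length a2R = length b2R"
  defines "k \<equiv> cutpt c c' (quad (aL @ aR) (bL @ bR) (a2L @ a2R) (b2L @ b2R) P)"
  shows "swap_tails (p * k) P \<in> good N c c' (aL @ a2R) (bL @ b2R) (a2L @ aR) (b2L @ bR)"
    and "cutpt c c' (quad (aL @ a2R) (bL @ b2R) (a2L @ aR) (b2L @ bR) (swap_tails (p * k) P)) = k"
    and "prodterm (aL @ a2R) (bL @ b2R) (a2L @ aR) (b2L @ bR) (swap_tails (p * k) P)
      = prodterm (aL @ aR) (bL @ bR) (a2L @ a2R) (b2L @ b2R) P"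
proof -
  let ?Q = "quad (aL @ aR) (bL @ bR) (a2L @ a2R) (b2L @ b2R) P"
  let ?Q' = "quad (aL @ a2R) (bL @ b2R) (a2L @ aR) (b2L @ bR) (swap_tails (p * k) P)"
  obtain k0 where "c < k0 \<and> k0 \<le> c' \<and> ?Q k0" using P by (auto simp: good_def)
  then have k: "c < k \<and> k \<le> c' \<and> ?Q k"
    unfolding k_def cutpt_def by (rule LeastI)
  have least: "\<not> ?Q j" if "c < j" "j < k" for j
    using that k not_less_Least[of j "\<lambda>k. c < k \<and> k \<le> c' \<and> ?Q k"] unfolding k_def cutpt_def by linarith
  have kc: "c < k" "k \<le> c'" "?Q k" using k by auto
  have q': "?Q' j \<longleftrightarrow> ?Q j" if "j \<le> k" for j using quad_swap[OF kc(1,2) that] .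
  show "cutpt c c' ?Q' = k"
    unfolding cutpt_def
  proof (rule Least_equality)
    show "c < k \<and> k \<le> c' \<and> ?Q' k" using k q' by blast
    fix j assume j: "c < j \<and> j \<le> c' \<and> ?Q' j"
    show "k \<le> j"
    proof (rule ccontr)
      assume "\<not> k \<le> j"
      then show False using least[of j] q'[of j] j by auto
    qed
  qed
  show "prodterm (aL @ a2R) (bL @ b2R) (a2L @ aR) (b2L @ bR) (swap_tails (p * k) P)
      = prodterm (aL @ aR) (bL @ bR) (a2L @ a2R) (b2L @ b2R) P"
    by (rule prodterm_swap[OF kc len'])
  note bal = quad_balanced[OF kc]
  have sz: "size (below (p * k) h) + size (above (p * k) h) = size h" for h
    by (metis below_above size_union)
  have PN: "size (fst P) = N - length (aL @ aR)" "size (snd P) = N - length (a2L @ a2R)"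
    "set_mset (fst P) \<subseteq> {..<p * N}" "set_mset (snd P) \<subseteq> {..<p * N}"
    using P by (auto simp: good_def bgs_def)
  have "size (fst (swap_tails (p * k) P)) = N - length (aL @ a2R)"
    "size (snd (swap_tails (p * k) P)) = N - length (a2L @ aR)"
    using PN(1,2) bal sz[of "fst P"] sz[of "snd P"] len by (auto simp: swap_tails_def)
  moreover have "set_mset (fst (swap_tails (p * k) P)) \<subseteq> {..<p * N}" "set_mset (snd (swap_tails (p * k) P)) \<subseteq> {..<p * N}"
    using PN(3,4) by (auto simp: swap_tails_def below_def above_def)
  moreover have "?Q' k" using q'[of k] kc(3) by simp
  ultimately show "swap_tails (p * k) P \<in> good N c c' (aL @ a2R) (bL @ b2R) (a2L @ aR) (b2L @ bR)"
    using kc by (auto simp: good_def bgs_def mem_Times_iff)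
qed

text \<open>At an admissible point bra and ket both have \<open>k\<close> particles below the cut
  over the same background, which forces equally many lower indices.\<close>

lemma good_empty:
  assumes "length aL \<noteq> length bL \<or> length a2L \<noteq> length b2L"
  shows "good N c c' (aL @ aR) (bL @ bR) (a2L @ a2R) (b2L @ b2R) = {}"
  unfolding good_def using quad_balanced assms by fastforce

end

text \<open>The exchange at the first admissible point maps the good pairs of one side bijectively
  onto those of the other and preserves every term, so the good parts agree exactly and only bad
  pairs cause an error.\<close>

lemma sum_good_swap:
  fixes N c c' :: nat and aL aR bL bR a2L a2R b2L b2R :: "nat list"
  assumes low: "\<forall>x\<in>set (aL @ bL @ a2L @ b2L). x < p * Suc c"
    and high: "\<forall>x\<in>set (aR @ bR @ a2R @ b2R). p * c' \<le> x"
    and len: "length (aL @ aR) + length (a2L @ a2R) \<le> N" "length aR = length bR" "length a2R = length b2R"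
  shows "(\<Sum>P\<in>good N c c' (aL @ aR) (bL @ bR) (a2L @ a2R) (b2L @ b2R). prodterm (aL @ aR) (bL @ bR) (a2L @ a2R) (b2L @ b2R) P)
    = (\<Sum>P\<in>good N c c' (aL @ a2R) (bL @ b2R) (a2L @ aR) (b2L @ bR). prodterm (aL @ a2R) (bL @ b2R) (a2L @ aR) (b2L @ bR) P)"
proof -
  have high': "\<forall>x\<in>set (a2R @ b2R @ aR @ bR). p * c' \<le> x" using high by auto
  let ?j = "\<lambda>P. swap_tails (p * cutpt c c' (quad (aL @ aR) (bL @ bR) (a2L @ a2R) (b2L @ b2R) P)) P"
  let ?i = "\<lambda>P. swap_tails (p * cutpt c c' (quad (aL @ a2R) (bL @ b2R) (a2L @ aR) (b2L @ bR) P)) P"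
  have l1: "length (aL @ aR) \<le> N" "length (a2L @ a2R) \<le> N" "length (aL @ a2R) \<le> N" "length (a2L @ aR) \<le> N"
    using len by auto
  show ?thesis
  proof (rule sum.reindex_bij_witness[where i = ?i and j = ?j])
    fix P assume P: "P \<in> good N c c' (aL @ aR) (bL @ bR) (a2L @ a2R) (b2L @ b2R)"
    note * = swap_good[OF low high P l1(1,2) len(2,3)]
    show "?i (?j P) = P" unfolding *(2) by simp
    show "?j P \<in> good N c c' (aL @ a2R) (bL @ b2R) (a2L @ aR) (b2L @ bR)" by (rule *(1))
    show "prodterm (aL @ a2R) (bL @ b2R) (a2L @ aR) (b2L @ bR) (?j P)
      = prodterm (aL @ aR) (bL @ bR) (a2L @ a2R) (b2L @ b2R) P" by (rule *(3))
  next
    fix P assume P: "P \<in> good N c c' (aL @ a2R) (bL @ b2R) (a2L @ aR) (b2L @ bR)"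
    note * = swap_good[OF low high' P l1(3,4) len(3,2)]
    show "?j (?i P) = P" unfolding *(2) by simp
    show "?i P \<in> good N c c' (aL @ aR) (bL @ bR) (a2L @ a2R) (b2L @ b2R)" by (rule *(1))
  qed
qed

end

section \<open>Clustering in the orbital basis\<close>

context clustering
begin

text \<open>Four consecutive windows of length \<open>d\<close> serve the four pairs of
  \<open>quad_exists\<close>. If every window had a common renewal of its pair, \<open>P\<close>
  would be good; so a bad \<open>P\<close> with nonzero amplitudes misses one, and each miss is rare
  by \<open>no_com_window\<close>.\<close>

lemma sum_abs_bad_le:
  assumes len: "length b1 = length a1" "length b2 = length a2" "length a1 + length a2 \<le> N"
    and cl: "clear c (c + 4 * d) a1" "clear c (c + 4 * d) b1" "clear c (c + 4 * d) a2" "clear c (c + 4 * d) b2"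
    and d: "c + 4 * d \<le> N" "d > 0"
  shows "(\<Sum>P\<in>bgs N (length a1) \<times> bgs N (length a2) - good N c (c + 4 * d) a1 b1 a2 b2. \<bar>prodterm a1 b1 a2 b2 P\<bar>)
    \<le> 4 * (Bc (length a1) * Bc (length a2) * sqrt (sqrt (dlt d)) * (C N)\<^sup>2)"
proof -
  let ?B = "bgs N (length a1) \<times> bgs N (length a2)"
  let ?t = "\<lambda>P. \<bar>prodterm a1 b1 a2 b2 P\<bar>"
  let ?W = "\<lambda>x1 x2 e. {P \<in> ?B. \<forall>k. e < k \<longrightarrow> k \<le> e + d \<longrightarrow> \<not> com (fst P + mset x1, snd P + mset x2) k}"
  let ?E = "Bc (length a1) * Bc (length a2) * sqrt (sqrt (dlt d)) * (C N)\<^sup>2"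
  have fW: "finite (?W x1 x2 e)" for x1 x2 e by (rule finite_subset[of _ ?B]) auto
  have W: "(\<Sum>P\<in>?W x1 x2 e. \<bar>prodterm x1 y1 x2 y2 P\<bar>) \<le> ?E"
    if "length x1 = length a1" "length x2 = length a2" "length y1 = length a1" "length y2 = length a2" "e + d \<le> N"
    for x1 x2 y1 y2 e
  proof -
    have "(\<Sum>P\<in>?W x1 x2 e. \<bar>prodterm x1 y1 x2 y2 P\<bar>) \<le> Bc (length x1) * Bc (length x2) * sqrt (sqrt (dlt d)) * (C N)\<^sup>2"
      unfolding prodterm_def
      by (rule bad_sum_le[where Q = "\<lambda>P. \<forall>k. e < k \<longrightarrow> k \<le> e + d \<longrightarrow> \<not> com P k"])
         (use that len d no_com_window[of e d N] in auto)
    then show ?thesis using that by simp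
  qed
  let ?S = "?B - good N c (c + 4 * d) a1 b1 a2 b2"
  let ?U = "?W a1 a2 c \<union> (?W b1 a2 (c + d) \<union> (?W a1 b2 (c + 2 * d) \<union> ?W a1 a2 (c + 3 * d)))"
  have sub: "{P \<in> ?S. ?t P \<noteq> 0} \<subseteq> ?U"
  proof
    fix P assume P: "P \<in> {P \<in> ?S. ?t P \<noteq> 0}"
    obtain h g' where hg: "P = (h, g')" by (cases P)
    have PB: "P \<in> ?B" and ng: "P \<notin> good N c (c + 4 * d) a1 b1 a2 b2" using P by blast+
    have nz: "layer a1 h \<noteq> 0" "layer b1 h \<noteq> 0" "layer a2 g' \<noteq> 0" "layer b2 g' \<noteq> 0"
      using P by (auto simp: prodterm_def hg)
    show "P \<in> ?U"
    proof (rule ccontr)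
      assume nU: "P \<notin> ?U"
      obtain k1 where k1: "c < k1" "k1 \<le> c + d" "com (h + mset a1, g' + mset a2) k1"
        using nU PB hg by auto
      obtain k2 where k2: "c + d < k2" "k2 \<le> c + d + d" "com (h + mset b1, g' + mset a2) k2"
        using nU PB hg by auto
      obtain k3 where k3: "c + 2 * d < k3" "k3 \<le> c + 2 * d + d" "com (h + mset a1, g' + mset b2) k3"
        using nU PB hg by auto
      obtain k4 where k4: "c + 3 * d < k4" "k4 \<le> c + 3 * d + d" "com (h + mset a1, g' + mset a2) k4"
        using nU PB hg by auto
      have "quad a1 b1 a2 b2 (h, g') k1"
        by (rule quad_exists[OF nz cl k1(3) k2(3) k3(3) k4(3)]) (use k1 k2 k3 k4 in linarith)+
      then have "P \<in> good N c (c + 4 * d) a1 b1 a2 b2"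
        using PB k1 unfolding good_def hg by fastforce
      then show False using ng by blast
    qed
  qed
  have "(\<Sum>P\<in>?S. ?t P) = (\<Sum>P\<in>{P \<in> ?S. ?t P \<noteq> 0}. ?t P)"
    by (rule sum.mono_neutral_right) auto
  also have "\<dots> \<le> (\<Sum>P\<in>?U. ?t P)"
    by (rule sum_mono2[OF _ sub]) (use fW in auto)
  also have "\<dots> \<le> (\<Sum>P\<in>?W a1 a2 c. ?t P) + ((\<Sum>P\<in>?W b1 a2 (c + d). ?t P)
      + ((\<Sum>P\<in>?W a1 b2 (c + 2 * d). ?t P) + (\<Sum>P\<in>?W a1 a2 (c + 3 * d). ?t P)))"
  proof -
    have un: "(\<Sum>P\<in>X \<union> Y. ?t P) \<le> (\<Sum>P\<in>X. ?t P) + y" if "(\<Sum>P\<in>Y. ?t P) \<le> y" "finite X" "finite Y" for X Y y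
    proof -
      have "(\<Sum>P\<in>X \<union> Y. ?t P) + (\<Sum>P\<in>X \<inter> Y. ?t P) = (\<Sum>P\<in>X. ?t P) + (\<Sum>P\<in>Y. ?t P)"
        using that by (intro sum.union_inter) auto
      moreover have "(\<Sum>P\<in>X \<inter> Y. ?t P) \<ge> 0" by (intro sum_nonneg) auto
      ultimately show ?thesis using that(1) by linarith
    qed
    show ?thesis using fW by (intro un finite_UnI order.refl)
  qed
  also have "\<dots> \<le> ?E + (?E + (?E + ?E))"
  proof (intro add_mono)
    show "(\<Sum>P\<in>?W a1 a2 c. ?t P) \<le> ?E" by (rule W) (use len d in auto)
    show "(\<Sum>P\<in>?W a1 a2 (c + 3 * d). ?t P) \<le> ?E" by (rule W) (use len d in auto)
    \<comment> \<open>Exchanging bra and ket in one factor does not change the term, and it puts the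
      pair named by the event into the slots in which \<open>bad_sum_le\<close> measures it.\<close>
    have "?t P = \<bar>prodterm b1 a1 a2 b2 P\<bar>" "?t P = \<bar>prodterm a1 b1 b2 a2 P\<bar>" for P
      by (simp_all add: prodterm_def ac_simps)
    note eqs = this
    show "(\<Sum>P\<in>?W b1 a2 (c + d). ?t P) \<le> ?E" unfolding eqs(1) by (rule W) (use len d in auto)
    show "(\<Sum>P\<in>?W a1 b2 (c + 2 * d). ?t P) \<le> ?E" unfolding eqs(2) by (rule W) (use len d in auto)
  qed
  finally show ?thesis by simp
qed

definition Bmax :: "nat \<Rightarrow> real" where "Bmax q = (\<Sum>j\<le>q. Bc j)"

lemma Bc_le_Bmax: "j \<le> q \<Longrightarrow> Bc j \<le> Bmax q"
  unfolding Bmax_def by (intro member_le_sum) (auto intro: less_imp_le[OF Bc_pos])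

text \<open>The fourth root comes from two uses of Cauchy-Schwarz: one separates the pair of layers
  named by the event from the other pair, one separates the event from the occupation numbers. The 4
  counts the windows.\<close>

definition eps :: "nat \<Rightarrow> nat \<Rightarrow> real" where
  "eps q d = 4 * (Bmax q * Bmax q * sqrt (sqrt (dlt d)))"

lemma eps_nonneg: "eps q d \<ge> 0"
  unfolding eps_def Bmax_def using dlt_nonneg less_imp_le[OF Bc_pos] by (intro mult_nonneg_nonneg sum_nonneg) auto

lemma eps_tendsto: "(\<lambda>d. eps q d) \<longlonglongrightarrow> 0"
proof -
  have "(\<lambda>d. 4 * (Bmax q * Bmax q * sqrt (sqrt (dlt d)))) \<longlonglongrightarrow> 4 * (Bmax q * Bmax q * sqrt (sqrt 0))"
    by (intro tendsto_intros dlt_tendsto)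
  then show ?thesis by (simp add: eps_def[abs_def])
qed

lemma bad_le_eps:
  assumes len: "length b1 = length a1" "length b2 = length a2" "length a1 + length a2 \<le> q" "q \<le> N"
    and cl: "clear c (c + 4 * d) a1" "clear c (c + 4 * d) b1" "clear c (c + 4 * d) a2" "clear c (c + 4 * d) b2"
    and d: "c + 4 * d \<le> N" "d > 0"
  shows "\<bar>Gam N a1 b1 * Gam N a2 b2 - (\<Sum>P\<in>good N c (c + 4 * d) a1 b1 a2 b2. prodterm a1 b1 a2 b2 P)\<bar> \<le> eps q d * (C N)\<^sup>2"
proof -
  let ?B = "bgs N (length a1) \<times> bgs N (length a2)"
  let ?G = "good N c (c + 4 * d) a1 b1 a2 b2"
  have "Gam N a1 b1 * Gam N a2 b2 = (\<Sum>P\<in>?B. prodterm a1 b1 a2 b2 P)"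
    using Gam_prod[of a1 b1 a2 b2 N] len by (simp add: prodterm_def)
  also have "\<dots> = (\<Sum>P\<in>?B - ?G. prodterm a1 b1 a2 b2 P) + (\<Sum>P\<in>?G. prodterm a1 b1 a2 b2 P)"
    by (rule sum.subset_diff) (auto simp: good_def)
  finally have "\<bar>Gam N a1 b1 * Gam N a2 b2 - (\<Sum>P\<in>?G. prodterm a1 b1 a2 b2 P)\<bar> \<le> (\<Sum>P\<in>?B - ?G. \<bar>prodterm a1 b1 a2 b2 P\<bar>)"
    using sum_abs[of "prodterm a1 b1 a2 b2" "?B - ?G"] by simp
  also have "\<dots> \<le> 4 * (Bc (length a1) * Bc (length a2) * sqrt (sqrt (dlt d)) * (C N)\<^sup>2)"
    by (rule sum_abs_bad_le) (use assms in auto)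
  also have "\<dots> \<le> 4 * (Bmax q * Bmax q * sqrt (sqrt (dlt d)) * (C N)\<^sup>2)"
    using len less_imp_le[OF Bc_pos] order.trans[OF less_imp_le[OF Bc_pos] Bc_le_Bmax, of _ q]
    by (intro mult_left_mono mult_right_mono mult_mono Bc_le_Bmax) (auto simp: dlt_nonneg)
  finally show ?thesis by (simp add: eps_def)
qed

text \<open>There are no good pairs here, so the whole product is its bad part; if even the total
  lengths differ, a \<open>Gam\<close> vanishes by definition.\<close>

lemma unbalanced_small:
  assumes low: "\<forall>x\<in>set (aL @ bL @ a2L @ b2L). x < p * Suc c"
    and high: "\<forall>x\<in>set (aR @ bR @ a2R @ b2R). p * (c + 4 * d) \<le> x"
    and len: "length (aL @ aR) + length (a2L @ a2R) \<le> q" "q \<le> N"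
    and d: "c + 4 * d \<le> N" "d > 0"
    and unb: "length aL \<noteq> length bL \<or> length a2L \<noteq> length b2L"
  shows "\<bar>Gam N (aL @ aR) (bL @ bR) * Gam N (a2L @ a2R) (b2L @ b2R)\<bar> \<le> eps q d * (C N)\<^sup>2"
proof (cases "length (aL @ aR) = length (bL @ bR) \<and> length (a2L @ a2R) = length (b2L @ b2R)")
  case True
  have "\<bar>Gam N (aL @ aR) (bL @ bR) * Gam N (a2L @ a2R) (b2L @ b2R)
     - (\<Sum>P\<in>good N c (c + 4 * d) (aL @ aR) (bL @ bR) (a2L @ a2R) (b2L @ b2R). prodterm (aL @ aR) (bL @ bR) (a2L @ a2R) (b2L @ b2R) P)\<bar>
    \<le> eps q d * (C N)\<^sup>2"
    by (rule bad_le_eps) (use True low high len d in \<open>auto simp: clear_def\<close>)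
  then show ?thesis using good_empty[OF low high unb] by simp
next
  case False
  then have *: "Gam N (aL @ aR) (bL @ bR) * Gam N (a2L @ a2R) (b2L @ b2R) = 0" by (auto simp: Gam_def)
  show ?thesis unfolding * using eps_nonneg[of q d] by simp
qed

lemma tail_swap:
  assumes low: "\<forall>x\<in>set (aL @ bL @ a2L @ b2L). x < p * Suc c"
    and high: "\<forall>x\<in>set (aR @ bR @ a2R @ b2R). p * (c + 4 * d) \<le> x"
    and len: "length (aL @ aR) + length (a2L @ a2R) \<le> q" "q \<le> N"
    and bal: "length aL = length bL" "length a2L = length b2L" "length aR = length bR" "length a2R = length b2R"
    and d: "c + 4 * d \<le> N" "d > 0"
  shows "\<bar>Gam N (aL @ aR) (bL @ bR) * Gam N (a2L @ a2R) (b2L @ b2R)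
     - Gam N (aL @ a2R) (bL @ b2R) * Gam N (a2L @ aR) (b2L @ bR)\<bar> \<le> 2 * eps q d * (C N)\<^sup>2"
proof -
  let ?S1 = "\<Sum>P\<in>good N c (c + 4 * d) (aL @ aR) (bL @ bR) (a2L @ a2R) (b2L @ b2R). prodterm (aL @ aR) (bL @ bR) (a2L @ a2R) (b2L @ b2R) P"
  let ?S2 = "\<Sum>P\<in>good N c (c + 4 * d) (aL @ a2R) (bL @ b2R) (a2L @ aR) (b2L @ bR). prodterm (aL @ a2R) (bL @ b2R) (a2L @ aR) (b2L @ bR) P"
  have "\<bar>Gam N (aL @ aR) (bL @ bR) * Gam N (a2L @ a2R) (b2L @ b2R) - ?S1\<bar> \<le> eps q d * (C N)\<^sup>2"
    by (rule bad_le_eps) (use low high len d bal in \<open>auto simp: clear_def\<close>)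
  moreover have "\<bar>Gam N (aL @ a2R) (bL @ b2R) * Gam N (a2L @ aR) (b2L @ bR) - ?S2\<bar> \<le> eps q d * (C N)\<^sup>2"
    by (rule bad_le_eps) (use low high len d bal in \<open>auto simp: clear_def\<close>)
  moreover have "?S1 = ?S2"
    by (rule sum_good_swap[OF low high]) (use len bal in auto)
  ultimately show ?thesis by linarith
qed

section \<open>Clouds that alternate along the axis\<close>

lemma Gam_swap:
  "Gam N (u @ v @ r) (u' @ v' @ r')
    = (-1) ^ (p * (length u * length v + length u' * length v')) * Gam N (v @ u @ r) (v' @ u' @ r')"
proof (cases "length (u @ v @ r) = length (u' @ v' @ r')")
  case True
  have "layer (u @ v @ r) h * layer (u' @ v' @ r') h
     = (-1) ^ (p * (length u * length v + length u' * length v')) * (layer (v @ u @ r) h * layer (v' @ u' @ r') h)" for h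
    using lamp_swap_blocks[of "[]" u v "r @ sorted_list_of_multiset h"] lamp_swap_blocks[of "[]" u' v' "r' @ sorted_list_of_multiset h"]
    by (simp add: layer_def power_add distrib_left)
  moreover have "length (v @ u @ r) = length (u' @ v' @ r')" "length (v' @ u' @ r') = length (u' @ v' @ r')"
    using True by auto
  ultimately show ?thesis unfolding Gam_def using True by (simp only: simp_thms if_True sum_distrib_left times_divide_eq_right)
qed (auto simp: Gam_def)

definition lowf :: "nat \<Rightarrow> nat list \<Rightarrow> nat list" where "lowf t xs = filter (\<lambda>x. x < t) xs"
definition uppf :: "nat \<Rightarrow> nat list \<Rightarrow> nat list" where "uppf t xs = filter (\<lambda>x. \<not> x < t) xs"

lemma sorted_lowf_uppf: "sorted xs \<Longrightarrow> lowf t xs @ uppf t xs = xs"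
proof (induction xs)
  case (Cons x xs)
  show ?case
  proof (cases "x < t")
    case False
    then have "lowf t xs = []" using Cons.prems by (auto simp: lowf_def filter_empty_conv)
    then show ?thesis using Cons False by (simp add: lowf_def uppf_def)
  qed (use Cons in \<open>simp add: lowf_def uppf_def\<close>)
qed (simp add: lowf_def uppf_def)

context
  fixes N D m n :: nat and a1 b1 a2 b2 :: "nat list"
  assumes srt: "sorted a1" "sorted b1" "sorted a2" "sorted b2"
    and len: "length a1 = m" "length b1 = m" "length a2 = n" "length b2 = n" "m + n \<le> N"
    and D: "4 * p \<le> D"
begin

text \<open>Both \<open>PP\<close> and \<open>QQ\<close> lead from
  \<open>Gam N (a1 @ a2) (b1 @ b2) * C N\<close> at \<open>t = 0\<close> to the product of the two
  \<open>Gam\<close> at \<open>t = p * N\<close>. \<open>PP\<close> changes only when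
  \<open>t\<close> passes an index of the second cloud, \<open>QQ\<close> only when it passes one of
  the first.\<close>

definition PP :: "nat \<Rightarrow> real" where
  "PP t = Gam N (a1 @ uppf t a2) (b1 @ uppf t b2) * Gam N (lowf t a2) (lowf t b2)"

definition QQ :: "nat \<Rightarrow> real" where
  "QQ t = Gam N (lowf t a1) (lowf t b1) * Gam N (uppf t a1 @ a2) (uppf t b1 @ b2)"

text \<open>\<open>PP t\<close> turns into \<open>QQ t\<close> when all indices from
  \<open>t\<close> upwards move from the factor with the lower part of the first cloud to the factor
  with the lower part of the second. This is one exchange with an empty tail, and it is possible
  because no index lies closer than \<open>D\<close> below \<open>t\<close>.\<close>

lemma PP_QQ:
  assumes t: "D \<le> t" "t \<le> p * N" and gap: "\<And>x. x \<in> set (a1 @ b1 @ a2 @ b2) \<Longrightarrow> x < t \<Longrightarrow> x + D \<le> t"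
  shows "\<bar>PP t - QQ t\<bar> \<le> 2 * eps (m + n) (D div (4 * p)) * (C N)\<^sup>2"
proof -
  \<comment> \<open>The thresholds \<open>p * k\<close> with \<open>c < k \<le> c + 4 * d\<close>
    lie above \<open>t - D\<close> and do not exceed \<open>t\<close>, so four windows of length
    \<open>d\<close> fit into the gap.\<close>
  define c d where "c = (t - D) div p" and "d = D div (4 * p)"
  have d0: "d > 0" using D p_pos by (simp add: d_def div_greater_zero_iff)
  have "p * c \<le> t - D" by (simp add: c_def)
  moreover have "4 * p * d \<le> D" unfolding d_def by (rule times_div_less_eq_dividend)
  ultimately have ct: "p * (c + 4 * d) \<le> t" using t by (simp add: algebra_simps)
  then have "p * (c + 4 * d) \<le> p * N" using t by linarith
  then have cN: "c + 4 * d \<le> N" using p_pos by simp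
  have cl: "x < p * Suc c" if "x \<le> t - D" for x
    unfolding c_def using that p_pos by (metis dividend_less_times_div order.strict_trans1 mult.commute mult_Suc_right add.commute)
  have low: "x < p * Suc c" if "x \<in> set (lowf t a1) \<union> set (lowf t b1) \<union> set (lowf t a2) \<union> set (lowf t b2)" for x
    using that gap[of x] t by (intro cl) (auto simp: lowf_def)
  have high: "p * (c + 4 * d) \<le> x" if "x \<in> set (uppf t a1) \<union> set (uppf t b1) \<union> set (uppf t a2) \<union> set (uppf t b2)" for x
    using that ct by (auto simp: uppf_def)
  have la: "length (lowf t a1) + length (uppf t a1) = m" "length (lowf t b1) + length (uppf t b1) = m"
    "length (lowf t a2) + length (uppf t a2) = n" "length (lowf t b2) + length (uppf t b2) = n"
    using sorted_lowf_uppf[OF srt(1), of t] sorted_lowf_uppf[OF srt(2), of t] sorted_lowf_uppf[OF srt(3), of t]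
      sorted_lowf_uppf[OF srt(4), of t] len by (metis length_append)+
  have P: "PP t = Gam N (lowf t a1 @ (uppf t a1 @ uppf t a2)) (lowf t b1 @ (uppf t b1 @ uppf t b2))
     * Gam N (lowf t a2 @ []) (lowf t b2 @ [])"
    using sorted_lowf_uppf[OF srt(1), of t] sorted_lowf_uppf[OF srt(2), of t] by (simp add: PP_def flip: append_assoc)
  define e where "e = p * (length (uppf t a1) * length (lowf t a2) + length (uppf t b1) * length (lowf t b2))"
  have "QQ t = Gam N (lowf t a1) (lowf t b1)
     * Gam N (uppf t a1 @ lowf t a2 @ uppf t a2) (uppf t b1 @ lowf t b2 @ uppf t b2)"
    unfolding QQ_def sorted_lowf_uppf[OF srt(3)] sorted_lowf_uppf[OF srt(4)] ..
  then have Q: "QQ t = (-1) ^ e * (Gam N (lowf t a1 @ []) (lowf t b1 @ [])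
     * Gam N (lowf t a2 @ (uppf t a1 @ uppf t a2)) (lowf t b2 @ (uppf t b1 @ uppf t b2)))"
    unfolding Gam_swap[of N "uppf t a1" "lowf t a2"] by (simp add: e_def)
  show ?thesis
  proof (cases "length (lowf t a1) = length (lowf t b1) \<and> length (lowf t a2) = length (lowf t b2)")
    case True
    then have e1: "length (uppf t a1) = length (uppf t b1)" "length (uppf t a2) = length (uppf t b2)" using la by auto
    have "e = 2 * (p * (length (uppf t a1) * length (lowf t a2)))" using True e1 by (simp add: e_def)
    then have "(-1) ^ e = (1::real)" by simp
    moreover have "\<bar>Gam N (lowf t a1 @ (uppf t a1 @ uppf t a2)) (lowf t b1 @ (uppf t b1 @ uppf t b2))
      * Gam N (lowf t a2 @ []) (lowf t b2 @ []) - Gam N (lowf t a1 @ []) (lowf t b1 @ [])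
      * Gam N (lowf t a2 @ (uppf t a1 @ uppf t a2)) (lowf t b2 @ (uppf t b1 @ uppf t b2))\<bar> \<le> 2 * eps (m + n) d * (C N)\<^sup>2"
      by (rule tail_swap[where c = c]) (use low high True e1 la cN d0 len in auto)
    ultimately show ?thesis unfolding P Q d_def[symmetric] by simp
  next
    case False
    have "\<bar>PP t\<bar> \<le> eps (m + n) d * (C N)\<^sup>2"
      unfolding P by (rule unbalanced_small[where c = c]) (use low high False la cN d0 len in auto)
    moreover have "\<bar>QQ t\<bar> \<le> eps (m + n) d * (C N)\<^sup>2"
    proof -
      have "\<bar>QQ t\<bar> = \<bar>Gam N (lowf t a1 @ []) (lowf t b1 @ [])
         * Gam N (lowf t a2 @ (uppf t a1 @ uppf t a2)) (lowf t b2 @ (uppf t b1 @ uppf t b2))\<bar>"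
        unfolding Q by (simp add: abs_mult)
      also have "\<dots> \<le> eps (m + n) d * (C N)\<^sup>2"
        by (rule unbalanced_small[where c = c]) (use low high False la cN d0 len in auto)
      finally show ?thesis .
    qed
    ultimately show ?thesis unfolding d_def[symmetric] by linarith
  qed
qed

text \<open>While the last index passed belongs to the first cloud, \<open>PP\<close> is followed,
  because it ignores further indices of that cloud; while it belongs to the second,
  \<open>QQ\<close>. Between indices of different clouds there is a gap of at least
  \<open>D\<close>, where \<open>PP_QQ\<close> permits the switch. Charging one error to every index
  passed bounds the total.\<close>

lemma PP_chain:
  assumes bnd: "\<And>x. x \<in> set (a1 @ b1 @ a2 @ b2) \<Longrightarrow> x < p * N"
    and sep: "\<And>x y. x \<in> set (a1 @ b1) \<Longrightarrow> y \<in> set (a2 @ b2) \<Longrightarrow> x + D \<le> y \<or> y + D \<le> x"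
  shows "\<bar>Gam N (a1 @ a2) (b1 @ b2) * C N - Gam N a1 b1 * Gam N a2 b2\<bar>
    \<le> real (2 * (m + n)) * (2 * eps (m + n) (D div (4 * p)) * (C N)\<^sup>2)"
proof -
  define A B where "A = set (a1 @ b1)" and "B = set (a2 @ b2)"
  define E where "E = 2 * eps (m + n) (D div (4 * p)) * (C N)\<^sup>2"
  have E0: "E \<ge> 0" unfolding E_def using eps_nonneg by simp
  have D0: "D > 0" using D p_pos by (metis gr0I le_zero_eq mult_is_0 not_gr0 zero_neq_numeral)
  have sep': "x + D \<le> y \<or> y + D \<le> x" if "x \<in> A" "y \<in> B" for x y using sep that by (auto simp: A_def B_def)
  \<comment> \<open>As long as no index has been passed both \<open>lastA\<close> and
    \<open>lastB\<close> hold, in accordance with \<open>QQ 0 = PP 0\<close>.\<close>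
  define lastA where "lastA t \<longleftrightarrow> (\<forall>y\<in>B. y < t \<longrightarrow> (\<exists>x\<in>A. y < x \<and> x < t))" for t
  define lastB where "lastB t \<longleftrightarrow> (\<forall>x\<in>A. x < t \<longrightarrow> (\<exists>y\<in>B. x < y \<and> y < t))" for t
  define num where "num t = real (card ((A \<union> B) \<inter> {..<t}))" for t
  have fin: "finite (A \<union> B)" by (simp add: A_def B_def)
  have num_Suc: "num (Suc t) = num t + (if t \<in> A \<union> B then 1 else 0)" for t
  proof -
    have "(A \<union> B) \<inter> {..<Suc t} = (if t \<in> A \<union> B then insert t ((A \<union> B) \<inter> {..<t}) else (A \<union> B) \<inter> {..<t})"
      by (auto simp: less_Suc_eq)
    then show ?thesis using fin by (simp add: num_def)
  qed
  have filt: "lowf (Suc t) xs = lowf t xs" "uppf (Suc t) xs = uppf t xs" if "t \<notin> set xs" for t xs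
    using that by (auto simp: lowf_def uppf_def less_Suc_eq intro!: filter_cong)
  have QQ0: "QQ 0 = PP 0" by (simp add: PP_def QQ_def lowf_def uppf_def mult.commute)
  have PQ: "\<bar>PP t - QQ t\<bar> \<le> E" if "t \<le> p * N" "D \<le> t" "\<And>x. x \<in> A \<union> B \<Longrightarrow> x < t \<Longrightarrow> x + D \<le> t" for t
    unfolding E_def by (rule PP_QQ) (use that in \<open>auto simp: A_def B_def\<close>)
  have inv: "(lastA t \<longrightarrow> \<bar>PP t - PP 0\<bar> \<le> num t * E) \<and> (lastB t \<longrightarrow> \<bar>QQ t - PP 0\<bar> \<le> num t * E)" if "t \<le> p * N" for t
    using that
  proof (induction t)
    case 0
    then show ?case by (simp add: num_def QQ0)
  next
    case (Suc t)
    then have IH: "lastA t \<Longrightarrow> \<bar>PP t - PP 0\<bar> \<le> num t * E" "lastB t \<Longrightarrow> \<bar>QQ t - PP 0\<bar> \<le> num t * E" by auto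
    consider "t \<in> A" | "t \<in> B" | "t \<notin> A \<union> B" by blast
    then show ?case
    proof cases
      case 1
      then have nB: "t \<notin> B" using sep'[of t t] D0 by auto
      then have PPt: "PP (Suc t) = PP t" by (simp add: PP_def filt B_def)
      have nl: "\<not> lastB (Suc t)" unfolding lastB_def using 1 by auto
      have "\<bar>PP t - PP 0\<bar> \<le> num t * E + E"
      proof (cases "lastA t")
        case True
        then show ?thesis using IH(1) E0 by linarith
      next
        case False
        then obtain y where y: "y \<in> B" "y < t" "\<And>x. x \<in> A \<Longrightarrow> x < t \<Longrightarrow> x \<le> y"
          unfolding lastA_def by (meson not_le)
        have yA: "y \<notin> A" using y(1) sep'[of y y] D0 by auto
        have "lastB t" unfolding lastB_def using y yA by (metis le_neq_implies_less)
        moreover have "\<bar>PP t - QQ t\<bar> \<le> E"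
        proof (rule PQ)
          show "t \<le> p * N" using Suc.prems by simp
          have yD: "y' + D \<le> t" if "y' \<in> B" "y' < t" for y' using sep'[OF 1 that(1)] that(2) D0 by linarith
          then show "D \<le> t" using y by fastforce
          fix x assume x: "x \<in> A \<union> B" "x < t"
          then show "x + D \<le> t" using yD[of x] yD[of y] y by fastforce
        qed
        ultimately show ?thesis using IH(2) by linarith
      qed
      then show ?thesis using nl 1 by (simp add: PPt num_Suc distrib_right)
    next
      case 2
      then have nA: "t \<notin> A" using sep'[of t t] D0 by auto
      then have QQt: "QQ (Suc t) = QQ t" by (simp add: QQ_def filt A_def)
      have nl: "\<not> lastA (Suc t)" unfolding lastA_def using 2 by auto
      have "\<bar>QQ t - PP 0\<bar> \<le> num t * E + E"
      proof (cases "lastB t")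
        case True
        then show ?thesis using IH(2) E0 by linarith
      next
        case False
        then obtain x where x: "x \<in> A" "x < t" "\<And>y. y \<in> B \<Longrightarrow> y < t \<Longrightarrow> y \<le> x"
          unfolding lastB_def by (meson not_le)
        have xB: "x \<notin> B" using x(1) sep'[of x x] D0 by auto
        have "lastA t" unfolding lastA_def using x xB by (metis le_neq_implies_less)
        moreover have "\<bar>PP t - QQ t\<bar> \<le> E"
        proof (rule PQ)
          show "t \<le> p * N" using Suc.prems by simp
          have xD: "x' + D \<le> t" if "x' \<in> A" "x' < t" for x' using sep'[OF that(1) 2] that(2) D0 by linarith
          then show "D \<le> t" using x by fastforce
          fix y assume y: "y \<in> A \<union> B" "y < t"
          then show "y + D \<le> t" using xD[of y] xD[of x] x by fastforce
        qed
        ultimately show ?thesis using IH(1) by linarith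
      qed
      then show ?thesis using nl 2 by (simp add: QQt num_Suc distrib_right)
    next
      case 3
      then have "PP (Suc t) = PP t" "QQ (Suc t) = QQ t" by (simp_all add: PP_def QQ_def filt A_def B_def)
      moreover have "lastA (Suc t) = lastA t" "lastB (Suc t) = lastB t"
        using 3 by (auto simp: lastA_def lastB_def less_Suc_eq)
      ultimately show ?thesis using IH 3 by (simp add: num_Suc)
    qed
  qed
  have all: "lowf (p * N) xs = xs" "uppf (p * N) xs = []" if "set xs \<subseteq> A \<union> B" for xs
    using that bnd by (auto simp: lowf_def uppf_def A_def B_def filter_empty_conv filter_id_conv)
  have sub: "set a1 \<subseteq> A \<union> B" "set b1 \<subseteq> A \<union> B" "set a2 \<subseteq> A \<union> B" "set b2 \<subseteq> A \<union> B"
    by (auto simp: A_def B_def)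
  have PN: "PP (p * N) = Gam N a1 b1 * Gam N a2 b2" "QQ (p * N) = Gam N a1 b1 * Gam N a2 b2"
    by (simp_all add: PP_def QQ_def all sub)
  have P0: "PP 0 = Gam N (a1 @ a2) (b1 @ b2) * C N"
    by (simp add: PP_def lowf_def uppf_def)
  have "lastA (p * N) \<or> lastB (p * N)"
  proof (cases "A \<union> B = {}")
    case False
    define o1 where "o1 = Max (A \<union> B)"
    have "o1 \<in> A \<union> B" "\<And>x. x \<in> A \<union> B \<Longrightarrow> x \<le> o1" using False fin by (auto simp: o1_def simp del: Un_iff)
    moreover have "o1 < p * N" using bnd \<open>o1 \<in> A \<union> B\<close> by (auto simp: A_def B_def)
    moreover have "x \<noteq> y" if "x \<in> A" "y \<in> B" for x y using sep'[OF that] D0 by auto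
    ultimately show ?thesis unfolding lastA_def lastB_def by (metis UnCI UnE le_neq_implies_less)
  qed (auto simp: lastA_def)
  then have "\<bar>Gam N a1 b1 * Gam N a2 b2 - PP 0\<bar> \<le> num (p * N) * E"
    using inv[of "p * N"] PN by auto
  also have "num (p * N) \<le> real (2 * (m + n))"
  proof -
    have "card ((A \<union> B) \<inter> {..<p * N}) \<le> card (set (a1 @ b1 @ a2 @ b2))"
      by (intro card_mono) (auto simp: A_def B_def)
    also have "\<dots> \<le> length (a1 @ b1 @ a2 @ b2)" by (rule card_length)
    also have "\<dots> = 2 * (m + n)" using len by simp
    finally show ?thesis unfolding num_def by (simp only: of_nat_le_iff)
  qed
  finally show ?thesis unfolding P0 E_def[symmetric] using E0 by (simp add: abs_minus_commute mult_right_mono)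
qed

end

text \<open>Cutting at a threshold splits a list into a prefix and a suffix only if the list is
  sorted. The signs produced by sorting are common to both sides of the comparison.\<close>

lemma Gam_sort:
  assumes "length a1 = length b1" "length a2 = length b2"
  obtains s :: real where "s = 1 \<or> s = -1"
    "Gam N (a1 @ a2) (b1 @ b2) = s * Gam N (sort a1 @ sort a2) (sort b1 @ sort b2)"
    "Gam N a1 b1 * Gam N a2 b2 = s * (Gam N (sort a1) (sort b1) * Gam N (sort a2) (sort b2))"
proof -
  obtain sa1 :: real where sa1: "sa1 = 1 \<or> sa1 = -1" "\<And>pre rest. lamp (pre @ a1 @ rest) = sa1 * lamp (pre @ sort a1 @ rest)"
    using lamp_permute[of a1 "sort a1"] by (metis mset_sort)
  obtain sa2 :: real where sa2: "sa2 = 1 \<or> sa2 = -1" "\<And>pre rest. lamp (pre @ a2 @ rest) = sa2 * lamp (pre @ sort a2 @ rest)"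
    using lamp_permute[of a2 "sort a2"] by (metis mset_sort)
  obtain sb1 :: real where sb1: "sb1 = 1 \<or> sb1 = -1" "\<And>pre rest. lamp (pre @ b1 @ rest) = sb1 * lamp (pre @ sort b1 @ rest)"
    using lamp_permute[of b1 "sort b1"] by (metis mset_sort)
  obtain sb2 :: real where sb2: "sb2 = 1 \<or> sb2 = -1" "\<And>pre rest. lamp (pre @ b2 @ rest) = sb2 * lamp (pre @ sort b2 @ rest)"
    using lamp_permute[of b2 "sort b2"] by (metis mset_sort)
  have l: "layer a1 h = sa1 * layer (sort a1) h" "layer b1 h = sb1 * layer (sort b1) h"
    "layer a2 h = sa2 * layer (sort a2) h" "layer b2 h = sb2 * layer (sort b2) h"
    "layer (a1 @ a2) h = sa1 * sa2 * layer (sort a1 @ sort a2) h"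
    "layer (b1 @ b2) h = sb1 * sb2 * layer (sort b1 @ sort b2) h" for h
    using sa1(2)[of "[]"] sa2(2)[of "[]"] sb1(2)[of "[]"] sb2(2)[of "[]"] sa2(2)[of "sort a1"] sb2(2)[of "sort b1"]
    by (auto simp: layer_def)
  show thesis
  proof (rule that)
    show "sa1 * sa2 * sb1 * sb2 = 1 \<or> sa1 * sa2 * sb1 * sb2 = -1"
      using sa1(1) sa2(1) sb1(1) sb2(1) by auto
    show "Gam N (a1 @ a2) (b1 @ b2) = (sa1 * sa2 * sb1 * sb2) * Gam N (sort a1 @ sort a2) (sort b1 @ sort b2)"
      unfolding Gam_def using assms by (simp add: l sum_distrib_left ac_simps)
    show "Gam N a1 b1 * Gam N a2 b2 = (sa1 * sa2 * sb1 * sb2) * (Gam N (sort a1) (sort b1) * Gam N (sort a2) (sort b2))"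
    proof -
      have "Gam N a1 b1 = sa1 * sb1 * Gam N (sort a1) (sort b1)" "Gam N a2 b2 = sa2 * sb2 * Gam N (sort a2) (sort b2)"
        unfolding Gam_def using assms by (simp_all add: l sum_distrib_left ac_simps)
      then show ?thesis by simp
    qed
  qed
qed

theorem Gam_clustering:
  assumes len: "length a1 = m" "length b1 = m" "length a2 = n" "length b2 = n" "m + n \<le> N"
    and D: "4 * p \<le> D"
    and bnd: "\<And>x. x \<in> set (a1 @ b1 @ a2 @ b2) \<Longrightarrow> x < p * N"
    and sep: "\<And>x y. x \<in> set (a1 @ b1) \<Longrightarrow> y \<in> set (a2 @ b2) \<Longrightarrow> x + D \<le> y \<or> y + D \<le> x"
  shows "\<bar>Gam N (a1 @ a2) (b1 @ b2) * C N - Gam N a1 b1 * Gam N a2 b2\<bar>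
    \<le> real (4 * (m + n)) * eps (m + n) (D div (4 * p)) * (C N)\<^sup>2"
proof -
  obtain s :: real where s: "s = 1 \<or> s = -1"
    "Gam N (a1 @ a2) (b1 @ b2) = s * Gam N (sort a1 @ sort a2) (sort b1 @ sort b2)"
    "Gam N a1 b1 * Gam N a2 b2 = s * (Gam N (sort a1) (sort b1) * Gam N (sort a2) (sort b2))"
    using Gam_sort len by metis
  have "\<bar>Gam N (a1 @ a2) (b1 @ b2) * C N - Gam N a1 b1 * Gam N a2 b2\<bar>
     = \<bar>s\<bar> * \<bar>Gam N (sort a1 @ sort a2) (sort b1 @ sort b2) * C N - Gam N (sort a1) (sort b1) * Gam N (sort a2) (sort b2)\<bar>"
    unfolding s(2,3) abs_mult[symmetric] by (simp add: algebra_simps)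
  also have "\<bar>s\<bar> = 1" using s(1) by auto
  also have "\<bar>Gam N (sort a1 @ sort a2) (sort b1 @ sort b2) * C N - Gam N (sort a1) (sort b1) * Gam N (sort a2) (sort b2)\<bar>
     \<le> real (2 * (m + n)) * (2 * eps (m + n) (D div (4 * p)) * (C N)\<^sup>2)"
    by (rule PP_chain) (use len D bnd sep in auto)
  finally show ?thesis by (simp add: algebra_simps)
qed

end

section \<open>Orbitals on the cylinder\<close>

lemma lborel_complex_distr:
  "(lborel :: complex measure) = distr (lborel \<Otimes>\<^sub>M lborel) borel (\<lambda>(x, y). Complex x y)"
proof (rule lborel_eqI)
  have m: "(\<lambda>(x, y). Complex x y) \<in> borel_measurable (lborel \<Otimes>\<^sub>M lborel)"
    unfolding Complex_eq split_def by measurable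
  fix a b :: complex assume ab: "\<And>c. c \<in> Basis \<Longrightarrow> a \<bullet> c \<le> b \<bullet> c"
  have le: "Re a \<le> Re b" "Im a \<le> Im b" using ab[of 1] ab[of \<i>] by (auto simp: Basis_complex_def)
  have "(\<lambda>(x, y). Complex x y) -` box a b \<inter> space (lborel \<Otimes>\<^sub>M lborel) = {Re a<..<Re b} \<times> {Im a<..<Im b}"
    by (auto simp: box_def Basis_complex_def space_pair_measure)
  then have "emeasure (distr (lborel \<Otimes>\<^sub>M lborel) borel (\<lambda>(x, y). Complex x y)) (box a b)
    = emeasure (lborel \<Otimes>\<^sub>M lborel) ({Re a<..<Re b} \<times> {Im a<..<Im b})"
    using m by (subst emeasure_distr) auto
  also have "\<dots> = ennreal (Re b - Re a) * ennreal (Im b - Im a)"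
    using le by (subst lborel.emeasure_pair_measure_Times) auto
  also have "\<dots> = ennreal (\<Prod>c\<in>Basis. (b - a) \<bullet> c)"
    using le by (simp add: Basis_complex_def ennreal_mult'')
  finally show "emeasure (distr (lborel \<Otimes>\<^sub>M lborel) borel (\<lambda>(x, y). Complex x y)) (box a b) = (\<Prod>c\<in>Basis. (b - a) \<bullet> c)" .
qed simp

lemma Complex_measurable [measurable]: "(\<lambda>(x, y). Complex x y) \<in> borel_measurable (lborel \<Otimes>\<^sub>M lborel)"
  unfolding Complex_eq split_def by measurable

lemma cnj_measurable [measurable]: "cnj \<in> borel_measurable borel"
  by (intro borel_measurable_continuous_onI continuous_intros)

lemma cyl_sets [measurable]: "cyl R \<in> sets borel"
proof -
  have "cyl R = {z. 0 \<le> Im z} \<inter> {z. Im z \<le> 2 * pi * R}" by (auto simp: cyl_def)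
  also have "closed \<dots>" by (intro closed_Int closed_Collect_le continuous_intros)
  finally show ?thesis by simp
qed

lemma nn_integral_cylM:
  assumes f [measurable]: "f \<in> borel_measurable borel"
  shows "(\<integral>\<^sup>+z. f z \<partial>cylM R) = (\<integral>\<^sup>+x. \<integral>\<^sup>+y. f (Complex x y) * indicator {0..2 * pi * R} y \<partial>lborel \<partial>lborel)"
proof -
  have "(\<integral>\<^sup>+z. f z \<partial>cylM R) = (\<integral>\<^sup>+z. f z * indicator (cyl R) z \<partial>lborel)"
    unfolding cylM_def by (subst nn_integral_restrict_space) auto
  also have "\<dots> = (\<integral>\<^sup>+xy. f (Complex (fst xy) (snd xy)) * indicator (cyl R) (Complex (fst xy) (snd xy)) \<partial>(lborel \<Otimes>\<^sub>M lborel))"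
    by (subst lborel_complex_distr, subst nn_integral_distr) (auto simp: split_def)
  also have "\<dots> = (\<integral>\<^sup>+x. \<integral>\<^sup>+y. f (Complex x y) * indicator (cyl R) (Complex x y) \<partial>lborel \<partial>lborel)"
    using Complex_measurable
    by (subst lborel.nn_integral_fst[symmetric]) (auto simp: split_def)
  also have "\<dots> = (\<integral>\<^sup>+x. \<integral>\<^sup>+y. f (Complex x y) * indicator {0..2 * pi * R} y \<partial>lborel \<partial>lborel)"
    by (intro nn_integral_cong) (auto simp: cyl_def indicator_def)
  finally show ?thesis .
qed

lemma integral_cylM:
  fixes f :: "complex \<Rightarrow> complex"
  assumes f: "integrable (cylM R) f"
  shows "(\<integral>z. f z \<partial>cylM R) = (\<integral>x. \<integral>y. indicator {0..2 * pi * R} y *\<^sub>R f (Complex x y) \<partial>lborel \<partial>lborel)"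
proof -
  let ?h = "\<lambda>z. indicator (cyl R) z *\<^sub>R f z"
  have i: "integrable lborel ?h"
    using f unfolding cylM_def by (subst (asm) integrable_restrict_space) auto
  then have [measurable]: "?h \<in> borel_measurable borel" by simp
  have i2: "integrable (lborel \<Otimes>\<^sub>M lborel) (\<lambda>(x, y). ?h (Complex x y))"
    using i by (subst (asm) lborel_complex_distr, subst (asm) integrable_distr_eq) (auto simp: split_def)
  have "(\<integral>z. f z \<partial>cylM R) = (\<integral>z. ?h z \<partial>lborel)"
    unfolding cylM_def by (subst integral_restrict_space) auto
  also have "\<dots> = (\<integral>xy. (case xy of (x, y) \<Rightarrow> ?h (Complex x y)) \<partial>(lborel \<Otimes>\<^sub>M lborel))"
    by (subst lborel_complex_distr, subst integral_distr) (auto simp: split_def)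
  also have "\<dots> = (\<integral>x. \<integral>y. ?h (Complex x y) \<partial>lborel \<partial>lborel)"
    using lborel_pair.integral_fst'[OF i2] by simp
  also have "\<dots> = (\<integral>x. \<integral>y. indicator {0..2 * pi * R} y *\<^sub>R f (Complex x y) \<partial>lborel \<partial>lborel)"
    by (intro Bochner_Integration.integral_cong refl) (auto simp: cyl_def indicator_def)
  finally show ?thesis .
qed

lemma prod_nth_list:
  fixes f :: "'a \<Rightarrow> 'b::comm_monoid_mult"
  shows "(\<Prod>j<length xs. f (xs ! j)) = (\<Prod>x\<leftarrow>xs. f x)"
  by (induction xs) (simp_all add: prod.lessThan_Suc_shift del: prod.lessThan_Suc)

lemma sigma_finite_cylM: "sigma_finite_measure (cylM R)"
  unfolding cylM_def by (intro sigma_finite_measure_restrict_space lborel.sigma_finite_measure_axioms) auto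

lemma sets_cylM_borel: "f \<in> borel_measurable borel \<Longrightarrow> f \<in> borel_measurable (cylM R)"
  unfolding cylM_def by (intro measurable_restrict_space1) simp

lemma has_bochner_integral_cis:
  assumes R: "R > 0" and q: "q \<noteq> (0 :: int)"
  shows "(\<integral>y. indicator {0..2 * pi * R} y *\<^sub>R cis (of_int q * y / R) \<partial>lborel) = 0"
proof -
  let ?F = "\<lambda>y. cis (of_int q * y / R) * (complex_of_real R / (\<i> * of_int q))"
  have "(\<integral>y. indicator {0..2 * pi * R} y *\<^sub>R cis (of_int q * y / R) \<partial>lborel) = ?F (2 * pi * R) - ?F 0"
  proof (rule integral_FTC_Icc)
    show "0 \<le> 2 * pi * R" using R by simp
    fix y assume "0 \<le> y" "y \<le> 2 * pi * R"
    have "((\<lambda>y. exp (\<i> * complex_of_real (of_int q * y / R)) * (complex_of_real R / (\<i> * of_int q)))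
        has_vector_derivative exp (\<i> * complex_of_real (of_int q * y / R))) (at y within {0..2 * pi * R})"
      using R q by (auto intro!: derivative_eq_intros has_vector_derivative_real_field simp: field_simps)
    then show "(?F has_vector_derivative cis (of_int q * y / R)) (at y within {0..2 * pi * R})"
      by (simp add: cis_conv_exp)
  next
    show "continuous_on {0..2 * pi * R} (\<lambda>y. cis (of_int q * y / R))"
      by (intro continuous_intros) (use R in auto)
  qed
  also have "cis (of_int q * (2 * pi * R) / R) = cis (2 * pi * of_int q)" using R by (simp add: field_simps)
  also have "\<dots> = 1" using cis_multiple_2pi[of "of_int q"] by simp
  finally show ?thesis by simp
qed

locale cylinder =
  fixes R l :: real and p :: nat
  assumes R_pos: "R > 0" and l_pos: "l > 0" and p_ge: "p \<ge> 1"
begin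

sublocale discrete p "l\<^sup>2 / R\<^sup>2"
  by unfold_locales (use p_ge in simp)

sublocale product_sigma_finite "\<lambda>_. cylM R"
  by (simp add: product_sigma_finite_def sigma_finite_cylM)

definition phi :: "nat \<Rightarrow> complex \<Rightarrow> complex" where
  "phi k z = exp (z / of_real R) ^ k * of_real (exp (- (Re z)\<^sup>2 / (2 * l\<^sup>2)))"

definition nu0 :: real where "nu0 = 2 * pi * R * (l * sqrt pi)"

text \<open>The squared norm of \<open>phi k\<close>: \<open>nu0\<close> collects the circumference
  and the Gaussian integral, and the exponential is what completing the square leaves
  behind.\<close>

definition nu :: "nat \<Rightarrow> real" where "nu k = nu0 * exp (l\<^sup>2 / R\<^sup>2 * (real k)\<^sup>2)"

lemma nu0_pos: "nu0 > 0" using R_pos l_pos by (simp add: nu0_def)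

lemma nu_pos: "nu k > 0" using nu0_pos by (simp add: nu_def)

lemma phi_measurable [measurable]: "phi k \<in> borel_measurable borel"
  unfolding phi_def by measurable

lemma gauss_integral:
  "integrable lborel (\<lambda>x. exp (q * x / R - x\<^sup>2 / l\<^sup>2))"
  "(\<integral>x. exp (q * x / R - x\<^sup>2 / l\<^sup>2) \<partial>lborel) = l * sqrt pi * exp (l\<^sup>2 / R\<^sup>2 * (q / 2)\<^sup>2)"
proof -
  let ?m = "q * l\<^sup>2 / (2 * R)" and ?s = "l / sqrt 2"
  have s: "?s > 0" using l_pos by simp
  have eq: "exp (q * x / R - x\<^sup>2 / l\<^sup>2) = (l * sqrt pi * exp (l\<^sup>2 / R\<^sup>2 * (q / 2)\<^sup>2)) * normal_density ?m ?s x" for x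
  proof -
    have "q * x / R - x\<^sup>2 / l\<^sup>2 = l\<^sup>2 / R\<^sup>2 * (q / 2)\<^sup>2 - (x - ?m)\<^sup>2 / l\<^sup>2"
      using R_pos l_pos by (simp add: field_simps power2_eq_square)
    moreover have "normal_density ?m ?s x = 1 / (l * sqrt pi) * exp (- (x - ?m)\<^sup>2 / l\<^sup>2)"
      using l_pos by (simp add: normal_density_def power_divide real_sqrt_mult)
    moreover have "exp (u - v) = (c * exp u) * (1 / c * exp (- v))" if "c \<noteq> 0" for u v c :: real
      using that by (simp add: exp_diff exp_minus field_simps)
    ultimately show ?thesis using l_pos by (metis minus_divide_left mult_eq_0_iff order_less_irrefl pi_gt_zero real_sqrt_eq_zero_cancel_iff)
  qed
  show "integrable lborel (\<lambda>x. exp (q * x / R - x\<^sup>2 / l\<^sup>2))"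
    unfolding eq by (intro integrable_mult_right integrable_normal_density s)
  show "(\<integral>x. exp (q * x / R - x\<^sup>2 / l\<^sup>2) \<partial>lborel) = l * sqrt pi * exp (l\<^sup>2 / R\<^sup>2 * (q / 2)\<^sup>2)"
    unfolding eq integral_mult_right_zero integral_normal_density[OF s] by simp
qed

lemma nn_integral_cylM_Re:
  assumes [measurable]: "f \<in> borel_measurable borel"
  shows "(\<integral>\<^sup>+z. f (Re z) \<partial>cylM R) = ennreal (2 * pi * R) * (\<integral>\<^sup>+x. f x \<partial>lborel)"
proof -
  have "(\<integral>\<^sup>+z. f (Re z) \<partial>cylM R) = (\<integral>\<^sup>+x. \<integral>\<^sup>+y. f x * indicator {0..2 * pi * R} y \<partial>lborel \<partial>lborel)"
    by (subst nn_integral_cylM) auto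
  also have "\<dots> = (\<integral>\<^sup>+x. f x * ennreal (2 * pi * R) \<partial>lborel)"
    using R_pos by (intro nn_integral_cong) (simp add: nn_integral_cmult_indicator)
  finally show ?thesis by (simp add: nn_integral_multc mult.commute)
qed

lemma phi_Complex:
  "phi k (Complex x y) * cnj (phi j (Complex x y))
    = of_real (exp (real (k + j) * x / R - x\<^sup>2 / l\<^sup>2)) * cis (of_int (int k - int j) * y / R)"
proof -
  have e: "exp (Complex x y / of_real R) = of_real (exp (x / R)) * cis (y / R)"
    using R_pos by (simp add: exp_eq_polar Complex_eq add_divide_distrib)
  have "phi k (Complex x y) * cnj (phi j (Complex x y))
     = of_real (exp (x / R) ^ (k + j) * exp (- x\<^sup>2 / (2 * l\<^sup>2)) * exp (- x\<^sup>2 / (2 * l\<^sup>2))) * (cis (y / R) ^ k * cnj (cis (y / R)) ^ j)"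
    unfolding phi_def e by (simp add: power_mult_distrib power_add)
  also have "cis (y / R) ^ k * cnj (cis (y / R)) ^ j = cis (of_int (int k - int j) * y / R)"
    by (simp add: Complex.DeMoivre cis_cnj cis_mult cis_divide algebra_simps diff_divide_distrib)
  also have "exp (x / R) ^ (k + j) * exp (- x\<^sup>2 / (2 * l\<^sup>2)) * exp (- x\<^sup>2 / (2 * l\<^sup>2)) = exp (real (k + j) * x / R - x\<^sup>2 / l\<^sup>2)"
  proof -
    have "exp (x / R) ^ (k + j) = exp (real (k + j) * (x / R))" by (rule exp_of_nat_mult[symmetric])
    moreover have "- x\<^sup>2 / (2 * l\<^sup>2) + - x\<^sup>2 / (2 * l\<^sup>2) = - (x\<^sup>2 / l\<^sup>2)" by (simp add: field_simps)
    ultimately show ?thesis by (simp add: mult.assoc exp_add[symmetric] del: exp_of_nat_mult)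
  qed
  finally show ?thesis .
qed

lemma integrable_phi: "integrable (cylM R) (\<lambda>z. phi k z * cnj (phi j z))"
proof (rule integrableI_bounded)
  show "(\<lambda>z. phi k z * cnj (phi j z)) \<in> borel_measurable (cylM R)"
    by (intro sets_cylM_borel) measurable
  have n: "norm (phi k z * cnj (phi j z)) = exp (real (k + j) * Re z / R - (Re z)\<^sup>2 / l\<^sup>2)" for z
    using phi_Complex[of k "Re z" "Im z" j] by (simp add: norm_mult)
  have "(\<integral>\<^sup>+z. norm (phi k z * cnj (phi j z)) \<partial>cylM R) = ennreal (2 * pi * R) * (\<integral>\<^sup>+x. exp (real (k + j) * x / R - x\<^sup>2 / l\<^sup>2) \<partial>lborel)"
    unfolding n by (subst nn_integral_cylM_Re[symmetric]) auto
  also have "\<dots> < \<infinity>"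
    by (subst nn_integral_eq_integral[OF gauss_integral(1)]) (auto intro: ennreal_mult_less_top[THEN iffD2])
  finally show "(\<integral>\<^sup>+z. norm (phi k z * cnj (phi j z)) \<partial>cylM R) < \<infinity>" .
qed

lemma integral_phi: "(\<integral>z. phi k z * cnj (phi j z) \<partial>cylM R) = (if k = j then of_real (nu k) else 0)"
proof -
  have "(\<integral>z. phi k z * cnj (phi j z) \<partial>cylM R)
     = (\<integral>x. \<integral>y. indicator {0..2 * pi * R} y *\<^sub>R (of_real (exp (real (k + j) * x / R - x\<^sup>2 / l\<^sup>2)) * cis (of_int (int k - int j) * y / R)) \<partial>lborel \<partial>lborel)"
    by (subst integral_cylM[OF integrable_phi]) (simp only: phi_Complex)
  also have "\<dots> = (\<integral>x. of_real (exp (real (k + j) * x / R - x\<^sup>2 / l\<^sup>2)) * (\<integral>y. indicator {0..2 * pi * R} y *\<^sub>R cis (of_int (int k - int j) * y / R) \<partial>lborel) \<partial>lborel)"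
    by (simp only: mult_scaleR_right[symmetric] integral_mult_right_zero)
  also have "\<dots> = (if k = j then of_real (nu k) else 0)"
  proof (cases "k = j")
    case True
    then have "(\<integral>y. indicator {0..2 * pi * R} y *\<^sub>R cis (of_int (int k - int j) * y / R) \<partial>lborel) = of_real (2 * pi * R)"
      using R_pos by (simp add: scaleR_conv_of_real)
    moreover have "(\<integral>x. complex_of_real (exp (real (k + j) * x / R - x\<^sup>2 / l\<^sup>2)) \<partial>lborel) = of_real (l * sqrt pi * exp (l\<^sup>2 / R\<^sup>2 * (real k)\<^sup>2))"
      using gauss_integral(2)[of "real (k + j)"] True by (simp add: integral_complex_of_real del: of_real_exp)
    ultimately show ?thesis using True by (simp add: nu_def nu0_def)
  next
    case False
    then show ?thesis using has_bochner_integral_cis[OF R_pos, of "int k - int j"] by simp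
  qed
  finally show ?thesis .
qed

section \<open>Integrals over many particles as sums over orbital lists\<close>

abbreviation orb_sum :: "nat list set \<Rightarrow> nat \<Rightarrow> nat \<Rightarrow> nat \<Rightarrow> (nat list \<Rightarrow> complex) \<Rightarrow> (nat \<Rightarrow> complex) \<Rightarrow> complex" where
  "orb_sum S n i0 s c u \<equiv> (\<Sum>xs\<in>S. c xs * (\<Prod>j<n. phi (xs ! j + s) (u (i0 + j))))"

text \<open>The offset \<open>i0\<close> of the variables and the shift \<open>s\<close> of the
  exponents are there for the right-hand stretch of a cut chain: in \<open>boltz_factor\<close> the
  \<open>hi\<close> particles to its left act on it like \<open>p * hi\<close> additional powers of
  \<open>exp (z / R)\<close>.\<close>

lemma parseval:
  assumes "finite S"
  shows "has_bochner_integral (\<Pi>\<^sub>M i\<in>{i0..<i0 + n}. cylM R)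
      (\<lambda>u. orb_sum S n i0 s c u * cnj (orb_sum S n i0 s d u))
      (\<Sum>xs\<in>S. \<Sum>ys\<in>S. c xs * cnj (d ys) * (\<Prod>j<n. if xs ! j = ys ! j then of_real (nu (xs ! j + s)) else 0))"
proof -
  let ?M = "\<Pi>\<^sub>M i\<in>{i0..<i0 + n}. cylM R"
  have one: "has_bochner_integral ?M (\<lambda>u. \<Prod>j<n. phi (xs ! j + s) (u (i0 + j)) * cnj (phi (ys ! j + s) (u (i0 + j))))
      (\<Prod>j<n. if xs ! j = ys ! j then of_real (nu (xs ! j + s)) else 0)" for xs ys
  proof -
    let ?f = "\<lambda>i z. phi (xs ! (i - i0) + s) z * cnj (phi (ys ! (i - i0) + s) z)"
    have sh: "(\<Prod>j<n. h (i0 + j)) = (\<Prod>i\<in>{i0..<i0 + n}. h i)" for h :: "nat \<Rightarrow> complex"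
      using prod.shift_bounds_nat_ivl[of h 0 i0 n] by (simp add: atLeast0LessThan add.commute)
    have "(\<lambda>u. \<Prod>j<n. phi (xs ! j + s) (u (i0 + j)) * cnj (phi (ys ! j + s) (u (i0 + j))))
       = (\<lambda>u. \<Prod>i\<in>{i0..<i0 + n}. ?f i (u i))"
      by (subst sh[symmetric]) simp
    moreover have "(\<integral>u. (\<Prod>i\<in>{i0..<i0 + n}. ?f i (u i)) \<partial>?M) = (\<Prod>i\<in>{i0..<i0 + n}. \<integral>z. ?f i z \<partial>cylM R)"
      by (rule product_integral_prod) (auto intro: integrable_phi)
    moreover have "\<dots> = (\<Prod>j<n. if xs ! j = ys ! j then of_real (nu (xs ! j + s)) else 0)"
      unfolding integral_phi by (subst sh[symmetric]) (simp cong: if_cong)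
    moreover have "integrable ?M (\<lambda>u. \<Prod>i\<in>{i0..<i0 + n}. ?f i (u i))"
      by (rule product_integrable_prod) (auto intro: integrable_phi)
    ultimately show ?thesis by (simp add: has_bochner_integral_iff)
  qed
  have "orb_sum S n i0 s c u * cnj (orb_sum S n i0 s d u)
    = (\<Sum>xs\<in>S. \<Sum>ys\<in>S. c xs * cnj (d ys) * (\<Prod>j<n. phi (xs ! j + s) (u (i0 + j)) * cnj (phi (ys ! j + s) (u (i0 + j)))))" for u
    by (simp add: sum_product prod.distrib ac_simps)
  then show ?thesis
    by (simp only:) (intro has_bochner_integral_sum has_bochner_integral_mult_right one)
qed

lemma parseval_orbs:
  assumes "S = orbs p N n"
  shows "has_bochner_integral (\<Pi>\<^sub>M i\<in>{i0..<i0 + n}. cylM R)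
      (\<lambda>u. orb_sum S n i0 s c u * cnj (orb_sum S n i0 s d u))
      (\<Sum>xs\<in>S. c xs * cnj (d xs) * (\<Prod>j<n. of_real (nu (xs ! j + s))))"
proof -
  have fin: "finite S" by (simp add: assms)
  have "(\<Sum>ys\<in>S. c xs * cnj (d ys) * (\<Prod>j<n. if xs ! j = ys ! j then of_real (nu (xs ! j + s)) else 0))
     = c xs * cnj (d xs) * (\<Prod>j<n. of_real (nu (xs ! j + s)))" if xs: "xs \<in> S" for xs
  proof -
    have *: "(\<Prod>j<n. if xs ! j = ys ! j then complex_of_real (nu (xs ! j + s)) else 0) = 0" if ys: "ys \<in> S - {xs}" for ys
    proof -
      have "length xs = n" "length ys = n" "xs \<noteq> ys" using xs ys by (auto simp: assms orbs_def)
      then obtain j where "j < n" "xs ! j \<noteq> ys ! j" by (metis nth_equalityI)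
      then show ?thesis by (intro prod_zero) auto
    qed
    have "(\<Sum>ys\<in>S - {xs}. c xs * cnj (d ys) * (\<Prod>j<n. if xs ! j = ys ! j then of_real (nu (xs ! j + s)) else 0)) = 0"
      by (intro sum.neutral ballI) (simp only: * mult_zero_right)
    then show ?thesis
      using fin xs by (subst sum.remove[of S xs]) auto
  qed
  with parseval[OF fin, where ?i0.0 = i0 and n = n and s = s and c = c and d = d] show ?thesis by simp
qed

lemma laughlin_orb_sum:
  "laughlin R l p \<kappa> N w = of_real (\<kappa> N) * (\<Sum>xs\<in>orbs p N N. of_real (amp p xs) * (\<Prod>v<N. phi (xs ! v) (w v)))"
proof -
  have e: "complex_of_real (exp (- (1 / (2 * l\<^sup>2)) * (\<Sum>k<N. (Re (w k))\<^sup>2))) = (\<Prod>v<N. of_real (exp (- (Re (w v))\<^sup>2 / (2 * l\<^sup>2))))"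
    by (simp add: exp_sum[symmetric] sum_distrib_left sum_negf sum_divide_distrib flip: of_real_prod)
  show ?thesis
    unfolding laughlin_def e vandermonde_expansion[OF p_pos, of "\<lambda>k. exp (w k / of_real R)" N] phi_def
    by (simp add: prod.distrib sum_distrib_left sum_distrib_right mult.assoc)
qed

lemma sum_orbs_mset:
  assumes "\<And>xs ys. mset xs = mset ys \<Longrightarrow> F xs = (F ys :: real)" "k \<le> N"
  shows "(\<Sum>xs\<in>orbs p N (N - k). F xs) = fact (N - k) * (\<Sum>h\<in>bgs N k. F (sorted_list_of_multiset h) / mfac h)"
proof -
  have "(\<Sum>xs\<in>orbs p N (N - k). F xs) = (\<Sum>h\<in>bgs N k. \<Sum>xs | xs \<in> orbs p N (N - k) \<and> mset xs = h. F xs)"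
    by (rule sum.group[symmetric, OF finite_orbs finite_bgs]) (auto simp: orbs_def bgs_def)
  also have "\<dots> = (\<Sum>h\<in>bgs N k. fact (N - k) * (F (sorted_list_of_multiset h) / mfac h))"
  proof (rule sum.cong[OF refl])
    fix h assume h: "h \<in> bgs N k"
    have "{xs \<in> orbs p N (N - k). mset xs = h} = permutations_of_multiset h"
      using h by (auto simp: orbs_def bgs_def permutations_of_multiset_def)
    then have "(\<Sum>xs | xs \<in> orbs p N (N - k) \<and> mset xs = h. F xs) = (\<Sum>xs\<in>permutations_of_multiset h. F (sorted_list_of_multiset h))"
      by (intro sum.cong) (auto intro!: assms(1) simp: permutations_of_multiset_def)
    also have "\<dots> = real (card (permutations_of_multiset h)) * F (sorted_list_of_multiset h)" by simp
    also have "real (card (permutations_of_multiset h)) = fact (N - k) / mfac h"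
    proof -
      have "real (card (permutations_of_multiset h) * (\<Prod>x\<in>set_mset h. fact (count h x))) = real (fact (size h))"
        by (simp only: card_permutations_of_multiset_aux)
      then have "real (card (permutations_of_multiset h)) * mfac h = fact (N - k)"
        using h by (simp add: mfac_def bgs_def)
      then show ?thesis by (simp add: field_simps)
    qed
    finally show "(\<Sum>xs | xs \<in> orbs p N (N - k) \<and> mset xs = h. F xs) = fact (N - k) * (F (sorted_list_of_multiset h) / mfac h)"
      by simp
  qed
  finally show ?thesis by (simp add: sum_distrib_left)
qed

lemma prod_nu: "(\<Prod>j<length xs. nu (xs ! j)) = nu0 ^ length xs * exp (l\<^sup>2 / R\<^sup>2 * en xs)"
proof -
  have "(\<Prod>j<length xs. nu (xs ! j)) = (\<Prod>x\<leftarrow>xs. nu x)"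
    by (rule prod_nth_list)
  also have "\<dots> = nu0 ^ length xs * exp (l\<^sup>2 / R\<^sup>2 * en xs)"
    by (induction xs) (auto simp: nu_def en_def distrib_left exp_add)
  finally show ?thesis .
qed

text \<open>The norms of the hidden orbitals turn \<open>amp\<close> into \<open>lamp\<close>. The
  norms of the listed orbitals are missing, hence the two negative exponentials; they cancel in
  \<open>corr_orbital_sum\<close> when \<open>phi\<close> is replaced by the normalised
  \<open>psi\<close>.\<close>

lemma layers_sum:
  assumes "length as = k" "length bs = k" "k \<le> N"
  shows "(\<Sum>hs\<in>orbs p N (N - k). amp p (as @ hs) * amp p (bs @ hs) * (\<Prod>j<N - k. nu (hs ! j)))
    = nu0 ^ (N - k) * exp (l\<^sup>2 / R\<^sup>2 * e0 N) * exp (- (l\<^sup>2 / R\<^sup>2 / 2 * en as)) * exp (- (l\<^sup>2 / R\<^sup>2 / 2 * en bs)) * (fact (N - k) * Gam N as bs)"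
proof -
  have "amp p (as @ hs) * amp p (bs @ hs) * (\<Prod>j<N - k. nu (hs ! j))
     = nu0 ^ (N - k) * exp (l\<^sup>2 / R\<^sup>2 * e0 N) * exp (- (l\<^sup>2 / R\<^sup>2 / 2 * en as)) * exp (- (l\<^sup>2 / R\<^sup>2 / 2 * en bs))
       * (lamp (as @ hs) * lamp (bs @ hs))" if "hs \<in> orbs p N (N - k)" for hs
  proof -
    have lh: "length hs = N - k" using that by (simp add: orbs_def)
    have len: "length (as @ hs) = N" "length (bs @ hs) = N" using lh assms by auto
    have a1: "amp p (as @ hs) = lamp (as @ hs) * exp (- (l\<^sup>2 / R\<^sup>2 / 2 * (en as + en hs - e0 N)))"
      and a2: "amp p (bs @ hs) = lamp (bs @ hs) * exp (- (l\<^sup>2 / R\<^sup>2 / 2 * (en bs + en hs - e0 N)))"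
      unfolding lamp_def len by (simp_all flip: exp_add)
    have e: "exp (- (G / 2 * (A + H - E))) * exp (- (G / 2 * (B + H - E))) * exp (G * H)
        = exp (G * E) * exp (- (G / 2 * A)) * exp (- (G / 2 * B))" for G A B H E :: real
      by (simp add: field_simps flip: exp_add)
    have pn: "(\<Prod>j<N - k. nu (hs ! j)) = nu0 ^ (N - k) * exp (l\<^sup>2 / R\<^sup>2 * en hs)"
      using prod_nu[of hs] unfolding lh .
    have "amp p (as @ hs) * amp p (bs @ hs) * (\<Prod>j<N - k. nu (hs ! j))
      = nu0 ^ (N - k) * (lamp (as @ hs) * lamp (bs @ hs)) *
       (exp (- (l\<^sup>2 / R\<^sup>2 / 2 * (en as + en hs - e0 N))) * exp (- (l\<^sup>2 / R\<^sup>2 / 2 * (en bs + en hs - e0 N))) * exp (l\<^sup>2 / R\<^sup>2 * en hs))"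
      unfolding a1 a2 pn by (simp only: ac_simps)
    then show ?thesis unfolding e by (simp only: ac_simps)
  qed
  then have "(\<Sum>hs\<in>orbs p N (N - k). amp p (as @ hs) * amp p (bs @ hs) * (\<Prod>j<N - k. nu (hs ! j)))
     = nu0 ^ (N - k) * exp (l\<^sup>2 / R\<^sup>2 * e0 N) * exp (- (l\<^sup>2 / R\<^sup>2 / 2 * en as)) * exp (- (l\<^sup>2 / R\<^sup>2 / 2 * en bs))
       * (\<Sum>hs\<in>orbs p N (N - k). lamp (as @ hs) * lamp (bs @ hs))"
    by (simp add: sum_distrib_left)
  also have "(\<Sum>hs\<in>orbs p N (N - k). lamp (as @ hs) * lamp (bs @ hs)) = fact (N - k) * Gam N as bs"
  proof -
    have "lamp (as @ xs) * lamp (bs @ xs) = lamp (as @ ys) * lamp (bs @ ys)" if eq: "mset xs = mset ys" for xs ys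
    proof -
      obtain s :: real where s: "s = 1 \<or> s = -1" "\<And>pre rest. lamp (pre @ xs @ rest) = s * lamp (pre @ ys @ rest)"
        using lamp_permute[OF eq] by metis
      show ?thesis using s(1) s(2)[of as "[]"] s(2)[of bs "[]"] by auto
    qed
    from sum_orbs_mset[where F = "\<lambda>hs. lamp (as @ hs) * lamp (bs @ hs)", OF this assms(3)]
    show ?thesis using assms by (simp add: Gam_def layer_def)
  qed
  finally show ?thesis .
qed

lemma laughlin_norm2_eq:
  "laughlin_norm2 R l p \<kappa> N = (\<kappa> N)\<^sup>2 * (nu0 ^ N * exp (l\<^sup>2 / R\<^sup>2 * e0 N) * (fact N * Gam N [] []))"
proof -
  have h: "has_bochner_integral (\<Pi>\<^sub>M i\<in>{..<N}. cylM R)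
      (\<lambda>u. orb_sum (orbs p N N) N 0 0 (\<lambda>xs. of_real (amp p xs)) u * cnj (orb_sum (orbs p N N) N 0 0 (\<lambda>xs. of_real (amp p xs)) u))
      (\<Sum>xs\<in>orbs p N N. of_real (amp p xs) * cnj (of_real (amp p xs)) * (\<Prod>j<N. of_real (nu (xs ! j))))"
    using parseval_orbs[OF refl, where N = N and n = N and ?i0.0 = 0 and s = 0 and c = "\<lambda>xs. of_real (amp p xs)" and d = "\<lambda>xs. of_real (amp p xs)"]
    by (simp add: atLeast0LessThan)
  have "complex_of_real (laughlin_norm2 R l p \<kappa> N)
     = (\<integral>w. complex_of_real ((cmod (laughlin R l p \<kappa> N w))\<^sup>2) \<partial>(\<Pi>\<^sub>M i\<in>{..<N}. cylM R))"
    unfolding laughlin_norm2_def by (rule integral_complex_of_real[symmetric])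
  also have "\<dots> = (\<integral>w. of_real ((\<kappa> N)\<^sup>2) * (orb_sum (orbs p N N) N 0 0 (\<lambda>xs. of_real (amp p xs)) w * cnj (orb_sum (orbs p N N) N 0 0 (\<lambda>xs. of_real (amp p xs)) w)) \<partial>(\<Pi>\<^sub>M i\<in>{..<N}. cylM R))"
    unfolding complex_norm_square laughlin_orb_sum by (simp add: power2_eq_square ac_simps)
  also have "\<dots> = of_real ((\<kappa> N)\<^sup>2) * (\<Sum>xs\<in>orbs p N N. of_real (amp p xs) * cnj (of_real (amp p xs)) * (\<Prod>j<N. of_real (nu (xs ! j))))"
    using has_bochner_integral_integral_eq[OF h] by simp
  also have "\<dots> = of_real ((\<kappa> N)\<^sup>2 * (\<Sum>xs\<in>orbs p N N. amp p xs * amp p xs * (\<Prod>j<N. nu (xs ! j))))"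
    by simp
  also have "(\<Sum>xs\<in>orbs p N N. amp p xs * amp p xs * (\<Prod>j<N. nu (xs ! j))) = nu0 ^ N * exp (l\<^sup>2 / R\<^sup>2 * e0 N) * (fact N * Gam N [] [])"
    using layers_sum[of "[]" 0 "[]" N] by (simp add: en_def)
  finally show ?thesis by (simp only: of_real_eq_iff)
qed

lemma orbs_append:
  assumes "k \<le> n"
  shows "(\<Sum>xs\<in>orbs p N n. f xs) = (\<Sum>as\<in>orbs p N k. \<Sum>hs\<in>orbs p N (n - k). f (as @ hs))"
  unfolding sum.cartesian_product
proof (rule sum.reindex_bij_witness[where i = "\<lambda>(as, hs). as @ hs" and j = "\<lambda>xs. (take k xs, drop k xs)"])
  fix xs assume "xs \<in> orbs p N n"
  then show "(take k xs, drop k xs) \<in> orbs p N k \<times> orbs p N (n - k)"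
    using assms by (auto simp: orbs_def dest: in_set_takeD in_set_dropD)
qed (use assms in \<open>auto simp: orbs_def\<close>)

definition psi :: "nat \<Rightarrow> complex \<Rightarrow> complex" where "psi k z = phi k z / of_real (sqrt (nu k))"

lemma sqrt_nu: "sqrt (nu k) = sqrt nu0 * exp (l\<^sup>2 / R\<^sup>2 * (real k)\<^sup>2 / 2)"
proof -
  have "exp (l\<^sup>2 / R\<^sup>2 * (real k)\<^sup>2) = (exp (l\<^sup>2 / R\<^sup>2 * (real k)\<^sup>2 / 2))\<^sup>2"
    by (simp add: power2_eq_square flip: exp_add)
  then have "sqrt (exp (l\<^sup>2 / R\<^sup>2 * (real k)\<^sup>2)) = exp (l\<^sup>2 / R\<^sup>2 * (real k)\<^sup>2 / 2)"
    by (metis exp_ge_zero real_sqrt_unique)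
  then show ?thesis by (simp add: nu_def real_sqrt_mult)
qed

lemma prod_phi_psi:
  assumes "length as = k"
  shows "(\<Prod>i<k. phi (as ! i) (z i)) = of_real (sqrt nu0 ^ k * exp (l\<^sup>2 / R\<^sup>2 / 2 * en as)) * (\<Prod>i<k. psi (as ! i) (z i))"
proof -
  have "(\<Prod>x\<leftarrow>as. sqrt (nu x)) = sqrt nu0 ^ length as * exp (l\<^sup>2 / R\<^sup>2 / 2 * en as)"
    by (induction as) (auto simp: sqrt_nu en_def distrib_left exp_add)
  then have "(\<Prod>i<k. sqrt (nu (as ! i))) = sqrt nu0 ^ k * exp (l\<^sup>2 / R\<^sup>2 / 2 * en as)"
    using assms prod_nth_list[of "\<lambda>x. sqrt (nu x)" as] by simp
  then have "of_real (sqrt nu0 ^ k * exp (l\<^sup>2 / R\<^sup>2 / 2 * en as)) * (\<Prod>i<k. psi (as ! i) (z i))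
     = (\<Prod>i<k. of_real (sqrt (nu (as ! i))) * psi (as ! i) (z i))"
    by (simp add: prod.distrib flip: of_real_prod)
  also have "\<dots> = (\<Prod>i<k. phi (as ! i) (z i))"
    using nu_pos by (intro prod.cong) (auto simp: psi_def less_imp_neq[symmetric])
  finally show ?thesis by simp
qed

text \<open>Integrating out the hidden particles by orthogonality leaves the matrix
  \<open>Gam\<close>. The constant \<open>\<kappa> N\<close>, the Gaussian constants and the
  factorials of the orderings cancel against the norm, so apart from the range of the indices
  \<open>N\<close> enters only through \<open>Gam\<close>.\<close>

theorem corr_orbital_sum:
  assumes "\<kappa> N > 0" "k \<le> N"
  shows "corr R l p \<kappa> N k z z' = (\<Sum>as\<in>orbs p N k. \<Sum>bs\<in>orbs p N k.
    (\<Prod>i<k. psi (as ! i) (z i)) * cnj (\<Prod>i<k. psi (bs ! i) (z' i)) * of_real (Gam N as bs / Gam N [] []))"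
proof -
  let ?H = "orbs p N (N - k)"
  let ?c = "\<lambda>z hs. \<Sum>as\<in>orbs p N k. of_real (amp p (as @ hs)) * (\<Prod>i<k. phi (as ! i) (z i))"
  have L: "laughlin R l p \<kappa> N (\<lambda>j. if j < k then z j else u j) = of_real (\<kappa> N) * orb_sum ?H (N - k) k 0 (?c z) u" for z u
  proof -
    have "(\<Prod>v<N. phi ((as @ hs) ! v) (if v < k then z v else u v)) = (\<Prod>i<k. phi (as ! i) (z i)) * (\<Prod>j<N - k. phi (hs ! j + 0) (u (k + j)))"
      if "as \<in> orbs p N k" for as hs
    proof -
      have la: "length as = k" using that by (simp add: orbs_def)
      have "(\<Prod>v<N. phi ((as @ hs) ! v) (if v < k then z v else u v))
         = (\<Prod>v<k. phi ((as @ hs) ! v) (if v < k then z v else u v)) * (\<Prod>v\<in>{k..<N}. phi ((as @ hs) ! v) (if v < k then z v else u v))"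
        using assms(2) by (subst prod.union_disjoint[symmetric]) (auto intro: prod.cong)
      also have "(\<Prod>v<k. phi ((as @ hs) ! v) (if v < k then z v else u v)) = (\<Prod>i<k. phi (as ! i) (z i))"
        by (intro prod.cong) (auto simp: nth_append la)
      also have "(\<Prod>v\<in>{k..<N}. phi ((as @ hs) ! v) (if v < k then z v else u v)) = (\<Prod>j<N - k. phi (hs ! j + 0) (u (k + j)))"
        using prod.shift_bounds_nat_ivl[of "\<lambda>v. phi ((as @ hs) ! v) (if v < k then z v else u v)" 0 k "N - k"] assms(2)
        by (simp add: atLeast0LessThan nth_append la add.commute)
      finally show ?thesis .
    qed
    then show ?thesis
      unfolding laughlin_orb_sum orbs_append[OF assms(2)]
      by (subst sum.swap) (simp add: sum_distrib_right sum_distrib_left mult.assoc)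
  qed
  have hb: "has_bochner_integral (\<Pi>\<^sub>M i\<in>{k..<N}. cylM R) (\<lambda>u. orb_sum ?H (N - k) k 0 (?c z) u * cnj (orb_sum ?H (N - k) k 0 (?c z') u))
      (\<Sum>hs\<in>?H. ?c z hs * cnj (?c z' hs) * (\<Prod>j<N - k. of_real (nu (hs ! j))))"
    using parseval_orbs[OF refl, where N = N and n = "N - k" and ?i0.0 = k and s = 0 and c = "?c z" and d = "?c z'"] assms(2) by simp
  let ?E = "nu0 ^ (N - k) * exp (l\<^sup>2 / R\<^sup>2 * e0 N)"
  let ?e = "\<lambda>as. exp (- (l\<^sup>2 / R\<^sup>2 / 2 * en as))"
  have "(\<integral>u. laughlin R l p \<kappa> N (\<lambda>j. if j < k then z j else u j) * cnj (laughlin R l p \<kappa> N (\<lambda>j. if j < k then z' j else u j)) \<partial>(\<Pi>\<^sub>M i\<in>{k..<N}. cylM R))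
     = (\<integral>u. of_real ((\<kappa> N)\<^sup>2) * (orb_sum ?H (N - k) k 0 (?c z) u * cnj (orb_sum ?H (N - k) k 0 (?c z') u)) \<partial>(\<Pi>\<^sub>M i\<in>{k..<N}. cylM R))"
    unfolding L by (simp add: power2_eq_square ac_simps)
  also have "\<dots> = of_real ((\<kappa> N)\<^sup>2) * (\<Sum>hs\<in>?H. ?c z hs * cnj (?c z' hs) * (\<Prod>j<N - k. of_real (nu (hs ! j))))"
    using has_bochner_integral_integral_eq[OF hb] by simp
  also have "(\<Sum>hs\<in>?H. ?c z hs * cnj (?c z' hs) * (\<Prod>j<N - k. of_real (nu (hs ! j))))
     = (\<Sum>hs\<in>?H. \<Sum>as\<in>orbs p N k. \<Sum>bs\<in>orbs p N k. ((\<Prod>i<k. phi (as ! i) (z i)) * cnj (\<Prod>i<k. phi (bs ! i) (z' i)))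
         * of_real (amp p (as @ hs) * amp p (bs @ hs) * (\<Prod>j<N - k. nu (hs ! j))))"
    unfolding cnj_sum sum_product by (intro sum.cong refl) (simp add: sum_distrib_left sum_distrib_right ac_simps)
  also have "\<dots> = (\<Sum>as\<in>orbs p N k. \<Sum>bs\<in>orbs p N k. \<Sum>hs\<in>?H. ((\<Prod>i<k. phi (as ! i) (z i)) * cnj (\<Prod>i<k. phi (bs ! i) (z' i)))
         * of_real (amp p (as @ hs) * amp p (bs @ hs) * (\<Prod>j<N - k. nu (hs ! j))))"
    by (rule trans[OF sum.swap]) (intro sum.cong refl sum.swap)
  also have "\<dots> = (\<Sum>as\<in>orbs p N k. \<Sum>bs\<in>orbs p N k. of_real (nu0 ^ N * exp (l\<^sup>2 / R\<^sup>2 * e0 N) * fact (N - k)) *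
       ((\<Prod>i<k. psi (as ! i) (z i)) * cnj (\<Prod>i<k. psi (bs ! i) (z' i)) * of_real (Gam N as bs)))"
  proof (intro sum.cong refl)
    fix as bs assume ab: "as \<in> orbs p N k" "bs \<in> orbs p N k"
    then have len: "length as = k" "length bs = k" by (auto simp: orbs_def)
    have "(\<Sum>hs\<in>?H. ((\<Prod>i<k. phi (as ! i) (z i)) * cnj (\<Prod>i<k. phi (bs ! i) (z' i)))
         * of_real (amp p (as @ hs) * amp p (bs @ hs) * (\<Prod>j<N - k. nu (hs ! j))))
       = ((\<Prod>i<k. phi (as ! i) (z i)) * cnj (\<Prod>i<k. phi (bs ! i) (z' i))) * of_real (?E * ?e as * ?e bs * (fact (N - k) * Gam N as bs))"
      unfolding layers_sum[OF len assms(2), symmetric] by (simp only: of_real_sum sum_distrib_left)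
    also have "\<dots> = of_real ((sqrt nu0 ^ k * sqrt nu0 ^ k) * (exp (l\<^sup>2 / R\<^sup>2 / 2 * en as) * ?e as) * (exp (l\<^sup>2 / R\<^sup>2 / 2 * en bs) * ?e bs) * ?E * fact (N - k))
       * ((\<Prod>i<k. psi (as ! i) (z i)) * cnj (\<Prod>i<k. psi (bs ! i) (z' i)) * of_real (Gam N as bs))"
      unfolding prod_phi_psi[OF len(1)] prod_phi_psi[OF len(2)] by (simp add: ac_simps)
    also have "sqrt nu0 ^ k * sqrt nu0 ^ k = nu0 ^ k" using nu0_pos by (simp flip: power_mult_distrib)
    also have "exp (l\<^sup>2 / R\<^sup>2 / 2 * en as) * ?e as = 1" by (simp flip: exp_add)
    also have "exp (l\<^sup>2 / R\<^sup>2 / 2 * en bs) * ?e bs = 1" by (simp flip: exp_add)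
    also have "nu0 ^ k * 1 * 1 * ?E * fact (N - k) = nu0 ^ N * exp (l\<^sup>2 / R\<^sup>2 * e0 N) * fact (N - k)"
      using assms(2) by (simp add: mult.assoc[symmetric] flip: power_add)
    finally show "(\<Sum>hs\<in>?H. ((\<Prod>i<k. phi (as ! i) (z i)) * cnj (\<Prod>i<k. phi (bs ! i) (z' i)))
         * of_real (amp p (as @ hs) * amp p (bs @ hs) * (\<Prod>j<N - k. nu (hs ! j))))
       = of_real (nu0 ^ N * exp (l\<^sup>2 / R\<^sup>2 * e0 N) * fact (N - k)) *
       ((\<Prod>i<k. psi (as ! i) (z i)) * cnj (\<Prod>i<k. psi (bs ! i) (z' i)) * of_real (Gam N as bs))" .
  qed
  finally have I: "(\<integral>u. laughlin R l p \<kappa> N (\<lambda>j. if j < k then z j else u j) * cnj (laughlin R l p \<kappa> N (\<lambda>j. if j < k then z' j else u j)) \<partial>(\<Pi>\<^sub>M i\<in>{k..<N}. cylM R))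
    = of_real ((\<kappa> N)\<^sup>2 * (nu0 ^ N * exp (l\<^sup>2 / R\<^sup>2 * e0 N) * fact (N - k))) *
       (\<Sum>as\<in>orbs p N k. \<Sum>bs\<in>orbs p N k. (\<Prod>i<k. psi (as ! i) (z i)) * cnj (\<Prod>i<k. psi (bs ! i) (z' i)) * of_real (Gam N as bs))"
    by (simp add: sum_distrib_left mult.assoc)
  have k0: "\<kappa> N \<noteq> 0" "nu0 \<noteq> 0" using assms(1) nu0_pos by auto
  have coef: "fact N / (fact (N - k) * laughlin_norm2 R l p \<kappa> N) * ((\<kappa> N)\<^sup>2 * (nu0 ^ N * exp (l\<^sup>2 / R\<^sup>2 * e0 N) * fact (N - k))) = 1 / Gam N [] []"
    unfolding laughlin_norm2_eq using k0 by (simp add: field_simps)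
  define S where "S = (\<Sum>as\<in>orbs p N k. \<Sum>bs\<in>orbs p N k. (\<Prod>i<k. psi (as ! i) (z i)) * cnj (\<Prod>i<k. psi (bs ! i) (z' i)) * of_real (Gam N as bs))"
  have "corr R l p \<kappa> N k z z' = of_real (fact N / (fact (N - k) * laughlin_norm2 R l p \<kappa> N) * ((\<kappa> N)\<^sup>2 * (nu0 ^ N * exp (l\<^sup>2 / R\<^sup>2 * e0 N) * fact (N - k)))) * S"
    unfolding corr_def I S_def[symmetric] by (simp only: of_real_mult mult.assoc)
  also have "\<dots> = of_real (1 / Gam N [] []) * S" unfolding coef ..
  finally show ?thesis by (simp add: S_def sum_distrib_left ac_simps)
qed

end

section \<open>Energy of ordered configurations\<close>

lemma sum_geometric_le:
  fixes q :: real
  assumes "0 \<le> q" "q < 1" "inj_on f S" "finite S"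
  shows "(\<Sum>i\<in>S. q ^ f i) \<le> 1 / (1 - q)"
proof -
  have "(\<Sum>i\<in>S. q ^ f i) = (\<Sum>n\<in>f ` S. q ^ n)" using assms by (simp add: sum.reindex)
  also have "\<dots> \<le> (\<Sum>n. q ^ n)" using assms by (intro sum_le_suminf summable_geometric) auto
  also have "\<dots> = 1 / (1 - q)" using assms by (intro suminf_geometric) auto
  finally show ?thesis .
qed

text \<open>Sorted positions \<open>x\<close>, with the equidistant chain of spacing
  \<open>a\<close> as reference. The chain is cut in front of particle \<open>k0\<close>, and the
  block of particles at distance up to \<open>L\<close> from \<open>k0\<close> in the numbering is
  to be discarded.\<close>

locale ordered_chain =
  fixes a R l :: real and N k0 L :: nat and x :: "nat \<Rightarrow> real"
  assumes a_pos: "a > 0" and R_pos: "R > 0" and l_pos: "l > 0"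
    and k0: "k0 \<le> N" and mono: "\<And>i j. i \<le> j \<Longrightarrow> j < N \<Longrightarrow> x i \<le> x j"
begin

definition dev :: "nat \<Rightarrow> real" where "dev i = x i - real i * a"

definition lo :: nat where "lo = k0 - L"
definition hi :: nat where "hi = min N (k0 + L + 1)"

text \<open>The pairs that meet the block or bridge it. What is left are the pairs inside the left
  stretch and those inside the right stretch, each a chain of its own.\<close>

definition others :: "(nat \<times> nat) set" where
  "others = {(j, k). j < k \<and> k < N \<and> lo \<le> k \<and> j < hi}"

lemma lo_le_hi: "lo \<le> hi" using k0 by (auto simp: lo_def hi_def)

lemma card_block: "real (card {lo..<hi}) \<le> 2 * real L + 1"
proof -
  have "hi - lo \<le> 2 * L + 1" by (auto simp: lo_def hi_def)
  then have "real (hi - lo) \<le> real (2 * L + 1)" by (simp only: of_nat_le_iff)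
  then show ?thesis by simp
qed

lemma finite_others: "finite others"
  by (rule finite_subset[of _ "{..<N} \<times> {..<N}"]) (auto simp: others_def)

end

text \<open>Only displacements towards the cut are restricted, since moving away from it weakens the
  interaction across the cut. With the fraction 1/8 two particles on opposite sides of the block
  keep more than half of their reference distance.\<close>

locale tame_chain = ordered_chain +
  assumes tame_lo: "\<And>i. i < lo \<Longrightarrow> dev i \<le> a * (real k0 - real i) / 8"
    and tame_hi: "\<And>i. hi \<le> i \<Longrightarrow> i < N \<Longrightarrow> - dev i \<le> a * (real i - real k0) / 8"
begin

definition close :: "(nat \<times> nat) set" where
  "close = {(j, k) \<in> others. x k - x j < real (k - j) * a / 2}"

definition ratio :: real where "ratio = exp (- a / (2 * R))"

lemma ratio: "0 < ratio" "ratio < 1"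
  using a_pos R_pos by (auto simp: ratio_def)

text \<open>A pair that keeps half of its reference distance contributes a geometrically small term;
  the others are estimated by 1 and have to be counted.\<close>

lemma pair_le: "(j, k) \<in> others \<Longrightarrow> exp (- (x k - x j) / R) \<le> ratio ^ (k - j) + of_bool ((j, k) \<in> close)"
proof -
  assume o: "(j, k) \<in> others"
  then have jk: "j < k" "k < N" by (auto simp: others_def)
  show ?thesis
  proof (cases "(j, k) \<in> close")
    case True
    have "exp (- (x k - x j) / R) \<le> 1" using mono[of j k] jk R_pos by (simp add: field_simps)
    then show ?thesis using True ratio by (simp add: add_increasing)
  next
    case False
    then have "real (k - j) * a / 2 \<le> x k - x j" using o by (auto simp: close_def)
    then have "real (k - j) * a / 2 / R \<le> (x k - x j) / R" using R_pos by (intro divide_right_mono) auto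
    then have "- (x k - x j) / R \<le> real (k - j) * (- a / (2 * R))"
      by (simp only: minus_divide_left[symmetric] mult_minus_right times_divide_eq_right divide_divide_eq_left neg_le_iff_le)
    then have "exp (- (x k - x j) / R) \<le> ratio ^ (k - j)"
      unfolding ratio_def exp_of_nat_mult[symmetric] by simp
    then show ?thesis using False by simp
  qed
qed

text \<open>Each block particle contributes a geometric series on either side. For a pair bridging
  the block, \<open>k - j\<close> is at least \<open>(lo - j) + (k - hi)\<close>, which gives a
  product of two series without a factor \<open>L\<close>.\<close>

lemma geometric_part: "(\<Sum>(j, k)\<in>others. ratio ^ (k - j)) \<le> 2 * (2 * real L + 1) / (1 - ratio) + 1 / (1 - ratio)\<^sup>2"
proof -
  let ?S1 = "SIGMA k:{lo..<hi}. {..<k}"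
  let ?S2 = "SIGMA j:{lo..<hi}. {j<..<N}"
  let ?S3 = "{..<lo} \<times> {hi..<N}"
  let ?f = "\<lambda>(j, k). ratio ^ (k - j)"
  have fin: "finite ((\<lambda>(k, j). (j, k)) ` ?S1)" "finite ?S2" "finite ?S3" by auto
  have nn: "?f P \<ge> 0" for P using ratio by (cases P) simp
  have un: "sum ?f (X \<union> Y) \<le> sum ?f X + sum ?f Y" if "finite X" "finite Y" for X Y
    using sum.union_inter[OF that, of ?f] sum_nonneg[of "X \<inter> Y" ?f] nn by (smt (verit))
  have "others \<subseteq> ((\<lambda>(k, j). (j, k)) ` ?S1 \<union> ?S2) \<union> ?S3"
    by (force simp: others_def image_iff)
  then have "sum ?f others \<le> sum ?f (((\<lambda>(k, j). (j, k)) ` ?S1 \<union> ?S2) \<union> ?S3)"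
    using fin nn by (intro sum_mono2) auto
  also have "\<dots> \<le> (sum ?f ((\<lambda>(k, j). (j, k)) ` ?S1) + sum ?f ?S2) + sum ?f ?S3"
    using fin by (intro order.trans[OF un] add_mono un finite_UnI order.refl)
  also have "\<dots> \<le> ((2 * real L + 1) / (1 - ratio) + (2 * real L + 1) / (1 - ratio)) + 1 / (1 - ratio)\<^sup>2"
  proof (intro add_mono)
    have "sum ?f ((\<lambda>(k, j). (j, k)) ` ?S1) = (\<Sum>k\<in>{lo..<hi}. \<Sum>j<k. ratio ^ (k - j))"
      by (subst sum.reindex, force simp: inj_on_def, subst sum.Sigma) (auto simp: split_def)
    also have "\<dots> \<le> (\<Sum>k\<in>{lo..<hi}. 1 / (1 - ratio))"
      using ratio by (intro sum_mono sum_geometric_le) (auto simp: inj_on_def)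
    also have "\<dots> = real (card {lo..<hi}) * (1 / (1 - ratio))" by simp
    also have "\<dots> \<le> (2 * real L + 1) * (1 / (1 - ratio))"
      using ratio card_block by (intro mult_right_mono) auto
    finally show "sum ?f ((\<lambda>(k, j). (j, k)) ` ?S1) \<le> (2 * real L + 1) / (1 - ratio)" by simp
    have "sum ?f ?S2 = (\<Sum>j\<in>{lo..<hi}. \<Sum>k\<in>{j<..<N}. ratio ^ (k - j))"
      by (subst sum.Sigma) auto
    also have "\<dots> \<le> (\<Sum>k\<in>{lo..<hi}. 1 / (1 - ratio))"
      using ratio by (intro sum_mono sum_geometric_le) (auto simp: inj_on_def)
    also have "\<dots> = real (card {lo..<hi}) * (1 / (1 - ratio))" by simp
    also have "\<dots> \<le> (2 * real L + 1) * (1 / (1 - ratio))"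
      using ratio card_block by (intro mult_right_mono) auto
    finally show "sum ?f ?S2 \<le> (2 * real L + 1) / (1 - ratio)" by simp
    have "sum ?f ?S3 = (\<Sum>j<lo. \<Sum>k\<in>{hi..<N}. ratio ^ (k - j))"
      by (subst sum.cartesian_product) simp
    also have "\<dots> \<le> (\<Sum>j<lo. \<Sum>k\<in>{hi..<N}. ratio ^ (lo - j) * ratio ^ (k - hi))"
      using ratio lo_le_hi by (intro sum_mono) (auto simp flip: power_add intro!: power_decreasing)
    also have "\<dots> = (\<Sum>j<lo. ratio ^ (lo - j)) * (\<Sum>k\<in>{hi..<N}. ratio ^ (k - hi))"
      by (simp add: sum_product)
    also have "\<dots> \<le> (1 / (1 - ratio)) * (1 / (1 - ratio))"
      using ratio by (intro mult_mono sum_geometric_le sum_nonneg) (auto simp: inj_on_def)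
    finally show "sum ?f ?S3 \<le> 1 / (1 - ratio)\<^sup>2" by (simp add: power2_eq_square)
  qed
  finally show ?thesis by simp
qed

lemma card_less_real:
  assumes "d \<ge> 0" "inj_on f S" "\<And>i. i \<in> S \<Longrightarrow> 1 \<le> f i \<and> real (f i) < d"
  shows "real (card S) \<le> d"
proof -
  have sub: "f ` S \<subseteq> {1..nat \<lfloor>d\<rfloor>}"
  proof
    fix m assume "m \<in> f ` S"
    then have "1 \<le> m" "real m < d" using assms(3) by auto
    then show "m \<in> {1..nat \<lfloor>d\<rfloor>}" by (simp add: le_nat_floor)
  qed
  have "card S = card (f ` S)" using assms(2) by (simp add: card_image)
  also have "\<dots> \<le> card {1..nat \<lfloor>d\<rfloor>}" using sub by (intro card_mono) auto
  finally have "real (card S) \<le> real (nat \<lfloor>d\<rfloor>)" by simp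
  also have "\<dots> \<le> d" using assms(1) by simp
  finally show ?thesis .
qed

text \<open>In a close pair one particle is displaced towards the other by more than a quarter of
  their reference distance. If that particle is in the block, it has at most \<open>4 / a\<close>
  times its displacement many such partners; if it is outside while its partner is in the block,
  tameness confines it to distance \<open>2 * L\<close> from \<open>k0\<close> in the numbering. A
  pair bridging the block is never close.\<close>

lemma close_part: "real (card close) \<le> (2 * real L + 1)\<^sup>2 + 4 * real L * (2 * real L + 1) + 8 / a * (\<Sum>i\<in>{lo..<hi}. \<bar>dev i\<bar>)"
proof -
  let ?B = "{lo..<hi}"
  let ?S1 = "?B \<times> ?B"
  let ?A' = "{k0 - 2 * L..<k0}" and ?C' = "{k0 + 1..<k0 + 2 * L + 1}"
  let ?T1 = "SIGMA k:?B. {j. j < k \<and> real (k - j) < 4 * \<bar>dev k\<bar> / a}"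
  let ?T2 = "SIGMA j:?B. {k. j < k \<and> k < N \<and> real (k - j) < 4 * \<bar>dev j\<bar> / a}"
  have sub: "close \<subseteq> ((?S1 \<union> ?A' \<times> ?B) \<union> ?B \<times> ?C') \<union> ((\<lambda>(k, j). (j, k)) ` ?T1 \<union> ?T2)"
  proof
    fix P assume P: "P \<in> close"
    obtain j k where jk: "P = (j, k)" by (cases P)
    have o: "j < k" "k < N" "lo \<le> k" "j < hi" and c: "x k - x j < real (k - j) * a / 2"
      using P by (auto simp: jk close_def others_def)
    have rkj: "real (k - j) = real k - real j" using o by simp
    have dd: "dev j - dev k > (real k - real j) * a / 2"
    proof -
      have "dev j - dev k = (real k - real j) * a - (x k - x j)" by (simp add: dev_def algebra_simps)
      then show ?thesis using c unfolding rkj by linarith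
    qed
    have or: "dev j > (real k - real j) * a / 4 \<or> - dev k > (real k - real j) * a / 4" using dd by linarith
    have T: "real (k - j) < 4 * \<bar>d\<bar> / a" if "\<bar>d\<bar> > (real k - real j) * a / 4" for d
      using that a_pos rkj by (simp add: field_simps)
    consider (bb) "lo \<le> j" "k < hi" | (ab) "j < lo" "k < hi" | (bc) "lo \<le> j" "hi \<le> k" | (ac) "j < lo" "hi \<le> k"
      by linarith
    then show "P \<in> ((?S1 \<union> ?A' \<times> ?B) \<union> ?B \<times> ?C') \<union> ((\<lambda>(k, j). (j, k)) ` ?T1 \<union> ?T2)"
    proof cases
      case bb
      then show ?thesis using o by (simp add: jk)
    next
      case ab
      have tj: "dev j \<le> a * (real k0 - real j) / 8" using tame_lo[of j] ab by simp
      show ?thesis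
      proof (cases "dev j > (real k - real j) * a / 4")
        case True
        then have "(real k - real j) * a / 4 < a * (real k0 - real j) / 8" using tj by linarith
        then have "a * (2 * (real k - real j)) < a * (real k0 - real j)" by (simp add: field_simps)
        then have "2 * (real k - real j) < real k0 - real j" using a_pos by (simp only: mult_less_cancel_left_pos)
        then have "real (2 * k) < real (k0 + j)" by simp
        then have "2 * k < k0 + j" by (simp only: of_nat_less_iff)
        moreover have "k0 \<le> k + L" using o(3) ab by (simp add: lo_def)
        ultimately have "j \<in> ?A'" using ab by (auto simp: lo_def)
        then show ?thesis using ab o by (simp add: jk)
      next
        case False
        then have "\<bar>dev k\<bar> > (real k - real j) * a / 4" using or by linarith
        then have "real (k - j) < 4 * \<bar>dev k\<bar> / a" by (rule T)
        then have "(k, j) \<in> ?T1" using o ab by simp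
        then show ?thesis by (auto simp: jk image_iff)
      qed
    next
      case bc
      have tk: "- dev k \<le> a * (real k - real k0) / 8" using tame_hi[of k] bc o by simp
      show ?thesis
      proof (cases "- dev k > (real k - real j) * a / 4")
        case True
        then have "(real k - real j) * a / 4 < a * (real k - real k0) / 8" using tk by linarith
        then have "a * (2 * (real k - real j)) < a * (real k - real k0)" by (simp add: field_simps)
        then have "2 * (real k - real j) < real k - real k0" using a_pos by (simp only: mult_less_cancel_left_pos)
        then have "real (k + k0) < real (2 * j)" by simp
        then have "k + k0 < 2 * j" by (simp only: of_nat_less_iff)
        moreover have "j \<le> k0 + L" using o(4) by (simp add: hi_def)
        ultimately have "k \<in> ?C'" using o by auto
        then show ?thesis using bc o by (simp add: jk)
      next
        case False
        then have "\<bar>dev j\<bar> > (real k - real j) * a / 4" using or by linarith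
        then have "real (k - j) < 4 * \<bar>dev j\<bar> / a" by (rule T)
        then have "(j, k) \<in> ?T2" using o bc by simp
        then show ?thesis by (auto simp: jk)
      qed
    next
      case ac
      have tj: "dev j \<le> a * (real k0 - real j) / 8" using tame_lo[of j] ac by simp
      have tk: "- dev k \<le> a * (real k - real k0) / 8" using tame_hi[of k] ac o by simp
      have "dev j - dev k \<le> a * (real k - real j) / 8" using tj tk by (simp add: algebra_simps)
      moreover have "a * (real k - real j) > 0" using a_pos o by simp
      ultimately show ?thesis using dd by (simp add: mult.commute)
    qed
  qed
  have f1: "finite {j. j < k \<and> real (k - j) < d}" and f2: "finite {j. k < j \<and> j < N \<and> real (j - k) < d}" for k d
    by (rule finite_subset[of _ "{..<k}"], auto)
  have fT: "finite ?T1" "finite ?T2" using f1 f2 by auto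
  have "card close \<le> card (((?S1 \<union> ?A' \<times> ?B) \<union> ?B \<times> ?C') \<union> ((\<lambda>(k, j). (j, k)) ` ?T1 \<union> ?T2))"
    using fT by (intro card_mono sub) auto
  also have "\<dots> \<le> ((card ?S1 + card (?A' \<times> ?B)) + card (?B \<times> ?C')) + (card ?T1 + card ?T2)"
    by (intro order.trans[OF card_Un_le] add_mono card_image_le fT order.refl)
  finally have "real (card close) \<le> real (card ?S1) + real (card (?A' \<times> ?B)) + real (card (?B \<times> ?C')) + (real (card ?T1) + real (card ?T2))"
    by (simp only: of_nat_add[symmetric] of_nat_le_iff)
  moreover have "real (card ?S1) \<le> (2 * real L + 1)\<^sup>2"
    unfolding card_cartesian_product of_nat_mult power2_eq_square using card_block by (intro mult_mono) auto
  moreover have "real (card (?A' \<times> ?B)) \<le> (2 * real L) * (2 * real L + 1)"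
    unfolding card_cartesian_product of_nat_mult using card_block by (intro mult_mono) auto
  moreover have "real (card (?B \<times> ?C')) \<le> (2 * real L + 1) * (2 * real L)"
    unfolding card_cartesian_product of_nat_mult using card_block by (intro mult_mono) auto
  moreover have "real (card ?T1) \<le> (\<Sum>i\<in>?B. 4 * \<bar>dev i\<bar> / a)"
  proof -
    have "real (card ?T1) = (\<Sum>k\<in>?B. real (card {j. j < k \<and> real (k - j) < 4 * \<bar>dev k\<bar> / a}))"
      using f1 by (simp add: card_SigmaI)
    also have "\<dots> \<le> (\<Sum>i\<in>?B. 4 * \<bar>dev i\<bar> / a)"
    proof (rule sum_mono)
      fix k show "real (card {j. j < k \<and> real (k - j) < 4 * \<bar>dev k\<bar> / a}) \<le> 4 * \<bar>dev k\<bar> / a"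
        by (rule card_less_real[where f = "\<lambda>j. k - j"]) (use a_pos in \<open>auto simp: inj_on_def\<close>)
    qed
    finally show ?thesis .
  qed
  moreover have "real (card ?T2) \<le> (\<Sum>i\<in>?B. 4 * \<bar>dev i\<bar> / a)"
  proof -
    have "real (card ?T2) = (\<Sum>j\<in>?B. real (card {k. j < k \<and> k < N \<and> real (k - j) < 4 * \<bar>dev j\<bar> / a}))"
      using f2 by (simp add: card_SigmaI)
    also have "\<dots> \<le> (\<Sum>i\<in>?B. 4 * \<bar>dev i\<bar> / a)"
    proof (rule sum_mono)
      fix j show "real (card {k. j < k \<and> k < N \<and> real (k - j) < 4 * \<bar>dev j\<bar> / a}) \<le> 4 * \<bar>dev j\<bar> / a"
        by (rule card_less_real[where f = "\<lambda>k. k - j"]) (use a_pos in \<open>auto simp: inj_on_def\<close>)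
    qed
    finally show ?thesis .
  qed
  moreover have "(\<Sum>i\<in>?B. 4 * \<bar>dev i\<bar> / a) = 4 / a * (\<Sum>i\<in>?B. \<bar>dev i\<bar>)"
    by (simp add: sum_distrib_left)
  ultimately show ?thesis by (simp add: algebra_simps)
qed

lemma others_sum_le:
  "(\<Sum>(j, k)\<in>others. exp (- (x k - x j) / R)) \<le>
    (2 / (1 - ratio) + 1 / (1 - ratio)\<^sup>2 + 8) * (2 * real L + 1)\<^sup>2 + 8 / a * (\<Sum>i\<in>{lo..<hi}. \<bar>dev i\<bar>)"
proof -
  have "(\<Sum>(j, k)\<in>others. exp (- (x k - x j) / R)) \<le> (\<Sum>(j, k)\<in>others. ratio ^ (k - j) + of_bool ((j, k) \<in> close))"
    by (intro sum_mono) (use pair_le in auto)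
  also have "\<dots> = (\<Sum>(j, k)\<in>others. ratio ^ (k - j)) + real (card close)"
  proof -
    have "(\<Sum>P\<in>others. of_bool (P \<in> close)) = real (card close)"
    proof -
      have "others \<inter> {P. P \<in> close} = close" by (auto simp: close_def)
      then show ?thesis using finite_others by (simp only: sum_of_bool_eq)
    qed
    then show ?thesis by (simp add: split_def sum.distrib)
  qed
  also have "\<dots> \<le> (2 * (2 * real L + 1) / (1 - ratio) + 1 / (1 - ratio)\<^sup>2)
     + ((2 * real L + 1)\<^sup>2 + 4 * real L * (2 * real L + 1) + 8 / a * (\<Sum>i\<in>{lo..<hi}. \<bar>dev i\<bar>))"
    by (intro add_mono geometric_part close_part)
  also have "\<dots> \<le> (2 / (1 - ratio) + 1 / (1 - ratio)\<^sup>2 + 8) * (2 * real L + 1)\<^sup>2 + 8 / a * (\<Sum>i\<in>{lo..<hi}. \<bar>dev i\<bar>)"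
  proof -
    have w: "(1::real) \<le> (2 * real L + 1)\<^sup>2" "2 * real L + 1 \<le> (2 * real L + 1)\<^sup>2"
      by (simp_all add: power2_eq_square algebra_simps)
    have "2 / (1 - ratio) * (2 * real L + 1) \<le> 2 / (1 - ratio) * (2 * real L + 1)\<^sup>2"
      using ratio w by (intro mult_left_mono) auto
    moreover have "1 / (1 - ratio)\<^sup>2 * 1 \<le> 1 / (1 - ratio)\<^sup>2 * (2 * real L + 1)\<^sup>2"
      using ratio w by (intro mult_left_mono) auto
    moreover have "(2 * real L + 1)\<^sup>2 + 4 * real L * (2 * real L + 1) \<le> 8 * (2 * real L + 1)\<^sup>2"
      by (simp add: power2_eq_square algebra_simps)
    ultimately show ?thesis by (simp add: algebra_simps)
  qed
  finally show ?thesis .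
qed

text \<open>Outside the block a particle keeps at least 7/8 of its reference distance from
  \<open>k0\<close>. Since \<open>xi\<close> may lie one spacing further to the right, 3/8 of it
  remains on that side from \<open>k0 + 2\<close> on, and \<open>k0 + 1\<close> is counted
  separately. The constant 9/128 is half the square of 3/8.\<close>

lemma cloud_sum_le:
  assumes xi: "real k0 * a \<le> xi" "xi \<le> real k0 * a + a"
  shows "(\<Sum>i<N. exp (- (x i - xi)\<^sup>2 / (2 * l\<^sup>2))) \<le> 2 * real L + 4 + 2 / (1 - exp (- 9 * a\<^sup>2 / (128 * l\<^sup>2)))"
proof -
  define q where "q = exp (- 9 * a\<^sup>2 / (128 * l\<^sup>2))"
  have q: "0 < q" "q < 1" using a_pos l_pos by (auto simp: q_def)
  let ?f = "\<lambda>i. exp (- (x i - xi)\<^sup>2 / (2 * l\<^sup>2))"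
  have f1: "?f i \<le> 1" for i by simp
  have far: "?f i \<le> q ^ m" if "\<bar>x i - xi\<bar> \<ge> 3 / 8 * a * real m" for i m
  proof -
    have "(3 / 8 * a * real m)\<^sup>2 \<le> (x i - xi)\<^sup>2" using that a_pos by (metis abs_le_square_iff abs_of_nonneg mult_nonneg_nonneg of_nat_0_le_iff less_imp_le zero_le_divide_iff zero_le_numeral)
    moreover have "9 / 64 * a\<^sup>2 * real m \<le> (3 / 8 * a * real m)\<^sup>2"
    proof -
      have "real m \<le> (real m)\<^sup>2" by (cases m) (auto simp: power2_eq_square)
      then have "9 / 64 * a\<^sup>2 * real m \<le> 9 / 64 * a\<^sup>2 * (real m)\<^sup>2" by (intro mult_left_mono) auto
      also have "\<dots> = (3 / 8 * a * real m)\<^sup>2" by (simp add: power_mult_distrib power_divide)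
      finally show ?thesis .
    qed
    ultimately have "9 / 64 * a\<^sup>2 * real m \<le> (x i - xi)\<^sup>2" by linarith
    then have "- (x i - xi)\<^sup>2 / (2 * l\<^sup>2) \<le> real m * (- 9 * a\<^sup>2 / (128 * l\<^sup>2))" using l_pos by (simp add: field_simps)
    then show ?thesis unfolding q_def exp_of_nat_mult[symmetric] by simp
  qed
  have "{..<N} \<subseteq> (({lo..<hi} \<union> {k0 + 1}) \<union> {..<lo}) \<union> {i. hi \<le> i \<and> i < N \<and> k0 + 2 \<le> i}"
    by (auto simp: hi_def)
  then have "sum ?f {..<N} \<le> sum ?f ((({lo..<hi} \<union> {k0 + 1}) \<union> {..<lo}) \<union> {i. hi \<le> i \<and> i < N \<and> k0 + 2 \<le> i})"
    by (intro sum_mono2) auto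
  also have "\<dots> \<le> ((sum ?f {lo..<hi} + sum ?f {k0 + 1}) + sum ?f {..<lo}) + sum ?f {i. hi \<le> i \<and> i < N \<and> k0 + 2 \<le> i}"
  proof -
    have un: "sum ?f (X \<union> Y) \<le> sum ?f X + sum ?f Y" if "finite X" "finite Y" for X Y
      using sum.union_inter[OF that, of ?f] sum_nonneg[of "X \<inter> Y" ?f] by (smt (verit) exp_ge_zero)
    show ?thesis by (intro order.trans[OF un] add_mono un finite_UnI order.refl) auto
  qed
  also have "\<dots> \<le> (((2 * real L + 1) + 1) + 1 / (1 - q)) + 1 / (1 - q)"
  proof (intro add_mono)
    have "sum ?f {lo..<hi} \<le> (\<Sum>i\<in>{lo..<hi}. 1)" by (intro sum_mono f1)
    also have "\<dots> = real (card {lo..<hi})" by simp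
    also note card_block
    finally show "sum ?f {lo..<hi} \<le> 2 * real L + 1" .
    show "sum ?f {k0 + 1} \<le> 1" by simp
    have "sum ?f {..<lo} \<le> (\<Sum>i<lo. q ^ (k0 - i))"
    proof (intro sum_mono far)
      fix i assume i: "i \<in> {..<lo}"
      then have "i \<le> k0" by (simp add: lo_def)
      have "x i \<le> real i * a + a * (real k0 - real i) / 8" using tame_lo[of i] i by (simp add: dev_def)
      moreover have "7 / 8 * a * (real k0 - real i) = real k0 * a - real i * a - a * (real k0 - real i) / 8"
        by (simp add: field_simps)
      ultimately have "xi - x i \<ge> 7 / 8 * a * (real k0 - real i)" using xi by linarith
      moreover have "a * (real k0 - real i) \<ge> 0" using a_pos \<open>i \<le> k0\<close> by simp
      ultimately show "\<bar>x i - xi\<bar> \<ge> 3 / 8 * a * real (k0 - i)" using \<open>i \<le> k0\<close> by (simp add: of_nat_diff)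
    qed
    also have "\<dots> \<le> 1 / (1 - q)" using q by (intro sum_geometric_le) (auto simp: inj_on_def lo_def)
    finally show "sum ?f {..<lo} \<le> 1 / (1 - q)" .
    have "sum ?f {i. hi \<le> i \<and> i < N \<and> k0 + 2 \<le> i} \<le> (\<Sum>i\<in>{i. hi \<le> i \<and> i < N \<and> k0 + 2 \<le> i}. q ^ (i - k0))"
    proof (intro sum_mono far)
      fix i assume i: "i \<in> {i. hi \<le> i \<and> i < N \<and> k0 + 2 \<le> i}"
      have "x i \<ge> real i * a - a * (real i - real k0) / 8" using tame_hi[of i] i by (simp add: dev_def)
      moreover have "7 / 8 * (a * (real i - real k0)) = real i * a - real k0 * a - a * (real i - real k0) / 8"
        by (simp add: field_simps)
      ultimately have "x i - xi \<ge> 7 / 8 * (a * (real i - real k0)) - a" using xi by linarith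
      moreover have "a * (real i - real k0) \<ge> a * 2" using a_pos i by (intro mult_left_mono) auto
      moreover have "3 / 8 * a * real (i - k0) = 3 / 8 * (a * (real i - real k0))" using i by (simp add: of_nat_diff)
      ultimately show "\<bar>x i - xi\<bar> \<ge> 3 / 8 * a * real (i - k0)" by linarith
    qed
    also have "\<dots> \<le> 1 / (1 - q)" using q by (intro sum_geometric_le) (auto simp: inj_on_def)
    finally show "sum ?f {i. hi \<le> i \<and> i < N \<and> k0 + 2 \<le> i} \<le> 1 / (1 - q)" .
  qed
  finally show ?thesis by (simp add: q_def)
qed

end

context ordered_chain
begin

text \<open>Positions are sorted, so the displacement drops by at most \<open>a\<close> from one
  particle to the next towards the cut. An excess over \<open>a * L / 8\<close> therefore leaves at
  least \<open>a * L / 16\<close> at the next \<open>L div 16\<close> particles as well, all of them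
  in the block. This gives at least \<open>L / 16\<close> terms of size
  \<open>(a * L / 16)\<^sup>2\<close>: a cubic gain against the quadratic cost in
  \<open>others_sum_le\<close>.\<close>

lemma energy_gain:
  assumes i: "i < N" "L \<ge> 1" and far: "i < k0 \<and> k0 - i = L \<and> dev i > a * real L / 8 \<or> k0 \<le> i \<and> i - k0 = L \<and> - dev i > a * real L / 8"
  shows "(\<Sum>i\<in>{lo..<hi}. (dev i)\<^sup>2) \<ge> a\<^sup>2 * real L ^ 3 / 4096"
proof -
  define t where "t = L div 16"
  have t16: "16 * t \<le> L" "t < L" "real L / 16 \<le> real t + 1"
  proof -
    show "16 * t \<le> L" by (simp add: t_def)
    show "t < L" using i(2) by (simp add: t_def)
    have "L < 16 * (t + 1)" by (simp add: t_def)
    then have "real L < real (16 * (t + 1))" by (simp only: of_nat_less_iff)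
    then show "real L / 16 \<le> real t + 1" by simp
  qed
  have key: "(\<Sum>i\<in>{lo..<hi}. (dev i)\<^sup>2) \<ge> a\<^sup>2 * real L ^ 3 / 4096"
    if T: "T \<subseteq> {lo..<hi}" "card T = t + 1" "\<And>i. i \<in> T \<Longrightarrow> \<bar>dev i\<bar> \<ge> a * real L / 16" for T
  proof -
    have "a\<^sup>2 * real L ^ 3 / 4096 = real L / 16 * (a * real L / 16)\<^sup>2" by (simp add: power2_eq_square power3_eq_cube)
    also have "\<dots> \<le> real (card T) * (a * real L / 16)\<^sup>2" using t16 T(2) by (intro mult_right_mono) auto
    also have "\<dots> = (\<Sum>i\<in>T. (a * real L / 16)\<^sup>2)" by simp
    also have "\<dots> \<le> (\<Sum>i\<in>T. (dev i)\<^sup>2)"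
    proof (intro sum_mono)
      fix i assume "i \<in> T"
      then have "\<bar>a * real L / 16\<bar> \<le> \<bar>dev i\<bar>" using T(3) a_pos by simp
      then show "(a * real L / 16)\<^sup>2 \<le> (dev i)\<^sup>2" by (simp only: abs_le_square_iff)
    qed
    also have "\<dots> \<le> (\<Sum>i\<in>{lo..<hi}. (dev i)\<^sup>2)" using T(1) by (intro sum_mono2) auto
    finally show ?thesis .
  qed
  have at: "a * real t \<le> a * real L / 16" using a_pos t16(1) by (simp add: field_simps)
  from far show ?thesis
  proof
    assume f: "i < k0 \<and> k0 - i = L \<and> dev i > a * real L / 8"
    show ?thesis
    proof (rule key[of "{i..<i + t + 1}"])
      show "{i..<i + t + 1} \<subseteq> {lo..<hi}" using f t16(2) k0 by (auto simp: lo_def hi_def)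
      show "card {i..<i + t + 1} = t + 1" by simp
      fix m assume m: "m \<in> {i..<i + t + 1}"
      then have mN: "m < N" using f t16(2) k0 by auto
      have "real m \<le> real i + real t" using m by simp
      then have "a * real m \<le> a * (real i + real t)" using a_pos by (simp only: mult_le_cancel_left_pos)
      then have "dev m \<ge> dev i - a * real t" using mono[of i m] m mN by (simp add: dev_def algebra_simps)
      then show "\<bar>dev m\<bar> \<ge> a * real L / 16" using f at by linarith
    qed
  next
    assume f: "k0 \<le> i \<and> i - k0 = L \<and> - dev i > a * real L / 8"
    show ?thesis
    proof (rule key[of "{i - t..<i + 1}"])
      show "{i - t..<i + 1} \<subseteq> {lo..<hi}" using f t16(2) i(1) by (auto simp: lo_def hi_def)
      have "t \<le> i" using f t16(2) by linarith
      then show "card {i - t..<i + 1} = t + 1" by simp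
      fix m assume m: "m \<in> {i - t..<i + 1}"
      have "real i \<le> real m + real t" using m by auto
      then have "a * real i \<le> a * (real m + real t)" using a_pos by (simp only: mult_le_cancel_left_pos)
      then have "- dev m \<ge> - dev i - a * real t" using mono[of m i] m i(1) by (simp add: dev_def algebra_simps)
      then show "\<bar>dev m\<bar> \<ge> a * real L / 16" using f at by linarith
    qed
  qed
qed

end

section \<open>Ordered integration\<close>

definition srt :: "nat set \<Rightarrow> (nat \<Rightarrow> complex) \<Rightarrow> bool" where
  "srt I u \<longleftrightarrow> (\<forall>i\<in>I. \<forall>j\<in>I. i < j \<longrightarrow> Re (u i) \<le> Re (u j))"

definition perm_app :: "nat set \<Rightarrow> (nat \<Rightarrow> nat) \<Rightarrow> (nat \<Rightarrow> complex) \<Rightarrow> nat \<Rightarrow> complex" where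
  "perm_app I \<sigma> u = (\<lambda>i\<in>I. u (\<sigma> i))"

lemma srt_cong: "(\<And>i. i \<in> I \<Longrightarrow> u i = v i) \<Longrightarrow> srt I u \<longleftrightarrow> srt I v"
  by (auto simp: srt_def)

text \<open>A permutation maximising the sum of \<^term>\<open>real i * Re (u (\<sigma> i))\<close> sorts, since exchanging
  an inversion would increase the sum.\<close>
lemma sorting_exists:
  assumes "finite I"
  obtains \<sigma> where "\<sigma> permutes I" "srt I (perm_app I \<sigma> u)"
proof -
  let ?v = "\<lambda>\<sigma>. \<Sum>i\<in>I. real i * Re (u (\<sigma> i))"
  have fin: "finite {\<sigma>. \<sigma> permutes I}" using assms by (rule finite_permutations)
  have ne: "{\<sigma>. \<sigma> permutes I} \<noteq> {}" using permutes_id by blast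
  define m where "m = Max (?v ` {\<sigma>. \<sigma> permutes I})"
  have "m \<in> ?v ` {\<sigma>. \<sigma> permutes I}" unfolding m_def using fin ne by (intro Max_in) auto
  then obtain \<sigma> where \<sigma>: "\<sigma> permutes I" "?v \<sigma> = m" by auto
  have max: "?v \<tau> \<le> ?v \<sigma>" if "\<tau> permutes I" for \<tau>
    unfolding \<sigma>(2) m_def using fin that by (intro Max_ge) auto
  have "Re (u (\<sigma> i)) \<le> Re (u (\<sigma> j))" if ij: "i \<in> I" "j \<in> I" "i < j" for i j
  proof (rule ccontr)
    assume *: "\<not> Re (u (\<sigma> i)) \<le> Re (u (\<sigma> j))"
    let ?t = "Transposition.transpose i j"
    have t: "\<sigma> \<circ> ?t permutes I" using ij \<sigma> by (intro permutes_compose permutes_swap_id) auto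
    have "?v (\<sigma> \<circ> ?t) - ?v \<sigma> = (\<Sum>k\<in>I. real k * (Re (u (\<sigma> (?t k))) - Re (u (\<sigma> k))))"
      by (simp add: sum_subtractf algebra_simps)
    also have "\<dots> = (\<Sum>k\<in>{i, j}. real k * (Re (u (\<sigma> (?t k))) - Re (u (\<sigma> k))))"
      using ij assms by (intro sum.mono_neutral_right) (auto simp: transpose_apply_other)
    also have "\<dots> = (real j - real i) * (Re (u (\<sigma> i)) - Re (u (\<sigma> j)))"
      using ij by (simp add: algebra_simps)
    also have "\<dots> > 0" using * ij by simp
    finally show False using max[OF t] by simp
  qed
  then have "srt I (perm_app I \<sigma> u)" by (auto simp: srt_def perm_app_def)
  with \<sigma>(1) show thesis by (rule that)
qed

text \<open>The point that a sorting permutation puts at \<open>i\<close> is determined by its rank,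
  the number of points with smaller real part.\<close>

lemma sorting_unique:
  assumes I: "finite I" and inj: "inj_on (\<lambda>i. Re (u i)) I"
    and \<sigma>: "\<sigma> permutes I" "srt I (perm_app I \<sigma> u)" and \<tau>: "\<tau> permutes I" "srt I (perm_app I \<tau> u)"
  shows "\<sigma> = \<tau>"
proof -
  have rank: "card {j \<in> I. j < i} = card {y \<in> I. Re (u y) < Re (u (\<rho> i))}"
    if \<rho>: "\<rho> permutes I" "srt I (perm_app I \<rho> u)" and i: "i \<in> I" for \<rho> i
  proof -
    have "Re (u (\<rho> j)) < Re (u (\<rho> i)) \<longleftrightarrow> j < i" if j: "j \<in> I" for j
    proof -
      have m: "\<rho> i \<in> I" "\<rho> j \<in> I" using \<rho>(1) i j by (simp_all add: permutes_in_image)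
      have ne: "Re (u (\<rho> j)) \<noteq> Re (u (\<rho> i))" if "j \<noteq> i"
        using inj m that \<rho>(1) by (metis inj_onD permutes_inj injD)
      show ?thesis using \<rho>(2) i j ne
        by (cases j i rule: linorder_cases) (force simp: srt_def perm_app_def)+
    qed
    then have "{y \<in> I. Re (u y) < Re (u (\<rho> i))} = \<rho> ` {j \<in> I. j < i}"
      using permutes_image[OF \<rho>(1)] by (auto simp: image_iff) (metis (no_types, lifting) image_iff)
    then show ?thesis using permutes_inj_on[OF \<rho>(1)] by (simp add: card_image)
  qed
  have "\<sigma> i = \<tau> i" if i: "i \<in> I" for i
  proof -
    have m: "\<sigma> i \<in> I" "\<tau> i \<in> I" using \<sigma>(1) \<tau>(1) i by (simp_all add: permutes_in_image)
    have c: "card {y \<in> I. Re (u y) < Re (u (\<sigma> i))} = card {y \<in> I. Re (u y) < Re (u (\<tau> i))}"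
      using rank[OF \<sigma> i] rank[OF \<tau> i] by simp
    have less: "card {y \<in> I. Re (u y) < Re (u r)} < card {y \<in> I. Re (u y) < Re (u s)}"
      if "r \<in> I" "Re (u r) < Re (u s)" for r s
      using that I by (intro psubset_card_mono) auto
    have "\<not> Re (u (\<sigma> i)) < Re (u (\<tau> i))" "\<not> Re (u (\<tau> i)) < Re (u (\<sigma> i))"
      using less[of "\<sigma> i" "\<tau> i"] less[of "\<tau> i" "\<sigma> i"] m c by auto
    then show ?thesis using inj m by (auto dest: inj_onD)
  qed
  moreover have "\<sigma> i = \<tau> i" if "i \<notin> I" for i
    using that \<sigma>(1) \<tau>(1) by (simp add: permutes_not_in)
  ultimately show ?thesis by blast
qed

context cylinder
begin

abbreviation PM where "PM I \<equiv> Pi\<^sub>M I (\<lambda>_. cylM R)"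

lemma measurable_coord:
  assumes "i \<in> K" "f \<in> borel_measurable borel"
  shows "(\<lambda>u. f (u i)) \<in> borel_measurable (PM K)"
  using measurable_component_singleton[OF assms(1), of "\<lambda>_. cylM R"] sets_cylM_borel[OF assms(2)]
  by (rule measurable_compose)

lemma perm_app_measurable:
  assumes "\<sigma> permutes I"
  shows "perm_app I \<sigma> \<in> measurable (PM I) (PM I)"
  unfolding perm_app_def
  by (intro measurable_restrict measurable_component_singleton) (use permutes_in_image[OF assms] in auto)

lemma nn_integral_permute:
  assumes I: "finite I" and \<sigma>: "\<sigma> permutes I" and F: "F \<in> borel_measurable (PM I)"
  shows "(\<integral>\<^sup>+u. F (perm_app I \<sigma> u) \<partial>PM I) = (\<integral>\<^sup>+u. F u \<partial>PM I)"
proof -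
  have "distr (PM I) (PM I) (perm_app I \<sigma>) = PM I"
  proof (rule PiM_eqI[OF I])
    fix A assume A: "\<And>i. i \<in> I \<Longrightarrow> A i \<in> sets (cylM R)"
    let ?A' = "\<lambda>i. A (inv \<sigma> i)"
    have inv: "inv \<sigma> permutes I" using \<sigma> by (rule permutes_inv)
    have A': "?A' i \<in> sets (cylM R)" if "i \<in> I" for i using A that permutes_in_image[OF inv] by auto
    have "perm_app I \<sigma> -` (Pi\<^sub>E I A) \<inter> space (PM I) = Pi\<^sub>E I ?A'"
    proof (intro set_eqI iffI)
      fix u assume u: "u \<in> perm_app I \<sigma> -` (Pi\<^sub>E I A) \<inter> space (PM I)"
      show "u \<in> Pi\<^sub>E I ?A'"
      proof (rule PiE_I)
        fix i assume i: "i \<in> I"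
        then have "inv \<sigma> i \<in> I" using permutes_in_image[OF inv] by simp
        then have "perm_app I \<sigma> u (inv \<sigma> i) \<in> A (inv \<sigma> i)" using u by auto
        then show "u i \<in> ?A' i" using \<open>inv \<sigma> i \<in> I\<close> permutes_inverses(1)[OF \<sigma>] by (simp add: perm_app_def)
      qed (use u in \<open>auto simp: space_PiM PiE_def extensional_def\<close>)
    next
      fix u assume u: "u \<in> Pi\<^sub>E I ?A'"
      have "u i \<in> space (cylM R)" if "i \<in> I" for i
        using u that A'[OF that] sets.sets_into_space by blast
      then have "u \<in> space (PM I)" using u by (auto simp: space_PiM PiE_def)
      moreover have "perm_app I \<sigma> u \<in> Pi\<^sub>E I A"
      proof (rule PiE_I)
        fix i assume i: "i \<in> I"
        then have "\<sigma> i \<in> I" using permutes_in_image[OF \<sigma>] by simp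
        then have "u (\<sigma> i) \<in> A (inv \<sigma> (\<sigma> i))" using u by auto
        then show "perm_app I \<sigma> u i \<in> A i" using i permutes_inverses(2)[OF \<sigma>] by (simp add: perm_app_def)
      qed (simp add: perm_app_def)
      ultimately show "u \<in> perm_app I \<sigma> -` (Pi\<^sub>E I A) \<inter> space (PM I)" by simp
    qed
    then have "emeasure (distr (PM I) (PM I) (perm_app I \<sigma>)) (Pi\<^sub>E I A) = emeasure (PM I) (Pi\<^sub>E I ?A')"
      using perm_app_measurable[OF \<sigma>] A I by (subst emeasure_distr) (auto intro!: sets_PiM_I_finite)
    also have "\<dots> = (\<Prod>i\<in>I. emeasure (cylM R) (?A' i))"
      using I A' by (intro emeasure_PiM) auto
    also have "\<dots> = (\<Prod>i\<in>I. emeasure (cylM R) (A i))"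
      using permutes_inv[OF \<sigma>] by (subst prod.permute[OF permutes_inv[OF \<sigma>]]) (simp add: comp_def permutes_inverses[OF \<sigma>])
    finally show "emeasure (distr (PM I) (PM I) (perm_app I \<sigma>)) (Pi\<^sub>E I A) = (\<Prod>i\<in>I. emeasure (cylM R) (A i))" .
  qed simp
  then have "(\<integral>\<^sup>+u. F u \<partial>PM I) = (\<integral>\<^sup>+u. F u \<partial>distr (PM I) (PM I) (perm_app I \<sigma>))" by simp
  also have "\<dots> = (\<integral>\<^sup>+u. F (perm_app I \<sigma> u) \<partial>PM I)"
    using perm_app_measurable[OF \<sigma>] F by (intro nn_integral_distr) auto
  finally show ?thesis by simp
qed

lemma AE_no_ties:
  assumes I: "finite I"
  shows "AE u in PM I. inj_on (\<lambda>i. Re (u i)) I"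
proof -
  have "AE u in PM I. Re (u i) \<noteq> Re (u j)" if ij: "i \<in> I" "j \<in> I" "i \<noteq> j" for i j
  proof -
    let ?J = "I - {i}"
    have Iins: "I = insert i ?J" using ij by auto
    let ?f = "\<lambda>u. indicator {0} (Re (u i) - Re (u j)) :: ennreal"
    have m: "(\<lambda>u. Re (u k)) \<in> borel_measurable (PM I)" if "k \<in> I" for k
      using that by (intro measurable_coord) auto
    have mf: "?f \<in> borel_measurable (PM I)"
      using m[OF ij(1)] m[OF ij(2)] by (intro measurable_compose[OF borel_measurable_diff borel_measurable_indicator]) auto
    have "(\<integral>\<^sup>+u. ?f u \<partial>PM I) = (\<integral>\<^sup>+u. \<integral>\<^sup>+z. ?f (u(i := z)) \<partial>cylM R \<partial>PM ?J)"
      using product_nn_integral_insert[of ?J i ?f] I mf Iins by auto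
    also have "\<dots> = (\<integral>\<^sup>+u. \<integral>\<^sup>+z. indicator {Re (u j)} (Re z) \<partial>cylM R \<partial>PM ?J)"
      using ij by (intro nn_integral_cong) (auto simp: indicator_def)
    also have "\<dots> = 0" by (simp add: nn_integral_cylM_Re)
    finally have "AE u in PM I. ?f u = 0" using mf by (simp add: nn_integral_0_iff_AE)
    then show ?thesis by (rule AE_mp) (auto simp: indicator_def)
  qed
  then have "AE u in PM I. \<forall>i\<in>I. \<forall>j\<in>I. i \<noteq> j \<longrightarrow> Re (u i) \<noteq> Re (u j)"
    using I by (intro AE_finite_allI) auto
  then show ?thesis by (rule AE_mp) (auto simp: inj_on_def)
qed

lemma srt_measurable:
  assumes "finite I" "I \<subseteq> K"
  shows "(\<lambda>u. indicator (Collect (srt I)) u :: ennreal) \<in> borel_measurable (PM K)"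
proof -
  have "(\<lambda>u. indicator (Collect (srt I)) u :: ennreal)
     = (\<lambda>u. \<Prod>i\<in>I. \<Prod>j\<in>I. if i < j then indicator {0..} (Re (u j) - Re (u i)) else 1)" (is "_ = ?f")
  proof
    fix u show "indicator (Collect (srt I)) u = ?f u"
    proof (cases "srt I u")
      case True
      then have "?f u = (\<Prod>i\<in>I. \<Prod>j\<in>I. 1)"
        by (intro prod.cong refl) (auto simp: srt_def indicator_def)
      then show ?thesis using True by simp
    next
      case False
      then obtain i j where ij: "i \<in> I" "j \<in> I" "i < j" "\<not> Re (u i) \<le> Re (u j)" by (auto simp: srt_def)
      have z: "(\<Prod>j\<in>I. if i < j then indicator {0..} (Re (u j) - Re (u i)) else 1) = (0::ennreal)"
        using ij assms(1) by (intro prod_zero) (auto intro!: bexI[of _ j])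
      have "?f u = 0" by (rule prod_zero[OF assms(1)], rule bexI[of _ i], rule z, rule ij(1))
      then show ?thesis using False by simp
    qed
  qed
  moreover have "?f \<in> borel_measurable (PM K)"
  proof (intro borel_measurable_prod_ennreal)
    fix i j assume ij: "i \<in> I" "j \<in> I"
    have m: "(\<lambda>u. Re (u k)) \<in> borel_measurable (PM K)" if "k \<in> I" for k
      using that assms by (intro measurable_coord) auto
    show "(\<lambda>u. if i < j then indicator {0..} (Re (u j) - Re (u i)) else (1::ennreal)) \<in> borel_measurable (PM K)"
      using m[OF ij(1)] m[OF ij(2)]
      by (cases "i < j") (auto intro!: measurable_compose[OF borel_measurable_diff borel_measurable_indicator])
  qed
  ultimately show ?thesis by simp
qed

text \<open>Almost every configuration is sorted by exactly one permutation, so inserting the sum of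
  the indicators over all permutations changes nothing, and by symmetry of \<open>F\<close> all
  terms have the same integral.\<close>

lemma sort_integral:
  assumes I: "finite I" and F: "F \<in> borel_measurable (PM I)"
    and sym: "\<And>\<sigma> u. \<sigma> permutes I \<Longrightarrow> F (perm_app I \<sigma> u) = F u"
  shows "(\<integral>\<^sup>+u. F u \<partial>PM I) = fact (card I) * (\<integral>\<^sup>+u. F u * indicator (Collect (srt I)) u \<partial>PM I)"
proof -
  let ?s = "\<lambda>\<sigma> u. indicator (Collect (srt I)) (perm_app I \<sigma> u) :: ennreal"
  have fP: "finite {\<sigma>. \<sigma> permutes I}" using I by (rule finite_permutations)
  have one: "(\<Sum>\<sigma>\<in>{\<sigma>. \<sigma> permutes I}. ?s \<sigma> u) = 1" if inj: "inj_on (\<lambda>i. Re (u i)) I" for u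
  proof -
    obtain \<sigma> where \<sigma>: "\<sigma> permutes I" "srt I (perm_app I \<sigma> u)" using sorting_exists[OF I] by metis
    have "(\<Sum>\<tau>\<in>{\<sigma>. \<sigma> permutes I}. ?s \<tau> u) = (\<Sum>\<tau>\<in>{\<sigma>}. ?s \<tau> u)"
    proof (rule sum.mono_neutral_right[OF fP])
      show "{\<sigma>} \<subseteq> {\<sigma>. \<sigma> permutes I}" using \<sigma>(1) by simp
      show "\<forall>\<tau>\<in>{\<sigma>. \<sigma> permutes I} - {\<sigma>}. ?s \<tau> u = 0"
      proof
        fix \<tau> assume "\<tau> \<in> {\<sigma>. \<sigma> permutes I} - {\<sigma>}"
        then have "\<not> srt I (perm_app I \<tau> u)" using sorting_unique[OF I inj \<sigma>, of \<tau>] by blast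
        then show "?s \<tau> u = 0" by simp
      qed
    qed
    then show ?thesis using \<sigma> by simp
  qed
  have ms: "?s \<sigma> \<in> borel_measurable (PM I)" if "\<sigma> permutes I" for \<sigma>
    by (rule measurable_compose[OF perm_app_measurable[OF that] srt_measurable[OF I order.refl]])
  have "(\<integral>\<^sup>+u. F u \<partial>PM I) = (\<integral>\<^sup>+u. F u * (\<Sum>\<sigma>\<in>{\<sigma>. \<sigma> permutes I}. ?s \<sigma> u) \<partial>PM I)"
    by (rule nn_integral_cong_AE) (use AE_no_ties[OF I] in eventually_elim, simp add: one)
  also have "\<dots> = (\<integral>\<^sup>+u. (\<Sum>\<sigma>\<in>{\<sigma>. \<sigma> permutes I}. F (perm_app I \<sigma> u) * ?s \<sigma> u) \<partial>PM I)"
    by (intro nn_integral_cong) (simp add: sum_distrib_left sym)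
  also have "\<dots> = (\<Sum>\<sigma>\<in>{\<sigma>. \<sigma> permutes I}. \<integral>\<^sup>+u. F (perm_app I \<sigma> u) * ?s \<sigma> u \<partial>PM I)"
    by (intro nn_integral_sum borel_measurable_times_ennreal ms measurable_compose[OF perm_app_measurable F]) auto
  also have "\<dots> = (\<Sum>\<sigma>\<in>{\<sigma>. \<sigma> permutes I}. \<integral>\<^sup>+u. F u * indicator (Collect (srt I)) u \<partial>PM I)"
    using nn_integral_permute[OF I, of _ "\<lambda>u. F u * indicator (Collect (srt I)) u"] F srt_measurable[OF I order.refl]
    by (intro sum.cong refl) auto
  also have "\<dots> = fact (card I) * (\<integral>\<^sup>+u. F u * indicator (Collect (srt I)) u \<partial>PM I)"
    using card_permutations[OF refl I] by simp
  finally show ?thesis .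
qed

end

definition prs :: "nat set \<Rightarrow> (nat \<times> nat) set" where
  "prs I = {(j, k). j \<in> I \<and> k \<in> I \<and> j < k}"

lemma finite_prs [simp]: "finite I \<Longrightarrow> finite (prs I)"
  by (rule finite_subset[of _ "I \<times> I"]) (auto simp: prs_def)

text \<open>A permutation of labels does not preserve the pairs with \<open>j < k\<close>, but it
  preserves those with \<open>j \<noteq> k\<close>, over which the product is a square. Symmetry is
  proved for the square, and roots are taken afterwards.\<close>

lemma prod_prs_sq:
  fixes h :: "nat \<Rightarrow> nat \<Rightarrow> 'a::comm_monoid_mult"
  assumes "finite I" "\<And>j k. h j k = h k j"
  shows "(\<Prod>(j, k)\<in>{(j, k). j \<in> I \<and> k \<in> I \<and> j \<noteq> k}. h j k) = (\<Prod>(j, k)\<in>prs I. h j k) * (\<Prod>(j, k)\<in>prs I. h j k)"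
proof -
  have split: "{(j, k). j \<in> I \<and> k \<in> I \<and> j \<noteq> k} = prs I \<union> prod.swap ` prs I"
    by (auto simp: prs_def image_iff)
  have "(\<Prod>(j, k)\<in>{(j, k). j \<in> I \<and> k \<in> I \<and> j \<noteq> k}. h j k)
      = (\<Prod>(j, k)\<in>prs I. h j k) * (\<Prod>(j, k)\<in>prod.swap ` prs I. h j k)"
    unfolding split using assms(1)
    by (intro prod.union_disjoint finite_imageI finite_prs) (auto simp: prs_def)
  also have "(\<Prod>(j, k)\<in>prod.swap ` prs I. h j k) = (\<Prod>(j, k)\<in>prs I. h j k)"
    by (subst prod.reindex) (auto simp: inj_on_def split_def assms(2))
  finally show ?thesis .
qed

section \<open>The plasma weight of one stretch of the chain\<close>

context cylinder
begin

text \<open>Up to normalisation the squared modulus of the Laughlin function of the particles in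
  \<open>I\<close>, multiplied by the modulus of \<open>exp (z / R) ^ (2 * s)\<close> for each of
  them: the influence of particles far to the left.\<close>

definition boltz :: "nat set \<Rightarrow> nat \<Rightarrow> (nat \<Rightarrow> complex) \<Rightarrow> real" where
  "boltz I s u = (\<Prod>(j, k)\<in>prs I. cmod (exp (u k / of_real R) - exp (u j / of_real R)) ^ (2 * p))
     * (\<Prod>j\<in>I. exp (2 * real s * Re (u j) / R - (Re (u j))\<^sup>2 / l\<^sup>2))"

lemma boltz_nonneg [simp]: "boltz I s u \<ge> 0"
  unfolding boltz_def by (intro mult_nonneg_nonneg prod_nonneg) auto

lemma boltz_cong: "(\<And>i. i \<in> I \<Longrightarrow> u i = v i) \<Longrightarrow> boltz I s u = boltz I s v"
  unfolding boltz_def by (intro arg_cong2[of _ _ _ _ "(*)"] prod.cong) (auto simp: prs_def)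

lemma boltz_measurable:
  assumes "finite I" "I \<subseteq> K"
  shows "boltz I s \<in> borel_measurable (PM K)"
proof -
  have E: "(\<lambda>u. exp (u k / of_real R)) \<in> borel_measurable (PM K)" if "k \<in> I" for k
    using that assms by (intro measurable_coord[where f = "\<lambda>z. exp (z / of_real R)"]) auto
  have G: "(\<lambda>u. exp (2 * real s * Re (u k) / R - (Re (u k))\<^sup>2 / l\<^sup>2)) \<in> borel_measurable (PM K)" if "k \<in> I" for k
    using that assms by (intro measurable_coord[where f = "\<lambda>z. exp (2 * real s * Re z / R - (Re z)\<^sup>2 / l\<^sup>2)"]) auto
  have H: "(\<lambda>u. cmod (exp (u k / of_real R) - exp (u j / of_real R))) \<in> borel_measurable (PM K)" if "j \<in> I" "k \<in> I" for j k
    by (intro measurable_compose[OF borel_measurable_diff borel_measurable_norm] E that)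
  show ?thesis
    unfolding boltz_def[abs_def] split_def
    by (intro borel_measurable_times borel_measurable_prod G borel_measurable_power H) (auto simp: prs_def)
qed

lemma boltz_perm:
  assumes I: "finite I" and \<sigma>: "\<sigma> permutes I"
  shows "boltz I s (perm_app I \<sigma> u) = boltz I s u"
proof -
  define h where "h u j k = cmod (exp (u k / of_real R) - exp (u j / of_real R)) ^ (2 * p)" for u :: "nat \<Rightarrow> complex" and j k
  have hs: "h u j k = h u k j" for u j k by (simp add: h_def norm_minus_commute)
  let ?D = "{(j, k). j \<in> I \<and> k \<in> I \<and> j \<noteq> k}"
  have inj: "inj \<sigma>" using \<sigma> by (rule permutes_inj)
  have "(\<Prod>(j, k)\<in>?D. h (perm_app I \<sigma> u) j k) = (\<Prod>(j, k)\<in>?D. h u (\<sigma> j) (\<sigma> k))"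
    by (intro prod.cong) (auto simp: h_def perm_app_def)
  also have "\<dots> = (\<Prod>(j, k)\<in>map_prod \<sigma> \<sigma> ` ?D. h u j k)"
    by (subst prod.reindex) (auto simp: inj_on_def split_def injD[OF inj])
  also have "map_prod \<sigma> \<sigma> ` ?D = ?D"
  proof (intro set_eqI iffI)
    fix P assume "P \<in> map_prod \<sigma> \<sigma> ` ?D"
    then show "P \<in> ?D" using permutes_in_image[OF \<sigma>] injD[OF inj] by auto
  next
    fix P assume P: "P \<in> ?D"
    have "P = map_prod \<sigma> \<sigma> (inv \<sigma> (fst P), inv \<sigma> (snd P))" using permutes_inverses[OF \<sigma>] by (cases P) simp
    moreover have "(inv \<sigma> (fst P), inv \<sigma> (snd P)) \<in> ?D"
      using P permutes_in_image[OF permutes_inv[OF \<sigma>]] permutes_inj[OF permutes_inv[OF \<sigma>]] by (auto dest: injD)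
    ultimately show "P \<in> map_prod \<sigma> \<sigma> ` ?D" by blast
  qed
  finally have "((\<Prod>(j, k)\<in>prs I. h (perm_app I \<sigma> u) j k))\<^sup>2 = ((\<Prod>(j, k)\<in>prs I. h u j k))\<^sup>2"
    using prod_prs_sq[OF I, of "h (perm_app I \<sigma> u)", OF hs] prod_prs_sq[OF I, of "h u", OF hs] by (simp add: power2_eq_square)
  moreover have "(\<Prod>(j, k)\<in>prs I. h v j k) \<ge> 0" for v by (intro prod_nonneg) (auto simp: h_def)
  ultimately have 1: "(\<Prod>(j, k)\<in>prs I. h (perm_app I \<sigma> u) j k) = (\<Prod>(j, k)\<in>prs I. h u j k)"
    by (meson power2_eq_iff_nonneg)
  have 2: "(\<Prod>j\<in>I. exp (2 * real s * Re (perm_app I \<sigma> u j) / R - (Re (perm_app I \<sigma> u j))\<^sup>2 / l\<^sup>2))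
      = (\<Prod>j\<in>I. exp (2 * real s * Re (u j) / R - (Re (u j))\<^sup>2 / l\<^sup>2))"
    using prod.permute[OF \<sigma>, of "\<lambda>j. exp (2 * real s * Re (u j) / R - (Re (u j))\<^sup>2 / l\<^sup>2)"]
    by (simp add: perm_app_def comp_def)
  show ?thesis using 1 unfolding boltz_def 2 h_def by simp
qed

text \<open>The sum of the squares of \<open>s + p * j\<close> for \<open>j < n\<close>: the energy
  of the reference configuration shifted by \<open>s\<close>.\<close>

definition es :: "nat \<Rightarrow> nat \<Rightarrow> real" where
  "es n s = e0 n + 2 * real s * real (tri p n) + real n * (real s)\<^sup>2"

lemma orb_sum_boltz:
  "orb_sum (orbs p n n) n i0 s (\<lambda>xs. complex_of_real (amp p xs)) u * cnj (orb_sum (orbs p n n) n i0 s (\<lambda>xs. complex_of_real (amp p xs)) u)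
    = of_real (boltz {i0..<i0 + n} s u)"
proof -
  let ?I = "{i0..<i0 + n}"
  let ?c = "\<lambda>xs. complex_of_real (amp p xs)"
  let ?F = "\<lambda>u. orb_sum (orbs p n n) n i0 s ?c u"
  define w where "w j = u (i0 + j)" for j
  have "?F u = (\<Sum>xs\<in>orbs p n n. ?c xs * (\<Prod>v<n. exp (w v / of_real R) ^ (xs ! v))) * (\<Prod>v<n. exp (w v / of_real R) ^ s * of_real (exp (- (Re (w v))\<^sup>2 / (2 * l\<^sup>2))))"
    unfolding phi_def w_def[symmetric] by (simp add: power_add prod.distrib sum_distrib_right mult.assoc)
  also have "(\<Sum>xs\<in>orbs p n n. ?c xs * (\<Prod>v<n. exp (w v / of_real R) ^ (xs ! v))) = (\<Prod>k<n. \<Prod>j<k. (exp (w k / of_real R) - exp (w j / of_real R)) ^ p)"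
    by (rule vandermonde_expansion[OF p_pos, symmetric])
  finally have F: "?F u = (\<Prod>k<n. \<Prod>j<k. (exp (w k / of_real R) - exp (w j / of_real R)) ^ p)
     * (\<Prod>v<n. exp (w v / of_real R) ^ s * of_real (exp (- (Re (w v))\<^sup>2 / (2 * l\<^sup>2))))" .
  have "(cmod (?F u))\<^sup>2 = (\<Prod>k<n. \<Prod>j<k. cmod (exp (w k / of_real R) - exp (w j / of_real R)) ^ (2 * p))
     * (\<Prod>v<n. exp (2 * real s * Re (w v) / R - (Re (w v))\<^sup>2 / l\<^sup>2))"
  proof -
    have "(cmod (exp (z / of_real R) ^ s * of_real (exp (- (Re z)\<^sup>2 / (2 * l\<^sup>2)))))\<^sup>2 = exp (2 * real s * Re z / R - (Re z)\<^sup>2 / l\<^sup>2)" for z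
    proof -
      have "cmod (exp (z / of_real R)) = exp (Re z / R)" by simp
      then have "cmod (exp (z / of_real R) ^ s * of_real (exp (- (Re z)\<^sup>2 / (2 * l\<^sup>2)))) = exp (Re z / R) ^ s * exp (- (Re z)\<^sup>2 / (2 * l\<^sup>2))"
        by (simp add: norm_mult norm_power)
      also have "\<dots> = exp (real s * (Re z / R) + - (Re z)\<^sup>2 / (2 * l\<^sup>2))"
        unfolding exp_of_nat_mult[symmetric] exp_add ..
      finally have "cmod (exp (z / of_real R) ^ s * of_real (exp (- (Re z)\<^sup>2 / (2 * l\<^sup>2)))) = exp (real s * (Re z / R) + - (Re z)\<^sup>2 / (2 * l\<^sup>2))" .
      then show ?thesis by (simp add: exp_double[symmetric] algebra_simps)
    qed
    then have W: "(cmod (\<Prod>v<n. exp (w v / of_real R) ^ s * of_real (exp (- (Re (w v))\<^sup>2 / (2 * l\<^sup>2)))))\<^sup>2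
        = (\<Prod>v<n. exp (2 * real s * Re (w v) / R - (Re (w v))\<^sup>2 / l\<^sup>2))"
      by (simp only: prod_norm[symmetric] prod_power_distrib)
    have V: "(cmod (\<Prod>k<n. \<Prod>j<k. (exp (w k / of_real R) - exp (w j / of_real R)) ^ p))\<^sup>2
        = (\<Prod>k<n. \<Prod>j<k. cmod (exp (w k / of_real R) - exp (w j / of_real R)) ^ (2 * p))"
      by (simp only: prod_norm[symmetric] prod_power_distrib norm_power power_mult[symmetric] mult.commute[of p 2])
    show ?thesis unfolding F norm_mult[of "prod _ _"] power_mult_distrib V W ..
  qed
  also have "(\<Prod>k<n. \<Prod>j<k. cmod (exp (w k / of_real R) - exp (w j / of_real R)) ^ (2 * p))
     = (\<Prod>(j, k)\<in>prs ?I. cmod (exp (u k / of_real R) - exp (u j / of_real R)) ^ (2 * p))"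
  proof -
    have "(\<Prod>k<n. \<Prod>j<k. cmod (exp (w k / of_real R) - exp (w j / of_real R)) ^ (2 * p))
      = (\<Prod>(k, j)\<in>(SIGMA k:{..<n}. {..<k}). cmod (exp (w k / of_real R) - exp (w j / of_real R)) ^ (2 * p))"
      by (subst prod.Sigma) auto
    also have "\<dots> = (\<Prod>(j, k)\<in>prs ?I. cmod (exp (u k / of_real R) - exp (u j / of_real R)) ^ (2 * p))"
      by (rule prod.reindex_bij_witness[where i = "\<lambda>(j, k). (k - i0, j - i0)" and j = "\<lambda>(k, j). (i0 + j, i0 + k)"])
         (auto simp: prs_def w_def)
    finally show ?thesis .
  qed
  also have "(\<Prod>v<n. exp (2 * real s * Re (w v) / R - (Re (w v))\<^sup>2 / l\<^sup>2)) = (\<Prod>j\<in>?I. exp (2 * real s * Re (u j) / R - (Re (u j))\<^sup>2 / l\<^sup>2))"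
    by (rule prod.reindex_bij_witness[where i = "\<lambda>j. j - i0" and j = "\<lambda>v. i0 + v"]) (auto simp: w_def)
  finally have "(cmod (?F u))\<^sup>2 = boltz ?I s u" by (simp add: boltz_def)
  then show ?thesis unfolding complex_norm_square[symmetric] by (rule arg_cong)
qed

text \<open>All monomials have the same degree, so the shift by \<open>s\<close> multiplies every
  term by the same factor, and \<open>s\<close> enters only through \<open>es\<close>.\<close>

lemma nn_integral_boltz:
  "(\<integral>\<^sup>+u. boltz {i0..<i0 + n} s u \<partial>PM {i0..<i0 + n}) = ennreal (fact n * (nu0 ^ n * exp (l\<^sup>2 / R\<^sup>2 * es n s) * C n))"
proof -
  let ?I = "{i0..<i0 + n}"
  let ?c = "\<lambda>xs. complex_of_real (amp p xs)"
  have hb: "has_bochner_integral (PM ?I) (\<lambda>u. complex_of_real (boltz ?I s u))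
      (\<Sum>xs\<in>orbs p n n. ?c xs * cnj (?c xs) * (\<Prod>j<n. of_real (nu (xs ! j + s))))"
    using parseval_orbs[OF refl, where N = n and n = n and ?i0.0 = i0 and s = s and c = ?c and d = ?c] unfolding orb_sum_boltz .
  have val: "(\<Sum>xs\<in>orbs p n n. ?c xs * cnj (?c xs) * (\<Prod>j<n. of_real (nu (xs ! j + s)))) = of_real (fact n * (nu0 ^ n * exp (l\<^sup>2 / R\<^sup>2 * es n s) * C n))"
  proof -
    have "?c xs * cnj (?c xs) * (\<Prod>j<n. of_real (nu (xs ! j + s)))
        = of_real (exp (l\<^sup>2 / R\<^sup>2 * (2 * real s * real (tri p n) + real n * (real s)\<^sup>2)) * (amp p xs * amp p xs * (\<Prod>j<n. nu (xs ! j))))"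
      if xs: "xs \<in> orbs p n n" for xs
    proof (cases "amp p xs = 0")
      case False
      have lx: "length xs = n" using xs by (simp add: orbs_def)
      have sl: "sum_list xs = tri p n" using amp_sum_list[OF False] lx by simp
      have "(\<Prod>j<n. nu (xs ! j + s)) = nu0 ^ n * exp (l\<^sup>2 / R\<^sup>2 * en (map (\<lambda>x. x + s) xs))"
        using prod_nu[of "map (\<lambda>x. x + s) xs"] lx by simp
      also have "en (map (\<lambda>x. x + s) xs) = en xs + (2 * real s * real (tri p n) + real n * (real s)\<^sup>2)"
        by (simp add: en_shift sl lx)
      also have "nu0 ^ n * exp (l\<^sup>2 / R\<^sup>2 * (en xs + (2 * real s * real (tri p n) + real n * (real s)\<^sup>2)))
        = exp (l\<^sup>2 / R\<^sup>2 * (2 * real s * real (tri p n) + real n * (real s)\<^sup>2)) * (nu0 ^ n * exp (l\<^sup>2 / R\<^sup>2 * en xs))"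
        unfolding distrib_left[of _ "en xs"] exp_add by (simp only: ac_simps)
      also have "nu0 ^ n * exp (l\<^sup>2 / R\<^sup>2 * en xs) = (\<Prod>j<n. nu (xs ! j))" using prod_nu[of xs] lx by simp
      finally have pn: "(\<Prod>j<n. nu (xs ! j + s)) = exp (l\<^sup>2 / R\<^sup>2 * (2 * real s * real (tri p n) + real n * (real s)\<^sup>2)) * (\<Prod>j<n. nu (xs ! j))" .
      show ?thesis unfolding of_real_prod[symmetric] pn by (simp only: complex_cnj_complex_of_real of_real_mult ac_simps)
    qed simp
    then have "(\<Sum>xs\<in>orbs p n n. ?c xs * cnj (?c xs) * (\<Prod>j<n. of_real (nu (xs ! j + s))))
       = of_real (exp (l\<^sup>2 / R\<^sup>2 * (2 * real s * real (tri p n) + real n * (real s)\<^sup>2)) * (\<Sum>xs\<in>orbs p n n. amp p xs * amp p xs * (\<Prod>j<n. nu (xs ! j))))"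
      by (simp only: of_real_sum sum_distrib_left cong: sum.cong)
    also have "(\<Sum>xs\<in>orbs p n n. amp p xs * amp p xs * (\<Prod>j<n. nu (xs ! j))) = nu0 ^ n * exp (l\<^sup>2 / R\<^sup>2 * e0 n) * (fact n * Gam n [] [])"
      using layers_sum[of "[]" 0 "[]" n] by (simp add: en_def)
    also have "Gam n [] [] = C n" by (rule Gam_Nil)
    finally show ?thesis by (simp add: es_def distrib_left exp_add ac_simps)
  qed
  have "(\<integral>\<^sup>+u. boltz ?I s u \<partial>PM ?I) = ennreal (\<integral>u. boltz ?I s u \<partial>PM ?I)"
  proof (rule nn_integral_eq_integral)
    have "integrable (PM ?I) (\<lambda>u. complex_of_real (boltz ?I s u))" using hb unfolding has_bochner_integral_iff by blast
    then have "integrable (PM ?I) (\<lambda>u. Re (complex_of_real (boltz ?I s u)))" by (rule integrable_Re)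
    then show "integrable (PM ?I) (boltz ?I s)" by simp
  qed simp
  also have "(\<integral>u. boltz ?I s u \<partial>PM ?I) = fact n * (nu0 ^ n * exp (l\<^sup>2 / R\<^sup>2 * es n s) * C n)"
    using has_bochner_integral_integral_eq[OF hb] unfolding val integral_complex_of_real of_real_eq_iff .
  finally show ?thesis .
qed

lemma nn_integral_boltz_srt:
  "(\<integral>\<^sup>+u. ennreal (boltz {i0..<i0 + n} s u) * indicator (Collect (srt {i0..<i0 + n})) u \<partial>PM {i0..<i0 + n})
    = ennreal (nu0 ^ n * exp (l\<^sup>2 / R\<^sup>2 * es n s) * C n)"
proof -
  let ?I = "{i0..<i0 + n}"
  let ?X = "\<integral>\<^sup>+u. ennreal (boltz ?I s u) * indicator (Collect (srt ?I)) u \<partial>PM ?I"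
  have ef: "(fact n :: ennreal) = ennreal (fact n)"
    by (metis ennreal_of_nat_eq_real_of_nat of_nat_fact)
  have "ennreal (fact n) * ennreal (nu0 ^ n * exp (l\<^sup>2 / R\<^sup>2 * es n s) * C n) = ennreal (fact n) * ?X"
    using sort_integral[of ?I "\<lambda>u. ennreal (boltz ?I s u)"] boltz_measurable[of ?I ?I s] boltz_perm[of ?I _ s]
      nn_integral_boltz[of i0 n s] nu0_pos C_nonneg[of n]
    by (simp add: ennreal_mult[symmetric] ef)
  moreover have "ennreal (fact n) \<noteq> 0" "ennreal (fact n) \<noteq> top"
    by (simp_all add: ennreal_eq_0_iff not_le)
  ultimately show ?thesis unfolding ennreal_mult_cancel_left by metis
qed

end

section \<open>Cutting the chain\<close>

context ordered_chain
begin

text \<open>Take \<^term>\<open>L\<close> to be the largest distance from \<^term>\<open>k0\<close> at which a particle has moved towards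
  \<^term>\<open>k0\<close> by more than an eighth of that distance.\<close>
lemma tame_radius:
  obtains L' where "L' \<le> N" "tame_chain a R l N k0 L' x"
    "L' = 0 \<or> (\<exists>i<N. i < k0 \<and> k0 - i = L' \<and> dev i > a * real L' / 8 \<or> k0 \<le> i \<and> i - k0 = L' \<and> - dev i > a * real L' / 8)"
proof -
  define bad where "bad d \<longleftrightarrow> (\<exists>i<N. i < k0 \<and> k0 - i = d \<and> dev i > a * real d / 8 \<or> k0 \<le> i \<and> i - k0 = d \<and> - dev i > a * real d / 8)" for d
  have bN: "d \<le> N" if "bad d" for d
  proof -
    obtain i where "i < N" "k0 - i = d \<or> i - k0 = d" using \<open>bad d\<close> unfolding bad_def by blast
    then show ?thesis using k0 by linarith
  qed
  have "{d. bad d} \<subseteq> {..N}" using bN by blast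
  then have fin: "finite {d. bad d}" using finite_subset by blast
  define L' where "L' = (if {d. bad d} = {} then 0 else Max {d. bad d})"
  have max: "d \<le> L'" if "bad d" for d
    unfolding L'_def using Max_ge[OF fin, of d] that by auto
  have L': "L' = 0 \<or> bad L'" using Max_in[OF fin] unfolding L'_def by auto
  have oc: "ordered_chain a R l N k0 x" by unfold_locales
  show thesis
  proof (rule that)
    show "L' \<le> N" using L' bN[of L'] by blast
    show "L' = 0 \<or> (\<exists>i<N. i < k0 \<and> k0 - i = L' \<and> dev i > a * real L' / 8 \<or> k0 \<le> i \<and> i - k0 = L' \<and> - dev i > a * real L' / 8)"
      using L' unfolding bad_def .
    show "tame_chain a R l N k0 L' x"
    proof (intro tame_chain.intro tame_chain_axioms.intro oc)
      fix i assume i: "i < ordered_chain.lo k0 L'"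
      then have ik: "L' < k0 - i" "i < k0" by (auto simp: ordered_chain.lo_def[OF oc])
      then have "\<not> bad (k0 - i)" using max by (meson not_le)
      then have "\<not> dev i > a * real (k0 - i) / 8" using ik k0 unfolding bad_def by (metis order.strict_trans2)
      then show "ordered_chain.dev a x i \<le> a * (real k0 - real i) / 8"
        using ik by (simp add: of_nat_diff)
    next
      fix i assume i: "ordered_chain.hi N k0 L' \<le> i" "i < N"
      then have ik: "L' < i - k0" "k0 \<le> i" by (auto simp: ordered_chain.hi_def[OF oc])
      then have "\<not> bad (i - k0)" using max by (meson not_le)
      then have "\<not> - dev i > a * real (i - k0) / 8" using ik i unfolding bad_def by metis
      then show "- ordered_chain.dev a x i \<le> a * (real i - real k0) / 8"
        using ik by (simp add: of_nat_diff)
    qed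
  qed
qed

end

context cylinder
begin

text \<open>The particles of the reference configuration occupy every \<open>p\<close>-th orbital,
  and the centres of neighbouring orbitals are \<open>l\<^sup>2 / R\<close> apart.\<close>

definition spac :: real where "spac = real p * l\<^sup>2 / R"

lemma spac_pos: "spac > 0" using R_pos l_pos p_pos by (simp add: spac_def)

lemma nn_integral_split:
  assumes I: "finite I" "finite J" "I \<inter> J = {}"
    and f: "f \<in> borel_measurable (PM (I \<union> J))" "f \<in> borel_measurable (PM I)"
    and h: "h \<in> borel_measurable (PM (I \<union> J))" "h \<in> borel_measurable (PM J)"
    and df: "\<And>u v. (\<And>i. i \<in> I \<Longrightarrow> u i = v i) \<Longrightarrow> f u = f v"
    and dh: "\<And>u v. (\<And>i. i \<in> J \<Longrightarrow> u i = v i) \<Longrightarrow> h u = h v"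
  shows "(\<integral>\<^sup>+u. f u * h u \<partial>PM (I \<union> J)) = (\<integral>\<^sup>+u. f u \<partial>PM I) * (\<integral>\<^sup>+u. h u \<partial>PM J)"
proof -
  have "(\<integral>\<^sup>+u. f u * h u \<partial>PM (I \<union> J)) = (\<integral>\<^sup>+x. \<integral>\<^sup>+y. f (merge I J (x, y)) * h (merge I J (x, y)) \<partial>PM J \<partial>PM I)"
    using I f(1) h(1) by (intro product_nn_integral_fold) auto
  also have "\<dots> = (\<integral>\<^sup>+x. \<integral>\<^sup>+y. f x * h y \<partial>PM J \<partial>PM I)"
    using I(3) by (intro nn_integral_cong arg_cong2[of _ _ _ _ "(*)"] df dh) (auto simp: merge_def)
  also have "\<dots> = (\<integral>\<^sup>+x. f x * (\<integral>\<^sup>+y. h y \<partial>PM J) \<partial>PM I)"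
    using h(2) by (intro nn_integral_cong nn_integral_cmult) auto
  also have "\<dots> = (\<integral>\<^sup>+u. f u \<partial>PM I) * (\<integral>\<^sup>+u. h u \<partial>PM J)"
    using f(2) by (intro nn_integral_multc) auto
  finally show ?thesis .
qed

abbreviation chain where "chain N k0 L u \<equiv> tame_chain spac R l N k0 L (\<lambda>i. Re (u i))"

abbreviation blo where "blo k0 L \<equiv> ordered_chain.lo k0 L"
abbreviation bhi where "bhi N k0 L \<equiv> ordered_chain.hi N k0 L"
abbreviation bdev where "bdev u i \<equiv> ordered_chain.dev spac (\<lambda>i. Re (u i)) i"
abbreviation boths where "boths N k0 L \<equiv> ordered_chain.others N k0 L"

text \<open>In every pair of \<open>others\<close> only the exponential of the particle with the
  larger label is kept; the correction is at most the exponential of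
  \<open>exp (- (Re (u k) - Re (u j)) / R)\<close>. A block particle \<open>k\<close> then sees
  \<open>k\<close> such factors and becomes an independent Gaussian centred at
  \<open>k * spac\<close>, while a particle of the right stretch sees \<open>bhi N k0 L\<close> of
  them, which is the shift in its \<open>boltz\<close>.\<close>

lemma boltz_factor:
  assumes "chain N k0 L u"
  defines "A \<equiv> {..<blo k0 L}" and "B \<equiv> {blo k0 L..<bhi N k0 L}" and "D \<equiv> {bhi N k0 L..<N}"
  shows "boltz {..<N} 0 u \<le> boltz A 0 u * boltz D (p * bhi N k0 L) u
    * (\<Prod>k\<in>B. exp ((real k * spac)\<^sup>2 / l\<^sup>2 - (bdev u k)\<^sup>2 / l\<^sup>2))
    * exp (2 * real p * (\<Sum>(j, k)\<in>boths N k0 L. exp (- (Re (u k) - Re (u j)) / R)))"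
proof -
  interpret tame_chain spac R l N k0 L "\<lambda>i. Re (u i)" by fact
  have AB: "A = {..<lo}" "B = {lo..<hi}" "D = {hi..<N}" by (simp_all add: A_def B_def D_def)
  have hN: "hi \<le> N" by (simp add: hi_def)
  let ?w = "\<lambda>k. exp (u k / complex_of_real R)"
  let ?h = "\<lambda>(j, k). cmod (?w k - ?w j) ^ (2 * p)"
  let ?g = "\<lambda>j. exp (- (Re (u j))\<^sup>2 / l\<^sup>2)"
  have hnn: "?h P \<ge> 0" for P by (cases P) simp
  have split: "prs {..<N} = (prs A \<union> prs D) \<union> others"
    using lo_le_hi hN unfolding AB by (auto simp: prs_def others_def)
  have "prod ?h (prs {..<N}) = (prod ?h (prs A) * prod ?h (prs D)) * prod ?h others"
    unfolding split
    by (subst prod.union_disjoint, simp add: AB, rule finite_others, use lo_le_hi in \<open>force simp: AB prs_def others_def\<close>,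
        subst prod.union_disjoint, simp add: AB, simp add: AB, use lo_le_hi in \<open>force simp: AB prs_def\<close>, rule refl)
  moreover have "prod ?h others \<le> (\<Prod>(j, k)\<in>others. exp (2 * real p * Re (u k) / R) * exp (2 * real p * exp (- (Re (u k) - Re (u j)) / R)))"
  proof (rule prod_mono)
    fix P assume P: "P \<in> others"
    obtain j k where jk: "P = (j, k)" by (cases P)
    have "cmod (?w k - ?w j) \<le> exp (Re (u k) / R) + exp (Re (u j) / R)"
      by (rule order.trans[OF norm_triangle_ineq4]) simp
    also have "\<dots> = exp (Re (u k) / R) * (1 + exp (- (Re (u k) - Re (u j)) / R))"
      by (simp add: distrib_left diff_divide_distrib flip: exp_add)
    also have "\<dots> \<le> exp (Re (u k) / R) * exp (exp (- (Re (u k) - Re (u j)) / R))"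
      by (intro mult_left_mono exp_ge_add_one_self) auto
    finally have "cmod (?w k - ?w j) ^ (2 * p) \<le> (exp (Re (u k) / R) * exp (exp (- (Re (u k) - Re (u j)) / R))) ^ (2 * p)"
      by (intro power_mono) auto
    also have "\<dots> = exp (2 * real p * Re (u k) / R) * exp (2 * real p * exp (- (Re (u k) - Re (u j)) / R))"
      unfolding power_mult_distrib exp_of_nat_mult[symmetric] by simp
    finally show "0 \<le> ?h P \<and> ?h P \<le> (case P of (j, k) \<Rightarrow> exp (2 * real p * Re (u k) / R) * exp (2 * real p * exp (- (Re (u k) - Re (u j)) / R)))"
      by (simp add: jk)
  qed
  moreover have "(\<Prod>(j, k)\<in>others. exp (2 * real p * Re (u k) / R) * exp (2 * real p * exp (- (Re (u k) - Re (u j)) / R)))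
     = ((\<Prod>k\<in>B. exp (2 * real (p * k) * Re (u k) / R)) * (\<Prod>k\<in>D. exp (2 * real (p * hi) * Re (u k) / R)))
       * exp (2 * real p * (\<Sum>(j, k)\<in>others. exp (- (Re (u k) - Re (u j)) / R)))"
  proof -
    have "(\<Prod>(j, k)\<in>others. exp (2 * real p * Re (u k) / R)) = (\<Prod>(k, j)\<in>(SIGMA k:B. {..<k}) \<union> (SIGMA k:D. {..<hi}). exp (2 * real p * Re (u k) / R))"
      by (rule prod.reindex_bij_witness[where i = "\<lambda>(k, j). (j, k)" and j = "\<lambda>(j, k). (k, j)"])
         (use lo_le_hi hN in \<open>auto simp: AB others_def\<close>)
    also have "\<dots> = (\<Prod>(k, j)\<in>(SIGMA k:B. {..<k}). exp (2 * real p * Re (u k) / R)) * (\<Prod>(k, j)\<in>(SIGMA k:D. {..<hi}). exp (2 * real p * Re (u k) / R))"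
      by (rule prod.union_disjoint) (auto simp: AB)
    also have "(\<Prod>(k, j)\<in>(SIGMA k:B. {..<k}). exp (2 * real p * Re (u k) / R)) = (\<Prod>k\<in>B. exp (2 * real (p * k) * Re (u k) / R))"
      by (subst prod.Sigma[symmetric]) (auto simp: AB ac_simps simp flip: exp_of_nat_mult)
    also have "(\<Prod>(k, j)\<in>(SIGMA k:D. {..<hi}). exp (2 * real p * Re (u k) / R)) = (\<Prod>k\<in>D. exp (2 * real (p * hi) * Re (u k) / R))"
      by (subst prod.Sigma[symmetric]) (auto simp: AB ac_simps simp flip: exp_of_nat_mult)
    finally have "(\<Prod>(j, k)\<in>others. exp (2 * real p * Re (u k) / R)) = (\<Prod>k\<in>B. exp (2 * real (p * k) * Re (u k) / R)) * (\<Prod>k\<in>D. exp (2 * real (p * hi) * Re (u k) / R))" .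
    moreover have "(\<Prod>(j, k)\<in>others. exp (2 * real p * exp (- (Re (u k) - Re (u j)) / R))) = exp (2 * real p * (\<Sum>(j, k)\<in>others. exp (- (Re (u k) - Re (u j)) / R)))"
      by (simp add: split_def sum_distrib_left exp_sum finite_others)
    ultimately show ?thesis by (simp only: split_def prod.distrib)
  qed
  ultimately have pairs: "prod ?h (prs {..<N}) \<le> (prod ?h (prs A) * prod ?h (prs D)) *
      (((\<Prod>k\<in>B. exp (2 * real (p * k) * Re (u k) / R)) * (\<Prod>k\<in>D. exp (2 * real (p * hi) * Re (u k) / R)))
       * exp (2 * real p * (\<Sum>(j, k)\<in>others. exp (- (Re (u k) - Re (u j)) / R))))"
    by (metis (no_types, lifting) hnn mult_left_mono mult_nonneg_nonneg prod_nonneg)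
  have sets: "{..<N} = (A \<union> B) \<union> D" using lo_le_hi hN by (auto simp: AB)
  have gs: "prod ?g {..<N} = prod ?g A * prod ?g B * prod ?g D"
  proof -
    have "prod ?g ((A \<union> B) \<union> D) = prod ?g (A \<union> B) * prod ?g D"
      by (rule prod.union_disjoint) (use lo_le_hi in \<open>auto simp: AB\<close>)
    moreover have "prod ?g (A \<union> B) = prod ?g A * prod ?g B"
      by (rule prod.union_disjoint) (auto simp: AB)
    ultimately show ?thesis unfolding sets by simp
  qed
  have gB: "exp (2 * real (p * k) * Re (u k) / R) * ?g k = exp ((real k * spac)\<^sup>2 / l\<^sup>2 - (bdev u k)\<^sup>2 / l\<^sup>2)" for k
  proof -
    have "2 * real (p * k) * Re (u k) / R = 2 * (real k * spac) * Re (u k) / l\<^sup>2"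
      using l_pos R_pos by (simp add: spac_def field_simps)
    then have "2 * real (p * k) * Re (u k) / R + - (Re (u k))\<^sup>2 / l\<^sup>2 = (real k * spac)\<^sup>2 / l\<^sup>2 - (bdev u k)\<^sup>2 / l\<^sup>2"
      by (simp add: dev_def power2_diff diff_divide_distrib add_divide_distrib)
    then show ?thesis by (simp flip: exp_add)
  qed
  have bD: "boltz D (p * hi) u = prod ?h (prs D) * ((\<Prod>k\<in>D. exp (2 * real (p * hi) * Re (u k) / R)) * prod ?g D)"
    unfolding boltz_def prod.distrib[symmetric] exp_add[symmetric] by (simp add: split_def)
  have b0: "boltz S 0 u = prod ?h (prs S) * prod ?g S" for S
    unfolding boltz_def by (simp add: split_def)
  have gnn: "prod ?g S \<ge> 0" for S by (intro prod_nonneg) auto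
  have "boltz {..<N} 0 u = prod ?h (prs {..<N}) * (prod ?g A * prod ?g B * prod ?g D)"
    unfolding b0 gs ..
  also have "\<dots> \<le> ((prod ?h (prs A) * prod ?h (prs D)) *
      (((\<Prod>k\<in>B. exp (2 * real (p * k) * Re (u k) / R)) * (\<Prod>k\<in>D. exp (2 * real (p * hi) * Re (u k) / R)))
       * exp (2 * real p * (\<Sum>(j, k)\<in>others. exp (- (Re (u k) - Re (u j)) / R))))) * (prod ?g A * prod ?g B * prod ?g D)"
    using pairs gnn by (intro mult_right_mono mult_nonneg_nonneg)
  also have "\<dots> = boltz A 0 u * boltz D (p * hi) u * (\<Prod>k\<in>B. exp (2 * real (p * k) * Re (u k) / R) * ?g k)
     * exp (2 * real p * (\<Sum>(j, k)\<in>others. exp (- (Re (u k) - Re (u j)) / R)))"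
    unfolding b0 bD prod.distrib by (simp only: ac_simps)
  finally show ?thesis unfolding gB .
qed

text \<open>This and \<open>c_pair\<close> are \<open>2 * p\<close> times the constants of
  \<open>others_sum_le\<close> at spacing \<open>spac\<close>; \<open>c_cloud\<close> is the part of
  the bound of \<open>cloud_sum_le\<close> without \<open>L\<close>.\<close>

definition c_dev :: real where "c_dev = 16 * real p / spac"

definition c_pair :: real where
  "c_pair = 2 * real p * (2 / (1 - exp (- spac / (2 * R))) + 1 / (1 - exp (- spac / (2 * R)))\<^sup>2 + 8)"

definition c_cloud :: real where "c_cloud = 4 + 2 / (1 - exp (- 9 * spac\<^sup>2 / (128 * l\<^sup>2)))"

text \<open>The Gaussian exponent \<open>(dev k)\<^sup>2 / l\<^sup>2\<close> of a block particle is
  spent in three parts. A quarter absorbs the term linear in the displacement, at the price of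
  \<open>c_dev\<^sup>2 * l\<^sup>2\<close>; a half pays for the cubic term in \<open>cst\<close>;
  the last quarter stays here, so that the block can be integrated.\<close>

definition blk :: "nat \<Rightarrow> complex \<Rightarrow> real" where
  "blk k z = exp ((real k * spac)\<^sup>2 / l\<^sup>2 + c_dev\<^sup>2 * l\<^sup>2 - (Re z - real k * spac)\<^sup>2 / (4 * l\<^sup>2))"

definition cst :: "real \<Rightarrow> nat \<Rightarrow> real" where
  "cst t L = exp (c_pair * (2 * real L + 1)\<^sup>2 + t * (2 * real L + c_cloud) - spac\<^sup>2 * real L ^ 3 / (8192 * l\<^sup>2))"

definition cloud :: "nat \<Rightarrow> real \<Rightarrow> (nat \<Rightarrow> complex) \<Rightarrow> real" where
  "cloud N xi u = (\<Sum>i<N. exp (- (Re (u i) - xi)\<^sup>2 / (2 * l\<^sup>2)))"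

lemma boltz_pointwise:
  assumes s: "srt {..<N} u" and k0: "k0 \<le> N" and xi: "real k0 * spac \<le> xi" "xi \<le> real k0 * spac + spac" and t: "t \<ge> 0"
  obtains L where "L \<le> N"
    "boltz {..<N} 0 u * exp (t * cloud N xi u) \<le> boltz {..<blo k0 L} 0 u * boltz {bhi N k0 L..<N} (p * bhi N k0 L) u
      * (\<Prod>k\<in>{blo k0 L..<bhi N k0 L}. blk k (u k)) * cst t L"
proof -
  interpret oc: ordered_chain spac R l N k0 0 "\<lambda>i. Re (u i)"
  proof
    show "spac > 0" "R > 0" "l > 0" "k0 \<le> N" using spac_pos R_pos l_pos k0 by auto
    fix i j assume "i \<le> j" "j < N"
    then show "Re (u i) \<le> Re (u j)" using s by (cases "i = j") (auto simp: srt_def)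
  qed
  obtain L where L: "L \<le> N" "chain N k0 L u"
    "L = 0 \<or> (\<exists>i<N. i < k0 \<and> k0 - i = L \<and> bdev u i > spac * real L / 8 \<or> k0 \<le> i \<and> i - k0 = L \<and> - bdev u i > spac * real L / 8)"
    by (rule oc.tame_radius)
  interpret tame_chain spac R l N k0 L "\<lambda>i. Re (u i)" by (rule L(2))
  let ?B = "{lo..<hi}"
  have gain: "(\<Sum>i\<in>?B. (dev i)\<^sup>2) \<ge> spac\<^sup>2 * real L ^ 3 / 4096"
  proof (cases "L = 0")
    case False
    then obtain i where "i < N" "i < k0 \<and> k0 - i = L \<and> dev i > spac * real L / 8 \<or> k0 \<le> i \<and> i - k0 = L \<and> - dev i > spac * real L / 8"
      using L(3) by blast
    then show ?thesis using False by (intro energy_gain) auto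
  qed (simp add: sum_nonneg)
  have oth: "2 * real p * (\<Sum>(j, k)\<in>others. exp (- (Re (u k) - Re (u j)) / R)) \<le> c_pair * (2 * real L + 1)\<^sup>2 + (\<Sum>i\<in>?B. c_dev * \<bar>dev i\<bar>)"
  proof -
    have "2 * real p * (\<Sum>(j, k)\<in>others. exp (- (Re (u k) - Re (u j)) / R))
       \<le> 2 * real p * ((2 / (1 - ratio) + 1 / (1 - ratio)\<^sup>2 + 8) * (2 * real L + 1)\<^sup>2 + 8 / spac * (\<Sum>i\<in>?B. \<bar>dev i\<bar>))"
      by (intro mult_left_mono others_sum_le) auto
    also have "\<dots> = c_pair * (2 * real L + 1)\<^sup>2 + c_dev * (\<Sum>i\<in>?B. \<bar>dev i\<bar>)"
    proof -
      have "2 * P * (Q * W + 8 / d * S) = (2 * P * Q) * W + (16 * P / d) * S" for P Q W S d :: real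
        by (simp add: algebra_simps)
      then show ?thesis unfolding c_pair_def c_dev_def ratio_def .
    qed
    finally show ?thesis by (simp add: sum_distrib_left)
  qed
  have quad: "c_dev * \<bar>d\<bar> \<le> c_dev\<^sup>2 * l\<^sup>2 + d\<^sup>2 / (4 * l\<^sup>2)" for d
  proof -
    have "0 \<le> (c_dev * l - \<bar>d\<bar> / (2 * l))\<^sup>2" by simp
    also have "\<dots> = c_dev\<^sup>2 * l\<^sup>2 + d\<^sup>2 / (4 * l\<^sup>2) - c_dev * \<bar>d\<bar>"
      using l_pos by (simp add: power2_diff power_mult_distrib power_divide)
    finally show ?thesis by simp
  qed
  have cl: "t * cloud N xi u \<le> t * (2 * real L + c_cloud)"
    unfolding cloud_def c_cloud_def using t cloud_sum_le[OF xi] by (intro mult_left_mono) auto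
  have "(\<Prod>k\<in>?B. exp ((real k * spac)\<^sup>2 / l\<^sup>2 - (dev k)\<^sup>2 / l\<^sup>2)) * exp (2 * real p * (\<Sum>(j, k)\<in>others. exp (- (Re (u k) - Re (u j)) / R))) * exp (t * cloud N xi u)
     = exp ((\<Sum>k\<in>?B. (real k * spac)\<^sup>2 / l\<^sup>2 - (dev k)\<^sup>2 / l\<^sup>2) + 2 * real p * (\<Sum>(j, k)\<in>others. exp (- (Re (u k) - Re (u j)) / R)) + t * cloud N xi u)"
    by (simp add: exp_sum exp_add)
  also have "\<dots> \<le> exp ((\<Sum>k\<in>?B. (real k * spac)\<^sup>2 / l\<^sup>2 + c_dev\<^sup>2 * l\<^sup>2 - (Re (u k) - real k * spac)\<^sup>2 / (4 * l\<^sup>2))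
      + (c_pair * (2 * real L + 1)\<^sup>2 + t * (2 * real L + c_cloud) - spac\<^sup>2 * real L ^ 3 / (8192 * l\<^sup>2)))"
  proof -
    have "(\<Sum>k\<in>?B. (real k * spac)\<^sup>2 / l\<^sup>2 - (dev k)\<^sup>2 / l\<^sup>2) + (\<Sum>i\<in>?B. c_dev * \<bar>dev i\<bar>)
       \<le> (\<Sum>k\<in>?B. (real k * spac)\<^sup>2 / l\<^sup>2 + c_dev\<^sup>2 * l\<^sup>2 - (Re (u k) - real k * spac)\<^sup>2 / (4 * l\<^sup>2)) - (\<Sum>k\<in>?B. (dev k)\<^sup>2 / (2 * l\<^sup>2))"
    proof -
      have "(real k * spac)\<^sup>2 / l\<^sup>2 - (dev k)\<^sup>2 / l\<^sup>2 + c_dev * \<bar>dev k\<bar>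
         \<le> (real k * spac)\<^sup>2 / l\<^sup>2 + c_dev\<^sup>2 * l\<^sup>2 - (Re (u k) - real k * spac)\<^sup>2 / (4 * l\<^sup>2) - (dev k)\<^sup>2 / (2 * l\<^sup>2)" for k
      proof -
        define X where "X = (dev k)\<^sup>2 / (4 * l\<^sup>2)"
        have "(dev k)\<^sup>2 / l\<^sup>2 = 4 * X" "(dev k)\<^sup>2 / (2 * l\<^sup>2) = 2 * X" "(Re (u k) - real k * spac)\<^sup>2 / (4 * l\<^sup>2) = X"
          using l_pos by (simp_all add: X_def dev_def)
        then show ?thesis using quad[of "dev k"] X_def by linarith
      qed
      then show ?thesis unfolding sum.distrib[symmetric] sum_subtractf[symmetric] by (intro sum_mono)
    qed
    moreover have "(\<Sum>k\<in>?B. (dev k)\<^sup>2 / (2 * l\<^sup>2)) \<ge> spac\<^sup>2 * real L ^ 3 / (8192 * l\<^sup>2)"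
    proof -
      have "spac\<^sup>2 * real L ^ 3 / (8192 * l\<^sup>2) = spac\<^sup>2 * real L ^ 3 / 4096 / (2 * l\<^sup>2)" by simp
      also have "\<dots> \<le> (\<Sum>k\<in>?B. (dev k)\<^sup>2) / (2 * l\<^sup>2)" by (intro divide_right_mono gain) simp
      finally show ?thesis by (simp add: sum_divide_distrib)
    qed
    ultimately show ?thesis using oth cl by simp
  qed
  also have "\<dots> = (\<Prod>k\<in>?B. blk k (u k)) * cst t L"
    by (simp add: blk_def cst_def exp_sum exp_add)
  finally have main: "(\<Prod>k\<in>?B. exp ((real k * spac)\<^sup>2 / l\<^sup>2 - (dev k)\<^sup>2 / l\<^sup>2)) * exp (2 * real p * (\<Sum>(j, k)\<in>others. exp (- (Re (u k) - Re (u j)) / R))) * exp (t * cloud N xi u)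
     \<le> (\<Prod>k\<in>?B. blk k (u k)) * cst t L" .
  have "boltz {..<N} 0 u * exp (t * cloud N xi u) \<le> (boltz {..<lo} 0 u * boltz {hi..<N} (p * hi) u
    * (\<Prod>k\<in>?B. exp ((real k * spac)\<^sup>2 / l\<^sup>2 - (dev k)\<^sup>2 / l\<^sup>2))
    * exp (2 * real p * (\<Sum>(j, k)\<in>others. exp (- (Re (u k) - Re (u j)) / R)))) * exp (t * cloud N xi u)"
    by (intro mult_right_mono boltz_factor L(2)) simp
  also have "\<dots> = boltz {..<lo} 0 u * boltz {hi..<N} (p * hi) u
    * ((\<Prod>k\<in>?B. exp ((real k * spac)\<^sup>2 / l\<^sup>2 - (dev k)\<^sup>2 / l\<^sup>2))
    * exp (2 * real p * (\<Sum>(j, k)\<in>others. exp (- (Re (u k) - Re (u j)) / R))) * exp (t * cloud N xi u))"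
    by (simp only: mult.assoc)
  also have "\<dots> \<le> boltz {..<lo} 0 u * boltz {hi..<N} (p * hi) u * ((\<Prod>k\<in>?B. blk k (u k)) * cst t L)"
    by (intro mult_left_mono main mult_nonneg_nonneg) auto
  finally show thesis by (intro that[OF L(1)]) (simp only: mult.assoc)
qed

text \<open>Only a quarter of the Gaussian exponent is left, so the width doubles: this is the
  factor 2.\<close>

lemma nn_integral_blk:
  "(\<integral>\<^sup>+z. blk k z \<partial>cylM R) = ennreal (2 * exp (c_dev\<^sup>2 * l\<^sup>2) * nu0 * exp ((real k * spac)\<^sup>2 / l\<^sup>2))"
proof -
  let ?m = "real k * spac" and ?s = "sqrt 2 * l"
  have s: "?s > 0" using l_pos by simp
  let ?c = "exp ((real k * spac)\<^sup>2 / l\<^sup>2 + c_dev\<^sup>2 * l\<^sup>2) * (2 * l * sqrt pi)"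
  have eq: "exp ((real k * spac)\<^sup>2 / l\<^sup>2 + c_dev\<^sup>2 * l\<^sup>2 - (x - ?m)\<^sup>2 / (4 * l\<^sup>2)) = ?c * normal_density ?m ?s x" for x
  proof -
    have "normal_density ?m ?s x = 1 / (2 * l * sqrt pi) * exp (- ((x - ?m)\<^sup>2 / (4 * l\<^sup>2)))"
      using l_pos by (simp add: normal_density_def power_mult_distrib real_sqrt_mult)
    moreover have "exp (U - V) = (exp U * W) * (1 / W * exp (- V))" if "W \<noteq> 0" for U V W :: real
      using that by (simp add: exp_diff exp_minus field_simps)
    moreover have "2 * l * sqrt pi \<noteq> 0" using l_pos by simp
    ultimately show ?thesis by presburger
  qed
  have "(\<integral>\<^sup>+z. blk k z \<partial>cylM R) = ennreal (2 * pi * R) * (\<integral>\<^sup>+x. ennreal (exp ((real k * spac)\<^sup>2 / l\<^sup>2 + c_dev\<^sup>2 * l\<^sup>2 - (x - ?m)\<^sup>2 / (4 * l\<^sup>2))) \<partial>lborel)"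
    unfolding blk_def
    by (rule nn_integral_cylM_Re[where f = "\<lambda>x. ennreal (exp ((real k * spac)\<^sup>2 / l\<^sup>2 + c_dev\<^sup>2 * l\<^sup>2 - (x - ?m)\<^sup>2 / (4 * l\<^sup>2)))"]) measurable
  also have "(\<integral>\<^sup>+x. ennreal (exp ((real k * spac)\<^sup>2 / l\<^sup>2 + c_dev\<^sup>2 * l\<^sup>2 - (x - ?m)\<^sup>2 / (4 * l\<^sup>2))) \<partial>lborel) = ennreal ?c"
    unfolding eq using l_pos s
    by (subst nn_integral_eq_integral) (auto intro!: integrable_mult_right integrable_normal_density simp: integral_normal_density[OF s])
  also have "ennreal (2 * pi * R) * ennreal ?c = ennreal (2 * exp (c_dev\<^sup>2 * l\<^sup>2) * nu0 * exp ((real k * spac)\<^sup>2 / l\<^sup>2))"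
    using R_pos by (subst ennreal_mult'[symmetric]) (simp_all add: nu0_def exp_add ac_simps)
  finally show ?thesis .
qed

text \<open>The left stretch, the block and the right stretch carry the energies of three
  consecutive segments of the reference configuration, so the cut loses nothing in the
  exponent.\<close>

lemma energy_split:
  assumes "lo \<le> hi" "hi \<le> N"
  shows "l\<^sup>2 / R\<^sup>2 * es lo 0 + (\<Sum>k\<in>{lo..<hi}. (real k * spac)\<^sup>2 / l\<^sup>2) + l\<^sup>2 / R\<^sup>2 * es (N - hi) (p * hi) = l\<^sup>2 / R\<^sup>2 * e0 N"
proof -
  have 1: "(real k * spac)\<^sup>2 / l\<^sup>2 = l\<^sup>2 / R\<^sup>2 * (real (p * k))\<^sup>2" for k
    using l_pos R_pos by (simp add: spac_def power2_eq_square)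
  have 2: "e0 lo + (\<Sum>k\<in>{lo..<hi}. (real (p * k))\<^sup>2) = e0 hi"
    unfolding e0_def using assms(1)
    by (simp add: atLeast0LessThan[symmetric] sum.atLeastLessThan_concat)
  have 3: "e0 hi + es (N - hi) (p * hi) = e0 N"
    using e0_add[of hi "N - hi"] assms(2) by (simp add: es_def)
  have 4: "es lo 0 = e0 lo" by (simp add: es_def)
  show ?thesis unfolding 1 4 sum_distrib_left[symmetric] distrib_left[symmetric] 2 3 ..
qed

text \<open>The integral factorises over the three stretches. Each block particle costs a constant
  factor, and there are at most \<open>2 * L + 1\<close> of them; the outer stretches hold at most
  \<open>k0\<close> and \<open>N - k0\<close> particles, and \<open>C_mono\<close> makes up for the
  difference.\<close>

lemma block_integral:
  assumes L: "k0 \<le> N"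
  shows "(\<integral>\<^sup>+u. ennreal (boltz {..<blo k0 L} 0 u) * indicator (Collect (srt {..<blo k0 L})) u
        * (\<Prod>k\<in>{blo k0 L..<bhi N k0 L}. ennreal (blk k (u k)))
        * (ennreal (boltz {bhi N k0 L..<N} (p * bhi N k0 L) u) * indicator (Collect (srt {bhi N k0 L..<N})) u) \<partial>PM {..<N})
    \<le> ennreal (nu0 ^ N * exp (l\<^sup>2 / R\<^sup>2 * e0 N) * (C k0 * C (N - k0)) * (2 * exp (c_dev\<^sup>2 * l\<^sup>2)) ^ (2 * L + 1))"
proof -
  define lo hi where "lo = blo k0 L" and "hi = bhi N k0 L"
  have oc: "ordered_chain spac R l N k0 (\<lambda>i. real i)"
    using spac_pos R_pos l_pos L by unfold_locales auto
  have lh: "lo \<le> hi" "hi \<le> N" "lo \<le> k0" "k0 \<le> hi" "hi - lo \<le> 2 * L + 1"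
    using L by (auto simp: lo_def hi_def ordered_chain.lo_def[OF oc] ordered_chain.hi_def[OF oc])
  let ?A = "{..<lo}" and ?B = "{lo..<hi}" and ?D = "{hi..<N}"
  let ?fA = "\<lambda>u. ennreal (boltz ?A 0 u) * indicator (Collect (srt ?A)) u :: ennreal"
  let ?fD = "\<lambda>u. ennreal (boltz ?D (p * hi) u) * indicator (Collect (srt ?D)) u :: ennreal"
  let ?fB = "\<lambda>u. (\<Prod>k\<in>?B. ennreal (blk k (u k)))"
  have sets: "{..<N} = (?A \<union> ?B) \<union> ?D" using lh by auto
  have mA: "?fA \<in> borel_measurable (PM K)" if "?A \<subseteq> K" for K
    using that by (intro borel_measurable_times_ennreal measurable_compose[OF boltz_measurable measurable_ennreal] srt_measurable) auto
  have mD: "?fD \<in> borel_measurable (PM K)" if "?D \<subseteq> K" for K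
    using that by (intro borel_measurable_times_ennreal measurable_compose[OF boltz_measurable measurable_ennreal] srt_measurable) auto
  have bm: "(\<lambda>z. ennreal (blk k z)) \<in> borel_measurable borel" for k unfolding blk_def by measurable
  have mB: "?fB \<in> borel_measurable (PM K)" if "?B \<subseteq> K" for K
    using that by (intro borel_measurable_prod_ennreal measurable_coord[where f = "\<lambda>z. ennreal (blk _ z)"] bm) auto
  have dA: "?fA u = ?fA v" if "\<And>i. i \<in> ?A \<Longrightarrow> u i = v i" for u v
  proof -
    have "boltz ?A 0 u = boltz ?A 0 v" by (rule boltz_cong) (rule that)
    moreover have "srt ?A u \<longleftrightarrow> srt ?A v" by (rule srt_cong) (rule that)
    ultimately show ?thesis by (simp add: indicator_def)
  qed
  have dD: "?fD u = ?fD v" if "\<And>i. i \<in> ?D \<Longrightarrow> u i = v i" for u v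
  proof -
    have "boltz ?D (p * hi) u = boltz ?D (p * hi) v" by (rule boltz_cong) (rule that)
    moreover have "srt ?D u \<longleftrightarrow> srt ?D v" by (rule srt_cong) (rule that)
    ultimately show ?thesis by (simp add: indicator_def)
  qed
  have dB: "?fB u = ?fB v" if "\<And>i. i \<in> ?B \<Longrightarrow> u i = v i" for u v
    using that by (intro prod.cong) auto
  have "(\<integral>\<^sup>+u. (?fA u * ?fB u) * ?fD u \<partial>PM {..<N}) = (\<integral>\<^sup>+u. ?fA u * ?fB u \<partial>PM (?A \<union> ?B)) * (\<integral>\<^sup>+u. ?fD u \<partial>PM ?D)"
    unfolding sets using lh
  proof (intro nn_integral_split)
    show "?fA u * ?fB u = ?fA v * ?fB v" if "\<And>i. i \<in> ?A \<union> ?B \<Longrightarrow> u i = v i" for u v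
      using dA[of u v] dB[of u v] that by auto
  qed (auto intro!: borel_measurable_times_ennreal mA mB mD dD)
  also have "(\<integral>\<^sup>+u. ?fA u * ?fB u \<partial>PM (?A \<union> ?B)) = (\<integral>\<^sup>+u. ?fA u \<partial>PM ?A) * (\<integral>\<^sup>+u. ?fB u \<partial>PM ?B)"
  proof (rule nn_integral_split)
    show "?fA \<in> borel_measurable (PM (?A \<union> ?B))" "?fA \<in> borel_measurable (PM ?A)"
      "?fB \<in> borel_measurable (PM (?A \<union> ?B))" "?fB \<in> borel_measurable (PM ?B)"
      by (rule mA mB, blast)+
    show "?A \<inter> ?B = {}" by auto
    show "?fA u = ?fA v" if "\<And>i. i \<in> ?A \<Longrightarrow> u i = v i" for u v by (rule dA) (rule that)
    show "?fB u = ?fB v" if "\<And>i. i \<in> ?B \<Longrightarrow> u i = v i" for u v by (rule dB) (rule that)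
  qed simp_all
  also have "(\<integral>\<^sup>+u. ?fA u \<partial>PM ?A) = ennreal (nu0 ^ lo * exp (l\<^sup>2 / R\<^sup>2 * es lo 0) * C lo)"
    using nn_integral_boltz_srt[of 0 lo 0] by (simp add: atLeast0LessThan)
  also have "(\<integral>\<^sup>+u. ?fD u \<partial>PM ?D) = ennreal (nu0 ^ (N - hi) * exp (l\<^sup>2 / R\<^sup>2 * es (N - hi) (p * hi)) * C (N - hi))"
    using nn_integral_boltz_srt[of hi "N - hi" "p * hi"] lh by simp
  also have "(\<integral>\<^sup>+u. ?fB u \<partial>PM ?B) = (\<Prod>k\<in>?B. \<integral>\<^sup>+z. ennreal (blk k z) \<partial>cylM R)"
    by (rule product_nn_integral_prod) (auto intro: sets_cylM_borel bm)
  also have "\<dots> = ennreal (\<Prod>k\<in>?B. 2 * exp (c_dev\<^sup>2 * l\<^sup>2) * nu0 * exp ((real k * spac)\<^sup>2 / l\<^sup>2))"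
    unfolding nn_integral_blk using nu0_pos by (intro prod_ennreal) auto
  also have "(\<Prod>k\<in>?B. 2 * exp (c_dev\<^sup>2 * l\<^sup>2) * nu0 * exp ((real k * spac)\<^sup>2 / l\<^sup>2))
      = (2 * exp (c_dev\<^sup>2 * l\<^sup>2)) ^ (hi - lo) * nu0 ^ (hi - lo) * exp (\<Sum>k\<in>?B. (real k * spac)\<^sup>2 / l\<^sup>2)"
    by (simp add: prod.distrib power_mult_distrib exp_sum)
  also have "ennreal (nu0 ^ lo * exp (l\<^sup>2 / R\<^sup>2 * es lo 0) * C lo)
      * ennreal ((2 * exp (c_dev\<^sup>2 * l\<^sup>2)) ^ (hi - lo) * nu0 ^ (hi - lo) * exp (\<Sum>k\<in>?B. (real k * spac)\<^sup>2 / l\<^sup>2))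
      * ennreal (nu0 ^ (N - hi) * exp (l\<^sup>2 / R\<^sup>2 * es (N - hi) (p * hi)) * C (N - hi))
    = ennreal ((nu0 ^ lo * exp (l\<^sup>2 / R\<^sup>2 * es lo 0) * C lo)
      * ((2 * exp (c_dev\<^sup>2 * l\<^sup>2)) ^ (hi - lo) * nu0 ^ (hi - lo) * exp (\<Sum>k\<in>?B. (real k * spac)\<^sup>2 / l\<^sup>2))
      * (nu0 ^ (N - hi) * exp (l\<^sup>2 / R\<^sup>2 * es (N - hi) (p * hi)) * C (N - hi)))"
    using nu0_pos C_nonneg by (simp add: ennreal_mult mult_nonneg_nonneg)
  also have "\<dots> \<le> ennreal (nu0 ^ N * exp (l\<^sup>2 / R\<^sup>2 * e0 N) * (C k0 * C (N - k0)) * (2 * exp (c_dev\<^sup>2 * l\<^sup>2)) ^ (2 * L + 1))"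
  proof (rule ennreal_leI)
    have "(nu0 ^ lo * exp (l\<^sup>2 / R\<^sup>2 * es lo 0) * C lo)
      * ((2 * exp (c_dev\<^sup>2 * l\<^sup>2)) ^ (hi - lo) * nu0 ^ (hi - lo) * exp (\<Sum>k\<in>?B. (real k * spac)\<^sup>2 / l\<^sup>2))
      * (nu0 ^ (N - hi) * exp (l\<^sup>2 / R\<^sup>2 * es (N - hi) (p * hi)) * C (N - hi))
      = (nu0 ^ lo * nu0 ^ (hi - lo) * nu0 ^ (N - hi))
       * (exp (l\<^sup>2 / R\<^sup>2 * es lo 0) * exp (\<Sum>k\<in>?B. (real k * spac)\<^sup>2 / l\<^sup>2) * exp (l\<^sup>2 / R\<^sup>2 * es (N - hi) (p * hi)))
       * (C lo * C (N - hi)) * (2 * exp (c_dev\<^sup>2 * l\<^sup>2)) ^ (hi - lo)"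
      by (simp only: ac_simps)
    also have "nu0 ^ lo * nu0 ^ (hi - lo) * nu0 ^ (N - hi) = nu0 ^ N"
      using lh by (simp flip: power_add)
    also have "exp (l\<^sup>2 / R\<^sup>2 * es lo 0) * exp (\<Sum>k\<in>?B. (real k * spac)\<^sup>2 / l\<^sup>2) * exp (l\<^sup>2 / R\<^sup>2 * es (N - hi) (p * hi)) = exp (l\<^sup>2 / R\<^sup>2 * e0 N)"
      unfolding exp_add[symmetric] energy_split[OF lh(1,2)] ..
    also have "nu0 ^ N * exp (l\<^sup>2 / R\<^sup>2 * e0 N) * (C lo * C (N - hi)) * (2 * exp (c_dev\<^sup>2 * l\<^sup>2)) ^ (hi - lo)
      \<le> nu0 ^ N * exp (l\<^sup>2 / R\<^sup>2 * e0 N) * (C k0 * C (N - k0)) * (2 * exp (c_dev\<^sup>2 * l\<^sup>2)) ^ (2 * L + 1)"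
    proof -
      have "1 \<le> exp (c_dev\<^sup>2 * l\<^sup>2)" by simp
      then have "1 \<le> 2 * exp (c_dev\<^sup>2 * l\<^sup>2)" by linarith
      then have pw: "(2 * exp (c_dev\<^sup>2 * l\<^sup>2)) ^ (hi - lo) \<le> (2 * exp (c_dev\<^sup>2 * l\<^sup>2)) ^ (2 * L + 1)"
        by (rule power_increasing[OF lh(5)])
      have CC: "C lo * C (N - hi) \<le> C k0 * C (N - k0)"
        using lh C_nonneg by (intro mult_mono C_mono) auto
      have "nu0 ^ N * exp (l\<^sup>2 / R\<^sup>2 * e0 N) \<ge> 0" using nu0_pos by simp
      then show ?thesis using CC pw C_nonneg by (intro mult_mono[OF mult_left_mono]) auto
    qed
    finally show "(nu0 ^ lo * exp (l\<^sup>2 / R\<^sup>2 * es lo 0) * C lo)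
      * ((2 * exp (c_dev\<^sup>2 * l\<^sup>2)) ^ (hi - lo) * nu0 ^ (hi - lo) * exp (\<Sum>k\<in>?B. (real k * spac)\<^sup>2 / l\<^sup>2))
      * (nu0 ^ (N - hi) * exp (l\<^sup>2 / R\<^sup>2 * es (N - hi) (p * hi)) * C (N - hi))
      \<le> nu0 ^ N * exp (l\<^sup>2 / R\<^sup>2 * e0 N) * (C k0 * C (N - k0)) * (2 * exp (c_dev\<^sup>2 * l\<^sup>2)) ^ (2 * L + 1)" .
  qed
  finally show ?thesis unfolding lo_def hi_def .
qed

definition wgt :: "real \<Rightarrow> nat \<Rightarrow> real" where
  "wgt t L = (2 * exp (c_dev\<^sup>2 * l\<^sup>2)) ^ (2 * L + 1) * cst t L"

lemma wgt_pos: "wgt t L > 0"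
  by (simp add: wgt_def cst_def)

text \<open>The exponent of \<open>wgt t L\<close> is a negative multiple of the cube of
  \<open>L\<close> plus a polynomial of degree two.\<close>

lemma summable_wgt: "summable (wgt t)"
proof (rule summable_comparison_test_ev)
  define b where "b = ln 2 + c_dev\<^sup>2 * l\<^sup>2"
  define d where "d = spac\<^sup>2 / (8192 * l\<^sup>2)"
  have d: "d > 0" using spac_pos l_pos by (simp add: d_def)
  have eq: "wgt t L = exp (real (2 * L + 1) * b + (c_pair * (2 * real L + 1)\<^sup>2 + t * (2 * real L + c_cloud) - d * real L ^ 3))" for L
  proof -
    have "2 * exp (c_dev\<^sup>2 * l\<^sup>2) = exp b" by (simp add: b_def exp_add)
    then show ?thesis unfolding wgt_def cst_def exp_add exp_of_nat_mult by (simp add: d_def)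
  qed
  have "filterlim (\<lambda>L. d * real L ^ 3 - (c_pair * (2 * real L + 1)\<^sup>2 + t * (2 * real L + c_cloud) + (2 * real L + 1) * b + real L)) at_top sequentially"
    using d by real_asymp
  then have "eventually (\<lambda>L. d * real L ^ 3 - (c_pair * (2 * real L + 1)\<^sup>2 + t * (2 * real L + c_cloud) + (2 * real L + 1) * b + real L) \<ge> 0) sequentially"
    unfolding filterlim_at_top by blast
  then show "eventually (\<lambda>L. norm (wgt t L) \<le> exp (-1) ^ L) sequentially"
  proof eventually_elim
    case (elim L)
    have r: "real (2 * L + 1) = 2 * real L + 1" by simp
    have gen: "B + (P + T - D) \<le> - M" if "0 \<le> D - (P + T + B + M)" for B P T D M :: real
      using that by linarith
    have "real (2 * L + 1) * b + (c_pair * (2 * real L + 1)\<^sup>2 + t * (2 * real L + c_cloud) - d * real L ^ 3) \<le> - real L"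
      unfolding r by (rule gen[OF elim])
    then show ?case unfolding eq exp_of_nat_mult[symmetric] by simp
  qed
  show "summable (\<lambda>L. exp (-1 :: real) ^ L)" by (intro summable_geometric) simp
qed

definition Kc :: "real \<Rightarrow> real" where "Kc t = (\<Sum>L. wgt t L)"

lemma cloud_perm:
  assumes "\<sigma> permutes {..<N}" shows "cloud N xi (perm_app {..<N} \<sigma> u) = cloud N xi u"
  using sum.permute[OF assms, of "\<lambda>i. exp (- (Re (u i) - xi)\<^sup>2 / (2 * l\<^sup>2))"]
  by (simp add: cloud_def perm_app_def comp_def)

lemma cloud_measurable: "cloud N xi \<in> borel_measurable (PM {..<N})"
  unfolding cloud_def[abs_def]
  by (intro borel_measurable_sum measurable_coord[where f = "\<lambda>z. exp (- (Re z - xi)\<^sup>2 / (2 * l\<^sup>2))"]) auto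

text \<open>Sorting makes the chain estimates applicable. The radius supplied by
  \<open>boltz_pointwise\<close> depends on the configuration, so the bounds for all radii are
  added; this costs \<open>Kc t\<close>, which depends neither on \<open>N\<close> nor on the cut.
  The case \<open>t = 0\<close> gives submultiplicativity of \<open>C\<close>, positive
  \<open>t\<close> gives moments.\<close>

theorem partition_bound:
  assumes k0: "k0 \<le> N" and xi: "real k0 * spac \<le> xi" "xi \<le> real k0 * spac + spac" and t: "t \<ge> 0"
  shows "(\<integral>\<^sup>+u. ennreal (boltz {..<N} 0 u * exp (t * cloud N xi u)) \<partial>PM {..<N})
    \<le> ennreal (fact N * (nu0 ^ N * exp (l\<^sup>2 / R\<^sup>2 * e0 N)) * (Kc t * (C k0 * C (N - k0))))"
proof -
  let ?F = "\<lambda>u. ennreal (boltz {..<N} 0 u * exp (t * cloud N xi u))"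
  let ?H = "\<lambda>L u. ennreal (boltz {..<blo k0 L} 0 u) * indicator (Collect (srt {..<blo k0 L})) u
        * (\<Prod>k\<in>{blo k0 L..<bhi N k0 L}. ennreal (blk k (u k)))
        * (ennreal (boltz {bhi N k0 L..<N} (p * bhi N k0 L) u) * indicator (Collect (srt {bhi N k0 L..<N})) u)"
  let ?Z = "nu0 ^ N * exp (l\<^sup>2 / R\<^sup>2 * e0 N) * (C k0 * C (N - k0))"
  have Z0: "?Z \<ge> 0" using nu0_pos C_nonneg by simp
  have oc: "ordered_chain spac R l N k0 (\<lambda>i. real i)"
    using spac_pos R_pos l_pos k0 by unfold_locales auto
  have lh: "blo k0 L \<le> N" "bhi N k0 L \<le> N" for L
    using k0 by (auto simp: ordered_chain.lo_def[OF oc] ordered_chain.hi_def[OF oc])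
  have mF: "?F \<in> borel_measurable (PM {..<N})"
    using boltz_measurable[of "{..<N}" "{..<N}" 0] cloud_measurable[of N xi] by measurable
  have pt: "?F u * indicator (Collect (srt {..<N})) u \<le> (\<Sum>L\<le>N. ennreal (cst t L) * ?H L u)" for u
  proof (cases "srt {..<N} u")
    case True
    obtain L where L: "L \<le> N" "boltz {..<N} 0 u * exp (t * cloud N xi u) \<le> boltz {..<blo k0 L} 0 u * boltz {bhi N k0 L..<N} (p * bhi N k0 L) u
      * (\<Prod>k\<in>{blo k0 L..<bhi N k0 L}. blk k (u k)) * cst t L"
      using boltz_pointwise[OF True k0 xi t] by metis
    have sA: "srt {..<blo k0 L} u" "srt {bhi N k0 L..<N} u"
      using True lh[of L] by (auto simp: srt_def)
    have c0: "cst t L \<ge> 0" and b0: "blk k z \<ge> 0" for k z by (simp_all add: cst_def blk_def)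
    have "?F u * indicator (Collect (srt {..<N})) u \<le> ennreal (boltz {..<blo k0 L} 0 u * boltz {bhi N k0 L..<N} (p * bhi N k0 L) u
      * (\<Prod>k\<in>{blo k0 L..<bhi N k0 L}. blk k (u k)) * cst t L)"
      using True L(2) by (simp add: ennreal_leI)
    also have "\<dots> = ennreal (cst t L) * ?H L u"
      using sA c0 b0 by (simp add: ennreal_mult prod_ennreal prod_nonneg mult_nonneg_nonneg ac_simps)
    also have "\<dots> \<le> (\<Sum>L\<le>N. ennreal (cst t L) * ?H L u)"
      using L(1) by (intro member_le_sum) auto
    finally show ?thesis .
  qed simp
  have mH: "?H L \<in> borel_measurable (PM {..<N})" for L
  proof (intro borel_measurable_times_ennreal borel_measurable_prod_ennreal)
    show "(\<lambda>u. ennreal (boltz {..<blo k0 L} 0 u)) \<in> borel_measurable (PM {..<N})"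
      "(\<lambda>u. ennreal (boltz {bhi N k0 L..<N} (p * bhi N k0 L) u)) \<in> borel_measurable (PM {..<N})"
      using lh[of L] by (intro measurable_compose[OF boltz_measurable measurable_ennreal]; force)+
    show "(\<lambda>u. indicator (Collect (srt {..<blo k0 L})) u :: ennreal) \<in> borel_measurable (PM {..<N})"
      "(\<lambda>u. indicator (Collect (srt {bhi N k0 L..<N})) u :: ennreal) \<in> borel_measurable (PM {..<N})"
      using lh[of L] by (intro srt_measurable; force)+
    fix k assume k: "k \<in> {blo k0 L..<bhi N k0 L}"
    have "(\<lambda>z. ennreal (blk k z)) \<in> borel_measurable borel" unfolding blk_def by measurable
    then show "(\<lambda>u. ennreal (blk k (u k))) \<in> borel_measurable (PM {..<N})"
      using k lh[of L] by (intro measurable_coord[where f = "\<lambda>z. ennreal (blk k z)"]) auto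
  qed
  have "(\<integral>\<^sup>+u. ?F u * indicator (Collect (srt {..<N})) u \<partial>PM {..<N}) \<le> (\<integral>\<^sup>+u. (\<Sum>L\<le>N. ennreal (cst t L) * ?H L u) \<partial>PM {..<N})"
    by (intro nn_integral_mono pt)
  also have "\<dots> = (\<Sum>L\<le>N. ennreal (cst t L) * (\<integral>\<^sup>+u. ?H L u \<partial>PM {..<N}))"
    using mH by (subst nn_integral_sum) (auto intro!: sum.cong nn_integral_cmult)
  also have "\<dots> \<le> (\<Sum>L\<le>N. ennreal (cst t L) * ennreal (?Z * (2 * exp (c_dev\<^sup>2 * l\<^sup>2)) ^ (2 * L + 1)))"
    by (intro sum_mono mult_left_mono block_integral k0) auto
  also have "\<dots> = (\<Sum>L\<le>N. ennreal (?Z * wgt t L))"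
    using Z0 by (intro sum.cong refl, subst ennreal_mult'[symmetric]) (auto simp: wgt_def cst_def ac_simps)
  also have "\<dots> = ennreal (\<Sum>L\<le>N. ?Z * wgt t L)"
    using Z0 wgt_pos by (intro sum_ennreal) (auto intro: less_imp_le mult_nonneg_nonneg)
  also have "\<dots> \<le> ennreal (?Z * Kc t)"
  proof (rule ennreal_leI)
    have "(\<Sum>L\<le>N. wgt t L) \<le> Kc t"
      unfolding Kc_def by (intro sum_le_suminf summable_wgt) (auto intro: less_imp_le[OF wgt_pos])
    then show "(\<Sum>L\<le>N. ?Z * wgt t L) \<le> ?Z * Kc t"
      unfolding sum_distrib_left[symmetric] using Z0 by (intro mult_left_mono)
  qed
  finally have 1: "(\<integral>\<^sup>+u. ?F u * indicator (Collect (srt {..<N})) u \<partial>PM {..<N}) \<le> ennreal (?Z * Kc t)" .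
  have "(\<integral>\<^sup>+u. ?F u \<partial>PM {..<N}) = fact (card {..<N}) * (\<integral>\<^sup>+u. ?F u * indicator (Collect (srt {..<N})) u \<partial>PM {..<N})"
    by (rule sort_integral) (use mF in \<open>auto simp: boltz_perm cloud_perm\<close>)
  also have "\<dots> \<le> fact N * ennreal (?Z * Kc t)"
    using 1 by (auto intro: mult_left_mono)
  also have "fact N = ennreal (fact N)"
    by (metis ennreal_of_nat_eq_real_of_nat of_nat_fact)
  also have "ennreal (fact N) * ennreal (?Z * Kc t) = ennreal (fact N * (nu0 ^ N * exp (l\<^sup>2 / R\<^sup>2 * e0 N)) * (Kc t * (C k0 * C (N - k0))))"
    by (subst ennreal_mult'[symmetric]) (simp_all add: ac_simps)
  finally show ?thesis .
qed

end

section \<open>Moments of the occupation numbers\<close>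

lemma orbs_Suc:
  "(\<Sum>xs\<in>orbs p N (Suc n). f xs) = (\<Sum>x<p * N. \<Sum>xs\<in>orbs p N n. f (x # xs))"
  unfolding sum.cartesian_product
  by (rule sum.reindex_bij_witness[where i = "\<lambda>(x, xs). x # xs" and j = "\<lambda>xs. (hd xs, tl xs)"])
     (auto simp: orbs_def length_Suc_conv)

context cylinder
begin

lemma Kc_nonneg: "Kc t \<ge> 0"
  unfolding Kc_def using wgt_pos by (intro suminf_nonneg summable_wgt) (simp add: less_imp_le)

lemma C_submult: "C (m + n) \<le> Kc 0 * (C m * C n)"
proof -
  let ?Z = "fact (m + n) * (nu0 ^ (m + n) * exp (l\<^sup>2 / R\<^sup>2 * e0 (m + n)))"
  have "ennreal (?Z * C (m + n)) \<le> ennreal (?Z * (Kc 0 * (C m * C n)))"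
    using partition_bound[of m "m + n" "real m * spac" 0] nn_integral_boltz[of 0 "m + n" 0] spac_pos
    by (simp add: atLeast0LessThan es_def mult.assoc)
  moreover have "?Z > 0" using nu0_pos by simp
  moreover have "0 \<le> ?Z * (Kc 0 * (C m * C n))" using Kc_nonneg nu0_pos C_nonneg by (intro mult_nonneg_nonneg) auto
  ultimately show ?thesis by (simp only: ennreal_le_iff mult_le_cancel_left_pos)
qed

lemma norm_psi: "norm (psi k z) = exp (- (Re z - real k * l\<^sup>2 / R)\<^sup>2 / (2 * l\<^sup>2)) / sqrt nu0"
proof -
  have "norm (exp (z / of_real R)) = exp (Re z / R)" by simp
  then have "norm (phi k z) = exp (Re z / R) ^ k * exp (- (Re z)\<^sup>2 / (2 * l\<^sup>2))"
    unfolding phi_def by (simp add: norm_mult norm_power)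
  also have "exp (Re z / R) ^ k = exp (real k * (Re z / R))" by (rule exp_of_nat_mult[symmetric])
  finally have n: "norm (phi k z) = exp (real k * (Re z / R)) * exp (- (Re z)\<^sup>2 / (2 * l\<^sup>2))" .
  have "norm (psi k z) = norm (phi k z) / sqrt (nu k)"
    using nu_pos[of k] by (simp add: psi_def norm_divide less_imp_le)
  then have "norm (psi k z) = exp (real k * (Re z / R)) * exp (- (Re z)\<^sup>2 / (2 * l\<^sup>2)) / (sqrt nu0 * exp (l\<^sup>2 / R\<^sup>2 * (real k)\<^sup>2 / 2))"
    unfolding n sqrt_nu .
  also have "\<dots> = exp (real k * (Re z / R) + - (Re z)\<^sup>2 / (2 * l\<^sup>2) - l\<^sup>2 / R\<^sup>2 * (real k)\<^sup>2 / 2) / sqrt nu0"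
    by (simp only: exp_add exp_diff divide_divide_eq_left mult.commute[of "sqrt nu0"])
  also have "real k * (Re z / R) + - (Re z)\<^sup>2 / (2 * l\<^sup>2) - l\<^sup>2 / R\<^sup>2 * (real k)\<^sup>2 / 2 = - (Re z - real k * l\<^sup>2 / R)\<^sup>2 / (2 * l\<^sup>2)"
    using R_pos l_pos by (simp add: field_simps power2_eq_square)
  finally show ?thesis .
qed

lemma psi_measurable [measurable]: "psi k \<in> borel_measurable borel"
  unfolding psi_def[abs_def] by measurable

definition c_psi :: real where "c_psi = 2 * pi * R * (l * sqrt (2 * pi)) / sqrt nu0"

lemma c_psi_pos: "c_psi > 0"
  using R_pos l_pos nu0_pos by (simp add: c_psi_def)

lemma nn_integral_psi: "(\<integral>\<^sup>+z. norm (psi k z) \<partial>cylM R) = ennreal c_psi"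
proof -
  let ?f = "\<lambda>x. exp (- (x - real k * l\<^sup>2 / R)\<^sup>2 / (2 * l\<^sup>2)) / sqrt nu0"
  have e: "?f x = l * sqrt (2 * pi) / sqrt nu0 * normal_density (real k * l\<^sup>2 / R) l x" for x
    using l_pos nu0_pos by (simp add: normal_density_def real_sqrt_mult field_simps)
  have "(\<integral>\<^sup>+x. ?f x \<partial>lborel) = ennreal (\<integral>x. ?f x \<partial>lborel)"
    unfolding e using l_pos nu0_pos by (intro nn_integral_eq_integral integrable_mult_right integrable_normal_density) auto
  also have "(\<integral>x. ?f x \<partial>lborel) = l * sqrt (2 * pi) / sqrt nu0"
    unfolding e integral_mult_right_zero using l_pos by simp
  finally have "(\<integral>\<^sup>+z. norm (psi k z) \<partial>cylM R) = ennreal (2 * pi * R) * ennreal (l * sqrt (2 * pi) / sqrt nu0)"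
    unfolding norm_psi by (subst nn_integral_cylM_Re[of "\<lambda>x. ennreal (?f x)"]) auto
  then show ?thesis using R_pos l_pos nu0_pos by (simp add: c_psi_def flip: ennreal_mult)
qed

lemma psi_orthonormal:
  "has_bochner_integral (cylM R) (\<lambda>z. psi j z * cnj (psi k z)) (if j = k then 1 else 0)"
proof -
  have e: "psi j z * cnj (psi k z) = of_real (1 / (sqrt (nu j) * sqrt (nu k))) * (phi j z * cnj (phi k z))" for z
    by (simp add: psi_def)
  have v: "complex_of_real (1 / (sqrt (nu j) * sqrt (nu k))) * (if j = k then of_real (nu j) else 0) = (if j = k then 1 else 0)"
  proof (cases "j = k")
    case True
    have "1 / (sqrt (nu k) * sqrt (nu k)) * nu k = 1" using nu_pos[of k] by simp
    then show ?thesis using True by (simp only: if_True simp_thms of_real_mult[symmetric] of_real_1)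
  qed simp
  have "has_bochner_integral (cylM R) (\<lambda>z. phi j z * cnj (phi k z)) (if j = k then of_real (nu j) else 0)"
    unfolding has_bochner_integral_iff using integrable_phi[of j k] integral_phi[of j k] by blast
  then show ?thesis unfolding e v[symmetric] by (rule has_bochner_integral_mult_right)
qed

lemma psi_sum_norm:
  fixes c :: "nat \<Rightarrow> complex"
  shows "(\<integral>\<^sup>+z. (norm (\<Sum>k<M. c k * psi k z))\<^sup>2 \<partial>cylM R) = ennreal (\<Sum>k<M. (norm (c k))\<^sup>2)"
proof -
  have "has_bochner_integral (cylM R) (\<lambda>z. \<Sum>j<M. \<Sum>k<M. (c j * cnj (c k)) * (psi j z * cnj (psi k z)))
     (\<Sum>j<M. \<Sum>k<M. (c j * cnj (c k)) * (if j = k then 1 else 0))"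
    by (intro has_bochner_integral_sum has_bochner_integral_mult_right psi_orthonormal)
  moreover have "(\<Sum>j<M. \<Sum>k<M. (c j * cnj (c k)) * (psi j z * cnj (psi k z))) = of_real ((norm (\<Sum>k<M. c k * psi k z))\<^sup>2)" for z
    unfolding complex_norm_square by (simp add: sum_product ac_simps)
  moreover have "(\<Sum>j<M. \<Sum>k<M. (c j * cnj (c k)) * (if j = k then 1 else 0)) = of_real (\<Sum>k<M. (norm (c k))\<^sup>2)"
    unfolding of_real_sum complex_norm_square by (simp add: if_distrib sum.delta cong: if_cong)
  ultimately have "has_bochner_integral (cylM R) (\<lambda>z. complex_of_real ((norm (\<Sum>k<M. c k * psi k z))\<^sup>2)) (of_real (\<Sum>k<M. (norm (c k))\<^sup>2))"
    by simp
  then have "has_bochner_integral (cylM R) (\<lambda>z. Re (complex_of_real ((norm (\<Sum>k<M. c k * psi k z))\<^sup>2))) (Re (of_real (\<Sum>k<M. (norm (c k))\<^sup>2)))"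
    by (rule has_bochner_integral_bounded_linear[OF bounded_linear_Re])
  then have "has_bochner_integral (cylM R) (\<lambda>z. (norm (\<Sum>k<M. c k * psi k z))\<^sup>2) (\<Sum>k<M. (norm (c k))\<^sup>2)"
    by simp
  then show ?thesis by (subst nn_integral_eq_integral) (auto simp: has_bochner_integral_iff)
qed

text \<open>\<open>c y\<close> is the inner product of the sum with \<open>psi y\<close>. Writing
  the modulus of \<open>psi y\<close> as a product of two square roots, Cauchy-Schwarz yields its
  integral \<open>c_psi\<close>, the same for all \<open>y\<close>. In effect the projection onto an
  orbital is dominated by multiplication with a function of position.\<close>

lemma psi_coefficient_bound:
  fixes c :: "nat \<Rightarrow> complex"
  assumes y: "y < M"
  shows "ennreal ((norm (c y))\<^sup>2) \<le> ennreal c_psi * (\<integral>\<^sup>+z. ennreal (norm (psi y z)) * ennreal ((norm (\<Sum>k<M. c k * psi k z))\<^sup>2) \<partial>cylM R)"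
proof -
  let ?S = "\<lambda>z. \<Sum>k<M. c k * psi k z"
  have [measurable]: "(\<lambda>z. norm (psi k z)) \<in> borel_measurable (cylM R)" for k by (intro sets_cylM_borel) measurable
  have [measurable]: "(\<lambda>z. norm (?S z)) \<in> borel_measurable (cylM R)" by (intro sets_cylM_borel) measurable
  have "has_bochner_integral (cylM R) (\<lambda>z. \<Sum>k<M. c k * (psi k z * cnj (psi y z))) (\<Sum>k<M. c k * (if k = y then 1 else 0))"
    by (intro has_bochner_integral_sum has_bochner_integral_mult_right psi_orthonormal)
  moreover have "(\<Sum>k<M. c k * (if k = y then 1 else 0)) = c y" using y by (simp add: if_distrib sum.delta cong: if_cong)
  moreover have "(\<Sum>k<M. c k * (psi k z * cnj (psi y z))) = ?S z * cnj (psi y z)" for z by (simp only: sum_distrib_right mult.assoc)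
  ultimately have hb: "has_bochner_integral (cylM R) (\<lambda>z. ?S z * cnj (psi y z)) (c y)" by simp
  then have "ennreal (norm (c y)) \<le> (\<integral>\<^sup>+z. norm (?S z * cnj (psi y z)) \<partial>cylM R)"
    using integral_norm_bound_ennreal[of "cylM R" "\<lambda>z. ?S z * cnj (psi y z)"] by (simp add: has_bochner_integral_iff)
  also have "\<dots> = (\<integral>\<^sup>+z. ennreal (sqrt (norm (psi y z))) * ennreal (sqrt (norm (psi y z)) * norm (?S z)) \<partial>cylM R)"
    by (intro nn_integral_cong) (simp add: norm_mult mult.commute flip: ennreal_mult mult.assoc)
  finally have "(ennreal (norm (c y)))\<^sup>2 \<le> (\<integral>\<^sup>+z. ennreal (sqrt (norm (psi y z))) * ennreal (sqrt (norm (psi y z)) * norm (?S z)) \<partial>cylM R)\<^sup>2"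
    by (intro power_mono) auto
  also have "\<dots> \<le> (\<integral>\<^sup>+z. (ennreal (sqrt (norm (psi y z))))\<^sup>2 \<partial>cylM R) * (\<integral>\<^sup>+z. (ennreal (sqrt (norm (psi y z)) * norm (?S z)))\<^sup>2 \<partial>cylM R)"
    by (intro Cauchy_Schwarz_nn_integral) measurable
  also have "(\<integral>\<^sup>+z. (ennreal (sqrt (norm (psi y z))))\<^sup>2 \<partial>cylM R) = ennreal c_psi"
    unfolding nn_integral_psi[of y, symmetric] by (intro nn_integral_cong) (simp add: ennreal_power)
  also have "(\<integral>\<^sup>+z. (ennreal (sqrt (norm (psi y z)) * norm (?S z)))\<^sup>2 \<partial>cylM R)
     = (\<integral>\<^sup>+z. ennreal (norm (psi y z)) * ennreal ((norm (?S z))\<^sup>2) \<partial>cylM R)"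
    by (intro nn_integral_cong) (simp add: ennreal_power power_mult_distrib flip: ennreal_mult)
  finally show ?thesis by (simp add: ennreal_power)
qed

lemma one_particle:
  fixes c :: "nat \<Rightarrow> complex"
  assumes y: "y < M" and t: "t \<ge> 0"
  shows "(\<Sum>k<M. ennreal (1 + t * of_bool (k = y)) * ennreal ((norm (c k))\<^sup>2))
    \<le> (\<integral>\<^sup>+z. ennreal (1 + t * c_psi * norm (psi y z)) * ennreal ((norm (\<Sum>k<M. c k * psi k z))\<^sup>2) \<partial>cylM R)"
proof -
  let ?S = "\<lambda>z. \<Sum>k<M. c k * psi k z"
  have [measurable]: "(\<lambda>z. norm (psi k z)) \<in> borel_measurable (cylM R)" for k by (intro sets_cylM_borel) measurable
  have [measurable]: "(\<lambda>z. norm (?S z)) \<in> borel_measurable (cylM R)" by (intro sets_cylM_borel) measurable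
  have "(\<Sum>k<M. ennreal (1 + t * of_bool (k = y)) * ennreal ((norm (c k))\<^sup>2))
     = ennreal (\<Sum>k<M. (norm (c k))\<^sup>2 + (if k = y then t * (norm (c k))\<^sup>2 else 0))"
    using t by (subst sum_ennreal[symmetric]) (auto intro!: sum.cong simp: distrib_right simp flip: ennreal_mult)
  also have "(\<Sum>k<M. (norm (c k))\<^sup>2 + (if k = y then t * (norm (c k))\<^sup>2 else 0)) = (\<Sum>k<M. (norm (c k))\<^sup>2) + t * (norm (c y))\<^sup>2"
    using y by (simp add: sum.distrib sum.delta')
  also have "ennreal \<dots> = (\<integral>\<^sup>+z. (norm (?S z))\<^sup>2 \<partial>cylM R) + ennreal t * ennreal ((norm (c y))\<^sup>2)"
    unfolding psi_sum_norm using t by (simp add: sum_nonneg flip: ennreal_mult)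
  also have "\<dots> \<le> (\<integral>\<^sup>+z. (norm (?S z))\<^sup>2 \<partial>cylM R) + ennreal t * (ennreal c_psi * (\<integral>\<^sup>+z. ennreal (norm (psi y z)) * ennreal ((norm (?S z))\<^sup>2) \<partial>cylM R))"
    by (intro add_mono mult_left_mono psi_coefficient_bound y) auto
  also have "\<dots> = (\<integral>\<^sup>+z. (norm (?S z))\<^sup>2 \<partial>cylM R) + (\<integral>\<^sup>+z. ennreal t * (ennreal c_psi * (ennreal (norm (psi y z)) * ennreal ((norm (?S z))\<^sup>2))) \<partial>cylM R)"
    by (simp add: nn_integral_cmult)
  also have "\<dots> = (\<integral>\<^sup>+z. (norm (?S z))\<^sup>2 + ennreal t * (ennreal c_psi * (ennreal (norm (psi y z)) * ennreal ((norm (?S z))\<^sup>2))) \<partial>cylM R)"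
    by (rule nn_integral_add[symmetric]) measurable
  also have "\<dots> = (\<integral>\<^sup>+z. ennreal (1 + t * c_psi * norm (psi y z)) * ennreal ((norm (?S z))\<^sup>2) \<partial>cylM R)"
    using t c_psi_pos by (intro nn_integral_cong) (simp add: distrib_right ennreal_mult mult.assoc)
  finally show ?thesis .
qed

text \<open>Induction over the variables, with \<open>one_particle\<close> applied to the first.
  Arbitrary coefficients \<open>A\<close> are allowed because the induction step needs the bound for
  the slices \<open>A (x # xs)\<close>, with the variables shifted by one.\<close>

lemma tensor_bound:
  fixes A :: "nat list \<Rightarrow> complex"
  assumes y: "y < p * N" and t: "t \<ge> 0"
  shows "(\<Sum>xs\<in>orbs p N n. (\<Prod>j<n. ennreal (1 + t * of_bool (xs ! j = y))) * ennreal ((norm (A xs))\<^sup>2))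
    \<le> (\<integral>\<^sup>+u. (\<Prod>j<n. ennreal (1 + t * c_psi * norm (psi y (u (i0 + j)))))
         * ennreal ((norm (\<Sum>xs\<in>orbs p N n. A xs * (\<Prod>j<n. psi (xs ! j) (u (i0 + j)))))\<^sup>2) \<partial>PM {i0..<i0 + n})"
proof (induction n arbitrary: A i0)
  case 0
  have "orbs p N 0 = {[]}" by (auto simp: orbs_def)
  then show ?case by (simp add: space_PiM_empty)
next
  case (Suc n)
  let ?I = "{Suc i0..<Suc i0 + n}"
  let ?w = "\<lambda>x. ennreal (1 + t * of_bool (x = y))"
  let ?q = "\<lambda>z. ennreal (1 + t * c_psi * norm (psi y z))"
  define \<Phi> where "\<Phi> x v = (\<Sum>xs\<in>orbs p N n. A (x # xs) * (\<Prod>j<n. psi (xs ! j) (v (Suc i0 + j))))" for x v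
  define W where "W v = (\<Prod>j<n. ?q (v (Suc i0 + j)))" for v
  define G where "G u = (\<Prod>j<Suc n. ?q (u (i0 + j)))
         * ennreal ((norm (\<Sum>xs\<in>orbs p N (Suc n). A xs * (\<Prod>j<Suc n. psi (xs ! j) (u (i0 + j)))))\<^sup>2)" for u
  have I: "{i0..<i0 + Suc n} = insert i0 ?I" by auto
  have pm: "(\<lambda>u. psi x (u i)) \<in> borel_measurable (PM K)" if "i \<in> K" for x i K
    using that by (intro measurable_coord psi_measurable)
  have qm: "(\<lambda>u. ?q (u i)) \<in> borel_measurable (PM K)" if "i \<in> K" for i K
    using that by (intro measurable_coord[where f = ?q]) auto
  have \<Phi>m: "\<Phi> x \<in> borel_measurable (PM ?I)" for x
    unfolding \<Phi>_def[abs_def] by (intro borel_measurable_sum borel_measurable_times borel_measurable_const borel_measurable_prod pm) auto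
  have Wm: "W \<in> borel_measurable (PM ?I)"
    unfolding W_def[abs_def] by (intro borel_measurable_prod_ennreal qm) auto
  have Gm: "G \<in> borel_measurable (PM (insert i0 ?I))"
    unfolding G_def[abs_def]
    by (intro borel_measurable_times_ennreal borel_measurable_prod_ennreal qm measurable_compose[OF _ measurable_ennreal]
        borel_measurable_power measurable_compose[OF _ borel_measurable_norm]
        borel_measurable_sum borel_measurable_times borel_measurable_const borel_measurable_prod pm) auto
  have "(\<Sum>xs\<in>orbs p N (Suc n). (\<Prod>j<Suc n. ?w (xs ! j)) * ennreal ((norm (A xs))\<^sup>2))
     = (\<Sum>x<p * N. ?w x * (\<Sum>xs\<in>orbs p N n. (\<Prod>j<n. ?w (xs ! j)) * ennreal ((norm (A (x # xs)))\<^sup>2)))"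
    unfolding orbs_Suc prod.lessThan_Suc_shift by (simp add: sum_distrib_left mult.assoc)
  also have "\<dots> \<le> (\<Sum>x<p * N. ?w x * (\<integral>\<^sup>+v. W v * ennreal ((norm (\<Phi> x v))\<^sup>2) \<partial>PM ?I))"
    unfolding W_def \<Phi>_def by (intro sum_mono mult_left_mono Suc.IH) auto
  also have "\<dots> = (\<Sum>x<p * N. (\<integral>\<^sup>+v. ?w x * (W v * ennreal ((norm (\<Phi> x v))\<^sup>2)) \<partial>PM ?I))"
    by (intro sum.cong refl nn_integral_cmult[symmetric] borel_measurable_times_ennreal Wm measurable_compose[OF _ measurable_ennreal]
        borel_measurable_power measurable_compose[OF _ borel_measurable_norm] \<Phi>m)
  also have "\<dots> = (\<integral>\<^sup>+v. (\<Sum>x<p * N. ?w x * (W v * ennreal ((norm (\<Phi> x v))\<^sup>2))) \<partial>PM ?I)"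
    by (intro nn_integral_sum[symmetric] borel_measurable_times_ennreal borel_measurable_const Wm measurable_compose[OF _ measurable_ennreal]
        borel_measurable_power measurable_compose[OF _ borel_measurable_norm] \<Phi>m)
  also have "\<dots> = (\<integral>\<^sup>+v. W v * (\<Sum>x<p * N. ?w x * ennreal ((norm (\<Phi> x v))\<^sup>2)) \<partial>PM ?I)"
    by (intro nn_integral_cong) (simp only: sum_distrib_left mult.left_commute)
  also have "\<dots> \<le> (\<integral>\<^sup>+v. W v * (\<integral>\<^sup>+z. ?q z * ennreal ((norm (\<Sum>x<p * N. \<Phi> x v * psi x z))\<^sup>2) \<partial>cylM R) \<partial>PM ?I)"
    by (intro nn_integral_mono mult_left_mono one_particle y t) auto
  also have "\<dots> = (\<integral>\<^sup>+v. (\<integral>\<^sup>+z. W v * (?q z * ennreal ((norm (\<Sum>x<p * N. \<Phi> x v * psi x z))\<^sup>2)) \<partial>cylM R) \<partial>PM ?I)"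
    by (intro nn_integral_cong nn_integral_cmult[symmetric] sets_cylM_borel) measurable
  also have "\<dots> = (\<integral>\<^sup>+v. (\<integral>\<^sup>+z. G (v(i0 := z)) \<partial>cylM R) \<partial>PM ?I)"
  proof (intro nn_integral_cong)
    fix v z
    have "(\<Sum>xs\<in>orbs p N (Suc n). A xs * (\<Prod>j<Suc n. psi (xs ! j) ((v(i0 := z)) (i0 + j)))) = (\<Sum>x<p * N. \<Phi> x v * psi x z)"
      unfolding orbs_Suc prod.lessThan_Suc_shift \<Phi>_def sum_distrib_right by (intro sum.cong refl) (simp add: mult.assoc mult.left_commute)
    moreover have "(\<Prod>j<Suc n. ?q ((v(i0 := z)) (i0 + j))) = ?q z * W v"
      unfolding prod.lessThan_Suc_shift W_def by simp
    ultimately show "W v * (?q z * ennreal ((norm (\<Sum>x<p * N. \<Phi> x v * psi x z))\<^sup>2)) = G (v(i0 := z))"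
      unfolding G_def by (simp only: mult.assoc mult.left_commute)
  qed
  also have "\<dots> = (\<integral>\<^sup>+u. G u \<partial>PM (insert i0 ?I))"
    by (rule product_nn_integral_insert[symmetric, OF _ _ Gm]) auto
  finally show ?case unfolding G_def I .
qed

text \<open>Occupation numbers are not functions of the positions. \<open>tensor_bound\<close>
  replaces \<open>(1 + t) ^ count F y\<close> by a product of functions of position concentrated
  near the orbital, and \<open>1 + x \<le> exp x\<close> turns that product into the cloud factor of
  \<open>partition_bound\<close>.\<close>

lemma exponential_moment:
  assumes y: "y < p * N" and t: "t \<ge> 0"
  shows "(\<Sum>F\<in>ms N. wt F * (1 + t) ^ count F y) \<le> Kc (t * c_psi / sqrt nu0) * C N"
proof -
  let ?t = "t * c_psi / sqrt nu0"
  let ?xi = "real y * l\<^sup>2 / R"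
  let ?Z = "fact N * (nu0 ^ N * exp (l\<^sup>2 / R\<^sup>2 * e0 N))"
  define A where "A xs = complex_of_real (amp p xs * (\<Prod>j<N. sqrt (nu (xs ! j))))" for xs
  have sA: "(\<Sum>xs\<in>orbs p N N. A xs * (\<Prod>j<N. psi (xs ! j) (u (0 + j)))) = orb_sum (orbs p N N) N 0 0 (\<lambda>xs. of_real (amp p xs)) u" for u
  proof (intro sum.cong refl)
    fix xs
    have "complex_of_real (\<Prod>j<N. sqrt (nu (xs ! j))) * (\<Prod>j<N. psi (xs ! j) (u (0 + j))) = (\<Prod>j<N. phi (xs ! j + 0) (u (0 + j)))"
      unfolding of_real_prod prod.distrib[symmetric] using nu_pos
      by (intro prod.cong) (auto simp: psi_def less_imp_neq[symmetric])
    then show "A xs * (\<Prod>j<N. psi (xs ! j) (u (0 + j))) = of_real (amp p xs) * (\<Prod>j<N. phi (xs ! j + 0) (u (0 + j)))"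
      unfolding A_def of_real_mult by (simp only: mult.assoc)
  qed
  have sq: "(norm (\<Sum>xs\<in>orbs p N N. A xs * (\<Prod>j<N. psi (xs ! j) (u (0 + j)))))\<^sup>2 = boltz {..<N} 0 u" for u
    unfolding sA using orb_sum_boltz[where n = N and ?i0.0 = 0 and s = 0 and u = u]
    by (simp only: complex_norm_square[symmetric] of_real_eq_iff add_0 atLeast0LessThan)
  have val: "(\<Sum>xs\<in>orbs p N N. (\<Prod>j<N. ennreal (1 + t * of_bool (xs ! j = y))) * ennreal ((norm (A xs))\<^sup>2))
      = ennreal (?Z * (\<Sum>F\<in>bgs N 0. wt F * (1 + t) ^ count F y))"
  proof -
    have "(\<Prod>j<N. ennreal (1 + t * of_bool (xs ! j = y))) * ennreal ((norm (A xs))\<^sup>2)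
        = ennreal (nu0 ^ N * exp (l\<^sup>2 / R\<^sup>2 * e0 N) * ((lamp xs)\<^sup>2 * (1 + t) ^ count (mset xs) y))"
      if xs: "xs \<in> orbs p N N" for xs
    proof -
      have lx: "length xs = N" using xs by (simp add: orbs_def)
      have "(\<Prod>j<N. 1 + t * of_bool (xs ! j = y)) = (\<Prod>x\<leftarrow>xs. 1 + t * of_bool (x = y))"
        using prod_nth_list[of "\<lambda>x. 1 + t * of_bool (x = y)" xs] lx by simp
      also have "\<dots> = (1 + t) ^ count (mset xs) y" by (induction xs) auto
      finally have 1: "(\<Prod>j<N. 1 + t * of_bool (xs ! j = y)) = (1 + t) ^ count (mset xs) y" .
      have "(norm (A xs))\<^sup>2 = (amp p xs)\<^sup>2 * (\<Prod>j<N. sqrt (nu (xs ! j)))\<^sup>2"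
        unfolding A_def norm_of_real power2_abs power_mult_distrib ..
      also have "(\<Prod>j<N. sqrt (nu (xs ! j)))\<^sup>2 = (\<Prod>j<N. nu (xs ! j))"
        using nu_pos by (simp add: prod_power_distrib less_imp_le)
      also have "\<dots> = nu0 ^ N * exp (l\<^sup>2 / R\<^sup>2 * en xs)" using prod_nu[of xs] lx by simp
      also have "exp (l\<^sup>2 / R\<^sup>2 * en xs) = exp (l\<^sup>2 / R\<^sup>2 * e0 N) * (exp (l\<^sup>2 / R\<^sup>2 / 2 * (en xs - e0 N)))\<^sup>2"
        by (simp add: power2_eq_square right_diff_distrib flip: exp_add)
      also have "(amp p xs)\<^sup>2 * (nu0 ^ N * (exp (l\<^sup>2 / R\<^sup>2 * e0 N) * (exp (l\<^sup>2 / R\<^sup>2 / 2 * (en xs - e0 N)))\<^sup>2))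
          = nu0 ^ N * exp (l\<^sup>2 / R\<^sup>2 * e0 N) * (lamp xs)\<^sup>2"
        unfolding lamp_def lx power_mult_distrib by (simp only: ac_simps)
      finally have 2: "(norm (A xs))\<^sup>2 = nu0 ^ N * exp (l\<^sup>2 / R\<^sup>2 * e0 N) * (lamp xs)\<^sup>2" .
      have "(\<Prod>j<N. ennreal (1 + t * of_bool (xs ! j = y))) = ennreal ((1 + t) ^ count (mset xs) y)"
        unfolding 1[symmetric] using t by (intro prod_ennreal) auto
      then show ?thesis unfolding 2 using t nu0_pos by (simp add: ac_simps flip: ennreal_mult)
    qed
    then have "(\<Sum>xs\<in>orbs p N N. (\<Prod>j<N. ennreal (1 + t * of_bool (xs ! j = y))) * ennreal ((norm (A xs))\<^sup>2))
        = (\<Sum>xs\<in>orbs p N N. ennreal (nu0 ^ N * exp (l\<^sup>2 / R\<^sup>2 * e0 N) * ((lamp xs)\<^sup>2 * (1 + t) ^ count (mset xs) y)))"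
      by (rule sum.cong[OF refl])
    also have "\<dots> = ennreal (\<Sum>xs\<in>orbs p N N. nu0 ^ N * exp (l\<^sup>2 / R\<^sup>2 * e0 N) * ((lamp xs)\<^sup>2 * (1 + t) ^ count (mset xs) y))"
      using t nu0_pos by (intro sum_ennreal) simp
    also have "(\<Sum>xs\<in>orbs p N N. nu0 ^ N * exp (l\<^sup>2 / R\<^sup>2 * e0 N) * ((lamp xs)\<^sup>2 * (1 + t) ^ count (mset xs) y))
        = nu0 ^ N * exp (l\<^sup>2 / R\<^sup>2 * e0 N) * (\<Sum>xs\<in>orbs p N N. (lamp xs)\<^sup>2 * (1 + t) ^ count (mset xs) y)"
      by (simp only: sum_distrib_left)
    also have "(\<Sum>xs\<in>orbs p N N. (lamp xs)\<^sup>2 * (1 + t) ^ count (mset xs) y) = fact N * (\<Sum>F\<in>bgs N 0. wt F * (1 + t) ^ count F y)"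
    proof -
      have "(lamp xs)\<^sup>2 * (1 + t) ^ count (mset xs) y = (lamp ys)\<^sup>2 * (1 + t) ^ count (mset ys) y" if "mset xs = mset ys" for xs ys
        unfolding that lamp_mset_sq[OF that] ..
      then have "(\<Sum>xs\<in>orbs p N (N - 0). (lamp xs)\<^sup>2 * (1 + t) ^ count (mset xs) y) = fact (N - 0) *
          (\<Sum>F\<in>bgs N 0. (lamp (sorted_list_of_multiset F))\<^sup>2 * (1 + t) ^ count (mset (sorted_list_of_multiset F)) y / mfac F)"
        by (rule sum_orbs_mset) simp_all
      then show ?thesis by (simp add: wt_def)
    qed
    finally show ?thesis by (simp only: ac_simps)
  qed
  have "ennreal (?Z * (\<Sum>F\<in>bgs N 0. wt F * (1 + t) ^ count F y))
     \<le> (\<integral>\<^sup>+u. (\<Prod>j<N. ennreal (1 + t * c_psi * norm (psi y (u (0 + j))))) * ennreal (boltz {..<N} 0 u) \<partial>PM {..<N})"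
    using tensor_bound[OF y t, where n = N and A = A and ?i0.0 = 0] unfolding val sq by (simp only: add_0 atLeast0LessThan)
  also have "\<dots> \<le> (\<integral>\<^sup>+u. ennreal (boltz {..<N} 0 u * exp (?t * cloud N ?xi u)) \<partial>PM {..<N})"
  proof (intro nn_integral_mono)
    fix u
    have "(\<Prod>j<N. 1 + t * c_psi * norm (psi y (u j))) \<le> (\<Prod>j<N. exp (?t * exp (- (Re (u j) - ?xi)\<^sup>2 / (2 * l\<^sup>2))))"
    proof (intro prod_mono conjI)
      fix j
      have "1 + t * c_psi * norm (psi y (u j)) = 1 + ?t * exp (- (Re (u j) - ?xi)\<^sup>2 / (2 * l\<^sup>2))"
        unfolding norm_psi by simp
      also have "\<dots> \<le> exp (?t * exp (- (Re (u j) - ?xi)\<^sup>2 / (2 * l\<^sup>2)))" by (rule exp_ge_add_one_self)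
      finally show "1 + t * c_psi * norm (psi y (u j)) \<le> exp (?t * exp (- (Re (u j) - ?xi)\<^sup>2 / (2 * l\<^sup>2)))" .
    qed (use t c_psi_pos in auto)
    also have "\<dots> = exp (?t * cloud N ?xi u)"
      unfolding cloud_def sum_distrib_left by (simp only: exp_sum finite_lessThan)
    finally have "(\<Prod>j<N. 1 + t * c_psi * norm (psi y (u j))) \<le> exp (?t * cloud N ?xi u)" .
    moreover have "(\<Prod>j<N. ennreal (1 + t * c_psi * norm (psi y (u (0 + j))))) = ennreal (\<Prod>j<N. 1 + t * c_psi * norm (psi y (u j)))"
      using t c_psi_pos by (subst prod_ennreal) auto
    ultimately show "(\<Prod>j<N. ennreal (1 + t * c_psi * norm (psi y (u (0 + j))))) * ennreal (boltz {..<N} 0 u)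
        \<le> ennreal (boltz {..<N} 0 u * exp (?t * cloud N ?xi u))"
      by (simp add: ennreal_mult mult.commute mult_left_mono ennreal_leI)
  qed
  also have "\<dots> \<le> ennreal (?Z * (Kc ?t * (C (y div p) * C (N - y div p))))"
  \<comment> \<open>Orbital \<open>y\<close> is centred between the reference positions of the
    particles \<open>y div p\<close> and \<open>y div p + 1\<close>, so this is where the chain is
    cut.\<close>
  proof (rule partition_bound)
    have "y div p < N" using y p_pos by (simp add: less_mult_imp_div_less mult.commute)
    then show "y div p \<le> N" by simp
    have "real (y div p * p) \<le> real y" by (intro of_nat_mono) simp
    then have "real (y div p) * real p \<le> real y" by simp
    moreover have "y \<le> y div p * p + p" using p_pos mod_less_divisor[of p y] div_mult_mod_eq[of y p] by linarith
    then have "real y \<le> real (y div p) * real p + real p" by (metis of_nat_add of_nat_le_iff of_nat_mult)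
    ultimately have "real (y div p) * real p * (l\<^sup>2 / R) \<le> real y * (l\<^sup>2 / R)" "real y * (l\<^sup>2 / R) \<le> (real (y div p) * real p + real p) * (l\<^sup>2 / R)"
      using R_pos by (intro mult_right_mono; simp)+
    then show "real (y div p) * spac \<le> ?xi" "?xi \<le> real (y div p) * spac + spac"
      unfolding spac_def by (simp_all add: distrib_right mult.assoc add_divide_distrib)
    show "?t \<ge> 0" using t c_psi_pos nu0_pos by simp
  qed
  finally have "?Z * (\<Sum>F\<in>bgs N 0. wt F * (1 + t) ^ count F y) \<le> ?Z * (Kc ?t * (C (y div p) * C (N - y div p)))"
    using nu0_pos C_nonneg Kc_nonneg by (subst (asm) ennreal_le_iff) auto
  then have "(\<Sum>F\<in>bgs N 0. wt F * (1 + t) ^ count F y) \<le> Kc ?t * (C (y div p) * C (N - y div p))"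
    using nu0_pos by (subst (asm) mult_le_cancel_left_pos) auto
  also have "\<dots> \<le> Kc ?t * C N"
  proof (intro mult_left_mono Kc_nonneg)
    have "y div p \<le> N" using y p_pos by (simp add: less_mult_imp_div_less mult.commute less_imp_le)
    then show "C (y div p) * C (N - y div p) \<le> C N" using C_mult_le[of "y div p" "N - y div p"] by simp
  qed
  finally have "(\<Sum>F\<in>bgs N 0. wt F * (1 + t) ^ count F y) \<le> Kc ?t * C N" .
  moreover have "(\<Sum>F\<in>ms N. wt F * (1 + t) ^ count F y) \<le> (\<Sum>F\<in>bgs N 0. wt F * (1 + t) ^ count F y)"
    using t wt_nonneg by (intro sum_mono2 finite_bgs) (auto simp: ms_def bgs_def)
  ultimately show ?thesis by linarith
qed

text \<open>\<open>exp 1 - 1\<close> is the parameter \<open>t\<close> for which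
  \<open>(1 + t) ^ n\<close> equals \<open>exp n\<close>, and \<open>exp n\<close> dominates
  \<open>n ^ k / fact k\<close>. The leading 1 covers orbitals out of range, where the occupation
  number is 0 but its power for \<open>k = 0\<close> is 1.\<close>

definition c_mom :: "nat \<Rightarrow> real" where
  "c_mom k = 1 + fact k * Kc ((exp 1 - 1) * c_psi / sqrt nu0)"

lemma occupation_moments:
  "(\<Sum>F\<in>ms N. wt F * real (count F y) ^ k) \<le> c_mom k * C N"
proof (cases "y < p * N")
  case True
  have pw: "x ^ k \<le> fact k * exp x" if x: "x \<ge> 0" for x :: real
  proof -
    have "(\<Sum>n\<in>{k}. inverse (fact n) * x ^ n) \<le> (\<Sum>n. inverse (fact n) * x ^ n)"
      using x summable_exp_generic[of x] by (intro sum_le_suminf) (auto simp: scaleR_conv_of_real divide_inverse)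
    then have "inverse (fact k) * x ^ k \<le> exp x" by (simp add: exp_def)
    then show ?thesis by (simp add: field_simps)
  qed
  have "(\<Sum>F\<in>ms N. wt F * real (count F y) ^ k) \<le> (\<Sum>F\<in>ms N. wt F * (fact k * (1 + (exp 1 - 1)) ^ count F y))"
  proof (intro sum_mono mult_left_mono wt_nonneg)
    fix F
    have "exp (real (count F y)) = (exp 1) ^ count F y" using exp_of_nat_mult[of "count F y" "1::real"] by simp
    then show "real (count F y) ^ k \<le> fact k * (1 + (exp 1 - 1)) ^ count F y"
      using pw[of "real (count F y)"] by simp
  qed
  also have "\<dots> = fact k * (\<Sum>F\<in>ms N. wt F * (1 + (exp 1 - 1)) ^ count F y)"
    by (simp only: sum_distrib_left mult.left_commute)
  also have "\<dots> \<le> fact k * (Kc ((exp 1 - 1) * c_psi / sqrt nu0) * C N)"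
    by (intro mult_left_mono exponential_moment True) (use exp_ge_add_one_self[of 1] in auto)
  also have "\<dots> \<le> c_mom k * C N" unfolding c_mom_def using C_nonneg[of N] by (simp add: distrib_right)
  finally show ?thesis .
next
  case False
  have "(\<Sum>F\<in>ms N. wt F * real (count F y) ^ k) \<le> (\<Sum>F\<in>ms N. wt F * 1)"
  proof (intro sum_mono mult_left_mono wt_nonneg)
    fix F assume "F \<in> ms N"
    then have "y \<notin># F" using False by (auto simp: ms_def)
    then have "count F y = 0" by (simp add: count_eq_zero_iff)
    then show "real (count F y) ^ k \<le> 1" by (cases k) auto
  qed
  also have "\<dots> = 1 * C N" by (simp add: C_def)
  also have "\<dots> \<le> c_mom k * C N"
    unfolding c_mom_def using C_nonneg[of N] Kc_nonneg by (intro mult_right_mono) auto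
  finally show ?thesis .
qed

sublocale clustering p "l\<^sup>2 / R\<^sup>2" "Kc 0" c_mom
  by unfold_locales (rule C_submult occupation_moments)+

end

section \<open>Clustering of the correlation functions\<close>

text \<open>On either side of \<open>t\<close> the distances of the integers are at least 0, 1, 2,
  and so on, and a natural number is at most its square: two geometric series.\<close>

lemma gauss_lattice_sum:
  fixes c t :: real
  assumes c: "c > 0" and S: "finite S"
  shows "(\<Sum>k\<in>S. exp (- c * (t - real k)\<^sup>2)) \<le> 2 / (1 - exp (- c))"
proof -
  have term_le: "exp (- c * (t - real k)\<^sup>2) \<le> exp (- c) ^ j" if j: "real j \<le> \<bar>t - real k\<bar>" for j k
  proof -
    have "real j \<le> (real j)\<^sup>2" by (cases j) (auto simp: power2_eq_square)
    also have "\<dots> \<le> (t - real k)\<^sup>2" using j by (metis abs_of_nat abs_le_square_iff)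
    finally have "- c * (t - real k)\<^sup>2 \<le> real j * (- c)" using c by (simp add: mult.commute mult_left_mono)
    then show ?thesis unfolding exp_of_nat_mult[symmetric] by simp
  qed
  let ?A = "{k \<in> S. real k \<le> t}" and ?B = "{k \<in> S. t < real k}"
  have e: "0 \<le> exp (- c)" "exp (- c) < 1" using c by auto
  have "(\<Sum>k\<in>?A. exp (- c * (t - real k)\<^sup>2)) \<le> (\<Sum>k\<in>?A. exp (- c) ^ (nat \<lfloor>t\<rfloor> - k))"
  proof (intro sum_mono term_le)
    fix k assume "k \<in> ?A"
    then have "real k \<le> t" by simp
    then have "k \<le> nat \<lfloor>t\<rfloor>" "real (nat \<lfloor>t\<rfloor>) \<le> t" by (auto simp: le_nat_floor)
    then show "real (nat \<lfloor>t\<rfloor> - k) \<le> \<bar>t - real k\<bar>" by (simp add: of_nat_diff)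
  qed
  also have "\<dots> \<le> 1 / (1 - exp (- c))"
  proof (intro sum_geometric_le e)
    show "inj_on (\<lambda>k. nat \<lfloor>t\<rfloor> - k) ?A"
    proof (rule inj_onI)
      fix j k assume "j \<in> ?A" "k \<in> ?A" "nat \<lfloor>t\<rfloor> - j = nat \<lfloor>t\<rfloor> - k"
      moreover from this have "j \<le> nat \<lfloor>t\<rfloor>" "k \<le> nat \<lfloor>t\<rfloor>" by (auto simp: le_nat_floor)
      ultimately show "j = k" by linarith
    qed
  qed (use S in simp)
  finally have A: "(\<Sum>k\<in>?A. exp (- c * (t - real k)\<^sup>2)) \<le> 1 / (1 - exp (- c))" .
  have up: "nat \<lceil>t\<rceil> \<le> k" if "k \<in> ?B" for k
  proof -
    have "t \<le> real k" using that by simp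
    then show ?thesis by simp
  qed
  have "(\<Sum>k\<in>?B. exp (- c * (t - real k)\<^sup>2)) \<le> (\<Sum>k\<in>?B. exp (- c) ^ (k - nat \<lceil>t\<rceil>))"
  proof (intro sum_mono term_le)
    fix k assume k: "k \<in> ?B"
    have "t \<le> real (nat \<lceil>t\<rceil>)" by (rule real_nat_ceiling_ge)
    then show "real (k - nat \<lceil>t\<rceil>) \<le> \<bar>t - real k\<bar>" using up[OF k] by (simp add: of_nat_diff)
  qed
  also have "\<dots> \<le> 1 / (1 - exp (- c))"
  proof (intro sum_geometric_le e)
    show "inj_on (\<lambda>k. k - nat \<lceil>t\<rceil>) ?B"
    proof (rule inj_onI)
      fix j k assume "j \<in> ?B" "k \<in> ?B" "j - nat \<lceil>t\<rceil> = k - nat \<lceil>t\<rceil>"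
      then show "j = k" using up[of j] up[of k] by linarith
    qed
  qed (use S in simp)
  finally have B: "(\<Sum>k\<in>?B. exp (- c * (t - real k)\<^sup>2)) \<le> 1 / (1 - exp (- c))" .
  have "(\<Sum>k\<in>S. exp (- c * (t - real k)\<^sup>2)) = (\<Sum>k\<in>?A. exp (- c * (t - real k)\<^sup>2)) + (\<Sum>k\<in>?B. exp (- c * (t - real k)\<^sup>2))"
    using S by (subst sum.union_disjoint[symmetric]) (auto intro: sum.cong)
  also have "\<dots> \<le> 1 / (1 - exp (- c)) + 1 / (1 - exp (- c))" by (intro add_mono A B)
  finally show ?thesis by simp
qed

lemma sum_orbs_prod:
  fixes f :: "nat \<Rightarrow> nat \<Rightarrow> real"
  shows "(\<Sum>xs\<in>orbs p N n. \<Prod>i<n. f i (xs ! i)) = (\<Prod>i<n. \<Sum>y<p * N. f i y)"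
proof (induction n arbitrary: f)
  case 0
  have "orbs p N 0 = {[]}" by (auto simp: orbs_def)
  then show ?case by simp
next
  case (Suc n)
  have "(\<Sum>xs\<in>orbs p N (Suc n). \<Prod>i<Suc n. f i (xs ! i)) = (\<Sum>x<p * N. f 0 x * (\<Sum>xs\<in>orbs p N n. \<Prod>i<n. f (Suc i) (xs ! i)))"
    unfolding orbs_Suc prod.lessThan_Suc_shift by (simp add: sum_distrib_left)
  also have "\<dots> = (\<Prod>i<Suc n. \<Sum>y<p * N. f i y)"
    unfolding Suc.IH[of "\<lambda>i. f (Suc i)"] prod.lessThan_Suc_shift by (simp add: sum_distrib_right)
  finally show ?case .
qed

text \<open>The circumference is bounded, so separation on the cylinder is separation along the axis
  up to a constant.\<close>

lemma cyl_dist_le: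
  assumes R: "R > 0" and "z \<in> cyl R" "w \<in> cyl R"
  shows "cyl_dist R z w \<le> \<bar>Re z - Re w\<bar> + 2 * pi * R"
proof -
  let ?h = "\<lambda>k::int. \<bar>Im z - Im w - 2 * pi * R * of_int k\<bar>"
  have bb: "bdd_below (range ?h)" by (rule bdd_belowI[of _ 0]) auto
  have "(INF k. ?h k) \<le> ?h 0" by (rule cINF_lower[OF bb]) simp
  also have "\<dots> \<le> 2 * pi * R" using assms by (auto simp: cyl_def)
  finally have up: "(INF k. ?h k) \<le> 2 * pi * R" .
  have lo: "0 \<le> (INF k. ?h k)" by (rule cINF_greatest) auto
  have "cyl_dist R z w \<le> \<bar>Re z - Re w\<bar> + \<bar>INF k. ?h k\<bar>"
    unfolding cyl_dist_def by (rule sqrt_sum_squares_le_sum_abs)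
  then show ?thesis using up lo by linarith
qed

context cylinder
begin

text \<open>Half of the Gaussian exponent of \<open>psi\<close> is kept here to sum over the
  orbitals; the other half supplies the decay in \<open>norm_psi_far\<close>.\<close>

definition broad :: "nat \<Rightarrow> complex \<Rightarrow> real" where
  "broad k z = exp (- (Re z - real k * l\<^sup>2 / R)\<^sup>2 / (4 * l\<^sup>2)) / sqrt nu0"

lemma broad_nonneg: "broad k z \<ge> 0"
  using nu0_pos by (simp add: broad_def)

lemma norm_psi_broad: "norm (psi k z) = exp (- (Re z - real k * l\<^sup>2 / R)\<^sup>2 / (4 * l\<^sup>2)) * broad k z"
proof -
  have "- (Re z - real k * l\<^sup>2 / R)\<^sup>2 / (2 * l\<^sup>2) = - (Re z - real k * l\<^sup>2 / R)\<^sup>2 / (4 * l\<^sup>2) + - (Re z - real k * l\<^sup>2 / R)\<^sup>2 / (4 * l\<^sup>2)"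
    by simp
  then show ?thesis unfolding norm_psi broad_def by (simp only: exp_add times_divide_eq_right)
qed

lemma norm_psi_le: "norm (psi k z) \<le> broad k z"
  unfolding norm_psi_broad using broad_nonneg[of k z] by (intro mult_left_le_one_le) auto

lemma norm_psi_far:
  assumes "0 \<le> r" "r \<le> \<bar>Re z - real k * l\<^sup>2 / R\<bar>"
  shows "norm (psi k z) \<le> exp (- r\<^sup>2 / (4 * l\<^sup>2)) * broad k z"
proof -
  have "r\<^sup>2 \<le> (Re z - real k * l\<^sup>2 / R)\<^sup>2" using assms by (metis abs_le_square_iff abs_of_nonneg)
  then show ?thesis unfolding norm_psi_broad using broad_nonneg[of k z] l_pos
    by (intro mult_right_mono) (simp_all add: divide_right_mono)
qed

definition c_broad :: real where
  "c_broad = 2 / (1 - exp (- (l\<^sup>2 / (4 * R\<^sup>2)))) / sqrt nu0"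

lemma sum_broad_le:
  assumes "finite S" shows "(\<Sum>k\<in>S. broad k z) \<le> c_broad"
proof -
  have "broad k z = exp (- (l\<^sup>2 / (4 * R\<^sup>2)) * (Re z * R / l\<^sup>2 - real k)\<^sup>2) / sqrt nu0" for k
  proof -
    have "- (Re z - real k * l\<^sup>2 / R)\<^sup>2 / (4 * l\<^sup>2) = - (l\<^sup>2 / (4 * R\<^sup>2)) * (Re z * R / l\<^sup>2 - real k)\<^sup>2"
      using R_pos l_pos by (simp add: field_simps power2_eq_square)
    then show ?thesis by (simp only: broad_def)
  qed
  then have "(\<Sum>k\<in>S. broad k z) = (\<Sum>k\<in>S. exp (- (l\<^sup>2 / (4 * R\<^sup>2)) * (Re z * R / l\<^sup>2 - real k)\<^sup>2)) / sqrt nu0"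
    by (simp add: sum_divide_distrib)
  also have "\<dots> \<le> c_broad"
    unfolding c_broad_def using R_pos l_pos nu0_pos by (intro divide_right_mono gauss_lattice_sum assms) auto
  finally show ?thesis .
qed

lemma sum_prod_broad_le: "(\<Sum>xs\<in>orbs p N n. \<Prod>i<n. broad (xs ! i) (z i)) \<le> c_broad ^ n"
proof -
  have "(\<Sum>xs\<in>orbs p N n. \<Prod>i<n. broad (xs ! i) (z i)) = (\<Prod>i<n. \<Sum>y<p * N. broad y (z i))"
    by (rule sum_orbs_prod)
  also have "\<dots> \<le> (\<Prod>i<n. c_broad)"
    by (intro prod_mono conjI sum_broad_le sum_nonneg broad_nonneg) auto
  finally show ?thesis by simp
qed

definition delta :: "nat \<Rightarrow> nat \<Rightarrow> nat list \<Rightarrow> nat list \<Rightarrow> real" where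
  "delta N m as bs = Gam N as bs / C N - Gam N (take m as) (take m bs) / C N * (Gam N (drop m as) (drop m bs) / C N)"

lemma corr_diff:
  assumes \<kappa>: "\<kappa> N > 0" and N: "m + n \<le> N"
  shows "corr R l p \<kappa> N (m + n) z z' - corr R l p \<kappa> N m z z' * corr R l p \<kappa> N n (\<lambda>j. z (m + j)) (\<lambda>j. z' (m + j))
    = (\<Sum>as\<in>orbs p N (m + n). \<Sum>bs\<in>orbs p N (m + n). (\<Prod>i<m + n. psi (as ! i) (z i)) * cnj (\<Prod>i<m + n. psi (bs ! i) (z' i))
        * of_real (delta N m as bs))"
proof -
  let ?q = "m + n"
  let ?P = "\<lambda>as. \<Prod>i<?q. psi (as ! i) (z i)" and ?P' = "\<lambda>bs. cnj (\<Prod>i<?q. psi (bs ! i) (z' i))"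
  let ?X = "\<lambda>a b. (\<Prod>i<m. psi (a ! i) (z i)) * cnj (\<Prod>i<m. psi (b ! i) (z' i)) * of_real (Gam N a b / C N)"
  let ?Y = "\<lambda>a b. (\<Prod>i<n. psi (a ! i) (z (m + i))) * cnj (\<Prod>i<n. psi (b ! i) (z' (m + i))) * of_real (Gam N a b / C N)"
  have split: "(\<Prod>i<?q. psi ((a1 @ a2) ! i) (w i)) = (\<Prod>i<m. psi (a1 ! i) (w i)) * (\<Prod>i<n. psi (a2 ! i) (w (m + i)))"
    if "a1 \<in> orbs p N m" for a1 a2 and w :: "nat \<Rightarrow> complex"
  proof -
    have la: "length a1 = m" using that by (simp add: orbs_def)
    have "(\<Prod>i<?q. psi ((a1 @ a2) ! i) (w i)) = (\<Prod>i<m. psi ((a1 @ a2) ! i) (w i)) * (\<Prod>i\<in>{m..<m + n}. psi ((a1 @ a2) ! i) (w i))"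
      by (subst prod.union_disjoint[symmetric]) (auto intro: prod.cong)
    also have "(\<Prod>i<m. psi ((a1 @ a2) ! i) (w i)) = (\<Prod>i<m. psi (a1 ! i) (w i))"
      by (intro prod.cong) (auto simp: nth_append la)
    also have "(\<Prod>i\<in>{m..<m + n}. psi ((a1 @ a2) ! i) (w i)) = (\<Prod>i<n. psi (a2 ! i) (w (m + i)))"
      using prod.shift_bounds_nat_ivl[of "\<lambda>i. psi ((a1 @ a2) ! i) (w i)" 0 m n]
      by (simp add: atLeast0LessThan nth_append la add.commute)
    finally show ?thesis .
  qed
  have pr: "?P (a1 @ a2) * ?P' (b1 @ b2) * of_real (Gam N (take m (a1 @ a2)) (take m (b1 @ b2)) / C N * (Gam N (drop m (a1 @ a2)) (drop m (b1 @ b2)) / C N))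
     = ?X a1 b1 * ?Y a2 b2" if "a1 \<in> orbs p N m" "b1 \<in> orbs p N m" for a1 a2 b1 b2
  proof -
    have "length a1 = m" "length b1 = m" using that by (auto simp: orbs_def)
    then have td: "take m (a1 @ a2) = a1" "take m (b1 @ b2) = b1" "drop m (a1 @ a2) = a2" "drop m (b1 @ b2) = b2" by auto
    show ?thesis unfolding td split[OF that(1)] split[OF that(2)] complex_cnj_mult of_real_mult by (simp only: ac_simps)
  qed
  have "corr R l p \<kappa> N m z z' * corr R l p \<kappa> N n (\<lambda>j. z (m + j)) (\<lambda>j. z' (m + j))
     = (\<Sum>a1\<in>orbs p N m. \<Sum>b1\<in>orbs p N m. ?X a1 b1) * (\<Sum>a2\<in>orbs p N n. \<Sum>b2\<in>orbs p N n. ?Y a2 b2)"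
    using N by (simp only: corr_orbital_sum[of \<kappa> N m, OF \<kappa>] corr_orbital_sum[of \<kappa> N n, OF \<kappa>] Gam_Nil)
  also have "\<dots> = (\<Sum>a1\<in>orbs p N m. \<Sum>a2\<in>orbs p N n. \<Sum>b1\<in>orbs p N m. \<Sum>b2\<in>orbs p N n. ?X a1 b1 * ?Y a2 b2)"
    by (simp only: sum_product)
  also have "\<dots> = (\<Sum>a1\<in>orbs p N m. \<Sum>a2\<in>orbs p N n. \<Sum>b1\<in>orbs p N m. \<Sum>b2\<in>orbs p N n.
      ?P (a1 @ a2) * ?P' (b1 @ b2) * of_real (Gam N (take m (a1 @ a2)) (take m (b1 @ b2)) / C N * (Gam N (drop m (a1 @ a2)) (drop m (b1 @ b2)) / C N)))"
    by (intro sum.cong refl pr[symmetric])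
  also have "\<dots> = (\<Sum>as\<in>orbs p N ?q. \<Sum>bs\<in>orbs p N ?q.
      ?P as * ?P' bs * of_real (Gam N (take m as) (take m bs) / C N * (Gam N (drop m as) (drop m bs) / C N)))"
    by (simp only: orbs_append[of m ?q] le_add1 add_diff_cancel_left')
  finally have prod: "corr R l p \<kappa> N m z z' * corr R l p \<kappa> N n (\<lambda>j. z (m + j)) (\<lambda>j. z' (m + j)) = \<dots>" .
  have "corr R l p \<kappa> N ?q z z' = (\<Sum>as\<in>orbs p N ?q. \<Sum>bs\<in>orbs p N ?q. ?P as * ?P' bs * of_real (Gam N as bs / C N))"
    using corr_orbital_sum[of \<kappa> N ?q, OF \<kappa> N] by (simp only: Gam_Nil)
  then show ?thesis
    unfolding prod delta_def by (simp only: sum_subtractf[symmetric] of_real_diff right_diff_distrib)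
qed

definition c_delta :: "nat \<Rightarrow> nat \<Rightarrow> real" where
  "c_delta m n = Bc (m + n) * Bc 0 + Bc m * Bc 0 * (Bc n * Bc 0)"

lemma c_delta_nonneg: "c_delta m n \<ge> 0"
  unfolding c_delta_def using Bc_pos by (intro add_nonneg_nonneg mult_nonneg_nonneg less_imp_le)

lemma delta_le:
  assumes "as \<in> orbs p N (m + n)" "bs \<in> orbs p N (m + n)" "m + n \<le> N"
  shows "\<bar>delta N m as bs\<bar> \<le> c_delta m n"
proof -
  have len: "length as = m + n" "length bs = m + n" using assms by (auto simp: orbs_def)
  have G: "\<bar>Gam N a b / C N\<bar> \<le> Bc k * Bc 0" if "length a = k" "length b = k" "k \<le> N" for a b k
    using Gam_le[of a b N] that by (simp add: abs_divide abs_of_pos[OF C_pos] pos_divide_le_eq[OF C_pos])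
  have "\<bar>delta N m as bs\<bar> \<le> \<bar>Gam N as bs / C N\<bar> + \<bar>Gam N (take m as) (take m bs) / C N\<bar> * \<bar>Gam N (drop m as) (drop m bs) / C N\<bar>"
    unfolding delta_def abs_mult[symmetric] by (rule abs_triangle_ineq4)
  also have "\<dots> \<le> c_delta m n"
    unfolding c_delta_def using len assms(3) Bc_pos
    by (intro add_mono mult_mono G mult_nonneg_nonneg) (auto simp: less_imp_le)
  finally show ?thesis .
qed

lemma delta_separated:
  assumes ab: "as \<in> orbs p N (m + n)" "bs \<in> orbs p N (m + n)" and N: "m + n \<le> N" and D: "4 * p \<le> D"
    and sep: "\<And>x y. x \<in> set (take m as @ take m bs) \<Longrightarrow> y \<in> set (drop m as @ drop m bs) \<Longrightarrow> x + D \<le> y \<or> y + D \<le> x"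
  shows "\<bar>delta N m as bs\<bar> \<le> real (4 * (m + n)) * eps (m + n) (D div (4 * p))"
proof -
  have len: "length (take m as) = m" "length (take m bs) = m" "length (drop m as) = n" "length (drop m bs) = n"
    using ab by (auto simp: orbs_def)
  have bnd: "x < p * N" if "x \<in> set (take m as @ take m bs @ drop m as @ drop m bs)" for x
    using that ab by (auto simp: orbs_def dest!: in_set_takeD in_set_dropD)
  have C: "C N > 0" by (rule C_pos)
  then have C0: "C N \<noteq> 0" by (metis less_irrefl)
  have "\<bar>Gam N (take m as @ drop m as) (take m bs @ drop m bs) * C N - Gam N (take m as) (take m bs) * Gam N (drop m as) (drop m bs)\<bar>
      \<le> real (4 * (m + n)) * eps (m + n) (D div (4 * p)) * (C N)\<^sup>2"
    by (rule Gam_clustering[OF len N D bnd sep])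
  moreover have "delta N m as bs = (Gam N as bs * C N - Gam N (take m as) (take m bs) * Gam N (drop m as) (drop m bs)) / (C N)\<^sup>2"
    unfolding delta_def using C0 by (simp add: diff_divide_distrib power2_eq_square)
  moreover have "(C N)\<^sup>2 > 0" using C0 by simp
  ultimately show ?thesis by (simp only: abs_divide abs_of_pos pos_divide_le_eq append_take_drop_id)
qed

text \<open>If every index has its centre within a quarter of \<open>d - 2 * pi * R\<close> from its
  point, the centres of the two clouds are at least half of that length apart. Division by the
  distance \<open>l\<^sup>2 / R\<close> of neighbouring centres converts this to a difference of
  indices.\<close>

definition gap :: "real \<Rightarrow> nat" where
  "gap d = nat \<lfloor>(d - 2 * pi * R) / (2 * (l\<^sup>2 / R))\<rfloor>"

text \<open>The first term belongs to index lists close to their points and hence separated, the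
  second to lists with some index far from its point. For \<open>gap d < 4 * p\<close> the four
  windows do not fit, and the uniform bound takes over, so that the estimate holds for every
  \<open>d\<close>.\<close>

definition rate :: "nat \<Rightarrow> nat \<Rightarrow> real \<Rightarrow> real" where
  "rate m n d = (if 4 * p \<le> gap d then real (4 * (m + n)) * eps (m + n) (gap d div (4 * p)) else c_delta m n)
     + c_delta m n * exp (- ((d - 2 * pi * R) / 4)\<^sup>2 / (4 * l\<^sup>2))"

lemma rate_nonneg: "rate m n d \<ge> 0"
  unfolding rate_def using eps_nonneg c_delta_nonneg by (intro add_nonneg_nonneg) auto

lemma gap_at_top: "filterlim (\<lambda>d. gap d div (4 * p)) at_top at_top"
  unfolding filterlim_at_top
proof
  fix Z
  show "\<forall>\<^sub>F d in at_top. Z \<le> gap d div (4 * p)"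
    using eventually_ge_at_top[of "2 * pi * R + 2 * (l\<^sup>2 / R) * real (4 * p * Z)"]
  proof eventually_elim
    case (elim d)
    have b: "2 * (l\<^sup>2 / R) > 0" using R_pos l_pos by simp
    have "real (4 * p * Z) \<le> (d - 2 * pi * R) / (2 * (l\<^sup>2 / R))"
      unfolding pos_le_divide_eq[OF b] using elim by (simp only: mult.commute algebra_simps)
    then have "4 * p * Z \<le> gap d" unfolding gap_def by (rule le_nat_floor)
    then have "(4 * p * Z) div (4 * p) \<le> gap d div (4 * p)" by (rule div_le_mono)
    then show "Z \<le> gap d div (4 * p)" using p_pos by simp
  qed
qed

lemma rate_tendsto: "(rate m n \<longlongrightarrow> 0) at_top"
proof -
  have "((\<lambda>d. exp (- ((d - 2 * pi * R) / 4)\<^sup>2 / (4 * l\<^sup>2))) \<longlongrightarrow> 0) at_top"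
    using l_pos by real_asymp
  moreover have "((\<lambda>d. eps (m + n) (gap d div (4 * p))) \<longlongrightarrow> 0) at_top"
    by (rule filterlim_compose[OF eps_tendsto gap_at_top])
  ultimately have "((\<lambda>d. real (4 * (m + n)) * eps (m + n) (gap d div (4 * p)) + c_delta m n * exp (- ((d - 2 * pi * R) / 4)\<^sup>2 / (4 * l\<^sup>2)))
      \<longlongrightarrow> real (4 * (m + n)) * 0 + c_delta m n * 0) at_top"
    by (intro tendsto_intros)
  then have lim: "((\<lambda>d. real (4 * (m + n)) * eps (m + n) (gap d div (4 * p)) + c_delta m n * exp (- ((d - 2 * pi * R) / 4)\<^sup>2 / (4 * l\<^sup>2)))
      \<longlongrightarrow> 0) at_top" by simp
  have "\<forall>\<^sub>F d in at_top. 1 \<le> gap d div (4 * p)" using gap_at_top unfolding filterlim_at_top by blast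
  then have "\<forall>\<^sub>F d in at_top. real (4 * (m + n)) * eps (m + n) (gap d div (4 * p)) + c_delta m n * exp (- ((d - 2 * pi * R) / 4)\<^sup>2 / (4 * l\<^sup>2)) = rate m n d"
  proof eventually_elim
    case (elim d)
    then have "4 * p \<le> gap d" by (metis div_less not_le not_one_le_zero)
    then show ?case by (simp add: rate_def)
  qed
  then show ?thesis using lim by (rule Lim_transform_eventually[rotated])
qed

lemma prod_psi_le: "(\<Prod>i<q. norm (psi (as ! i) (z i))) \<le> (\<Prod>i<q. broad (as ! i) (z i))"
  by (intro prod_mono conjI norm_psi_le) auto

lemma prod_psi_far:
  assumes i: "i < q" "r \<le> \<bar>Re (z i) - real (as ! i) * l\<^sup>2 / R\<bar>" and r: "0 \<le> r"
  shows "(\<Prod>i<q. norm (psi (as ! i) (z i))) \<le> exp (- r\<^sup>2 / (4 * l\<^sup>2)) * (\<Prod>i<q. broad (as ! i) (z i))"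
proof -
  have "(\<Prod>j<q. norm (psi (as ! j) (z j))) = norm (psi (as ! i) (z i)) * (\<Prod>j\<in>{..<q} - {i}. norm (psi (as ! j) (z j)))"
    using i by (intro prod.remove) auto
  also have "\<dots> \<le> exp (- r\<^sup>2 / (4 * l\<^sup>2)) * broad (as ! i) (z i) * (\<Prod>j\<in>{..<q} - {i}. broad (as ! j) (z j))"
    using i(2) r broad_nonneg by (intro mult_mono prod_mono norm_psi_far conjI norm_psi_le prod_nonneg mult_nonneg_nonneg) auto
  also have "\<dots> = exp (- r\<^sup>2 / (4 * l\<^sup>2)) * (\<Prod>j<q. broad (as ! j) (z j))"
    using i prod.remove[of "{..<q}" i "\<lambda>j. broad (as ! j) (z j)"] by simp
  finally show ?thesis .
qed

lemma corr_term_le: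
  assumes ab: "as \<in> orbs p N (m + n)" "bs \<in> orbs p N (m + n)" and N: "m + n \<le> N"
    and cyl: "\<And>j. j < m + n \<Longrightarrow> z j \<in> cyl R \<and> z' j \<in> cyl R"
    and sep: "\<forall>a \<in> z ` {..<m} \<union> z' ` {..<m}. \<forall>b \<in> z ` {m..<m+n} \<union> z' ` {m..<m+n}. d \<le> cyl_dist R a b"
  shows "(\<Prod>i<m + n. norm (psi (as ! i) (z i))) * (\<Prod>i<m + n. norm (psi (bs ! i) (z' i))) * \<bar>delta N m as bs\<bar>
    \<le> rate m n d * ((\<Prod>i<m + n. broad (as ! i) (z i)) * (\<Prod>i<m + n. broad (bs ! i) (z' i)))"
proof -
  let ?q = "m + n" and ?b = "l\<^sup>2 / R" and ?r = "(d - 2 * pi * R) / 4"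
  let ?P = "(\<Prod>i<?q. norm (psi (as ! i) (z i))) * (\<Prod>i<?q. norm (psi (bs ! i) (z' i)))"
  let ?W = "(\<Prod>i<?q. broad (as ! i) (z i)) * (\<Prod>i<?q. broad (bs ! i) (z' i))"
  let ?g = "exp (- ?r\<^sup>2 / (4 * l\<^sup>2))"
  have b: "?b > 0" using R_pos l_pos by simp
  have W0: "?W \<ge> 0" by (intro mult_nonneg_nonneg prod_nonneg broad_nonneg)
  have PW: "?P \<le> ?W"
    by (intro mult_mono prod_psi_le prod_nonneg broad_nonneg) auto
  have P0: "?P \<ge> 0" by (intro mult_nonneg_nonneg prod_nonneg) auto
  have dl: "\<bar>delta N m as bs\<bar> \<le> c_delta m n" by (rule delta_le[OF ab N])
  have len: "length as = ?q" "length bs = ?q" using ab by (auto simp: orbs_def)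
  show ?thesis
  proof (cases "4 * p \<le> gap d")
    case False
    have "?P * \<bar>delta N m as bs\<bar> \<le> ?W * c_delta m n" by (intro mult_mono PW dl W0) simp
    also have "\<dots> \<le> ?W * rate m n d"
      using False c_delta_nonneg[of m n] by (intro mult_left_mono W0) (simp add: rate_def)
    finally show ?thesis by (simp only: mult.commute)
  next
    case gap: True
    have r0: "?r \<ge> 0"
    proof (rule ccontr)
      assume "\<not> ?r \<ge> 0"
      then have "(d - 2 * pi * R) / (2 * ?b) \<le> 0" using b by (intro divide_nonpos_pos) auto
      then have "gap d = 0" by (simp add: gap_def)
      then show False using gap p_pos by simp
    qed
    show ?thesis
    proof (cases "\<forall>i<?q. \<bar>Re (z i) - real (as ! i) * l\<^sup>2 / R\<bar> < ?r \<and> \<bar>Re (z' i) - real (bs ! i) * l\<^sup>2 / R\<bar> < ?r")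
      case True
      \<comment> \<open>The flag \<open>f\<close> tells the first cloud from the second, so that one
        statement locates the indices of both.\<close>
      have pos: "\<exists>w i. i < ?q \<and> (w = z i \<or> w = z' i) \<and> (i < m \<longleftrightarrow> f) \<and> \<bar>Re w - real x * l\<^sup>2 / R\<bar> < ?r"
        if "f \<and> x \<in> set (take m as @ take m bs) \<or> \<not> f \<and> x \<in> set (drop m as @ drop m bs)" for x f
      proof -
        have "\<exists>i<?q. (x = as ! i \<or> x = bs ! i) \<and> (i < m \<longleftrightarrow> f)"
        proof (cases f)
          case True
          with that have "x \<in> set (take m as) \<or> x \<in> set (take m bs)" by simp
          then obtain i where "i < m" "x = as ! i \<or> x = bs ! i" using len by (auto simp: in_set_conv_nth)
          then show ?thesis using True by (intro exI[of _ i]) auto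
        next
          case False
          with that have "x \<in> set (drop m as) \<or> x \<in> set (drop m bs)" by simp
          then obtain i where "i < n" "x = as ! (m + i) \<or> x = bs ! (m + i)" using len by (auto simp: in_set_conv_nth)
          then show ?thesis using False by (intro exI[of _ "m + i"]) auto
        qed
        then obtain i where "i < ?q" "x = as ! i \<or> x = bs ! i" "i < m \<longleftrightarrow> f" by blast
        then show ?thesis using True by metis
      qed
      have tri: "e / 2 \<le> \<bar>s - t\<bar>" if "e \<le> \<bar>s' - t'\<bar>" "\<bar>s' - s\<bar> < e / 4" "\<bar>t' - t\<bar> < e / 4" for e s t s' t' :: real
        using that by linarith
      have sepD: "x + gap d \<le> y \<or> y + gap d \<le> x"
        if x: "x \<in> set (take m as @ take m bs)" and y: "y \<in> set (drop m as @ drop m bs)" for x y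
      proof -
        obtain u i where u: "i < ?q" "u = z i \<or> u = z' i" "i < m" "\<bar>Re u - real x * l\<^sup>2 / R\<bar> < ?r"
          using pos[of True x] x by auto
        obtain v j where v: "j < ?q" "v = z j \<or> v = z' j" "\<not> j < m" "\<bar>Re v - real y * l\<^sup>2 / R\<bar> < ?r"
          using pos[of False y] y by auto
        have "u \<in> z ` {..<m} \<union> z' ` {..<m}" "v \<in> z ` {m..<m+n} \<union> z' ` {m..<m+n}" using u v by auto
        then have "d \<le> cyl_dist R u v" using sep by blast
        also have "\<dots> \<le> \<bar>Re u - Re v\<bar> + 2 * pi * R" using cyl[of i] cyl[of j] u v by (intro cyl_dist_le R_pos) auto
        finally have "d - 2 * pi * R \<le> \<bar>Re u - Re v\<bar>" by simp
        then have "(d - 2 * pi * R) / 2 \<le> \<bar>real x * l\<^sup>2 / R - real y * l\<^sup>2 / R\<bar>"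
          by (rule tri[OF _ u(4) v(4)])
        also have "\<dots> = \<bar>real x - real y\<bar> * ?b"
        proof -
          have "real x * l\<^sup>2 / R - real y * l\<^sup>2 / R = (real x - real y) * ?b" by (simp add: left_diff_distrib diff_divide_distrib)
          then show ?thesis using b by (simp only: abs_mult abs_of_pos)
        qed
        finally have "(d - 2 * pi * R) / (2 * ?b) \<le> \<bar>real x - real y\<bar>"
          using b by (simp only: divide_divide_eq_left[symmetric] pos_divide_le_eq)
        then have "gap d \<le> nat \<lfloor>\<bar>real x - real y\<bar>\<rfloor>" unfolding gap_def by (intro nat_mono floor_mono)
        also have "\<bar>real x - real y\<bar> = real (if x \<le> y then y - x else x - y)" by (simp add: of_nat_diff)
        finally show ?thesis by (simp split: if_splits) linarith+
      qed
      have "\<bar>delta N m as bs\<bar> \<le> real (4 * ?q) * eps ?q (gap d div (4 * p))"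
        by (rule delta_separated[OF ab N gap sepD])
      also have "\<dots> \<le> rate m n d" using gap c_delta_nonneg[of m n] by (simp add: rate_def)
      finally have "?P * \<bar>delta N m as bs\<bar> \<le> ?W * rate m n d" by (intro mult_mono PW W0) auto
      then show ?thesis by (simp only: mult.commute)
    next
      case False
      then obtain i where i: "i < ?q" "?r \<le> \<bar>Re (z i) - real (as ! i) * l\<^sup>2 / R\<bar> \<or> ?r \<le> \<bar>Re (z' i) - real (bs ! i) * l\<^sup>2 / R\<bar>"
        by (meson not_le)
      have PgW: "?P \<le> ?g * ?W"
        using i(2)
      proof
        assume f: "?r \<le> \<bar>Re (z i) - real (as ! i) * l\<^sup>2 / R\<bar>"
        have "?P \<le> (?g * (\<Prod>i<?q. broad (as ! i) (z i))) * (\<Prod>i<?q. broad (bs ! i) (z' i))"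
          by (intro mult_mono prod_psi_far[where z = z and as = as, OF i(1) f r0] prod_psi_le prod_nonneg mult_nonneg_nonneg broad_nonneg) auto
        then show ?thesis by (simp only: mult.assoc)
      next
        assume f: "?r \<le> \<bar>Re (z' i) - real (bs ! i) * l\<^sup>2 / R\<bar>"
        have "?P \<le> (\<Prod>i<?q. broad (as ! i) (z i)) * (?g * (\<Prod>i<?q. broad (bs ! i) (z' i)))"
          by (intro mult_mono prod_psi_far[where z = z' and as = bs, OF i(1) f r0] prod_psi_le prod_nonneg mult_nonneg_nonneg broad_nonneg) auto
        then show ?thesis by (simp only: mult.left_commute)
      qed
      have "?P * \<bar>delta N m as bs\<bar> \<le> (?g * ?W) * c_delta m n"
        by (rule mult_mono[OF PgW dl]) (intro mult_nonneg_nonneg W0 exp_ge_zero abs_ge_zero)+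
      also have "\<dots> = (c_delta m n * ?g) * ?W" by (simp only: ac_simps)
      also have "\<dots> \<le> rate m n d * ?W"
        using gap eps_nonneg by (intro mult_right_mono W0) (simp add: rate_def)
      finally show ?thesis .
    qed
  qed
qed

text \<open>Each of the \<open>2 * (m + n)\<close> index sums over \<open>broad\<close> is at most
  \<open>c_broad\<close>, uniformly in \<open>N\<close> and in the points, so the bound on single
  terms survives summation.\<close>

theorem corr_clustering:
  assumes \<kappa>: "\<kappa> N > 0" and N: "m + n \<le> N"
    and cyl: "\<And>j. j < m + n \<Longrightarrow> z j \<in> cyl R \<and> z' j \<in> cyl R"
    and sep: "\<forall>a \<in> z ` {..<m} \<union> z' ` {..<m}. \<forall>b \<in> z ` {m..<m+n} \<union> z' ` {m..<m+n}. d \<le> cyl_dist R a b"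
  shows "cmod (corr R l p \<kappa> N (m + n) z z' - corr R l p \<kappa> N m z z' * corr R l p \<kappa> N n (\<lambda>j. z (m + j)) (\<lambda>j. z' (m + j)))
    \<le> (c_broad ^ (m + n))\<^sup>2 * rate m n d"
proof -
  let ?q = "m + n"
  let ?O = "orbs p N ?q"
  have c0: "c_broad \<ge> 0" using R_pos l_pos nu0_pos by (simp add: c_broad_def)
  have "cmod (corr R l p \<kappa> N ?q z z' - corr R l p \<kappa> N m z z' * corr R l p \<kappa> N n (\<lambda>j. z (m + j)) (\<lambda>j. z' (m + j)))
      \<le> (\<Sum>as\<in>?O. \<Sum>bs\<in>?O. cmod ((\<Prod>i<?q. psi (as ! i) (z i)) * cnj (\<Prod>i<?q. psi (bs ! i) (z' i)) * of_real (delta N m as bs)))"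
    unfolding corr_diff[where \<kappa> = \<kappa> and N = N and m = m and n = n, OF \<kappa> N] by (intro sum_norm_le order_refl)
  also have "\<dots> = (\<Sum>as\<in>?O. \<Sum>bs\<in>?O. (\<Prod>i<?q. norm (psi (as ! i) (z i))) * (\<Prod>i<?q. norm (psi (bs ! i) (z' i))) * \<bar>delta N m as bs\<bar>)"
    by (simp only: norm_mult complex_mod_cnj prod_norm[symmetric] norm_of_real)
  also have "\<dots> \<le> (\<Sum>as\<in>?O. \<Sum>bs\<in>?O. rate m n d * ((\<Prod>i<?q. broad (as ! i) (z i)) * (\<Prod>i<?q. broad (bs ! i) (z' i))))"
    by (intro sum_mono corr_term_le[OF _ _ N cyl sep])
  also have "\<dots> = rate m n d * ((\<Sum>as\<in>?O. \<Prod>i<?q. broad (as ! i) (z i)) * (\<Sum>bs\<in>?O. \<Prod>i<?q. broad (bs ! i) (z' i)))"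
    by (subst sum_product) (simp only: sum_distrib_left)
  also have "\<dots> \<le> rate m n d * (c_broad ^ ?q * c_broad ^ ?q)"
    using c0 by (intro mult_left_mono mult_mono sum_prod_broad_le rate_nonneg sum_nonneg prod_nonneg broad_nonneg zero_le_power)
  finally show ?thesis by (simp only: power2_eq_square mult.commute)
qed

end

theorem theorem2p3:
  fixes R l :: real and p m n :: nat and \<kappa> :: "nat \<Rightarrow> real"
  assumes "R > 0" and "l > 0" and "p \<ge> 1" and "m \<ge> 1" and "n \<ge> 1"
    and "\<And>N. \<kappa> N > 0"
  shows "\<exists>(\<epsilon>::real \<Rightarrow> real) (K::real). (\<epsilon> \<longlongrightarrow> 0) at_top \<and>
    (\<forall>N (d::real) (z::nat \<Rightarrow> complex) (z'::nat \<Rightarrow> complex).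
       m + n \<le> N \<longrightarrow> d > 0 \<longrightarrow>
       (\<forall>j < m + n. z j \<in> cyl R \<and> z' j \<in> cyl R) \<longrightarrow>
       (\<forall>a \<in> z ` {..<m} \<union> z' ` {..<m}. \<forall>b \<in> z ` {m..<m+n} \<union> z' ` {m..<m+n}.
           d \<le> cyl_dist R a b) \<longrightarrow>
       cmod (corr R l p \<kappa> N (m + n) z z'
             - corr R l p \<kappa> N m z z'
               * corr R l p \<kappa> N n (\<lambda>j. z (m + j)) (\<lambda>j. z' (m + j)))
         \<le> K * \<epsilon> d)"
proof -
  interpret cylinder R l p using assms(1-3) by unfold_locales
  show ?thesis
    by (intro exI[of _ "rate m n"] exI[of _ "(c_broad ^ (m + n))\<^sup>2"] conjI allI impI rate_tendsto corr_clustering assms(6)) blast+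
qed

end
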